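(* Suppose $\Omega_1\subset\mathbb{R}^{d_1}$ and $\Omega_2\subset\mathbb{R}^{d_2}$ are two open, bounded and connected sets which are regular in capacity. Suppose also that $U:L^2(\Omega_1)\to L^2(\Omega_2)$ is an invertible disjointness-preserving operator intertwining the Dirichlet Laplacians on $L^2(\Omega_1)$ and $L^2(\Omega_2)$. Then $d_1=d_2=:d$, and there exist an isometry $\tau:\mathbb{R}^d\to\mathbb{R}^d$ with $\tau(\Omega_2)=\Omega_1$ and a constant $c\in\mathbb{C}\setminus\{0\}$ such that $$Uf=c\,f\circ\tau\qquad\text{for all } f\in L^2(\Omega_1).$$
   Context: Functions are complex-valued and open sets are non-empty. For an open set $\Omega\subset\mathbb{R}^d$, the Dirichlet Laplacian on $L^2(\Omega)$ is given by $D(\Delta^D_\Omega)=\{u\in H_0^1(\Omega):\Delta u\in L^2(\Omega)\}$, $\Delta^D_\Omega u=\Delta u$ (distributional Laplacian). An operator $U:X_1\to X_2$ between Banach spaces intertwines $A_1:D(A_1)\subset X_1\to X_1$ and $A_2:D(A_2)\subset X_2\to X_2$ if $x\in D(A_1)$ implies $Ux\in D(A_2)$ and $A_2Ux=UA_1x$. A bounded linear operator $U:L^2(\Omega_1)\to L^2(\Omega_2)$ is disjointness-preserving if $f\cdot g=0$ a.e. implies $(Uf)\cdot(Ug)=0$ a.e. for all $f,g\in L^2(\Omega_1)$; invertible means bijective (hence with bounded inverse). The capacity of $A\subset\mathbb{R}^d$ is $\operatorname{cap}(A)=\inf\{\|u\|_{H^1(\mathbb{R}^d)}^2:u\in H^1(\mathbb{R}^d),\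 u\geq1\text{ a.e. in a neighbourhood of }A\}$. An open set $\Omega$ is regular in capacity if $\operatorname{cap}(B(z,r)\setminus\Omega)>0$ for all $z\in\partial\Omega$ and all $r>0$, where $B(z,r)$ is the open ball of radius $r$ about $z$. *)

theory Defs
  imports "HOL-Analysis.Analysis"
begin

section \<open>The space of square-integrable functions\<close>

text \<open>
  Elements of \<open>L\<^sup>2(\<Omega>)\<close> are represented by square-integrable functions; only their values on
  \<open>\<Omega>\<close> matter, and two of them denote the same element iff they are related by \<open>ae_eq \<Omega>\<close>.
  An operator between such spaces is a map on representatives that respects \<open>ae_eq\<close>, and
  all algebraic statements about it are made up to \<open>ae_eq\<close>.
\<close>

definition L2 :: "'a::euclidean_space set \<Rightarrow> ('a \<Rightarrow> complex) set" where
  "L2 \<Omega> = {f. f \<in> borel_measurable (lebesgue_on \<Omega>) \<and>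
              integrable (lebesgue_on \<Omega>) (\<lambda>x. (norm (f x))\<^sup>2)}"

definition L2_norm :: "'a::euclidean_space set \<Rightarrow> ('a \<Rightarrow> complex) \<Rightarrow> real" where
  "L2_norm \<Omega> f = sqrt (\<integral>x. (norm (f x))\<^sup>2 \<partial>lebesgue_on \<Omega>)"

definition ae_eq :: "'a::euclidean_space set \<Rightarrow> ('a \<Rightarrow> complex) \<Rightarrow> ('a \<Rightarrow> complex) \<Rightarrow> bool" where
  "ae_eq \<Omega> f g \<longleftrightarrow> (AE x in lebesgue_on \<Omega>. f x = g x)"


section \<open>Sobolev spaces\<close>

text \<open>For a differentiable function the Frechet derivative at a basis vector is the partial
  derivative in that direction.\<close>

definition partial_deriv :: "'a::euclidean_space \<Rightarrow> ('a \<Rightarrow> complex) \<Rightarrow> 'a \<Rightarrow> complex" where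
  "partial_deriv b f x = frechet_derivative f (at x) b"

primrec C_diff :: "nat \<Rightarrow> ('a::euclidean_space \<Rightarrow> complex) \<Rightarrow> bool" where
  "C_diff 0 f \<longleftrightarrow> continuous_on UNIV f"
| "C_diff (Suc k) f \<longleftrightarrow> f differentiable_on UNIV \<and> (\<forall>b\<in>Basis. C_diff k (partial_deriv b f))"

definition test_functions :: "'a::euclidean_space set \<Rightarrow> ('a \<Rightarrow> complex) set" where
  "test_functions \<Omega> =
     {\<phi>. (\<forall>k. C_diff k \<phi>) \<and> compact (closure {x. \<phi> x \<noteq> 0}) \<and> closure {x. \<phi> x \<noteq> 0} \<subseteq> \<Omega>}"

definition has_weak_deriv ::
    "'a::euclidean_space set \<Rightarrow> 'a \<Rightarrow> ('a \<Rightarrow> complex) \<Rightarrow> ('a \<Rightarrow> complex) \<Rightarrow> bool" where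
  "has_weak_deriv \<Omega> b u g \<longleftrightarrow>
     (\<forall>\<phi>\<in>test_functions \<Omega>.
        (\<integral>x. u x * partial_deriv b \<phi> x \<partial>lebesgue_on \<Omega>) = - (\<integral>x. g x * \<phi> x \<partial>lebesgue_on \<Omega>))"

definition H1 :: "'a::euclidean_space set \<Rightarrow> ('a \<Rightarrow> complex) set" where
  "H1 \<Omega> = {u \<in> L2 \<Omega>. \<forall>b\<in>Basis. \<exists>g\<in>L2 \<Omega>. has_weak_deriv \<Omega> b u g}"

text \<open>The weak derivative of an element of \<open>H1 \<Omega>\<close> is determined up to \<open>ae_eq \<Omega>\<close> when \<open>\<Omega>\<close> is open,
  so the choice does not matter below.\<close>

definition weak_deriv :: "'a::euclidean_space set \<Rightarrow> 'a \<Rightarrow> ('a \<Rightarrow> complex) \<Rightarrow> 'a \<Rightarrow> complex" where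
  "weak_deriv \<Omega> b u = (SOME g. g \<in> L2 \<Omega> \<and> has_weak_deriv \<Omega> b u g)"

definition H1_norm :: "'a::euclidean_space set \<Rightarrow> ('a \<Rightarrow> complex) \<Rightarrow> real" where
  "H1_norm \<Omega> u = sqrt ((L2_norm \<Omega> u)\<^sup>2 + (\<Sum>b\<in>Basis. (L2_norm \<Omega> (weak_deriv \<Omega> b u))\<^sup>2))"

text \<open>The closure of the test functions in \<open>H1 \<Omega>\<close>.\<close>

definition H10 :: "'a::euclidean_space set \<Rightarrow> ('a \<Rightarrow> complex) set" where
  "H10 \<Omega> = {u \<in> H1 \<Omega>. \<exists>\<phi>. (\<forall>n::nat. \<phi> n \<in> test_functions \<Omega>) \<and>
                          (\<lambda>n. H1_norm \<Omega> (\<lambda>x. \<phi> n x - u x)) \<longlonglongrightarrow> 0}"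


section \<open>The Dirichlet Laplacian\<close>

definition laplacian :: "('a::euclidean_space \<Rightarrow> complex) \<Rightarrow> 'a \<Rightarrow> complex" where
  "laplacian \<phi> x = (\<Sum>b\<in>Basis. partial_deriv b (partial_deriv b \<phi>) x)"

definition has_distr_laplacian ::
    "'a::euclidean_space set \<Rightarrow> ('a \<Rightarrow> complex) \<Rightarrow> ('a \<Rightarrow> complex) \<Rightarrow> bool" where
  "has_distr_laplacian \<Omega> u v \<longleftrightarrow>
     (\<forall>\<phi>\<in>test_functions \<Omega>.
        (\<integral>x. u x * laplacian \<phi> x \<partial>lebesgue_on \<Omega>) = (\<integral>x. v x * \<phi> x \<partial>lebesgue_on \<Omega>))"

definition dirichlet_domain :: "'a::euclidean_space set \<Rightarrow> ('a \<Rightarrow> complex) set" where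
  "dirichlet_domain \<Omega> = {u \<in> H10 \<Omega>. \<exists>v\<in>L2 \<Omega>. has_distr_laplacian \<Omega> u v}"

text \<open>As for \<open>weak_deriv\<close>, the chosen function is determined up to \<open>ae_eq \<Omega>\<close>.\<close>

definition dirichlet_laplacian :: "'a::euclidean_space set \<Rightarrow> ('a \<Rightarrow> complex) \<Rightarrow> 'a \<Rightarrow> complex" where
  "dirichlet_laplacian \<Omega> u = (SOME v. v \<in> L2 \<Omega> \<and> has_distr_laplacian \<Omega> u v)"


section \<open>Operators between spaces of square-integrable functions\<close>

definition bounded_L2_operator ::
    "'a::euclidean_space set \<Rightarrow> 'b::euclidean_space set \<Rightarrow>
     (('a \<Rightarrow> complex) \<Rightarrow> 'b \<Rightarrow> complex) \<Rightarrow> bool" where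
  "bounded_L2_operator \<Omega>1 \<Omega>2 U \<longleftrightarrow>
     (\<forall>f\<in>L2 \<Omega>1. U f \<in> L2 \<Omega>2) \<and>
     (\<forall>f\<in>L2 \<Omega>1. \<forall>g\<in>L2 \<Omega>1. ae_eq \<Omega>1 f g \<longrightarrow> ae_eq \<Omega>2 (U f) (U g)) \<and>
     (\<forall>f\<in>L2 \<Omega>1. \<forall>g\<in>L2 \<Omega>1. ae_eq \<Omega>2 (U (\<lambda>x. f x + g x)) (\<lambda>y. U f y + U g y)) \<and>
     (\<forall>f\<in>L2 \<Omega>1. \<forall>a. ae_eq \<Omega>2 (U (\<lambda>x. a * f x)) (\<lambda>y. a * U f y)) \<and>
     (\<exists>C. \<forall>f\<in>L2 \<Omega>1. L2_norm \<Omega>2 (U f) \<le> C * L2_norm \<Omega>1 f)"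

text \<open>Bijectivity of the induced map on classes modulo \<open>ae_eq\<close>.\<close>

definition invertible_L2_operator ::
    "'a::euclidean_space set \<Rightarrow> 'b::euclidean_space set \<Rightarrow>
     (('a \<Rightarrow> complex) \<Rightarrow> 'b \<Rightarrow> complex) \<Rightarrow> bool" where
  "invertible_L2_operator \<Omega>1 \<Omega>2 U \<longleftrightarrow>
     bounded_L2_operator \<Omega>1 \<Omega>2 U \<and>
     (\<forall>f\<in>L2 \<Omega>1. \<forall>g\<in>L2 \<Omega>1. ae_eq \<Omega>2 (U f) (U g) \<longrightarrow> ae_eq \<Omega>1 f g) \<and>
     (\<forall>h\<in>L2 \<Omega>2. \<exists>f\<in>L2 \<Omega>1. ae_eq \<Omega>2 (U f) h)"

definition disjointness_preserving ::
    "'a::euclidean_space set \<Rightarrow> 'b::euclidean_space set \<Rightarrow>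
     (('a \<Rightarrow> complex) \<Rightarrow> 'b \<Rightarrow> complex) \<Rightarrow> bool" where
  "disjointness_preserving \<Omega>1 \<Omega>2 U \<longleftrightarrow>
     (\<forall>f\<in>L2 \<Omega>1. \<forall>g\<in>L2 \<Omega>1. (AE x in lebesgue_on \<Omega>1. f x * g x = 0) \<longrightarrow>
        (AE y in lebesgue_on \<Omega>2. U f y * U g y = 0))"

definition intertwines_dirichlet_laplacians ::
    "'a::euclidean_space set \<Rightarrow> 'b::euclidean_space set \<Rightarrow>
     (('a \<Rightarrow> complex) \<Rightarrow> 'b \<Rightarrow> complex) \<Rightarrow> bool" where
  "intertwines_dirichlet_laplacians \<Omega>1 \<Omega>2 U \<longleftrightarrow>
     (\<forall>u\<in>dirichlet_domain \<Omega>1.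
        U u \<in> dirichlet_domain \<Omega>2 \<and>
        ae_eq \<Omega>2 (dirichlet_laplacian \<Omega>2 (U u)) (U (dirichlet_laplacian \<Omega>1 u)))"


section \<open>Capacity\<close>

text \<open>For a complex-valued \<open>u\<close>, the condition \<open>u \<ge> 1\<close> means that \<open>u\<close> is real and at least 1.
  The infimum is taken in \<open>ennreal\<close>, so that the capacity is infinite if no \<open>u\<close> is admissible.\<close>

definition capacity :: "'a::euclidean_space set \<Rightarrow> ennreal" where
  "capacity A =
     (INF u \<in> {u \<in> H1 UNIV. \<exists>V. open V \<and> A \<subseteq> V \<and>
                 (AE x in lebesgue_on V. u x \<in> \<real> \<and> Re (u x) \<ge> 1)}.
        ennreal ((H1_norm UNIV u)\<^sup>2))"

definition regular_in_capacity :: "'a::euclidean_space set \<Rightarrow> bool" where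
  "regular_in_capacity \<Omega> \<longleftrightarrow> (\<forall>z\<in>frontier \<Omega>. \<forall>r>0. capacity (ball z r - \<Omega>) > 0)"

end

theory Submission imports Defs begin

text \<open>
  A disjointness-preserving bijection satisfies \<open>U (f g) U 1 = U f U g\<close> for bounded \<open>f\<close>, so
  it carries multiplication by the coordinate \<open>x\<^sub>i\<close> over to multiplication by the real function
  \<open>t\<^sub>i = U x\<^sub>i / U 1\<close>. Since \<open>U\<close> intertwines the Laplacians, the commutator relation
  \<open>[[\<Delta>, x\<^sub>i], x\<^sub>j] = 2 \<delta>\<^sub>i\<^sub>j\<close> passes to the \<open>t\<^sub>i\<close>: their gradients are orthonormal almost everywhere.
  Hence \<open>d\<^sub>1 \<le> d\<^sub>2\<close>, and by the same argument for the inverse \<open>d\<^sub>1 = d\<^sub>2\<close>. When the number of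
  functions equals the dimension, the columns of the Jacobian are orthonormal as well; summing
  Pohozaev's identity over \<open>i\<close> shows that the \<open>t\<^sub>i\<close> are harmonic, and then Bochner's identity shows
  that they are affine. So \<open>\<tau> = (t\<^sub>1, \<dots>, t\<^sub>d)\<close> is an isometry and \<open>U f = U 1 \<cdot> f \<circ> \<tau>\<close>.
  Comparing the commutators \<open>[\<Delta>, x\<^sub>i]\<close> and \<open>[\<Delta>, t\<^sub>i]\<close> shows that \<open>U 1\<close> has zero gradient.
  Thus \<open>\<tau>\<close> maps \<open>\<Omega>\<^sub>2\<close> onto \<open>\<Omega>\<^sub>1\<close> up to null sets, and maps the one \<open>H10\<close> onto the other; a point
  missing from either set would make the complement have zero capacity near it.
\<close>

section \<open>Smooth functions\<close>

text \<open>\<open>U\<close> acts on classes of functions, and the constant 1 is not in H10, so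
  intertwining says nothing directly about \<open>U 1\<close>, and the quotients
  \<open>t\<^sub>i\<close> have no regularity at the start. Regularity comes from localising: for a
  test function \<phi> on the second domain, its preimage \<open>u\<close> lies in the Dirichlet
  domain; boundedness makes coordinates bounded multipliers, so \<open>x\<^sub>i u\<close> lies
  there too and \<open>t\<^sub>i \<phi> = U (x\<^sub>i u)\<close> has a gradient and a Laplacian in
  L2. The weight is handled in the same way: where \<phi> is 1, \<open>1 / U 1\<close> is
  \<open>u\<close> composed with the isometry, and it is the gradient of \<open>u\<close> that is
  shown to vanish. Pulling back requires that the inverse of \<open>U\<close> respects the Dirichlet
  domains, which is derived from the resolvents. Products of gradients are merely integrable, so
  nonlinear identities are proved for mollifications on a smaller ball and passed to the limit
  against a test function; this explains the many shrinking radii. The boundary enters twice: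
  elements of H10 extend by zero across null parts of the complement, and regularity in capacity
  excludes such parts.\<close>

abbreviation smooth :: "('a::euclidean_space \<Rightarrow> complex) \<Rightarrow> bool" where
  "smooth f \<equiv> \<forall>k. C_diff k f"

lemma C_diff_continuous: "C_diff k f \<Longrightarrow> continuous_on UNIV f"
  by (cases k) (auto intro: differentiable_imp_continuous_on)

lemma C_diff_Suc_imp: "C_diff (Suc k) f \<Longrightarrow> C_diff k f"
proof (induction k arbitrary: f)
  case 0 then show ?case by (auto intro: differentiable_imp_continuous_on)
next
  case (Suc k) then show ?case by (metis C_diff.simps(2))
qed

lemma smooth_differentiable: "smooth f \<Longrightarrow> f differentiable (at x)"
  using C_diff.simps(2)[of 0 f] by (metis UNIV_I differentiable_on_def)

lemma smooth_partial_deriv: "smooth f \<Longrightarrow> b \<in> Basis \<Longrightarrow> smooth (partial_deriv b f)"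
  by (meson C_diff.simps(2))

lemma smooth_continuous: "smooth f \<Longrightarrow> continuous_on S f"
  using C_diff_continuous[of 0 f] continuous_on_subset by blast

lemma smooth_has_derivative:
  assumes "smooth f"
  shows "(f has_derivative (\<lambda>h. \<Sum>b\<in>Basis. (h \<bullet> b) *\<^sub>R partial_deriv b f x)) (at x)"
proof -
  have D: "(f has_derivative frechet_derivative f (at x)) (at x)"
    using smooth_differentiable[OF assms] frechet_derivative_works by blast
  interpret bounded_linear "frechet_derivative f (at x)"
    using D has_derivative_bounded_linear by blast
  have "frechet_derivative f (at x) = (\<lambda>h. \<Sum>b\<in>Basis. (h \<bullet> b) *\<^sub>R partial_deriv b f x)"
  proof
    fix h
    have "frechet_derivative f (at x) h = frechet_derivative f (at x) (\<Sum>b\<in>Basis. (h \<bullet> b) *\<^sub>R b)"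
      by (simp add: euclidean_representation)
    then show "frechet_derivative f (at x) h = (\<Sum>b\<in>Basis. (h \<bullet> b) *\<^sub>R partial_deriv b f x)"
      by (simp add: sum scale partial_deriv_def)
  qed
  with D show ?thesis by simp
qed

lemma partial_deriv_eqI: "(f has_derivative D) (at x) \<Longrightarrow> partial_deriv b f x = D b"
  by (metis partial_deriv_def frechet_derivative_at)

lemma C_diff_const: "C_diff k (\<lambda>x. c)"
proof (induction k arbitrary: c)
  case (Suc k)
  have "partial_deriv b (\<lambda>x. c) = (\<lambda>x. 0)" for b :: 'a
    by (rule ext, rule partial_deriv_eqI[of _ "\<lambda>h. 0"]) auto
  then show ?case using Suc[of 0] by simp
qed auto

text \<open>Derivatives of sums, products and compositions come with explicit linear maps. By
  uniqueness of the derivative such a family can replace the chosen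
  \<open>frechet_derivative\<close>, so the inductions on \<open>k\<close> below only differentiate
  formulas.\<close>

lemma C_diff_SucI:
  assumes "\<And>x. (f has_derivative D x) (at x)" "\<And>b. b \<in> Basis \<Longrightarrow> C_diff k (\<lambda>x. D x b)"
  shows "C_diff (Suc k) f"
proof -
  have "partial_deriv b f = (\<lambda>x. D x b)" for b
    using partial_deriv_eqI[OF assms(1)] by auto
  moreover have "f differentiable_on UNIV"
    using assms(1) by (auto simp: differentiable_on_def differentiable_def)
  ultimately show ?thesis using assms(2) by simp
qed

lemma C_diff_Suc_has_derivative:
  assumes "C_diff (Suc k) f"
  shows "(f has_derivative (\<lambda>h. frechet_derivative f (at x) h)) (at x)"
    and "b \<in> Basis \<Longrightarrow> C_diff k (\<lambda>x. frechet_derivative f (at x) b)"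
proof -
  show "(f has_derivative (\<lambda>h. frechet_derivative f (at x) h)) (at x)"
    using assms by (simp add: differentiable_on_def frechet_derivative_works[symmetric])
  have "partial_deriv b f = (\<lambda>x. frechet_derivative f (at x) b)"
    by (auto simp: fun_eq_iff partial_deriv_def)
  then show "b \<in> Basis \<Longrightarrow> C_diff k (\<lambda>x. frechet_derivative f (at x) b)"
    using assms by (metis C_diff.simps(2))
qed

lemma C_diff_add:
  assumes "C_diff k f" "C_diff k g" shows "C_diff k (\<lambda>x. f x + g x)"
  using assms
proof (induction k arbitrary: f g)
  case (Suc k)
  note F = C_diff_Suc_has_derivative[OF Suc.prems(1)]
  note G = C_diff_Suc_has_derivative[OF Suc.prems(2)]
  show ?case
    by (rule C_diff_SucI[OF has_derivative_add[OF F(1) G(1)]]) (rule Suc.IH[OF F(2) G(2)])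
qed (simp add: continuous_on_add continuous_on_mult continuous_on_cnj)

lemma C_diff_mult:
  assumes "C_diff k f" "C_diff k g" shows "C_diff k (\<lambda>x. f x * g x)"
  using assms
proof (induction k arbitrary: f g)
  case (Suc k)
  note F = C_diff_Suc_has_derivative[OF Suc.prems(1)]
  note G = C_diff_Suc_has_derivative[OF Suc.prems(2)]
  show ?case
    by (rule C_diff_SucI[OF has_derivative_mult[OF F(1) G(1)]])
      (rule C_diff_add[OF Suc.IH[OF C_diff_Suc_imp[OF Suc.prems(1)] G(2)]
          Suc.IH[OF F(2) C_diff_Suc_imp[OF Suc.prems(2)]]])
qed (simp add: continuous_on_add continuous_on_mult continuous_on_cnj)

lemma C_diff_cnj:
  assumes "C_diff k f" shows "C_diff k (\<lambda>x. cnj (f x))"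
  using assms
proof (induction k arbitrary: f)
  case (Suc k)
  note F = C_diff_Suc_has_derivative[OF Suc.prems(1)]
  show ?case
    by (rule C_diff_SucI[OF has_derivative_cnj[OF F(1)]]) (rule Suc.IH[OF F(2)])
qed (simp add: continuous_on_add continuous_on_mult continuous_on_cnj)

lemma C_diff_inner: "C_diff k (\<lambda>x. complex_of_real (x \<bullet> v))"
proof (cases k)
  case (Suc j)
  have "((\<lambda>x. complex_of_real (x \<bullet> v)) has_derivative (\<lambda>h. of_real (h \<bullet> v))) (at x)" for x
    by (auto intro!: derivative_eq_intros)
  from C_diff_SucI[OF this] show ?thesis using Suc by (simp add: C_diff_const)
qed (auto intro!: continuous_intros)

lemma smooth_const: "smooth (\<lambda>x. c)"
  and smooth_add: "smooth f \<Longrightarrow> smooth g \<Longrightarrow> smooth (\<lambda>x. f x + g x)"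
  and smooth_mult: "smooth f \<Longrightarrow> smooth g \<Longrightarrow> smooth (\<lambda>x. f x * g x)"
  and smooth_cnj: "smooth f \<Longrightarrow> smooth (\<lambda>x. cnj (f x))"
  and smooth_inner: "smooth (\<lambda>x. complex_of_real (x \<bullet> v))"
  by (simp_all add: C_diff_const C_diff_add C_diff_mult C_diff_cnj C_diff_inner)

lemma smooth_cmult: "smooth f \<Longrightarrow> smooth (\<lambda>x. c * f x)"
  by (intro smooth_mult smooth_const)

lemma C_diff_sum: "(\<And>i. i \<in> I \<Longrightarrow> C_diff k (f i)) \<Longrightarrow> C_diff k (\<lambda>x. \<Sum>i\<in>I. f i x)"
proof (induction I rule: infinite_finite_induct)
  case (insert i I)
  then show ?case using C_diff_add[of k "f i" "\<lambda>x. \<Sum>i\<in>I. f i x"] by simp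
qed (simp_all add: C_diff_const)

lemma smooth_sum: "(\<And>i. i \<in> I \<Longrightarrow> smooth (f i)) \<Longrightarrow> smooth (\<lambda>x. \<Sum>i\<in>I. f i x)"
  by (simp add: C_diff_sum)

lemma smooth_laplacian: "smooth f \<Longrightarrow> smooth (laplacian f)"
  unfolding laplacian_def by (intro smooth_sum smooth_partial_deriv)

lemma partial_deriv_add:
  assumes "smooth f" "smooth g"
  shows "partial_deriv b (\<lambda>x. f x + g x) = (\<lambda>x. partial_deriv b f x + partial_deriv b g x)"
  unfolding fun_eq_iff partial_deriv_def[of b f] partial_deriv_def[of b g]
  using partial_deriv_eqI[OF has_derivative_add[OF smooth_differentiable[OF assms(1), THEN frechet_derivative_works[THEN iffD1]]
        smooth_differentiable[OF assms(2), THEN frechet_derivative_works[THEN iffD1]]]]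
  by blast

lemma partial_deriv_mult:
  assumes "smooth f" "smooth g"
  shows "partial_deriv b (\<lambda>x. f x * g x) = (\<lambda>x. f x * partial_deriv b g x + partial_deriv b f x * g x)"
  unfolding fun_eq_iff partial_deriv_def[of b f] partial_deriv_def[of b g]
  using partial_deriv_eqI[OF has_derivative_mult[OF smooth_differentiable[OF assms(1), THEN frechet_derivative_works[THEN iffD1]]
        smooth_differentiable[OF assms(2), THEN frechet_derivative_works[THEN iffD1]]]]
  by blast

lemma partial_deriv_cnj:
  assumes "smooth f"
  shows "partial_deriv b (\<lambda>x. cnj (f x)) = (\<lambda>x. cnj (partial_deriv b f x))"
  using partial_deriv_eqI[OF has_derivative_cnj[OF frechet_derivative_works[THEN iffD1]]]
    smooth_differentiable[OF assms(1)]
  by (auto simp: fun_eq_iff partial_deriv_def)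

lemma partial_deriv_const: "partial_deriv b (\<lambda>x. c) = (\<lambda>x. 0)"
  by (rule ext, rule partial_deriv_eqI[of _ "\<lambda>h. 0"]) auto

lemma partial_deriv_cmult:
  assumes "smooth f"
  shows "partial_deriv b (\<lambda>x. c * f x) = (\<lambda>x. c * partial_deriv b f x)"
  using partial_deriv_mult[OF smooth_const assms, of b c] by (simp add: partial_deriv_const)

lemma partial_deriv_diff:
  assumes "smooth f" "smooth g"
  shows "partial_deriv b (\<lambda>x. f x - g x) = (\<lambda>x. partial_deriv b f x - partial_deriv b g x)"
  using partial_deriv_add[OF assms(1) smooth_cmult[OF assms(2), of "-1"], of b]
    partial_deriv_cmult[OF assms(2), of b "-1"] by simp

lemma partial_deriv_inner: "partial_deriv b (\<lambda>x. complex_of_real (x \<bullet> v)) = (\<lambda>x. of_real (b \<bullet> v))"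
  by (rule ext, rule partial_deriv_eqI) (auto intro!: derivative_eq_intros)

lemma laplacian_mult:
  assumes "smooth f" "smooth g"
  shows "laplacian (\<lambda>x. f x * g x) x = f x * laplacian g x + laplacian f x * g x
     + 2 * (\<Sum>b\<in>Basis. partial_deriv b f x * partial_deriv b g x)"
proof -
  have "partial_deriv b (partial_deriv b (\<lambda>x. f x * g x)) x =
     f x * partial_deriv b (partial_deriv b g) x + partial_deriv b (partial_deriv b f) x * g x
     + 2 * (partial_deriv b f x * partial_deriv b g x)" if b: "b \<in> Basis" for b
    using smooth_partial_deriv[OF assms(1) b] smooth_partial_deriv[OF assms(2) b] assms
    by (simp add: partial_deriv_mult partial_deriv_add smooth_mult algebra_simps)
  then show ?thesis
    unfolding laplacian_def by (simp add: sum.distrib sum_distrib_left sum_distrib_right)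
qed

lemma laplacian_const: "laplacian (\<lambda>x. c) = (\<lambda>x. 0)"
  by (simp add: fun_eq_iff laplacian_def partial_deriv_const)

lemma laplacian_inner: "laplacian (\<lambda>x. complex_of_real (x \<bullet> v)) = (\<lambda>x. 0)"
  by (simp add: fun_eq_iff laplacian_def partial_deriv_inner partial_deriv_const)

text \<open>Both functions have the same set of derivatives at \<open>x\<close>, so the choice
  inside \<open>frechet_derivative\<close> picks the same map; this covers points without
  differentiability as well.\<close>

lemma partial_deriv_local:
  assumes "open S" "x \<in> S" "\<And>y. y \<in> S \<Longrightarrow> f y = g y"
  shows "partial_deriv b f x = partial_deriv b g x"
proof -
  have *: "(f has_derivative D) (at x) = (g has_derivative D) (at x)" for D
    using has_derivative_transform_within_open[of f D x UNIV S g]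
      has_derivative_transform_within_open[of g D x UNIV S f] assms by metis
  show ?thesis unfolding partial_deriv_def frechet_derivative_def * ..
qed

text \<open>The derivative \<open>L\<close> is the same at every point, so \<open>A\<close> is
  affine. A partial derivative of the composition is then a fixed linear combination of partial
  derivatives of \<open>f\<close> composed with \<open>A\<close>, which closes the
  induction.\<close>

lemma C_diff_affine:
  assumes "C_diff k f" and A: "\<And>x. (A has_derivative L) (at x)"
  shows "C_diff k (\<lambda>x. f (A x))"
  using assms(1)
proof (induction k arbitrary: f)
  case 0
  have "continuous_on UNIV A" using A
    by (meson continuous_at_imp_continuous_on has_derivative_continuous)
  then show ?case using 0 by (auto intro: continuous_on_compose2)
next
  case (Suc k)
  note F = C_diff_Suc_has_derivative[OF Suc.prems]
  have eq: "frechet_derivative f (at y) v = (\<Sum>b\<in>Basis. of_real (v \<bullet> b) * frechet_derivative f (at y) b)" for y v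
  proof -
    interpret bounded_linear "frechet_derivative f (at y)"
      using F(1) has_derivative_bounded_linear by blast
    have "frechet_derivative f (at y) v = frechet_derivative f (at y) (\<Sum>b\<in>Basis. (v \<bullet> b) *\<^sub>R b)"
      by (simp add: euclidean_representation)
    then show ?thesis
      by (simp add: sum scale scaleR_conv_of_real)
  qed
  show ?case
  proof (rule C_diff_SucI)
    show "((\<lambda>x. f (A x)) has_derivative (\<lambda>h. frechet_derivative f (at (A x)) (L h))) (at x)" for x
      using diff_chain_at[OF A F(1)] by (simp add: o_def)
    show "C_diff k (\<lambda>x. frechet_derivative f (at (A x)) (L b))" for b
      unfolding eq[of _ "L b"]
      by (intro C_diff_sum C_diff_mult C_diff_const) (rule Suc.IH[OF F(2)])
  qed
qed

section \<open>Square-integrable functions\<close>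

lemma L2_measurable: "f \<in> L2 \<Omega> \<Longrightarrow> f \<in> borel_measurable (lebesgue_on \<Omega>)"
  by (simp add: L2_def)

lemma L2_square_integrable: "f \<in> L2 \<Omega> \<Longrightarrow> integrable (lebesgue_on \<Omega>) (\<lambda>x. (norm (f x))\<^sup>2)"
  by (simp add: L2_def)

lemma L2_norm_nonneg [simp]: "0 \<le> L2_norm \<Omega> f"
  by (simp add: L2_norm_def)

lemma L2_norm_power2: "(L2_norm \<Omega> f)\<^sup>2 = (\<integral>x. (norm (f x))\<^sup>2 \<partial>lebesgue_on \<Omega>)"
  by (simp add: L2_norm_def)

lemma L2_zero [simp]: "(\<lambda>x. 0) \<in> L2 \<Omega>"
  by (simp add: L2_def)

lemma L2_bound:
  assumes "f \<in> L2 \<Omega>" "g \<in> borel_measurable (lebesgue_on \<Omega>)"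
    "AE x in lebesgue_on \<Omega>. norm (g x) \<le> C * norm (f x)"
  shows "g \<in> L2 \<Omega>"
proof -
  have "integrable (lebesgue_on \<Omega>) (\<lambda>x. (norm (g x))\<^sup>2)"
  proof (rule Bochner_Integration.integrable_bound)
    show "integrable (lebesgue_on \<Omega>) (\<lambda>x. C\<^sup>2 * (norm (f x))\<^sup>2)"
      using L2_square_integrable[OF assms(1)] by simp
    show "(\<lambda>x. (norm (g x))\<^sup>2) \<in> borel_measurable (lebesgue_on \<Omega>)"
      using assms(2) by measurable
    show "AE x in lebesgue_on \<Omega>. norm ((norm (g x))\<^sup>2) \<le> norm (C\<^sup>2 * (norm (f x))\<^sup>2)"
      using assms(3)
    proof eventually_elim
      case (elim x)
      have "(norm (g x))\<^sup>2 \<le> (C * norm (f x))\<^sup>2"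
        using elim by (intro power_mono) auto
      then show ?case by (simp add: power_mult_distrib)
    qed
  qed
  with assms(2) show ?thesis by (simp add: L2_def)
qed

lemma L2_cmult: "f \<in> L2 \<Omega> \<Longrightarrow> (\<lambda>x. c * f x) \<in> L2 \<Omega>"
  by (rule L2_bound[where f=f and C="norm c"]) (auto simp: norm_mult intro!: borel_measurable_times dest: L2_measurable)

lemma L2_cnj: "f \<in> L2 \<Omega> \<Longrightarrow> (\<lambda>x. cnj (f x)) \<in> L2 \<Omega>"
  by (rule L2_bound[where f=f and C=1])
    (auto simp: L2_measurable intro: borel_measurable_continuous_on[OF continuous_on_cnj[OF continuous_on_id]])

lemma L2_norm_cnj: "L2_norm \<Omega> (\<lambda>x. cnj (f x)) = L2_norm \<Omega> f"
  by (simp add: L2_norm_def)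

lemma L2_mult_bounded:
  assumes "f \<in> L2 \<Omega>" "g \<in> borel_measurable (lebesgue_on \<Omega>)" "\<And>x. x \<in> \<Omega> \<Longrightarrow> norm (g x) \<le> C"
  shows "(\<lambda>x. g x * f x) \<in> L2 \<Omega>"
proof (rule L2_bound[where C=C])
  show "(\<lambda>x. g x * f x) \<in> borel_measurable (lebesgue_on \<Omega>)"
    using assms L2_measurable by measurable
  show "AE x in lebesgue_on \<Omega>. norm (g x * f x) \<le> C * norm (f x)"
    by (rule AE_I2) (use assms(3) in \<open>auto simp: norm_mult space_restrict_space intro!: mult_right_mono\<close>)
qed (fact assms)

lemma L2_prod_integrable:
  assumes "f \<in> L2 \<Omega>" "g \<in> L2 \<Omega>"
  shows "integrable (lebesgue_on \<Omega>) (\<lambda>x. f x * g x)"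
    and "integrable (lebesgue_on \<Omega>) (\<lambda>x. norm (f x) * norm (g x))"
proof -
  have I: "integrable (lebesgue_on \<Omega>) (\<lambda>x. (norm (f x))\<^sup>2 + (norm (g x))\<^sup>2)"
    using assms by (simp add: L2_square_integrable)
  have le: "norm (f x) * norm (g x) \<le> (norm (f x))\<^sup>2 + (norm (g x))\<^sup>2" for x
    using sum_squares_bound[of "norm (f x)" "norm (g x)"] mult_nonneg_nonneg[OF norm_ge_zero[of "f x"] norm_ge_zero[of "g x"]]
    by linarith
  note [measurable] = assms[THEN L2_measurable]
  show "integrable (lebesgue_on \<Omega>) (\<lambda>x. f x * g x)"
    by (rule Bochner_Integration.integrable_bound[OF I]) (auto simp: norm_mult intro!: order_trans[OF le])
  show "integrable (lebesgue_on \<Omega>) (\<lambda>x. norm (f x) * norm (g x))"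
    by (rule Bochner_Integration.integrable_bound[OF I]) (auto intro!: order_trans[OF le])
qed

lemma L2_add:
  assumes "f \<in> L2 \<Omega>" "g \<in> L2 \<Omega>"
  shows "(\<lambda>x. f x + g x) \<in> L2 \<Omega>"
proof -
  note [measurable] = assms[THEN L2_measurable]
  have I: "integrable (lebesgue_on \<Omega>) (\<lambda>x. 2 * ((norm (f x))\<^sup>2 + (norm (g x))\<^sup>2))"
    using assms by (simp add: L2_square_integrable)
  have le: "(norm (f x + g x))\<^sup>2 \<le> 2 * ((norm (f x))\<^sup>2 + (norm (g x))\<^sup>2)" for x
  proof -
    have "(norm (f x + g x))\<^sup>2 \<le> (norm (f x) + norm (g x))\<^sup>2"
      by (intro power_mono norm_triangle_ineq) auto
    also have "\<dots> \<le> 2 * ((norm (f x))\<^sup>2 + (norm (g x))\<^sup>2)"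
      using sum_squares_bound[of "norm (f x)" "norm (g x)"] by (simp add: power2_sum)
    finally show ?thesis .
  qed
  have "integrable (lebesgue_on \<Omega>) (\<lambda>x. (norm (f x + g x))\<^sup>2)"
    by (rule Bochner_Integration.integrable_bound[OF I]) (auto intro!: order_trans[OF le])
  then show ?thesis by (simp add: L2_def)
qed

lemma L2_diff: "f \<in> L2 \<Omega> \<Longrightarrow> g \<in> L2 \<Omega> \<Longrightarrow> (\<lambda>x. f x - g x) \<in> L2 \<Omega>"
  using L2_add[OF _ L2_cmult[of g \<Omega> "-1"], of f] by simp

lemma L2_sum: "(\<And>i. i \<in> I \<Longrightarrow> f i \<in> L2 \<Omega>) \<Longrightarrow> (\<lambda>x. \<Sum>i\<in>I. f i x) \<in> L2 \<Omega>"
proof (induction I rule: infinite_finite_induct)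
  case (insert i I)
  then show ?case using L2_add[of "f i" \<Omega> "\<lambda>x. \<Sum>i\<in>I. f i x"] by simp
qed simp_all

text \<open>The integral of \<open>(norm (f x) - t * norm (g x))\<^sup>2\<close> is a quadratic in
  \<open>t\<close> that is never negative; evaluating it at its minimum gives the bound.\<close>

lemma L2_Cauchy_Schwarz_norm:
  assumes "f \<in> L2 \<Omega>" "g \<in> L2 \<Omega>"
  shows "(\<integral>x. norm (f x) * norm (g x) \<partial>lebesgue_on \<Omega>) \<le> L2_norm \<Omega> f * L2_norm \<Omega> g"
proof -
  define C where "C = (\<integral>x. norm (f x) * norm (g x) \<partial>lebesgue_on \<Omega>)"
  define A where "A = (L2_norm \<Omega> f)\<^sup>2"
  define B where "B = (L2_norm \<Omega> g)\<^sup>2"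
  note I = L2_square_integrable[OF assms(1)] L2_square_integrable[OF assms(2)] L2_prod_integrable(2)[OF assms]
  have C0: "0 \<le> C" unfolding C_def by (rule Bochner_Integration.integral_nonneg) auto
  have pos: "0 \<le> A - 2 * t * C + t\<^sup>2 * B" for t
  proof -
    have "0 \<le> (\<integral>x. (norm (f x) - t * norm (g x))\<^sup>2 \<partial>lebesgue_on \<Omega>)"
      by (rule Bochner_Integration.integral_nonneg) auto
    also have "\<dots> = (\<integral>x. (norm (f x))\<^sup>2 - 2 * t * (norm (f x) * norm (g x)) + t\<^sup>2 * (norm (g x))\<^sup>2 \<partial>lebesgue_on \<Omega>)"
      by (rule Bochner_Integration.integral_cong) (auto simp: power2_diff algebra_simps power_mult_distrib)
    also have "\<dots> = A - 2 * t * C + t\<^sup>2 * B"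
      using I by (simp add: A_def B_def C_def L2_norm_power2 Bochner_Integration.integral_add Bochner_Integration.integral_diff)
    finally show ?thesis .
  qed
  have "C\<^sup>2 \<le> A * B"
  proof (cases "B = 0")
    case True
    have "C = 0"
    proof (rule ccontr)
      assume "C \<noteq> 0"
      then have "0 < C" using C0 by simp
      \<comment> \<open>With \<open>B = 0\<close> the quadratic is linear in \<open>t\<close>, and
        this value of \<open>t\<close> makes it equal to -1.\<close>
      then show False using pos[of "(A + 1) / (2 * C)"] True by (simp add: field_simps)
    qed
    with True show ?thesis by simp
  next
    case False
    then have "0 < B" by (simp add: B_def)
    then show ?thesis using pos[of "C / B"] by (simp add: field_simps power2_eq_square)
  qed
  also have "A * B = (L2_norm \<Omega> f * L2_norm \<Omega> g)\<^sup>2" by (simp add: A_def B_def power_mult_distrib)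
  finally show ?thesis unfolding C_def[symmetric] by (rule power2_le_imp_le) simp
qed

lemma L2_Cauchy_Schwarz:
  assumes "f \<in> L2 \<Omega>" "g \<in> L2 \<Omega>"
  shows "norm (\<integral>x. f x * g x \<partial>lebesgue_on \<Omega>) \<le> L2_norm \<Omega> f * L2_norm \<Omega> g"
proof -
  have "norm (\<integral>x. f x * g x \<partial>lebesgue_on \<Omega>) \<le> (\<integral>x. norm (f x) * norm (g x) \<partial>lebesgue_on \<Omega>)"
    using Bochner_Integration.integral_norm_bound[of "lebesgue_on \<Omega>" "\<lambda>x. f x * g x"] by (simp add: norm_mult)
  then show ?thesis using L2_Cauchy_Schwarz_norm[OF assms] by linarith
qed

lemma L2_norm_triangle:
  assumes "f \<in> L2 \<Omega>" "g \<in> L2 \<Omega>"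
  shows "L2_norm \<Omega> (\<lambda>x. f x + g x) \<le> L2_norm \<Omega> f + L2_norm \<Omega> g"
proof (rule power2_le_imp_le)
  note I = L2_square_integrable[OF assms(1)] L2_square_integrable[OF assms(2)] L2_prod_integrable(2)[OF assms]
  have "(L2_norm \<Omega> (\<lambda>x. f x + g x))\<^sup>2 = (\<integral>x. (norm (f x + g x))\<^sup>2 \<partial>lebesgue_on \<Omega>)"
    by (simp add: L2_norm_power2)
  also have "\<dots> \<le> (\<integral>x. (norm (f x))\<^sup>2 + 2 * (norm (f x) * norm (g x)) + (norm (g x))\<^sup>2 \<partial>lebesgue_on \<Omega>)"
  proof (rule Bochner_Integration.integral_mono)
    show "integrable (lebesgue_on \<Omega>) (\<lambda>x. (norm (f x + g x))\<^sup>2)"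
      using L2_add[OF assms] by (simp add: L2_square_integrable)
    show "integrable (lebesgue_on \<Omega>) (\<lambda>x. (norm (f x))\<^sup>2 + 2 * (norm (f x) * norm (g x)) + (norm (g x))\<^sup>2)"
      using I by simp
    show "(norm (f x + g x))\<^sup>2 \<le> (norm (f x))\<^sup>2 + 2 * (norm (f x) * norm (g x)) + (norm (g x))\<^sup>2" for x
    proof -
      have "(norm (f x + g x))\<^sup>2 \<le> (norm (f x) + norm (g x))\<^sup>2"
        by (intro power_mono norm_triangle_ineq) auto
      then show ?thesis by (simp add: power2_sum algebra_simps)
    qed
  qed
  also have "\<dots> = (L2_norm \<Omega> f)\<^sup>2 + 2 * (\<integral>x. norm (f x) * norm (g x) \<partial>lebesgue_on \<Omega>) + (L2_norm \<Omega> g)\<^sup>2"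
    using I by (simp add: L2_norm_power2)
  also have "\<dots> \<le> (L2_norm \<Omega> f + L2_norm \<Omega> g)\<^sup>2"
    using L2_Cauchy_Schwarz_norm[OF assms] by (simp add: power2_sum)
  finally show "(L2_norm \<Omega> (\<lambda>x. f x + g x))\<^sup>2 \<le> (L2_norm \<Omega> f + L2_norm \<Omega> g)\<^sup>2" .
qed simp

lemma L2_norm_cmult: "L2_norm \<Omega> (\<lambda>x. c * f x) = norm c * L2_norm \<Omega> f"
  by (simp add: L2_norm_def norm_mult power_mult_distrib real_sqrt_mult)

lemma L2_norm_minus_commute: "L2_norm \<Omega> (\<lambda>x. f x - g x) = L2_norm \<Omega> (\<lambda>x. g x - f x)"
  by (simp add: L2_norm_def norm_minus_commute)

lemma L2_norm_triangle_diff: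
  assumes "f \<in> L2 \<Omega>" "g \<in> L2 \<Omega>" "h \<in> L2 \<Omega>"
  shows "L2_norm \<Omega> (\<lambda>x. f x - h x) \<le> L2_norm \<Omega> (\<lambda>x. f x - g x) + L2_norm \<Omega> (\<lambda>x. g x - h x)"
  using L2_norm_triangle[OF L2_diff[OF assms(1,2)] L2_diff[OF assms(2,3)]] by simp

lemma L2_norm_cong_AE:
  assumes "f \<in> borel_measurable (lebesgue_on \<Omega>)" "g \<in> borel_measurable (lebesgue_on \<Omega>)"
    "AE x in lebesgue_on \<Omega>. f x = g x"
  shows "L2_norm \<Omega> f = L2_norm \<Omega> g"
proof -
  note [measurable] = assms(1,2)
  have "(\<integral>x. (norm (f x))\<^sup>2 \<partial>lebesgue_on \<Omega>) = (\<integral>x. (norm (g x))\<^sup>2 \<partial>lebesgue_on \<Omega>)"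
    by (rule integral_cong_AE) (use assms(3) in auto)
  then show ?thesis by (simp add: L2_norm_def)
qed

lemma L2_norm_eq_0_imp:
  assumes "f \<in> L2 \<Omega>" "L2_norm \<Omega> f = 0"
  shows "AE x in lebesgue_on \<Omega>. f x = 0"
proof -
  have "(\<integral>x. (norm (f x))\<^sup>2 \<partial>lebesgue_on \<Omega>) = 0" using assms(2) by (simp add: L2_norm_def)
  then have "AE x in lebesgue_on \<Omega>. (norm (f x))\<^sup>2 = 0"
    using integral_nonneg_eq_0_iff_AE[OF L2_square_integrable[OF assms(1)]] by simp
  then show ?thesis by simp
qed

text \<open>Completeness of Lebesgue measure: a change on a null set preserves measurability.
  Extending by zero moves the question from \<Omega> to the whole space.\<close>

lemma lebesgue_on_measurable_AE:
  fixes f g :: "'a::euclidean_space \<Rightarrow> 'c::euclidean_space"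
  assumes "\<Omega> \<in> sets lebesgue" "f \<in> borel_measurable (lebesgue_on \<Omega>)"
    "AE x in lebesgue_on \<Omega>. f x = g x"
  shows "g \<in> borel_measurable (lebesgue_on \<Omega>)"
proof -
  obtain N where N: "N \<in> null_sets (lebesgue_on \<Omega>)" "{x \<in> space (lebesgue_on \<Omega>). f x \<noteq> g x} \<subseteq> N"
    using assms(3) by (auto simp: eventually_ae_filter)
  then have neg: "negligible N"
    using assms(1) by (auto simp: null_sets_restrict_space negligible_iff_null_sets)
  have "(\<lambda>x. if x \<in> \<Omega> then f x else 0) \<in> borel_measurable lebesgue"
    using assms(1,2) borel_measurable_if_I by blast
  then have "(\<lambda>x. if x \<in> \<Omega> then g x else 0) \<in> borel_measurable lebesgue"
    by (rule borel_measurable_AE)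
      (rule AE_I'[of N], use N neg in \<open>auto simp: negligible_iff_null_sets space_restrict_space\<close>)
  then show ?thesis using assms(1) borel_measurable_if_D by blast
qed

lemma L2_cong_AE:
  assumes "\<Omega> \<in> sets lebesgue" "f \<in> L2 \<Omega>" "AE x in lebesgue_on \<Omega>. f x = g x"
  shows "g \<in> L2 \<Omega>"
proof (rule L2_bound[where C=1, OF assms(2)])
  show "g \<in> borel_measurable (lebesgue_on \<Omega>)"
    by (rule lebesgue_on_measurable_AE[OF assms(1) L2_measurable[OF assms(2)] assms(3)])
qed (use assms(3) in \<open>auto elim: eventually_mono\<close>)

lemma L2_mono:
  assumes "S \<subseteq> \<Omega>" "S \<in> sets lebesgue" "\<Omega> \<in> sets lebesgue" "f \<in> L2 \<Omega>"
  shows "f \<in> L2 S" "L2_norm S f \<le> L2_norm \<Omega> f"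
proof -
  have m: "f \<in> borel_measurable (lebesgue_on S)"
    using measurable_restrict_mono[OF L2_measurable[OF assms(4)] assms(1)] .
  have I: "integrable lebesgue (\<lambda>x. indicator \<Omega> x *\<^sub>R (norm (f x))\<^sup>2)"
    using L2_square_integrable[OF assms(4)] assms(3) by (simp add: integrable_restrict_space)
  have IS: "integrable lebesgue (\<lambda>x. indicator S x *\<^sub>R (norm (f x))\<^sup>2)"
  proof (rule Bochner_Integration.integrable_bound[OF I])
    have "(\<lambda>x. indicator S x *\<^sub>R (indicator \<Omega> x *\<^sub>R (norm (f x))\<^sup>2)) \<in> borel_measurable lebesgue"
      using borel_measurable_integrable[OF I] assms(2) by measurable
    also have "(\<lambda>x. indicator S x *\<^sub>R (indicator \<Omega> x *\<^sub>R (norm (f x))\<^sup>2)) = (\<lambda>x. indicator S x *\<^sub>R (norm (f x))\<^sup>2)"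
      using assms(1) by (auto simp: indicator_def fun_eq_iff)
    finally show "(\<lambda>x. indicator S x *\<^sub>R (norm (f x))\<^sup>2) \<in> borel_measurable lebesgue" .
  qed (use assms(1) in \<open>auto simp: indicator_def\<close>)
  then have "integrable (lebesgue_on S) (\<lambda>x. (norm (f x))\<^sup>2)"
    using assms(2) by (simp add: integrable_restrict_space)
  with m show "f \<in> L2 S" by (simp add: L2_def)
  have "(\<integral>x. (norm (f x))\<^sup>2 \<partial>lebesgue_on S) \<le> (\<integral>x. (norm (f x))\<^sup>2 \<partial>lebesgue_on \<Omega>)"
    using assms IS I
    by (simp add: integral_restrict_space) (rule Bochner_Integration.integral_mono, auto simp: indicator_def)
  then show "L2_norm S f \<le> L2_norm \<Omega> f" by (simp add: L2_norm_def)
qed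

section \<open>Convergence in the mean\<close>

abbreviation L2_lim :: "'a::euclidean_space set \<Rightarrow> (nat \<Rightarrow> 'a \<Rightarrow> complex) \<Rightarrow> ('a \<Rightarrow> complex) \<Rightarrow> bool" where
  "L2_lim \<Omega> F f \<equiv> (\<lambda>n. L2_norm \<Omega> (\<lambda>x. F n x - f x)) \<longlonglongrightarrow> 0"

lemma L2_lim_bound:
  assumes "\<And>n. L2_norm \<Omega> (\<lambda>x. F n x - f x) \<le> C * L2_norm \<Omega>' (\<lambda>x. G n x - g x)" "L2_lim \<Omega>' G g"
  shows "L2_lim \<Omega> F f"
proof (rule tendsto_sandwich[of "\<lambda>n. 0"])
  show "(\<lambda>n. C * L2_norm \<Omega>' (\<lambda>x. G n x - g x)) \<longlonglongrightarrow> 0"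
    using tendsto_mult_right_zero[OF assms(2)] by simp
qed (use assms in auto)

lemma L2_lim_mono:
  assumes "L2_lim \<Omega> F f" "\<And>n. F n \<in> L2 \<Omega>" "f \<in> L2 \<Omega>" "S \<subseteq> \<Omega>" "S \<in> sets lebesgue" "\<Omega> \<in> sets lebesgue"
  shows "L2_lim S F f"
  by (rule L2_lim_bound[where C=1, OF _ assms(1)])
    (use L2_mono(2)[OF assms(4-6) L2_diff[OF assms(2,3)]] in simp)

lemma L2_lim_const: "L2_lim \<Omega> (\<lambda>n. f) f"
  by (simp add: L2_norm_def)

lemma L2_lim_add:
  assumes "L2_lim \<Omega> F f" "L2_lim \<Omega> G g" "\<And>n. F n \<in> L2 \<Omega>" "\<And>n. G n \<in> L2 \<Omega>" "f \<in> L2 \<Omega>" "g \<in> L2 \<Omega>"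
  shows "L2_lim \<Omega> (\<lambda>n x. F n x + G n x) (\<lambda>x. f x + g x)"
proof (rule tendsto_sandwich[of "\<lambda>n. 0"])
  show "(\<lambda>n. L2_norm \<Omega> (\<lambda>x. F n x - f x) + L2_norm \<Omega> (\<lambda>x. G n x - g x)) \<longlonglongrightarrow> 0"
    using tendsto_add[OF assms(1,2)] by simp
  have "L2_norm \<Omega> (\<lambda>x. (F n x + G n x) - (f x + g x)) \<le> L2_norm \<Omega> (\<lambda>x. F n x - f x) + L2_norm \<Omega> (\<lambda>x. G n x - g x)" for n
    using L2_norm_triangle[OF L2_diff[OF assms(3,5)] L2_diff[OF assms(4,6)], of n n] by (simp add: algebra_simps)
  then show "\<forall>\<^sub>F n in sequentially. L2_norm \<Omega> (\<lambda>x. (F n x + G n x) - (f x + g x)) \<le> L2_norm \<Omega> (\<lambda>x. F n x - f x) + L2_norm \<Omega> (\<lambda>x. G n x - g x)"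
    by simp
qed auto

lemma L2_lim_cmult:
  assumes "L2_lim \<Omega> F f"
  shows "L2_lim \<Omega> (\<lambda>n x. c * F n x) (\<lambda>x. c * f x)"
proof (rule L2_lim_bound[OF _ assms])
  show "L2_norm \<Omega> (\<lambda>x. c * F n x - c * f x) \<le> norm c * L2_norm \<Omega> (\<lambda>x. F n x - f x)" for n
    by (simp add: L2_norm_cmult flip: right_diff_distrib)
qed

lemma L2_lim_mult_bounded:
  assumes "L2_lim \<Omega> F f" "\<And>n. F n \<in> L2 \<Omega>" "f \<in> L2 \<Omega>"
    "g \<in> borel_measurable (lebesgue_on \<Omega>)" "\<And>x. x \<in> \<Omega> \<Longrightarrow> norm (g x) \<le> C"
  shows "L2_lim \<Omega> (\<lambda>n x. g x * F n x) (\<lambda>x. g x * f x)"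
proof (rule L2_lim_bound[OF _ assms(1)])
  fix n
  have d: "(\<lambda>x. F n x - f x) \<in> L2 \<Omega>" by (rule L2_diff[OF assms(2,3)])
  have "(\<integral>x. (norm (g x * (F n x - f x)))\<^sup>2 \<partial>lebesgue_on \<Omega>) \<le> (\<integral>x. C\<^sup>2 * (norm (F n x - f x))\<^sup>2 \<partial>lebesgue_on \<Omega>)"
  proof (rule Bochner_Integration.integral_mono)
    show "integrable (lebesgue_on \<Omega>) (\<lambda>x. (norm (g x * (F n x - f x)))\<^sup>2)"
      by (rule L2_square_integrable[OF L2_mult_bounded[OF d assms(4,5)]])
    show "integrable (lebesgue_on \<Omega>) (\<lambda>x. C\<^sup>2 * (norm (F n x - f x))\<^sup>2)"
      using L2_square_integrable[OF d] by simp
    show "(norm (g x * (F n x - f x)))\<^sup>2 \<le> C\<^sup>2 * (norm (F n x - f x))\<^sup>2" if "x \<in> space (lebesgue_on \<Omega>)" for x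
      using that assms(5) by (auto simp: norm_mult power_mult_distrib space_restrict_space intro!: mult_right_mono power_mono)
  qed
  then have "L2_norm \<Omega> (\<lambda>x. g x * (F n x - f x)) \<le> sqrt (C\<^sup>2 * (L2_norm \<Omega> (\<lambda>x. F n x - f x))\<^sup>2)"
    unfolding L2_norm_power2 by (simp add: L2_norm_def)
  then show "L2_norm \<Omega> (\<lambda>x. g x * F n x - g x * f x) \<le> \<bar>C\<bar> * L2_norm \<Omega> (\<lambda>x. F n x - f x)"
    by (simp add: right_diff_distrib real_sqrt_mult)
qed

lemma L2_lim_cnj: "L2_lim \<Omega> F f \<Longrightarrow> L2_lim \<Omega> (\<lambda>n x. cnj (F n x)) (\<lambda>x. cnj (f x))"
  by (simp add: L2_norm_cnj[of \<Omega> "\<lambda>x. _ x - f x", simplified])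

lemma L2_lim_norm:
  assumes "L2_lim \<Omega> F f" "\<And>n. F n \<in> L2 \<Omega>" "f \<in> L2 \<Omega>"
  shows "(\<lambda>n. L2_norm \<Omega> (F n)) \<longlonglongrightarrow> L2_norm \<Omega> f"
proof (rule LIM_zero_cancel, rule tendsto_rabs_zero_cancel, rule tendsto_sandwich[OF _ _ tendsto_const assms(1)])
  have "\<bar>L2_norm \<Omega> (F n) - L2_norm \<Omega> f\<bar> \<le> L2_norm \<Omega> (\<lambda>x. F n x - f x)" for n
    using L2_norm_triangle[OF L2_diff[OF assms(2)[of n] assms(3)] assms(3)]
      L2_norm_triangle[OF L2_diff[OF assms(3) assms(2)[of n]] assms(2)[of n]]
    by (simp add: L2_norm_minus_commute[of \<Omega> f])
  then show "\<forall>\<^sub>F n in sequentially. \<bar>L2_norm \<Omega> (F n) - L2_norm \<Omega> f\<bar> \<le> L2_norm \<Omega> (\<lambda>x. F n x - f x)" by simp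
qed simp

lemma L2_lim_integral_norm:
  assumes "L2_lim \<Omega> F f" "L2_lim \<Omega> G g" "\<And>n. F n \<in> L2 \<Omega>" "\<And>n. G n \<in> L2 \<Omega>" "f \<in> L2 \<Omega>" "g \<in> L2 \<Omega>"
  shows "(\<lambda>n. \<integral>x. norm (F n x * G n x - f x * g x) \<partial>lebesgue_on \<Omega>) \<longlonglongrightarrow> 0"
proof (rule tendsto_sandwich[of "\<lambda>n. 0"])
  show "(\<lambda>n. L2_norm \<Omega> (\<lambda>x. F n x - f x) * L2_norm \<Omega> (G n) + L2_norm \<Omega> f * L2_norm \<Omega> (\<lambda>x. G n x - g x)) \<longlonglongrightarrow> 0"
    using tendsto_add[OF tendsto_mult[OF assms(1) L2_lim_norm[OF assms(2,4,6)]] tendsto_mult_right_zero[OF assms(2)]]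
    by simp
  have "(\<integral>x. norm (F n x * G n x - f x * g x) \<partial>lebesgue_on \<Omega>)
      \<le> L2_norm \<Omega> (\<lambda>x. F n x - f x) * L2_norm \<Omega> (G n) + L2_norm \<Omega> f * L2_norm \<Omega> (\<lambda>x. G n x - g x)" for n
  proof -
    note d = L2_diff[OF assms(3)[of n] assms(5)] L2_diff[OF assms(4)[of n] assms(6)]
    have "(\<integral>x. norm (F n x * G n x - f x * g x) \<partial>lebesgue_on \<Omega>) \<le>
       (\<integral>x. norm (F n x - f x) * norm (G n x) + norm (f x) * norm (G n x - g x) \<partial>lebesgue_on \<Omega>)"
    proof (rule Bochner_Integration.integral_mono)
      show "integrable (lebesgue_on \<Omega>) (\<lambda>x. norm (F n x * G n x - f x * g x))"
        using L2_prod_integrable(1)[OF assms(3,4)] L2_prod_integrable(1)[OF assms(5,6)] by auto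
      show "integrable (lebesgue_on \<Omega>) (\<lambda>x. norm (F n x - f x) * norm (G n x) + norm (f x) * norm (G n x - g x))"
        using L2_prod_integrable(2)[OF d(1) assms(4)] L2_prod_integrable(2)[OF assms(5) d(2)] by auto
      show "norm (F n x * G n x - f x * g x) \<le> norm (F n x - f x) * norm (G n x) + norm (f x) * norm (G n x - g x)" for x
      proof -
        have "F n x * G n x - f x * g x = (F n x - f x) * G n x + f x * (G n x - g x)" by (simp add: algebra_simps)
        then show ?thesis by (metis norm_mult norm_triangle_ineq)
      qed
    qed
    also have "\<dots> = (\<integral>x. norm (F n x - f x) * norm (G n x) \<partial>lebesgue_on \<Omega>) + (\<integral>x. norm (f x) * norm (G n x - g x) \<partial>lebesgue_on \<Omega>)"
      using L2_prod_integrable(2)[OF d(1) assms(4)] L2_prod_integrable(2)[OF assms(5) d(2)] by simp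
    also have "\<dots> \<le> L2_norm \<Omega> (\<lambda>x. F n x - f x) * L2_norm \<Omega> (G n) + L2_norm \<Omega> f * L2_norm \<Omega> (\<lambda>x. G n x - g x)"
      by (intro add_mono L2_Cauchy_Schwarz_norm d assms)
    finally show ?thesis .
  qed
  then show "\<forall>\<^sub>F n in sequentially. (\<integral>x. norm (F n x * G n x - f x * g x) \<partial>lebesgue_on \<Omega>)
      \<le> L2_norm \<Omega> (\<lambda>x. F n x - f x) * L2_norm \<Omega> (G n) + L2_norm \<Omega> f * L2_norm \<Omega> (\<lambda>x. G n x - g x)" by simp
qed (auto intro!: eventuallyI Bochner_Integration.integral_nonneg)

lemma L2_lim_integral:
  assumes "L2_lim \<Omega> F f" "L2_lim \<Omega> G g" "\<And>n. F n \<in> L2 \<Omega>" "\<And>n. G n \<in> L2 \<Omega>" "f \<in> L2 \<Omega>" "g \<in> L2 \<Omega>"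
  shows "(\<lambda>n. \<integral>x. F n x * G n x \<partial>lebesgue_on \<Omega>) \<longlonglongrightarrow> (\<integral>x. f x * g x \<partial>lebesgue_on \<Omega>)"
proof (rule LIM_zero_cancel, rule tendsto_norm_zero_cancel, rule tendsto_sandwich[OF _ _ tendsto_const L2_lim_integral_norm[OF assms]])
  have "norm ((\<integral>x. F n x * G n x \<partial>lebesgue_on \<Omega>) - (\<integral>x. f x * g x \<partial>lebesgue_on \<Omega>))
     \<le> (\<integral>x. norm (F n x * G n x - f x * g x) \<partial>lebesgue_on \<Omega>)" for n
    using Bochner_Integration.integral_norm_bound[of "lebesgue_on \<Omega>" "\<lambda>x. F n x * G n x - f x * g x"]
      L2_prod_integrable(1)[OF assms(3,4)] L2_prod_integrable(1)[OF assms(5,6)] by simp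
  then show "\<forall>\<^sub>F n in sequentially. norm ((\<integral>x. F n x * G n x \<partial>lebesgue_on \<Omega>) - (\<integral>x. f x * g x \<partial>lebesgue_on \<Omega>))
     \<le> (\<integral>x. norm (F n x * G n x - f x * g x) \<partial>lebesgue_on \<Omega>)" by simp
qed simp

lemma L2_lim_integral_right:
  assumes "L2_lim \<Omega> F f" "\<And>n. F n \<in> L2 \<Omega>" "f \<in> L2 \<Omega>" "g \<in> L2 \<Omega>"
  shows "(\<lambda>n. \<integral>x. F n x * g x \<partial>lebesgue_on \<Omega>) \<longlonglongrightarrow> (\<integral>x. f x * g x \<partial>lebesgue_on \<Omega>)"
  using L2_lim_integral[OF assms(1) L2_lim_const assms(2,4,3,4)] .

text \<open>An L2-convergent sequence times a fixed L2 function converges in L1, so the identity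
  survives the limit. This is how relations between images under \<open>U\<close> pass from simple
  or bounded functions to general ones.\<close>

lemma L2_lim_prod_eq:
  assumes "L2_lim \<Omega> F f" "L2_lim \<Omega> G g" "\<And>n. F n \<in> L2 \<Omega>" "\<And>n. G n \<in> L2 \<Omega>" "f \<in> L2 \<Omega>" "g \<in> L2 \<Omega>"
    "h \<in> L2 \<Omega>" "k \<in> L2 \<Omega>" "\<And>n. AE x in lebesgue_on \<Omega>. F n x * h x = G n x * k x"
  shows "AE x in lebesgue_on \<Omega>. f x * h x = g x * k x"
proof -
  note I = L2_prod_integrable(1)[OF assms(3,7)] L2_prod_integrable(1)[OF assms(4,8)]
    L2_prod_integrable(1)[OF assms(5,7)] L2_prod_integrable(1)[OF assms(6,8)]
  have "(\<integral>x. norm (f x * h x - g x * k x) \<partial>lebesgue_on \<Omega>) \<le> 0"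
  proof (rule tendsto_lowerbound)
    show "(\<lambda>n. (\<integral>x. norm (F n x * h x - f x * h x) \<partial>lebesgue_on \<Omega>) + (\<integral>x. norm (G n x * k x - g x * k x) \<partial>lebesgue_on \<Omega>)) \<longlonglongrightarrow> 0"
      using tendsto_add[OF L2_lim_integral_norm[OF assms(1) L2_lim_const assms(3,7,5,7)]
          L2_lim_integral_norm[OF assms(2) L2_lim_const assms(4,8,6,8)]] by simp
    have "(\<integral>x. norm (f x * h x - g x * k x) \<partial>lebesgue_on \<Omega>) \<le> (\<integral>x. norm (F n x * h x - f x * h x) + norm (G n x * k x - g x * k x) \<partial>lebesgue_on \<Omega>)" for n
    proof (rule integral_mono_AE)
      show "AE x in lebesgue_on \<Omega>. norm (f x * h x - g x * k x) \<le> norm (F n x * h x - f x * h x) + norm (G n x * k x - g x * k x)"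
        using assms(9)[of n]
      proof eventually_elim
        case (elim x)
        have "f x * h x - g x * k x = (f x * h x - F n x * h x) + (G n x * k x - g x * k x)" using elim by simp
        also have "norm \<dots> \<le> norm (f x * h x - F n x * h x) + norm (G n x * k x - g x * k x)" by (rule norm_triangle_ineq)
        finally show ?case by (simp add: norm_minus_commute)
      qed
    qed (use I in auto)
    then show "\<forall>\<^sub>F n in sequentially. (\<integral>x. norm (f x * h x - g x * k x) \<partial>lebesgue_on \<Omega>) \<le> (\<integral>x. norm (F n x * h x - f x * h x) \<partial>lebesgue_on \<Omega>) + (\<integral>x. norm (G n x * k x - g x * k x) \<partial>lebesgue_on \<Omega>)"
      using I by simp
  qed simp
  moreover have "0 \<le> (\<integral>x. norm (f x * h x - g x * k x) \<partial>lebesgue_on \<Omega>)" by (rule Bochner_Integration.integral_nonneg) simp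
  ultimately have "(\<integral>x. norm (f x * h x - g x * k x) \<partial>lebesgue_on \<Omega>) = 0" by linarith
  moreover have "integrable (lebesgue_on \<Omega>) (\<lambda>x. norm (f x * h x - g x * k x))" using I by simp
  ultimately show ?thesis
    using integral_nonneg_eq_0_iff_AE[of "lebesgue_on \<Omega>" "\<lambda>x. norm (f x * h x - g x * k x)"] by simp
qed

section \<open>Test functions\<close>

text \<open>Any compact set outside of which the function vanishes may stand in for the support.
  Such a set is a union for sums and can be kept unchanged for products and derivatives.\<close>

lemma test_functions_iff:
  "\<phi> \<in> test_functions \<Omega> \<longleftrightarrow> smooth \<phi> \<and> (\<exists>K. compact K \<and> K \<subseteq> \<Omega> \<and> (\<forall>x. x \<notin> K \<longrightarrow> \<phi> x = 0))"
proof
  assume L: "\<phi> \<in> test_functions \<Omega>"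
  have "x \<notin> closure {x. \<phi> x \<noteq> 0} \<Longrightarrow> \<phi> x = 0" for x
    using closure_subset[of "{x. \<phi> x \<noteq> 0}"] by auto
  then show "smooth \<phi> \<and> (\<exists>K. compact K \<and> K \<subseteq> \<Omega> \<and> (\<forall>x. x \<notin> K \<longrightarrow> \<phi> x = 0))"
    using L unfolding test_functions_def by blast
next
  assume R: "smooth \<phi> \<and> (\<exists>K. compact K \<and> K \<subseteq> \<Omega> \<and> (\<forall>x. x \<notin> K \<longrightarrow> \<phi> x = 0))"
  then obtain K where K: "compact K" "K \<subseteq> \<Omega>" "\<forall>x. x \<notin> K \<longrightarrow> \<phi> x = 0" by blast
  have "closure {x. \<phi> x \<noteq> 0} \<subseteq> K"
    by (rule closure_minimal) (use K compact_imp_closed in auto)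
  then show "\<phi> \<in> test_functions \<Omega>"
    using R K(1,2) by (auto simp: test_functions_def intro: compact_closure[THEN iffD2] bounded_subset compact_imp_bounded)
qed

lemma test_functionsI:
  "smooth \<phi> \<Longrightarrow> compact K \<Longrightarrow> K \<subseteq> \<Omega> \<Longrightarrow> (\<And>x. x \<notin> K \<Longrightarrow> \<phi> x = 0) \<Longrightarrow> \<phi> \<in> test_functions \<Omega>"
  unfolding test_functions_iff by blast

lemma test_functions_smooth: "\<phi> \<in> test_functions \<Omega> \<Longrightarrow> smooth \<phi>"
  by (simp add: test_functions_iff)

lemma test_functions_mono: "\<Omega> \<subseteq> \<Omega>' \<Longrightarrow> \<phi> \<in> test_functions \<Omega> \<Longrightarrow> \<phi> \<in> test_functions \<Omega>'"
  unfolding test_functions_iff by blast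

lemma test_functions_outside: "\<phi> \<in> test_functions \<Omega> \<Longrightarrow> x \<notin> \<Omega> \<Longrightarrow> \<phi> x = 0"
  unfolding test_functions_iff by blast

lemma test_functions_mult:
  assumes "\<phi> \<in> test_functions \<Omega>" "smooth g"
  shows "(\<lambda>x. g x * \<phi> x) \<in> test_functions \<Omega>"
  using assms unfolding test_functions_iff by (auto simp: C_diff_mult)

lemma test_functions_cmult: "\<phi> \<in> test_functions \<Omega> \<Longrightarrow> (\<lambda>x. c * \<phi> x) \<in> test_functions \<Omega>"
  by (rule test_functions_mult) (simp_all add: C_diff_const)

lemma test_functions_add:
  assumes "\<phi> \<in> test_functions \<Omega>" "\<psi> \<in> test_functions \<Omega>"
  shows "(\<lambda>x. \<phi> x + \<psi> x) \<in> test_functions \<Omega>"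
proof -
  obtain K L where "compact K" "K \<subseteq> \<Omega>" "\<forall>x. x \<notin> K \<longrightarrow> \<phi> x = 0" "compact L" "L \<subseteq> \<Omega>" "\<forall>x. x \<notin> L \<longrightarrow> \<psi> x = 0"
    using assms unfolding test_functions_iff by blast
  then show ?thesis
    using assms by (intro test_functionsI[of _ "K \<union> L"] smooth_add) (auto simp: test_functions_smooth)
qed

lemma test_functions_diff:
  "\<phi> \<in> test_functions \<Omega> \<Longrightarrow> \<psi> \<in> test_functions \<Omega> \<Longrightarrow> (\<lambda>x. \<phi> x - \<psi> x) \<in> test_functions \<Omega>"
  using test_functions_add[OF _ test_functions_cmult[of \<psi> \<Omega> "-1"], of \<phi>] by simp

lemma test_functions_cnj: "\<phi> \<in> test_functions \<Omega> \<Longrightarrow> (\<lambda>x. cnj (\<phi> x)) \<in> test_functions \<Omega>"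
  unfolding test_functions_iff by (auto simp: C_diff_cnj)

lemma partial_deriv_outside:
  assumes "closed K" "\<And>x. x \<notin> K \<Longrightarrow> \<phi> x = 0" "x \<notin> K"
  shows "partial_deriv b \<phi> x = 0"
  using partial_deriv_local[of "- K" x \<phi> "\<lambda>x. 0" b] assms by (auto simp: partial_deriv_const)

lemma test_functions_partial_deriv:
  assumes "\<phi> \<in> test_functions \<Omega>" "b \<in> Basis"
  shows "partial_deriv b \<phi> \<in> test_functions \<Omega>"
  using assms smooth_partial_deriv partial_deriv_outside compact_imp_closed
  unfolding test_functions_iff by (metis (no_types, lifting))

lemma test_functions_sum:
  "(\<And>i. i \<in> I \<Longrightarrow> f i \<in> test_functions \<Omega>) \<Longrightarrow> (\<lambda>x. \<Sum>i\<in>I. f i x) \<in> test_functions \<Omega>"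
proof (induction I rule: infinite_finite_induct)
  case (insert i I)
  then show ?case using test_functions_add[of "f i" \<Omega> "\<lambda>x. \<Sum>i\<in>I. f i x"] by simp
qed (auto intro!: test_functionsI[of _ "{}"] simp: C_diff_const)

lemma test_functions_laplacian: "\<phi> \<in> test_functions \<Omega> \<Longrightarrow> laplacian \<phi> \<in> test_functions \<Omega>"
proof -
  assume "\<phi> \<in> test_functions \<Omega>"
  then have "(\<lambda>x. \<Sum>b\<in>Basis. partial_deriv b (partial_deriv b \<phi>) x) \<in> test_functions \<Omega>"
    by (intro test_functions_sum test_functions_partial_deriv)
  also have "(\<lambda>x. \<Sum>b\<in>Basis. partial_deriv b (partial_deriv b \<phi>) x) = laplacian \<phi>"
    by (simp add: laplacian_def fun_eq_iff)
  finally show ?thesis .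
qed

lemma test_functions_shift:
  assumes "\<phi> \<in> test_functions UNIV" "\<And>x. x \<notin> cball 0 e \<Longrightarrow> \<phi> x = 0" "cball a e \<subseteq> \<Omega>"
  shows "(\<lambda>x. \<phi> (x - a)) \<in> test_functions \<Omega>"
proof (rule test_functionsI)
  have "((\<lambda>x. x - a) has_derivative (\<lambda>h. h)) (at x)" for x
    by (auto intro!: derivative_eq_intros)
  from C_diff_affine[OF _ this] test_functions_smooth[OF assms(1)]
  show "smooth (\<lambda>x. \<phi> (x - a))" by blast
  show "\<phi> (x - a) = 0" if "x \<notin> cball a e" for x
    using that by (intro assms(2)) (auto simp: dist_norm norm_minus_commute)
qed (use assms(3) in auto)

lemma partial_deriv_shift:
  assumes "smooth \<phi>"
  shows "partial_deriv b (\<lambda>x. \<phi> (x - a)) x = partial_deriv b \<phi> (x - a)"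
proof -
  have "((\<lambda>x. x - a) has_derivative (\<lambda>h. h)) (at x)" for x
    by (auto intro!: derivative_eq_intros)
  note d = diff_chain_at[OF this smooth_has_derivative[OF assms], unfolded o_def]
  have "partial_deriv b \<phi> (x - a) = (\<Sum>c\<in>Basis. (b \<bullet> c) *\<^sub>R partial_deriv c \<phi> (x - a))"
    by (rule partial_deriv_eqI[OF smooth_has_derivative[OF assms]])
  with partial_deriv_eqI[OF d] show ?thesis by simp
qed

lemma laplacian_shift:
  assumes "smooth \<phi>"
  shows "laplacian (\<lambda>x. \<phi> (x - a)) x = laplacian \<phi> (x - a)"
proof -
  have "partial_deriv b (partial_deriv b (\<lambda>x. \<phi> (x - a))) x = partial_deriv b (partial_deriv b \<phi>) (x - a)"
    if "b \<in> Basis" for b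
  proof -
    have "partial_deriv b (\<lambda>x. \<phi> (x - a)) = (\<lambda>x. partial_deriv b \<phi> (x - a))"
      using partial_deriv_shift[OF assms] by blast
    then show ?thesis using partial_deriv_shift[OF smooth_partial_deriv[OF assms that]] by metis
  qed
  then show ?thesis by (simp add: laplacian_def)
qed

lemma continuous_imp_measurable_lebesgue_on:
  fixes f :: "'a::euclidean_space \<Rightarrow> 'b::euclidean_space"
  shows "continuous_on UNIV f \<Longrightarrow> f \<in> borel_measurable (lebesgue_on \<Omega>)"
  by (intro measurable_restrict_space1 measurable_completion) (simp add: borel_measurable_continuous_onI)

lemma smooth_measurable: "smooth f \<Longrightarrow> f \<in> borel_measurable (lebesgue_on \<Omega>)"
  using continuous_imp_measurable_lebesgue_on smooth_continuous by blast

lemma test_functions_bounded: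
  assumes "\<phi> \<in> test_functions \<Omega>" obtains C where "C > 0" "\<And>x. norm (\<phi> x) \<le> C"
proof -
  obtain K where K: "compact K" "\<forall>x. x \<notin> K \<longrightarrow> \<phi> x = 0"
    using assms unfolding test_functions_iff by blast
  have "compact (\<phi> ` K)"
    using K(1) assms by (intro compact_continuous_image smooth_continuous test_functions_smooth)
  then obtain C where "C > 0" "\<forall>y\<in>\<phi> ` K. norm y \<le> C"
    using compact_imp_bounded bounded_pos by metis
  then show ?thesis using that[of C] K(2) by (metis imageI less_imp_le norm_zero)
qed

lemma test_functions_L2:
  assumes "\<phi> \<in> test_functions \<Omega>'" "\<Omega> \<in> sets lebesgue"
  shows "\<phi> \<in> L2 \<Omega>"
proof -
  obtain K where K: "compact K" "\<forall>x. x \<notin> K \<longrightarrow> \<phi> x = 0"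
    using assms unfolding test_functions_iff by blast
  obtain C where C: "\<And>x. norm (\<phi> x) \<le> C" using test_functions_bounded[OF assms(1)] by blast
  have "integrable lebesgue (\<lambda>x. (norm (\<phi> x))\<^sup>2)"
  proof (rule Bochner_Integration.integrable_bound)
    have "K \<in> lmeasurable" using K(1) by (rule lmeasurable_compact)
    then show "integrable lebesgue (\<lambda>x. C\<^sup>2 * indicator K x :: real)"
      by (intro integrable_mult_right) (auto simp: fmeasurable_def)
    show "(\<lambda>x. (norm (\<phi> x))\<^sup>2) \<in> borel_measurable lebesgue"
      using smooth_measurable[OF test_functions_smooth[OF assms(1)], of UNIV] by simp
    show "AE x in lebesgue. norm ((norm (\<phi> x))\<^sup>2) \<le> norm (C\<^sup>2 * indicator K x :: real)"
      using C K(2) by (auto simp: indicator_def intro!: power_mono)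
  qed
  then have "\<phi> \<in> L2 UNIV"
    using smooth_measurable[OF test_functions_smooth[OF assms(1)], of UNIV] by (simp add: L2_def lebesgue_on_UNIV_eq)
  then show ?thesis using L2_mono(1)[of \<Omega> UNIV \<phi>] assms(2) by simp
qed

lemma test_functions_integrable:
  assumes "\<phi> \<in> test_functions \<Omega>'"
  shows "integrable lebesgue \<phi>"
proof -
  obtain K where K: "compact K" "\<forall>x. x \<notin> K \<longrightarrow> \<phi> x = 0"
    using assms unfolding test_functions_iff by blast
  obtain C where C: "\<And>x. norm (\<phi> x) \<le> C" using test_functions_bounded[OF assms(1)] by blast
  show ?thesis
  proof (rule Bochner_Integration.integrable_bound)
    have "K \<in> lmeasurable" using K(1) by (rule lmeasurable_compact)
    then show "integrable lebesgue (\<lambda>x. C * indicator K x :: real)"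
      by (intro integrable_mult_right) (auto simp: fmeasurable_def)
    show "\<phi> \<in> borel_measurable lebesgue"
      using smooth_measurable[OF test_functions_smooth[OF assms(1)], of UNIV] by simp
    show "AE x in lebesgue. norm (\<phi> x) \<le> norm (C * indicator K x :: real)"
      using C K(2) by (auto simp: indicator_def intro: order_trans[OF _ abs_ge_self])
  qed
qed

section \<open>Smooth bumps\<close>

definition bump_profile :: "nat \<Rightarrow> real \<Rightarrow> real" where
  "bump_profile m t = (if t \<le> 0 then 0 else (1 / t) ^ m / exp (1 / t))"

lemma bump_profile_tendsto_0: "((\<lambda>t. (1 / t) ^ m / exp (1 / t)) \<longlongrightarrow> (0::real)) (at_right 0)"
proof -
  have "filterlim (\<lambda>t::real. 1 / t) at_top (at_right 0)"
    using filterlim_inverse_at_top_right by (simp add: inverse_eq_divide)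
  from filterlim_compose[OF tendsto_power_div_exp_0 this] show ?thesis .
qed

text \<open>With \<open>s = 1 / t\<close> the profile is \<open>s ^ m / exp s\<close>, and the
  derivative of \<open>s\<close> is \<open>- s\<^sup>2\<close>. The power \<open>m\<close> is
  carried in the definition so that differentiation stays within the span of the family. At 0 the
  difference quotient from the right is the profile with \<open>m + 1\<close>, which tends to
  0.\<close>

lemma bump_profile_DERIV:
  "(bump_profile m has_real_derivative (bump_profile (m + 2) t - real m * bump_profile (m + 1) t)) (at t)"
proof (cases t "0::real" rule: linorder_cases)
  case less
  have "((\<lambda>t. 0) has_real_derivative 0) (at t)" by simp
  then have "(bump_profile m has_real_derivative 0) (at t)"
    by (rule has_field_derivative_transform_within_open[of _ _ _ "{..<0}"])
      (use less in \<open>auto simp: bump_profile_def\<close>)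
  then show ?thesis using less by (simp add: bump_profile_def)
next
  case equal
  have "((\<lambda>h. (bump_profile m h - bump_profile m 0) / (h - 0)) \<longlongrightarrow> 0) (at_right 0)"
  proof (rule Lim_transform_eventually[OF bump_profile_tendsto_0[of "Suc m"]])
    show "\<forall>\<^sub>F h in at_right 0. (1 / h) ^ Suc m / exp (1 / h) = (bump_profile m h - bump_profile m 0) / (h - 0)"
      by (auto simp: eventually_at_filter bump_profile_def)
  qed
  moreover have "((\<lambda>h. (bump_profile m h - bump_profile m 0) / (h - 0)) \<longlongrightarrow> 0) (at_left 0)"
  proof (rule Lim_transform_eventually[OF tendsto_const[of 0]])
    show "\<forall>\<^sub>F h in at_left 0. 0 = (bump_profile m h - bump_profile m 0) / (h - 0)"
      by (auto simp: eventually_at_filter bump_profile_def)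
  qed
  ultimately have "(bump_profile m has_real_derivative 0) (at 0)"
    by (simp add: has_field_derivative_iff filterlim_split_at)
  then show ?thesis using equal by (simp add: bump_profile_def)
next
  case greater
  have "((\<lambda>t. (1 / t) ^ m / exp (1 / t)) has_real_derivative
     ((1 / t) ^ (m + 2) / exp (1 / t) - real m * ((1 / t) ^ (m + 1) / exp (1 / t)))) (at t)"
  proof (cases m)
    case 0
    then show ?thesis using greater
      by (auto intro!: derivative_eq_intros simp: field_simps power2_eq_square)
  next
    case (Suc n)
    then show ?thesis using greater
      by (auto intro!: derivative_eq_intros simp: divide_simps power2_eq_square) (cases n, auto simp: algebra_simps)
  qed
  then have "(bump_profile m has_real_derivative ((1 / t) ^ (m + 2) / exp (1 / t) - real m * ((1 / t) ^ (m + 1) / exp (1 / t)))) (at t)"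
    by (rule has_field_derivative_transform_within_open[of _ _ _ "{0<..}"])
      (use greater in \<open>auto simp: bump_profile_def\<close>)
  then show ?thesis using greater by (simp add: bump_profile_def)
qed

lemma C_diff_bump: "C_diff k (\<lambda>x. complex_of_real (bump_profile m (r - x \<bullet> x)))"
proof (induction k arbitrary: m)
  case 0
  have "continuous_on UNIV (bump_profile m)"
    using bump_profile_DERIV DERIV_isCont by (intro continuous_at_imp_continuous_on) blast
  then show ?case
    by (auto intro!: continuous_intros intro: continuous_on_compose2)
next
  case (Suc k)
  show ?case
  proof (rule C_diff_SucI)
    fix x :: 'a
    have "((\<lambda>x. r - x \<bullet> x) has_derivative (\<lambda>h. - 2 * (h \<bullet> x))) (at x)"
      by (auto intro!: derivative_eq_intros simp: inner_commute)
    from DERIV_compose_FDERIV[OF bump_profile_DERIV this]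
    have "((\<lambda>x. bump_profile m (r - x \<bullet> x)) has_derivative
        (\<lambda>h. (bump_profile (m + 2) (r - x \<bullet> x) - real m * bump_profile (m + 1) (r - x \<bullet> x)) * (- 2 * (h \<bullet> x)))) (at x)"
      by (simp add: mult.commute)
    from has_derivative_of_real[OF this]
    show "((\<lambda>x. complex_of_real (bump_profile m (r - x \<bullet> x))) has_derivative
        (\<lambda>h. complex_of_real ((bump_profile (m + 2) (r - x \<bullet> x) - real m * bump_profile (m + 1) (r - x \<bullet> x)) * (- 2 * (h \<bullet> x))))) (at x)" .
  next
    fix b :: 'a
    have "C_diff k (\<lambda>x. (complex_of_real (bump_profile (m + 2) (r - x \<bullet> x)) + (- of_nat m) * complex_of_real (bump_profile (m + 1) (r - x \<bullet> x)))
        * ((-2) * complex_of_real (x \<bullet> b)))"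
      by (intro C_diff_mult C_diff_add C_diff_const C_diff_inner Suc.IH)
    then show "C_diff k (\<lambda>x. complex_of_real ((bump_profile (m + 2) (r - x \<bullet> x) - real m * bump_profile (m + 1) (r - x \<bullet> x)) * (- 2 * (b \<bullet> x))))"
      by (simp add: inner_commute algebra_simps)
  qed
qed

text \<open>Negligibility of the exceptional set requires no measurability of \<open>P\<close> and
  passes to subsets, unions and Lipschitz images; most changes of domain below are made in this
  form.\<close>

lemma AE_lebesgue_on_iff:
  assumes "S \<in> sets lebesgue"
  shows "(AE x in lebesgue_on S. P x) \<longleftrightarrow> negligible {x \<in> S. \<not> P x}"
proof -
  have "(AE x in lebesgue_on S. P x) \<longleftrightarrow> (AE x in lebesgue. x \<in> S \<longrightarrow> P x)"
    using assms by (intro AE_restrict_space_iff) auto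
  also have "\<dots> \<longleftrightarrow> negligible {x. \<not> (x \<in> S \<longrightarrow> P x)}"
    unfolding eventually_ae_filter
    using negligible_iff_null_sets negligible_subset by (auto; blast)
  also have "{x. \<not> (x \<in> S \<longrightarrow> P x)} = {x \<in> S. \<not> P x}" by auto
  finally show ?thesis .
qed

lemma mollifier_exists:
  assumes "r > 0"
  obtains \<rho> :: "'a::euclidean_space \<Rightarrow> real"
  where "(\<lambda>x. complex_of_real (\<rho> x)) \<in> test_functions UNIV"
    "\<And>x. 0 \<le> \<rho> x" "\<And>x. x \<notin> cball 0 r \<Longrightarrow> \<rho> x = 0" "integral\<^sup>L lebesgue \<rho> = 1" "continuous_on UNIV \<rho>"
proof -
  \<comment> \<open>The argument is a polynomial in \<open>x\<close>, so there is no loss of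
    smoothness at the origin. The function is positive exactly on the open ball of radius
    \<open>r\<close>, which lets its integral be normalised.\<close>
  define f where "f x = bump_profile 0 (r\<^sup>2 - x \<bullet> x)" for x :: 'a
  have cont: "continuous_on UNIV (bump_profile 0)"
    using bump_profile_DERIV DERIV_isCont by (intro continuous_at_imp_continuous_on) blast
  have contf: "continuous_on UNIV f" unfolding f_def
    by (rule continuous_on_compose2[OF cont]) (auto intro!: continuous_intros)
  have out: "f x = 0" if "x \<notin> ball 0 r" for x
  proof -
    have "r\<^sup>2 \<le> (norm x)\<^sup>2" using that assms by (intro power_mono) auto
    then show ?thesis by (simp add: f_def bump_profile_def power2_norm_eq_inner)
  qed
  have pos: "f x > 0" if "x \<in> ball 0 r" for x
  proof -
    have "(norm x)\<^sup>2 < r\<^sup>2" using that assms by (intro power_strict_mono) auto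
    then show ?thesis by (simp add: f_def bump_profile_def power2_norm_eq_inner)
  qed
  have nonneg: "0 \<le> f x" for x using out[of x] pos[of x] by (cases "x \<in> ball 0 r") auto
  have test: "(\<lambda>x. complex_of_real (f x)) \<in> test_functions UNIV"
    by (rule test_functionsI[of _ "cball 0 r"]) (use out in \<open>auto simp: f_def C_diff_bump\<close>)
  have int: "integrable lebesgue f"
    using integrable_Re[OF test_functions_integrable[OF test]] by simp
  define c where "c = integral\<^sup>L lebesgue f"
  have "c \<noteq> 0"
  proof
    assume "c = 0"
    then have "AE x in lebesgue. f x = 0"
      using integral_nonneg_eq_0_iff_AE[OF int] nonneg by (simp add: c_def)
    then have "AE x in lebesgue_on UNIV. f x = 0" unfolding lebesgue_on_UNIV_eq .
    then have "negligible {x. f x \<noteq> 0}" by (subst (asm) AE_lebesgue_on_iff) auto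
    then have "negligible (ball (0::'a) r)"
      by (rule negligible_subset) (use pos in fastforce)
    then show False using open_not_negligible[of "ball (0::'a) r"] assms by auto
  qed
  moreover have "0 \<le> c" unfolding c_def by (rule Bochner_Integration.integral_nonneg) (rule nonneg)
  ultimately have c: "c > 0" by simp
  show ?thesis
  proof (rule that[of "\<lambda>x. inverse c * f x"])
    show "(\<lambda>x. complex_of_real (inverse c * f x)) \<in> test_functions UNIV"
      using test_functions_cmult[OF test, of "of_real (inverse c)"] by simp
    show "integral\<^sup>L lebesgue (\<lambda>x. inverse c * f x) = 1" using c by (simp add: c_def)
    show "continuous_on UNIV (\<lambda>x. inverse c * f x)" by (intro continuous_intros contf)
  qed (use out nonneg c in auto)
qed

section \<open>Convolution\<close>

text \<open>A correlation rather than a convolution: without reflecting \<eta>, the shifted function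
  \<open>\<eta> (x - a)\<close> can be inserted directly as a test function into a weak equation on
  \<Omega>. The price is a minus sign in each derivative with respect to \<open>a\<close>.\<close>

definition convolve :: "'a::euclidean_space set \<Rightarrow> ('a \<Rightarrow> complex) \<Rightarrow> ('a \<Rightarrow> complex) \<Rightarrow> 'a \<Rightarrow> complex" where
  "convolve \<Omega> u \<eta> a = (\<integral>x. u x * \<eta> (x - a) \<partial>lebesgue_on \<Omega>)"

lemma test_uniformly_continuous:
  assumes "\<phi> \<in> test_functions UNIV" "e > 0"
  obtains d where "d > 0" "\<And>x y. dist x y < d \<Longrightarrow> dist (\<phi> x) (\<phi> y) < e"
proof -
  obtain K where K: "compact K" "\<forall>x. x \<notin> K \<longrightarrow> \<phi> x = 0"
    using assms unfolding test_functions_iff by blast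
  obtain R where R: "K \<subseteq> cball 0 R"
    using compact_imp_bounded[OF K(1)] unfolding bounded_pos by (metis mem_cball_0 subsetI)
  have "uniformly_continuous_on (cball 0 (R + 1)) \<phi>"
    by (intro compact_uniformly_continuous smooth_continuous test_functions_smooth[OF assms(1)]) simp
  then obtain d where d: "d > 0" "\<And>x y. x \<in> cball 0 (R + 1) \<Longrightarrow> y \<in> cball 0 (R + 1) \<Longrightarrow> dist x y < d \<Longrightarrow> dist (\<phi> x) (\<phi> y) < e"
    using assms(2) unfolding uniformly_continuous_on_def by (metis dist_commute)
  show ?thesis
  \<comment> \<open>The bound 1 keeps both points in the ball of radius \<open>R + 1\<close> as soon
    as one of them lies in \<open>K\<close>; otherwise both values are 0.\<close>
  proof (rule that[of "min d 1"])
    fix x y :: 'a assume xy: "dist x y < min d 1"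
    show "dist (\<phi> x) (\<phi> y) < e"
    proof (cases "x \<in> K \<or> y \<in> K")
      case True
      have "norm x \<le> norm y + dist x y" "norm y \<le> norm x + dist x y"
        by (metis add.commute dist_norm norm_triangle_sub) (metis add.commute dist_commute dist_norm norm_triangle_sub)
      moreover have "norm x \<le> R \<or> norm y \<le> R" using True R by auto
      ultimately show ?thesis using xy by (intro d(2)) auto
    next
      case False then show ?thesis using K(2) assms(2) by simp
    qed
  qed (use d in auto)
qed

lemma test_uniformly_differentiable:
  fixes \<phi> :: "'a::euclidean_space \<Rightarrow> complex"
  assumes "\<phi> \<in> test_functions UNIV" "e > 0"
  obtains d where "d > 0" "\<And>x h. norm h < d \<Longrightarrow>
    norm (\<phi> (x + h) - \<phi> x - (\<Sum>b\<in>Basis. (h \<bullet> b) *\<^sub>R partial_deriv b \<phi> x)) \<le> e * norm h"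
proof -
  \<comment> \<open>Each partial derivative contributes an equal share to the operator norm of the
    difference of two derivatives.\<close>
  define e' where "e' = e / real DIM('a)"
  have e': "e' > 0" using assms(2) by (simp add: e'_def)
  have "\<exists>d>0. \<forall>x y. dist x y < d \<longrightarrow> dist (partial_deriv b \<phi> x) (partial_deriv b \<phi> y) < e'" if "b \<in> Basis" for b
    using test_uniformly_continuous[OF test_functions_partial_deriv[OF assms(1) that] e'] by metis
  then obtain D where D: "\<And>b. b \<in> Basis \<Longrightarrow> D b > 0"
    "\<And>b x y. b \<in> Basis \<Longrightarrow> dist x y < D b \<Longrightarrow> dist (partial_deriv b \<phi> x) (partial_deriv b \<phi> y) < e'"
    by metis
  define d where "d = Min (D ` Basis)"
  have d: "d > 0" "\<And>b. b \<in> Basis \<Longrightarrow> d \<le> D b" using D(1) by (auto simp: d_def)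
  let ?F = "\<lambda>x h. \<Sum>b\<in>Basis. (h \<bullet> b) *\<^sub>R partial_deriv b \<phi> x"
  show ?thesis
  proof (rule that[OF d(1)])
    fix x h :: 'a assume h: "norm h < d"
    have "norm (\<phi> (x + h) - \<phi> x - ?F x ((x + h) - x)) \<le> norm ((x + h) - x) * e"
    proof (rule differentiable_bound_linearization[of x "x + h" "ball x d"])
      show "x + t *\<^sub>R (x + h - x) \<in> ball x d" if "t \<in> {0..1}" for t
        using that h by (auto simp: dist_norm intro: le_less_trans[OF mult_left_le_one_le])
      show "(\<phi> has_derivative ?F y) (at y within ball x d)" for y
        using smooth_has_derivative[OF test_functions_smooth[OF assms(1)]] has_derivative_at_withinI by blast
      show "onorm (?F y - ?F x) \<le> e" if y: "y \<in> ball x d" for y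
      proof (rule onorm_bound)
        fix k :: 'a
        have "norm ((?F y - ?F x) k) = norm (\<Sum>b\<in>Basis. (k \<bullet> b) *\<^sub>R (partial_deriv b \<phi> y - partial_deriv b \<phi> x))"
          by (simp add: sum_subtractf scaleR_diff_right)
        also have "\<dots> \<le> (\<Sum>b\<in>(Basis::'a set). norm k * e')"
        proof (rule order_trans[OF norm_sum sum_mono])
          fix b :: 'a assume b: "b \<in> Basis"
          have "dist x y < D b" using y d(2)[OF b] by auto
          then have "dist (partial_deriv b \<phi> x) (partial_deriv b \<phi> y) < e'" using D(2)[OF b] by blast
          then have "norm (partial_deriv b \<phi> y - partial_deriv b \<phi> x) \<le> e'"
            by (simp add: dist_norm norm_minus_commute)
          then show "norm ((k \<bullet> b) *\<^sub>R (partial_deriv b \<phi> y - partial_deriv b \<phi> x)) \<le> norm k * e'"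
            using Basis_le_norm[OF b, of k] by (simp add: mult_mono)
        qed
        also have "\<dots> = e * norm k" by (simp add: e'_def)
        finally show "norm ((?F y - ?F x) k) \<le> e * norm k" .
      qed (use assms(2) in simp)
      show "x \<in> ball x d" using d by simp
    qed
    then show "norm (\<phi> (x + h) - \<phi> x - ?F x h) \<le> e * norm h" by (simp add: mult.commute)
  qed
qed

lemma integrable_mult_bounded:
  fixes u g :: "'a::euclidean_space \<Rightarrow> complex"
  assumes "integrable M u" "g \<in> borel_measurable M" "\<And>x. norm (g x) \<le> C"
  shows "integrable M (\<lambda>x. u x * g x)"
proof (rule Bochner_Integration.integrable_bound)
  show "integrable M (\<lambda>x. C * norm (u x))" using assms(1) by simp
  show "(\<lambda>x. u x * g x) \<in> borel_measurable M" using assms by measurable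
  show "AE x in M. norm (u x * g x) \<le> norm (C * norm (u x))"
  proof (intro AE_I2)
    fix x
    have "norm (u x * g x) \<le> norm (u x) * C" by (simp add: norm_mult assms(3) mult_left_mono)
    also have "\<dots> \<le> norm (C * norm (u x))" by (simp add: mult.commute abs_mult mult_right_mono)
    finally show "norm (u x * g x) \<le> norm (C * norm (u x))" .
  qed
qed

lemma shifted_test_measurable:
  "\<phi> \<in> test_functions UNIV \<Longrightarrow> (\<lambda>x. \<phi> (x - a)) \<in> borel_measurable (lebesgue_on \<Omega>)"
  by (rule continuous_imp_measurable_lebesgue_on)
    (auto intro!: continuous_intros continuous_on_compose2[OF smooth_continuous[of \<phi> UNIV]] simp: test_functions_smooth)

lemma convolve_integrable:
  assumes "integrable (lebesgue_on \<Omega>) u" "\<phi> \<in> test_functions UNIV"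
  shows "integrable (lebesgue_on \<Omega>) (\<lambda>x. u x * \<phi> (x - a))"
  using test_functions_bounded[OF assms(2)] integrable_mult_bounded[OF assms(1) shifted_test_measurable[OF assms(2)]]
  by metis

lemma convolve_has_derivative:
  fixes u :: "'a::euclidean_space \<Rightarrow> complex"
  assumes u: "integrable (lebesgue_on \<Omega>) u" and \<phi>: "\<phi> \<in> test_functions UNIV"
  shows "(convolve \<Omega> u \<phi> has_derivative (\<lambda>h. \<Sum>b\<in>Basis. (h \<bullet> b) *\<^sub>R (- convolve \<Omega> u (partial_deriv b \<phi>) a))) (at a)"
  unfolding has_derivative_at_alt
proof (intro conjI allI impI)
  show "bounded_linear (\<lambda>h. \<Sum>b\<in>Basis. (h \<bullet> b) *\<^sub>R (- convolve \<Omega> u (partial_deriv b \<phi>) a))"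
    by (intro bounded_linear_sum bounded_linear_compose[OF bounded_linear_scaleR_left] bounded_linear_inner_left)
next
  fix e :: real assume e: "e > 0"
  define I where "I = (\<integral>x. norm (u x) \<partial>lebesgue_on \<Omega>)"
  have I: "I \<ge> 0" unfolding I_def by (rule Bochner_Integration.integral_nonneg) simp
  \<comment> \<open>The denominator is \<open>I + 1\<close> because \<open>I\<close> may vanish. The
    remainder of \<phi> is uniform in \<open>x\<close>, so integrating it against \<open>u\<close>
    costs only the factor \<open>I\<close>.\<close>
  then have "e / (I + 1) > 0" using e by simp
  from test_uniformly_differentiable[OF \<phi> this]
  obtain d where d: "d > 0" "\<And>x h. norm h < d \<Longrightarrow>
    norm (\<phi> (x + h) - \<phi> x - (\<Sum>b\<in>Basis. (h \<bullet> b) *\<^sub>R partial_deriv b \<phi> x)) \<le> e / (I + 1) * norm h" by blast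
  have "norm (convolve \<Omega> u \<phi> y - convolve \<Omega> u \<phi> a - (\<Sum>b\<in>Basis. ((y - a) \<bullet> b) *\<^sub>R (- convolve \<Omega> u (partial_deriv b \<phi>) a))) \<le> e * norm (y - a)"
    if y: "norm (y - a) < d" for y
  proof -
    \<comment> \<open>The sign is reversed because \<open>a\<close> enters the kernel through
      \<open>x - a\<close>.\<close>
    define h where "h = a - y"
    have h: "norm h < d" using y by (simp add: h_def norm_minus_commute)
    let ?R = "\<lambda>x. \<phi> (x + h) - \<phi> x - (\<Sum>b\<in>Basis. (h \<bullet> b) *\<^sub>R partial_deriv b \<phi> x)"
    note int1 = convolve_integrable[OF u \<phi>]
    note int2 = convolve_integrable[OF u test_functions_partial_deriv[OF \<phi>]]
    have int2': "integrable (lebesgue_on \<Omega>) (\<lambda>x. u x * (\<Sum>b\<in>Basis. (h \<bullet> b) *\<^sub>R partial_deriv b \<phi> (x - a)))"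
      unfolding sum_distrib_left mult_scaleR_right using int2 by auto
    have eq: "u x * ?R (x - a) = u x * \<phi> (x - y) - u x * \<phi> (x - a) - u x * (\<Sum>b\<in>Basis. (h \<bullet> b) *\<^sub>R partial_deriv b \<phi> (x - a))" for x
      by (simp add: h_def algebra_simps)
    have intR: "integrable (lebesgue_on \<Omega>) (\<lambda>x. u x * ?R (x - a))"
      unfolding eq using int1 int2' by auto
    have sum: "(\<Sum>b\<in>Basis. ((y - a) \<bullet> b) *\<^sub>R (- convolve \<Omega> u (partial_deriv b \<phi>) a))
       = (\<integral>x. u x * (\<Sum>b\<in>Basis. (h \<bullet> b) *\<^sub>R partial_deriv b \<phi> (x - a)) \<partial>lebesgue_on \<Omega>)"
    proof -
      have "(\<Sum>b\<in>Basis. ((y - a) \<bullet> b) *\<^sub>R (- convolve \<Omega> u (partial_deriv b \<phi>) a))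
          = (\<Sum>b\<in>Basis. \<integral>x. (h \<bullet> b) *\<^sub>R (u x * partial_deriv b \<phi> (x - a)) \<partial>lebesgue_on \<Omega>)"
      proof (intro sum.cong refl)
        fix b
        have "(y - a) \<bullet> b = - (h \<bullet> b)" by (simp add: h_def inner_diff_left)
        then show "((y - a) \<bullet> b) *\<^sub>R (- convolve \<Omega> u (partial_deriv b \<phi>) a) = (\<integral>x. (h \<bullet> b) *\<^sub>R (u x * partial_deriv b \<phi> (x - a)) \<partial>lebesgue_on \<Omega>)"
          by (simp add: convolve_def)
      qed
      also have "\<dots> = (\<integral>x. (\<Sum>b\<in>Basis. (h \<bullet> b) *\<^sub>R (u x * partial_deriv b \<phi> (x - a))) \<partial>lebesgue_on \<Omega>)"
        by (rule Bochner_Integration.integral_sum[symmetric]) (use int2 in auto)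
      finally show ?thesis by (simp add: sum_distrib_left)
    qed
    have "norm (convolve \<Omega> u \<phi> y - convolve \<Omega> u \<phi> a - (\<Sum>b\<in>Basis. ((y - a) \<bullet> b) *\<^sub>R (- convolve \<Omega> u (partial_deriv b \<phi>) a)))
       = norm (\<integral>x. u x * ?R (x - a) \<partial>lebesgue_on \<Omega>)"
      unfolding sum eq unfolding convolve_def using int1 int2' by simp
    also have "\<dots> \<le> (\<integral>x. norm (u x * ?R (x - a)) \<partial>lebesgue_on \<Omega>)" by (rule integral_norm_bound)
    also have "\<dots> \<le> (\<integral>x. norm (u x) * (e / (I + 1) * norm h) \<partial>lebesgue_on \<Omega>)"
    proof (rule Bochner_Integration.integral_mono)
      show "integrable (lebesgue_on \<Omega>) (\<lambda>x. norm (u x * ?R (x - a)))" using intR by (rule integrable_norm)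
      show "integrable (lebesgue_on \<Omega>) (\<lambda>x. norm (u x) * (e / (I + 1) * norm h))" using u by simp
      show "norm (u x * ?R (x - a)) \<le> norm (u x) * (e / (I + 1) * norm h)" for x
        unfolding norm_mult using d(2)[OF h] by (intro mult_left_mono) auto
    qed
    also have "\<dots> = I * (e / (I + 1) * norm h)" unfolding I_def by simp
    also have "\<dots> \<le> e * norm h"
    proof -
      have "I * (e / (I + 1)) \<le> e" using I e by (simp add: field_simps)
      then have "I * (e / (I + 1)) * norm h \<le> e * norm h" by (rule mult_right_mono) simp
      then show ?thesis by (simp add: mult.assoc)
    qed
    finally show ?thesis by (simp add: h_def norm_minus_commute)
  qed
  then show "\<exists>d>0. \<forall>y. norm (y - a) < d \<longrightarrow> norm (convolve \<Omega> u \<phi> y - convolve \<Omega> u \<phi> a - (\<Sum>b\<in>Basis. ((y - a) \<bullet> b) *\<^sub>R (- convolve \<Omega> u (partial_deriv b \<phi>) a))) \<le> e * norm (y - a)"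
    using d(1) by blast
qed

lemma partial_deriv_convolve:
  assumes "integrable (lebesgue_on \<Omega>) u" "\<phi> \<in> test_functions UNIV" "b \<in> Basis"
  shows "partial_deriv b (convolve \<Omega> u \<phi>) = (\<lambda>a. - convolve \<Omega> u (partial_deriv b \<phi>) a)"
proof
  fix a
  have "partial_deriv b (convolve \<Omega> u \<phi>) a = (\<Sum>c\<in>Basis. (b \<bullet> c) *\<^sub>R (- convolve \<Omega> u (partial_deriv c \<phi>) a))"
    by (rule partial_deriv_eqI[OF convolve_has_derivative[OF assms(1,2)]])
  also have "\<dots> = (\<Sum>c\<in>Basis. if c = b then - convolve \<Omega> u (partial_deriv c \<phi>) a else 0)"
    by (intro sum.cong) (use assms(3) in \<open>auto simp: inner_Basis\<close>)
  finally show "partial_deriv b (convolve \<Omega> u \<phi>) a = - convolve \<Omega> u (partial_deriv b \<phi>) a"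
    using assms(3) by simp
qed

lemma smooth_convolve:
  assumes "integrable (lebesgue_on \<Omega>) u" "\<phi> \<in> test_functions UNIV"
  shows "smooth (convolve \<Omega> u \<phi>)"
proof
  fix k
  show "C_diff k (convolve \<Omega> u \<phi>)" using assms(2)
  proof (induction k arbitrary: \<phi>)
    case 0
    show ?case using convolve_has_derivative[OF assms(1) 0]
      by (auto intro!: continuous_at_imp_continuous_on has_derivative_continuous)
  next
    case (Suc k)
    show ?case
    proof (rule C_diff_SucI[OF convolve_has_derivative[OF assms(1) Suc.prems]])
      fix b :: 'a
      have "C_diff k (\<lambda>a. \<Sum>c\<in>Basis. (- of_real (b \<bullet> c)) * convolve \<Omega> u (partial_deriv c \<phi>) a)"
        by (intro C_diff_sum C_diff_mult C_diff_const Suc.IH test_functions_partial_deriv Suc.prems)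
      then show "C_diff k (\<lambda>a. \<Sum>c\<in>Basis. (b \<bullet> c) *\<^sub>R - convolve \<Omega> u (partial_deriv c \<phi>) a)"
        by (simp add: scaleR_conv_of_real)
    qed
  qed
qed

lemma laplacian_convolve:
  assumes "integrable (lebesgue_on \<Omega>) u" "\<phi> \<in> test_functions UNIV"
  shows "laplacian (convolve \<Omega> u \<phi>) a = convolve \<Omega> u (laplacian \<phi>) a"
proof -
  note sm = smooth_convolve[OF assms(1)]
  have "laplacian (convolve \<Omega> u \<phi>) a = (\<Sum>b\<in>Basis. convolve \<Omega> u (partial_deriv b (partial_deriv b \<phi>)) a)"
    unfolding laplacian_def
  proof (intro sum.cong refl)
    fix b :: 'a assume b: "b \<in> Basis"
    note t = test_functions_partial_deriv[OF assms(2) b]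
    have "partial_deriv b (partial_deriv b (convolve \<Omega> u \<phi>)) = partial_deriv b (\<lambda>a. (-1) * convolve \<Omega> u (partial_deriv b \<phi>) a)"
      unfolding partial_deriv_convolve[OF assms b] by simp
    also have "\<dots> = (\<lambda>a. (-1) * (- convolve \<Omega> u (partial_deriv b (partial_deriv b \<phi>)) a))"
      unfolding partial_deriv_cmult[OF sm[OF t]] partial_deriv_convolve[OF assms(1) t b] ..
    finally show "partial_deriv b (partial_deriv b (convolve \<Omega> u \<phi>)) a = convolve \<Omega> u (partial_deriv b (partial_deriv b \<phi>)) a" by simp
  qed
  also have "\<dots> = convolve \<Omega> u (laplacian \<phi>) a"
    unfolding convolve_def laplacian_def sum_distrib_left
    by (rule Bochner_Integration.integral_sum[symmetric])
      (intro convolve_integrable assms test_functions_partial_deriv)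
  finally show ?thesis .
qed

lemma convolve_weak_deriv:
  assumes "has_weak_deriv \<Omega> b u g" "smooth \<phi>" "(\<lambda>x. \<phi> (x - a)) \<in> test_functions \<Omega>"
  shows "- convolve \<Omega> u (partial_deriv b \<phi>) a = convolve \<Omega> g \<phi> a"
  using bspec[OF assms(1)[unfolded has_weak_deriv_def] assms(3)]
  by (simp add: partial_deriv_shift[OF assms(2)] convolve_def)

lemma convolve_distr_laplacian:
  assumes "has_distr_laplacian \<Omega> u f" "smooth \<phi>" "(\<lambda>x. \<phi> (x - a)) \<in> test_functions \<Omega>"
  shows "convolve \<Omega> u (laplacian \<phi>) a = convolve \<Omega> f \<phi> a"
  using bspec[OF assms(1)[unfolded has_distr_laplacian_def] assms(3)]
  by (simp add: laplacian_shift[OF assms(2)] convolve_def)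

text \<open>Translation and reflection: the mass of a kernel evaluated at \<open>x - a\<close> has
  to be computed both as an integral over \<open>x\<close> and, after Tonelli, as an integral over
  \<open>a\<close>.\<close>

lemma nn_integral_lebesgue_affine:
  fixes g :: "'a::euclidean_space \<Rightarrow> ennreal"
  assumes "g \<in> borel_measurable borel" "c = 1 \<or> c = -1"
  shows "(\<integral>\<^sup>+x. g (t + c *\<^sub>R x) \<partial>lebesgue) = (\<integral>\<^sup>+x. g x \<partial>lebesgue)"
proof -
  have m: "(\<lambda>x. t + c *\<^sub>R x) \<in> borel_measurable borel" by measurable
  have "(\<integral>\<^sup>+x. g x \<partial>lebesgue) = (\<integral>\<^sup>+x. g x \<partial>lborel)"
    using assms by (simp add: nn_integral_completion)
  also have "\<dots> = (\<integral>\<^sup>+x. g x \<partial>density (distr lborel borel (\<lambda>x. t + c *\<^sub>R x)) (\<lambda>_. \<bar>c\<bar> ^ DIM('a)))"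
    using lborel_affine[of c t] assms(2) by auto
  also have "\<dots> = (\<integral>\<^sup>+x. g (t + c *\<^sub>R x) \<partial>lborel)"
    using assms m by (subst nn_integral_density) (auto simp: nn_integral_distr)
  also have "\<dots> = (\<integral>\<^sup>+x. g (t + c *\<^sub>R x) \<partial>lebesgue)"
    using measurable_compose[OF m assms(1)] by (simp add: nn_integral_completion)
  finally show ?thesis by simp
qed

lemma id_measurable_lebesgue_on: "(\<lambda>x. x) \<in> borel_measurable (lebesgue_on (\<Omega>::'a::euclidean_space set))"
  by (rule continuous_imp_measurable_lebesgue_on) (rule continuous_on_id)

lemma has_bochner_nn:
  fixes \<rho> :: "'a::euclidean_space \<Rightarrow> real"
  assumes "continuous_on UNIV \<rho>" "\<And>x. 0 \<le> \<rho> x" "integrable lebesgue \<rho>" "integral\<^sup>L lebesgue \<rho> = 1" "c = 1 \<or> c = -1"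
  shows "(\<integral>\<^sup>+x. \<rho> (t + c *\<^sub>R x) \<partial>lebesgue) = 1"
proof -
  have m: "\<rho> \<in> borel_measurable borel" using assms(1) by (rule borel_measurable_continuous_onI)
  have "(\<integral>\<^sup>+x. \<rho> (t + c *\<^sub>R x) \<partial>lebesgue) = (\<integral>\<^sup>+x. \<rho> x \<partial>lebesgue)"
    by (rule nn_integral_lebesgue_affine[OF _ assms(5), of "\<lambda>x. ennreal (\<rho> x)"]) (use m in measurable)
  also have "\<dots> = 1" using assms by (simp add: nn_integral_eq_integral)
  finally show ?thesis .
qed

section \<open>Kernels of unit mass\<close>

definition is_kernel :: "real \<Rightarrow> ('a::euclidean_space \<Rightarrow> real) \<Rightarrow> bool" where
  "is_kernel r \<rho> \<longleftrightarrow> (\<lambda>x. complex_of_real (\<rho> x)) \<in> test_functions UNIV \<and> (\<forall>x. 0 \<le> \<rho> x)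
     \<and> (\<forall>x. x \<notin> cball 0 r \<longrightarrow> \<rho> x = 0) \<and> integral\<^sup>L lebesgue \<rho> = 1"

lemma is_kernel_exists: "r > 0 \<Longrightarrow> \<exists>\<rho>. is_kernel r \<rho>"
  unfolding is_kernel_def using mollifier_exists[of r] by metis

lemma is_kernel_continuous:
  assumes "is_kernel r \<rho>" shows "continuous_on UNIV \<rho>"
proof -
  have "continuous_on UNIV (\<lambda>x. complex_of_real (\<rho> x))"
    using assms by (intro smooth_continuous test_functions_smooth[where \<Omega>=UNIV]) (simp add: is_kernel_def)
  from continuous_on_Re[OF this] show ?thesis by simp
qed

lemma is_kernel_integrable: "is_kernel r \<rho> \<Longrightarrow> integrable lebesgue \<rho>"
  unfolding is_kernel_def using integrable_Re[OF test_functions_integrable] by fastforce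

lemma is_kernel_nn_integral:
  assumes "is_kernel r \<rho>"
  shows "(\<integral>\<^sup>+x. \<rho> (x - a) \<partial>lebesgue) = 1" "(\<integral>\<^sup>+x. \<rho> (a - x) \<partial>lebesgue) = 1"
  using has_bochner_nn[OF is_kernel_continuous[OF assms] _ is_kernel_integrable[OF assms], of 1 "-a"]
    has_bochner_nn[OF is_kernel_continuous[OF assms] _ is_kernel_integrable[OF assms], of "-1" a] assms
  by (auto simp: is_kernel_def)

lemma is_kernel_shift_integral:
  assumes "is_kernel r \<rho>" "\<Omega> \<in> sets lebesgue"
  shows "integrable (lebesgue_on \<Omega>) (\<lambda>x. \<rho> (x - a))" "(\<integral>x. \<rho> (x - a) \<partial>lebesgue_on \<Omega>) \<le> 1"
    "cball a r \<subseteq> \<Omega> \<Longrightarrow> (\<integral>x. \<rho> (x - a) \<partial>lebesgue_on \<Omega>) = 1"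
proof -
  have nn: "\<And>x. 0 \<le> \<rho> x" using assms by (simp add: is_kernel_def)
  have cont: "continuous_on UNIV (\<lambda>x. \<rho> (x - a))"
    by (rule continuous_on_compose2[OF is_kernel_continuous[OF assms(1)]]) (auto intro!: continuous_intros)
  have m: "(\<lambda>x. \<rho> (x - a)) \<in> borel_measurable lebesgue"
    using continuous_imp_measurable_lebesgue_on[OF cont, of UNIV] by (simp add: lebesgue_on_UNIV_eq)
  have I: "integrable lebesgue (\<lambda>x. \<rho> (x - a))"
    using is_kernel_nn_integral(1)[OF assms(1), of a] nn m by (intro integrableI_nonneg) auto
  have one: "(\<integral>x. \<rho> (x - a) \<partial>lebesgue) = 1"
    using is_kernel_nn_integral(1)[OF assms(1), of a] nn I
    by (subst (asm) nn_integral_eq_integral) auto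
  have I2: "integrable lebesgue (\<lambda>x. indicator \<Omega> x *\<^sub>R \<rho> (x - a))"
    by (rule integrable_mult_indicator[OF assms(2) I])
  then show "integrable (lebesgue_on \<Omega>) (\<lambda>x. \<rho> (x - a))" using assms(2) by (simp add: integrable_restrict_space)
  have "(\<integral>x. indicator \<Omega> x *\<^sub>R \<rho> (x - a) \<partial>lebesgue) \<le> (\<integral>x. \<rho> (x - a) \<partial>lebesgue)"
    by (rule Bochner_Integration.integral_mono[OF I2 I]) (use nn in \<open>auto simp: indicator_def\<close>)
  then show "(\<integral>x. \<rho> (x - a) \<partial>lebesgue_on \<Omega>) \<le> 1"
    using assms(2) one by (simp add: integral_restrict_space)
  show "(\<integral>x. \<rho> (x - a) \<partial>lebesgue_on \<Omega>) = 1" if "cball a r \<subseteq> \<Omega>"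
  proof -
    have "indicator \<Omega> x *\<^sub>R \<rho> (x - a) = \<rho> (x - a)" for x
    proof (cases "x \<in> \<Omega>")
      case False
      then have "x - a \<notin> cball 0 r" using that by (auto simp: dist_norm norm_minus_commute)
      then show ?thesis using assms(1) by (simp add: is_kernel_def)
    qed simp
    then have "(\<integral>x. indicator \<Omega> x *\<^sub>R \<rho> (x - a) \<partial>lebesgue) = 1" using one by presburger
    then show ?thesis using assms(2) by (simp add: integral_restrict_space)
  qed
qed

lemma L2_finite_measure_integrable:
  assumes "\<Omega> \<in> lmeasurable" "u \<in> L2 \<Omega>"
  shows "integrable (lebesgue_on \<Omega>) u"
proof -
  interpret finite_measure "lebesgue_on \<Omega>" using assms(1) by (rule finite_measure_lebesgue_on)
  have "(\<lambda>x. 1) \<in> L2 \<Omega>" by (simp add: L2_def)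
  from L2_prod_integrable(1)[OF assms(2) this] show ?thesis by simp
qed

section \<open>Approximation in the mean\<close>

text \<open>Jensen's inequality for a measure of mass at most 1, obtained by writing the kernel as
  the square of \<open>s\<close> and applying Cauchy-Schwarz to the factors \<open>s u\<close> and
  \<open>s\<close>.\<close>

lemma convolve_kernel_bound:
  assumes \<rho>: "is_kernel r \<rho>" and u: "u \<in> L2 \<Omega>" and \<Omega>: "\<Omega> \<in> sets lebesgue"
  shows "(norm (convolve \<Omega> u (\<lambda>x. of_real (\<rho> x)) a))\<^sup>2 \<le> (\<integral>x. (norm (u x))\<^sup>2 * \<rho> (x - a) \<partial>lebesgue_on \<Omega>)"
    and "integrable (lebesgue_on \<Omega>) (\<lambda>x. (norm (u x))\<^sup>2 * \<rho> (x - a))"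
proof -
  have nn: "\<And>x. 0 \<le> \<rho> x" using \<rho> by (simp add: is_kernel_def)
  have T: "(\<lambda>x. complex_of_real (\<rho> x)) \<in> test_functions UNIV" using \<rho> by (simp add: is_kernel_def)
  obtain C where C: "C > 0" "\<And>x. norm (complex_of_real (\<rho> x)) \<le> C"
    using test_functions_bounded[OF T] by blast
  then have C': "\<rho> x \<le> C" for x by (metis norm_of_real abs_ge_self order_trans)
  define s where "s x = complex_of_real (sqrt (\<rho> (x - a)))" for x
  have contr: "continuous_on UNIV (\<lambda>x. \<rho> (x - a))"
    by (rule continuous_on_compose2[OF is_kernel_continuous[OF \<rho>]]) (auto intro!: continuous_intros)
  have "continuous_on UNIV s" unfolding s_def by (intro continuous_intros contr)
  then have sm: "s \<in> borel_measurable (lebesgue_on \<Omega>)" by (rule continuous_imp_measurable_lebesgue_on)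
  have norms: "(norm (s x))\<^sup>2 = \<rho> (x - a)" for x by (simp add: s_def nn)
  have "s \<in> L2 \<Omega>"
    using is_kernel_shift_integral(1)[OF \<rho> \<Omega>] sm by (simp add: L2_def norms)
  moreover have us: "(\<lambda>x. s x * u x) \<in> L2 \<Omega>"
  proof (rule L2_mult_bounded[OF u sm])
    show "norm (s x) \<le> sqrt C" for x
      using C'[of "x - a"] nn by (simp add: s_def)
  qed
  ultimately have CS: "norm (\<integral>x. (s x * u x) * s x \<partial>lebesgue_on \<Omega>) \<le> L2_norm \<Omega> (\<lambda>x. s x * u x) * L2_norm \<Omega> s"
    by (intro L2_Cauchy_Schwarz)
  have "s x * u x * s x = u x * of_real (\<rho> (x - a))" for x
  proof -
    have "s x * s x = of_real (\<rho> (x - a))" unfolding s_def by (simp flip: of_real_mult add: nn)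
    then show ?thesis by (metis mult.assoc mult.commute)
  qed
  then have eq: "(\<integral>x. (s x * u x) * s x \<partial>lebesgue_on \<Omega>) = convolve \<Omega> u (\<lambda>x. of_real (\<rho> x)) a"
    unfolding convolve_def by presburger
  have "(L2_norm \<Omega> s)\<^sup>2 \<le> 1"
    using is_kernel_shift_integral(2)[OF \<rho> \<Omega>] by (simp add: L2_norm_power2 norms)
  then have "L2_norm \<Omega> s \<le> 1" using power_le_imp_le_base[of "L2_norm \<Omega> s" 1 1] by (simp add: abs_square_le_1)
  then have "L2_norm \<Omega> (\<lambda>x. s x * u x) * L2_norm \<Omega> s \<le> L2_norm \<Omega> (\<lambda>x. s x * u x)"
    by (simp add: mult_left_le)
  with CS have "norm (convolve \<Omega> u (\<lambda>x. of_real (\<rho> x)) a) \<le> L2_norm \<Omega> (\<lambda>x. s x * u x)"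
    unfolding eq by linarith
  then have "(norm (convolve \<Omega> u (\<lambda>x. of_real (\<rho> x)) a))\<^sup>2 \<le> (L2_norm \<Omega> (\<lambda>x. s x * u x))\<^sup>2"
    by (rule power_mono) simp
  also have "\<dots> = (\<integral>x. (norm (u x))\<^sup>2 * \<rho> (x - a) \<partial>lebesgue_on \<Omega>)"
    by (simp add: L2_norm_power2 norm_mult power_mult_distrib norms mult.commute)
  finally show "(norm (convolve \<Omega> u (\<lambda>x. of_real (\<rho> x)) a))\<^sup>2 \<le> (\<integral>x. (norm (u x))\<^sup>2 * \<rho> (x - a) \<partial>lebesgue_on \<Omega>)" .
  show "integrable (lebesgue_on \<Omega>) (\<lambda>x. (norm (u x))\<^sup>2 * \<rho> (x - a))"
    using L2_square_integrable[OF us] by (simp add: norm_mult power_mult_distrib norms mult.commute)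
qed

text \<open>Young's inequality for a unit kernel: after Jensen, Tonelli moves the integral over
  \<open>a\<close> onto the kernel, whose mass over \<open>B\<close> is at most 1. The constant 1
  makes the approximation argument below uniform in the kernel.\<close>

lemma convolve_kernel_L2:
  assumes \<rho>: "is_kernel r \<rho>" and u: "u \<in> L2 \<Omega>" and \<Omega>: "\<Omega> \<in> lmeasurable" and B: "B \<in> lmeasurable"
  shows "convolve \<Omega> u (\<lambda>x. of_real (\<rho> x)) \<in> L2 B"
    and "L2_norm B (convolve \<Omega> u (\<lambda>x. of_real (\<rho> x))) \<le> L2_norm \<Omega> u"
proof -
  have \<Omega>': "\<Omega> \<in> sets lebesgue" and B': "B \<in> sets lebesgue" using \<Omega> B by (auto simp: fmeasurable_def)
  have nn: "\<And>x. 0 \<le> \<rho> x" using \<rho> by (simp add: is_kernel_def)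
  have T: "(\<lambda>x. complex_of_real (\<rho> x)) \<in> test_functions UNIV" using \<rho> by (simp add: is_kernel_def)
  let ?c = "convolve \<Omega> u (\<lambda>x. of_real (\<rho> x))"
  have cm: "?c \<in> borel_measurable (lebesgue_on B)"
    by (rule smooth_measurable[OF smooth_convolve[OF L2_finite_measure_integrable[OF \<Omega> u] T]])
  interpret M1: finite_measure "lebesgue_on \<Omega>" by (rule finite_measure_lebesgue_on[OF \<Omega>])
  interpret M2: finite_measure "lebesgue_on B" by (rule finite_measure_lebesgue_on[OF B])
  interpret pair_sigma_finite "lebesgue_on \<Omega>" "lebesgue_on B" ..
  note [measurable] = id_measurable_lebesgue_on L2_measurable[OF u] borel_measurable_continuous_onI[OF is_kernel_continuous[OF \<rho>]]
  have "(\<integral>\<^sup>+a. ennreal ((norm (?c a))\<^sup>2) \<partial>lebesgue_on B)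
     \<le> (\<integral>\<^sup>+a. (\<integral>\<^sup>+x. ennreal ((norm (u x))\<^sup>2 * \<rho> (x - a)) \<partial>lebesgue_on \<Omega>) \<partial>lebesgue_on B)"
  proof (rule nn_integral_mono)
    fix a
    have "ennreal ((norm (?c a))\<^sup>2) \<le> ennreal (\<integral>x. (norm (u x))\<^sup>2 * \<rho> (x - a) \<partial>lebesgue_on \<Omega>)"
      using convolve_kernel_bound(1)[OF \<rho> u \<Omega>'] by (rule ennreal_leI)
    also have "\<dots> = (\<integral>\<^sup>+x. ennreal ((norm (u x))\<^sup>2 * \<rho> (x - a)) \<partial>lebesgue_on \<Omega>)"
      using convolve_kernel_bound(2)[OF \<rho> u \<Omega>'] by (intro nn_integral_eq_integral[symmetric]) (auto simp: nn)
    finally show "ennreal ((norm (?c a))\<^sup>2) \<le> (\<integral>\<^sup>+x. ennreal ((norm (u x))\<^sup>2 * \<rho> (x - a)) \<partial>lebesgue_on \<Omega>)" .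
  qed
  also have "\<dots> = (\<integral>\<^sup>+x. (\<integral>\<^sup>+a. ennreal ((norm (u x))\<^sup>2 * \<rho> (x - a)) \<partial>lebesgue_on B) \<partial>lebesgue_on \<Omega>)"
    by (rule Fubini') measurable
  also have "\<dots> \<le> (\<integral>\<^sup>+x. ennreal ((norm (u x))\<^sup>2) \<partial>lebesgue_on \<Omega>)"
  proof (rule nn_integral_mono)
    fix x
    have "(\<integral>\<^sup>+a. ennreal ((norm (u x))\<^sup>2 * \<rho> (x - a)) \<partial>lebesgue_on B) = ennreal ((norm (u x))\<^sup>2) * (\<integral>\<^sup>+a. ennreal (\<rho> (x - a)) \<partial>lebesgue_on B)"
      by (simp add: ennreal_mult' nn_integral_cmult)
    also have "(\<integral>\<^sup>+a. ennreal (\<rho> (x - a)) \<partial>lebesgue_on B) \<le> 1"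
    proof -
      have "(\<integral>\<^sup>+a. ennreal (\<rho> (x - a)) \<partial>lebesgue_on B) = (\<integral>\<^sup>+a. ennreal (\<rho> (x - a)) * indicator B a \<partial>lebesgue)"
        using B' by (simp add: nn_integral_restrict_space)
      also have "\<dots> \<le> (\<integral>\<^sup>+a. ennreal (\<rho> (x - a)) \<partial>lebesgue)"
        by (rule nn_integral_mono) (auto simp: indicator_def)
      finally show ?thesis using is_kernel_nn_integral(2)[OF \<rho>] by simp
    qed
    then have "ennreal ((norm (u x))\<^sup>2) * (\<integral>\<^sup>+a. ennreal (\<rho> (x - a)) \<partial>lebesgue_on B) \<le> ennreal ((norm (u x))\<^sup>2) * 1"
      by (rule mult_left_mono) simp
    finally show "(\<integral>\<^sup>+a. ennreal ((norm (u x))\<^sup>2 * \<rho> (x - a)) \<partial>lebesgue_on B) \<le> ennreal ((norm (u x))\<^sup>2)" by simp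
  qed
  also have "\<dots> = ennreal ((L2_norm \<Omega> u)\<^sup>2)"
    unfolding L2_norm_power2 by (rule nn_integral_eq_integral[OF L2_square_integrable[OF u]]) simp
  finally have le: "(\<integral>\<^sup>+a. ennreal ((norm (?c a))\<^sup>2) \<partial>lebesgue_on B) \<le> ennreal ((L2_norm \<Omega> u)\<^sup>2)" .
  have I: "integrable (lebesgue_on B) (\<lambda>a. (norm (?c a))\<^sup>2)"
  proof (rule integrableI_nonneg)
    show "(\<lambda>a. (norm (?c a))\<^sup>2) \<in> borel_measurable (lebesgue_on B)" using cm by measurable
    show "(\<integral>\<^sup>+a. ennreal ((norm (?c a))\<^sup>2) \<partial>lebesgue_on B) < \<infinity>" using le by (simp add: order_le_less_trans)
  qed simp
  then show "?c \<in> L2 B" using cm by (simp add: L2_def)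
  have "ennreal ((L2_norm B ?c)\<^sup>2) \<le> ennreal ((L2_norm \<Omega> u)\<^sup>2)"
    using le unfolding L2_norm_power2 by (subst (asm) nn_integral_eq_integral[OF I]) auto
  then have "(L2_norm B ?c)\<^sup>2 \<le> (L2_norm \<Omega> u)\<^sup>2" by (simp add: ennreal_le_iff)
  then show "L2_norm B ?c \<le> L2_norm \<Omega> u" by (rule power2_le_imp_le) simp
qed

lemma L2_lim_dominated:
  assumes "\<And>n. F n \<in> borel_measurable (lebesgue_on \<Omega>)" "f \<in> L2 \<Omega>" "g \<in> L2 \<Omega>"
    "\<And>n. AE x in lebesgue_on \<Omega>. norm (F n x - f x) \<le> norm (g x)"
    "AE x in lebesgue_on \<Omega>. (\<lambda>n. F n x) \<longlonglongrightarrow> f x"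
  shows "L2_lim \<Omega> F f"
proof -
  note [measurable] = assms(1) L2_measurable[OF assms(2)]
  have "(\<lambda>n. \<integral>x. (norm (F n x - f x))\<^sup>2 \<partial>lebesgue_on \<Omega>) \<longlonglongrightarrow> (\<integral>x. 0 \<partial>lebesgue_on \<Omega>)"
  proof (rule integral_dominated_convergence[OF _ _ L2_square_integrable[OF assms(3)]])
    show "AE x in lebesgue_on \<Omega>. (\<lambda>n. (norm (F n x - f x))\<^sup>2) \<longlonglongrightarrow> 0"
      using assms(5)
    proof eventually_elim
      case (elim x)
      have "(\<lambda>n. (norm (F n x - f x))\<^sup>2) \<longlonglongrightarrow> (norm (f x - f x))\<^sup>2"
        by (intro tendsto_intros elim)
      then show ?case by simp
    qed
    show "AE x in lebesgue_on \<Omega>. norm ((norm (F n x - f x))\<^sup>2) \<le> (norm (g x))\<^sup>2" for n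
      using assms(4)[of n] by eventually_elim (simp add: power_mono)
  qed measurable
  then have "(\<lambda>n. sqrt (\<integral>x. (norm (F n x - f x))\<^sup>2 \<partial>lebesgue_on \<Omega>)) \<longlonglongrightarrow> sqrt 0"
    by (intro tendsto_real_sqrt) simp
  then show ?thesis by (simp add: L2_norm_def)
qed

text \<open>Large values are replaced by 0 instead of being scaled down, so that truncation is
  multiplication by an indicator; this matches the multiplicativity of \<open>U\<close> on
  indicators.\<close>

definition truncate :: "nat \<Rightarrow> ('a \<Rightarrow> complex) \<Rightarrow> 'a \<Rightarrow> complex" where
  "truncate n f x = (if norm (f x) \<le> real n then f x else 0)"

lemma truncate_bounded: "norm (truncate n f x) \<le> real n"
  by (simp add: truncate_def)

lemma truncate_measurable:
  assumes [measurable]: "f \<in> borel_measurable M"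
  shows "truncate n f \<in> borel_measurable M"
  unfolding truncate_def[abs_def] by measurable

lemma truncate_L2:
  assumes "f \<in> L2 \<Omega>" shows "truncate n f \<in> L2 \<Omega>"
  by (rule L2_bound[OF assms, where C=1])
    (use truncate_measurable[OF L2_measurable[OF assms]] in \<open>auto simp: truncate_def\<close>)

lemma truncate_L2_lim:
  assumes "f \<in> L2 \<Omega>"
  shows "L2_lim \<Omega> (\<lambda>n. truncate n f) f"
proof (rule L2_lim_dominated[OF _ assms assms])
  show "AE x in lebesgue_on \<Omega>. (\<lambda>n. truncate n f x) \<longlonglongrightarrow> f x"
  proof (rule AE_I2)
    fix x
    have "\<forall>\<^sub>F n in sequentially. truncate n f x = f x"
      using eventually_ge_at_top[of "nat \<lceil>norm (f x)\<rceil>"] by eventually_elim (auto simp: truncate_def le_nat_iff ceiling_le_iff)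
    then show "(\<lambda>n. truncate n f x) \<longlonglongrightarrow> f x" by (simp add: tendsto_eventually)
  qed
  show "truncate n f \<in> borel_measurable (lebesgue_on \<Omega>)" for n
    by (intro truncate_measurable L2_measurable assms)
qed (simp add: truncate_def)

text \<open>Truncation makes the function bounded, and a Lebesgue measurable function is almost
  everywhere a limit of continuous functions. Dominated convergence applies once these are bounded
  too.\<close>

lemma L2_continuous_dense:
  assumes \<Omega>: "\<Omega> \<in> lmeasurable" and f: "f \<in> L2 \<Omega>" and e: "e > 0"
  obtains g M where "continuous_on UNIV g" "\<And>x. norm (g x) \<le> M" "g \<in> L2 \<Omega>" "L2_norm \<Omega> (\<lambda>x. f x - g x) < e"
proof -
  have \<Omega>': "\<Omega> \<in> sets lebesgue" using \<Omega> by (auto simp: fmeasurable_def)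
  interpret finite_measure "lebesgue_on \<Omega>" by (rule finite_measure_lebesgue_on[OF \<Omega>])
  have "\<forall>\<^sub>F n in sequentially. L2_norm \<Omega> (\<lambda>x. truncate n f x - f x) < e / 2"
    using truncate_L2_lim[OF f] e by (intro order_tendstoD(2)) auto
  then obtain m where m: "L2_norm \<Omega> (\<lambda>x. truncate m f x - f x) < e / 2"
    by (auto simp: eventually_sequentially)
  define h where "h = truncate m f"
  have h: "h \<in> L2 \<Omega>" "\<And>x. norm (h x) \<le> real m" by (auto simp: h_def truncate_L2 f truncate_bounded)
  have "h measurable_on \<Omega>"
    using L2_measurable[OF h(1)] measurable_on_iff_borel_measurable[OF \<Omega>'] by blast
  then obtain N G where NG: "negligible N" "\<And>n::nat. continuous_on UNIV (G n)"
      "\<And>x. x \<notin> N \<Longrightarrow> (\<lambda>n. G n x) \<longlonglongrightarrow> (if x \<in> \<Omega> then h x else 0)"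
    unfolding measurable_on_def by blast
  \<comment> \<open>Projection onto the disc of radius \<open>m\<close> is continuous and fixes the
    values of \<open>h\<close>, so it bounds the approximants without disturbing their
    limit.\<close>
  define cp where "cp = closest_point (cball (0::complex) (real m))"
  have cp_cont: "continuous_on UNIV cp" unfolding cp_def
    by (rule continuous_on_closest_point) auto
  have cp_bd: "norm (cp z) \<le> real m" for z
    using closest_point_in_set[of "cball (0::complex) (real m)" z] by (simp add: cp_def)
  have cp_id: "cp z = z" if "norm z \<le> real m" for z
    using that by (simp add: cp_def closest_point_self)
  have cont: "continuous_on UNIV (\<lambda>x. cp (G n x))" for n
    by (rule continuous_on_compose2[OF cp_cont NG(2)]) auto
  have const: "(\<lambda>x. of_real (2 * real m)) \<in> L2 \<Omega>" by (simp add: L2_def)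
  have "L2_lim \<Omega> (\<lambda>n x. cp (G n x)) h"
  proof (rule L2_lim_dominated[OF _ h(1) const])
    show "(\<lambda>x. cp (G n x)) \<in> borel_measurable (lebesgue_on \<Omega>)" for n
      using cont by (rule continuous_imp_measurable_lebesgue_on)
    have "norm (cp (G n x) - h x) \<le> 2 * real m" for n x
      using norm_triangle_ineq4[of "cp (G n x)" "h x"] cp_bd[of "G n x"] h(2)[of x] by linarith
    then show "AE x in lebesgue_on \<Omega>. norm (cp (G n x) - h x) \<le> norm (complex_of_real (2 * real m))" for n
      by (simp del: of_real_mult)
    show "AE x in lebesgue_on \<Omega>. (\<lambda>n. cp (G n x)) \<longlonglongrightarrow> h x"
    proof -
      have "(\<lambda>n. cp (G n x)) \<longlonglongrightarrow> h x" if "x \<in> \<Omega>" "x \<notin> N" for x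
      proof -
        have "(\<lambda>n. cp (G n x)) \<longlonglongrightarrow> cp (h x)"
          using NG(3)[OF that(2)] that(1) cp_cont
          by (intro isCont_tendsto_compose[of "h x" cp]) (auto simp: continuous_on_eq_continuous_at)
        then show ?thesis using cp_id[OF h(2)] by simp
      qed
      then have "{x \<in> \<Omega>. \<not> (\<lambda>n. cp (G n x)) \<longlonglongrightarrow> h x} \<subseteq> N" by blast
      then show ?thesis using NG(1) negligible_subset by (subst AE_lebesgue_on_iff[OF \<Omega>']) blast
    qed
  qed
  then have "\<forall>\<^sub>F n in sequentially. L2_norm \<Omega> (\<lambda>x. cp (G n x) - h x) < e / 2"
    using e by (intro order_tendstoD(2)) auto
  then obtain n where n: "L2_norm \<Omega> (\<lambda>x. cp (G n x) - h x) < e / 2"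
    by (auto simp: eventually_sequentially)
  have g2: "(\<lambda>x. cp (G n x)) \<in> L2 \<Omega>"
  proof (rule L2_bound[OF const, where C=1])
    show "(\<lambda>x. cp (G n x)) \<in> borel_measurable (lebesgue_on \<Omega>)"
      by (rule continuous_imp_measurable_lebesgue_on[OF cont])
    show "AE x in lebesgue_on \<Omega>. norm (cp (G n x)) \<le> 1 * norm (complex_of_real (2 * real m))"
    proof (rule AE_I2)
      fix x
      have "norm (complex_of_real (2 * real m)) = 2 * real m" by (simp only: norm_of_real)
      then show "norm (cp (G n x)) \<le> 1 * norm (complex_of_real (2 * real m))"
        using cp_bd[of "G n x"] norm_ge_zero[of "cp (G n x)"] by linarith
    qed
  qed
  show ?thesis
  proof (rule that[OF cont cp_bd g2])
    show "L2_norm \<Omega> (\<lambda>x. f x - cp (G n x)) < e"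
      using L2_norm_triangle_diff[OF f h(1) g2] m[folded h_def] n
        L2_norm_minus_commute[of \<Omega> f h] L2_norm_minus_commute[of \<Omega> h "\<lambda>x. cp (G n x)"] by linarith
  qed
qed

lemma L2_norm_bounded:
  assumes B: "B \<in> lmeasurable" and f: "f \<in> borel_measurable (lebesgue_on B)" and bd: "\<And>x. x \<in> B \<Longrightarrow> norm (f x) \<le> c"
  shows "f \<in> L2 B" "c \<ge> 0 \<Longrightarrow> L2_norm B f \<le> c * sqrt (measure lebesgue B)"
proof -
  interpret finite_measure "lebesgue_on B" by (rule finite_measure_lebesgue_on[OF B])
  have 1: "(\<lambda>x. 1) \<in> L2 B" by (simp add: L2_def)
  show L: "f \<in> L2 B" using L2_mult_bounded[OF 1 f bd] by simp
  assume c: "c \<ge> 0"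
  have "(\<integral>x. (norm (f x))\<^sup>2 \<partial>lebesgue_on B) \<le> (\<integral>x. c\<^sup>2 \<partial>lebesgue_on B)"
    by (rule Bochner_Integration.integral_mono[OF L2_square_integrable[OF L]])
      (auto intro!: power_mono bd)
  also have "\<dots> = c\<^sup>2 * measure lebesgue B" using B by (simp add: measure_restrict_space fmeasurable_def)
  finally have "L2_norm B f \<le> sqrt (c\<^sup>2 * measure lebesgue B)" by (simp add: L2_norm_def)
  then show "L2_norm B f \<le> c * sqrt (measure lebesgue B)" using c by (simp add: real_sqrt_mult)
qed

lemma convolve_kernel_continuous:
  assumes \<rho>: "is_kernel r \<rho>" and g: "continuous_on UNIV g" "\<And>x. norm (g x) \<le> M" and \<Omega>: "\<Omega> \<in> lmeasurable"
    and B: "cball a r \<subseteq> \<Omega>" and osc: "\<And>x. x \<in> cball a r \<Longrightarrow> norm (g x - g a) \<le> e"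
  shows "norm (convolve \<Omega> g (\<lambda>x. of_real (\<rho> x)) a - g a) \<le> e"
proof -
  have \<Omega>': "\<Omega> \<in> sets lebesgue" using \<Omega> by (auto simp: fmeasurable_def)
  have nn: "\<And>x. 0 \<le> \<rho> x" using \<rho> by (simp add: is_kernel_def)
  have T: "(\<lambda>x. complex_of_real (\<rho> x)) \<in> test_functions UNIV" using \<rho> by (simp add: is_kernel_def)
  note k = is_kernel_shift_integral[OF \<rho> \<Omega>', of a]
  have gL: "g \<in> L2 \<Omega>" by (rule L2_norm_bounded(1)[OF \<Omega> continuous_imp_measurable_lebesgue_on[OF g(1)] g(2)])
  have I1: "integrable (lebesgue_on \<Omega>) (\<lambda>x. g x * of_real (\<rho> (x - a)))"
    by (rule convolve_integrable[OF L2_finite_measure_integrable[OF \<Omega> gL] T])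
  have I2: "integrable (lebesgue_on \<Omega>) (\<lambda>x. g a * complex_of_real (\<rho> (x - a)))" using k(1) by simp
  have "(\<integral>x. (g x - g a) * complex_of_real (\<rho> (x - a)) \<partial>lebesgue_on \<Omega>)
      = convolve \<Omega> g (\<lambda>x. of_real (\<rho> x)) a - g a * complex_of_real (\<integral>x. \<rho> (x - a) \<partial>lebesgue_on \<Omega>)"
    using I1 I2 unfolding convolve_def by (simp add: left_diff_distrib)
  then have "norm (convolve \<Omega> g (\<lambda>x. of_real (\<rho> x)) a - g a) = norm (\<integral>x. (g x - g a) * complex_of_real (\<rho> (x - a)) \<partial>lebesgue_on \<Omega>)"
    using k(3)[OF B] by simp
  also have "\<dots> \<le> (\<integral>x. norm ((g x - g a) * complex_of_real (\<rho> (x - a))) \<partial>lebesgue_on \<Omega>)"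
    by (rule integral_norm_bound)
  also have "\<dots> \<le> (\<integral>x. e * \<rho> (x - a) \<partial>lebesgue_on \<Omega>)"
  proof (rule Bochner_Integration.integral_mono)
    show "integrable (lebesgue_on \<Omega>) (\<lambda>x. norm ((g x - g a) * complex_of_real (\<rho> (x - a))))"
      using I1 I2 by (intro integrable_norm) (simp add: left_diff_distrib)
    show "integrable (lebesgue_on \<Omega>) (\<lambda>x. e * \<rho> (x - a))" using k(1) by simp
    show "norm ((g x - g a) * complex_of_real (\<rho> (x - a))) \<le> e * \<rho> (x - a)" for x
    proof (cases "x \<in> cball a r")
      case True
      then show ?thesis using osc nn by (simp add: norm_mult mult_right_mono)
    next
      case False
      then have "x - a \<notin> cball 0 r" by (auto simp: dist_norm norm_minus_commute)
      then have "\<rho> (x - a) = 0" using \<rho> by (simp add: is_kernel_def)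
      then show ?thesis by simp
    qed
  qed
  also have "\<dots> = e" using k(3)[OF B] by simp
  finally show ?thesis .
qed

text \<open>The contraction property transfers the error from \<open>u\<close> to a continuous
  \<open>g\<close>, where uniform continuity bounds it pointwise. The condition on \<open>B\<close>
  ensures that a kernel centred at a point of \<open>B\<close> has its full mass inside
  \<Omega>.\<close>

lemma convolve_kernel_L2_lim:
  fixes u :: "'a::euclidean_space \<Rightarrow> complex"
  assumes \<rho>: "\<And>n. is_kernel (r / real (Suc n)) (\<rho> n)" and r: "r > 0" and u: "u \<in> L2 \<Omega>"
    and \<Omega>: "\<Omega> \<in> sets lebesgue" "bounded \<Omega>" and B: "B \<in> sets lebesgue" "B \<subseteq> \<Omega>" "\<And>a. a \<in> B \<Longrightarrow> cball a r \<subseteq> \<Omega>"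
  shows "L2_lim B (\<lambda>n. convolve \<Omega> u (\<lambda>x. of_real (\<rho> n x))) u"
proof (rule LIMSEQ_I)
  have \<Omega>': "\<Omega> \<in> lmeasurable" and B': "B \<in> lmeasurable"
    using \<Omega> B bounded_set_imp_lmeasurable bounded_subset by blast+
  fix e :: real assume e: "e > 0"
  define mB where "mB = sqrt (measure lebesgue B)"
  have mB: "mB \<ge> 0" by (simp add: mB_def)
  obtain g M where g: "continuous_on UNIV g" "\<And>x. norm (g x) \<le> M" "g \<in> L2 \<Omega>" "L2_norm \<Omega> (\<lambda>x. u x - g x) < e / 4"
    using L2_continuous_dense[OF \<Omega>' u, of "e / 4"] e by auto
  \<comment> \<open>Adding 1 avoids division by zero when \<open>B\<close> is null. The error then
    splits into three parts of size at most \<open>e / 4\<close>.\<close>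
  define e' where "e' = e / (4 * (mB + 1))"
  have e': "e' > 0" "e' * mB \<le> e / 4" using e mB by (auto simp: e'_def field_simps)
  obtain R where R: "\<Omega> \<subseteq> cball 0 R" using \<Omega>(2) unfolding bounded_pos by (metis mem_cball_0 subsetI)
  have "uniformly_continuous_on (cball 0 R) g"
    using g(1) continuous_on_subset by (intro compact_uniformly_continuous) auto
  then obtain d where d: "d > 0" "\<And>x y. x \<in> cball 0 R \<Longrightarrow> y \<in> cball 0 R \<Longrightarrow> dist x y < d \<Longrightarrow> dist (g x) (g y) < e'"
    using e'(1) unfolding uniformly_continuous_on_def by (metis dist_commute)
  obtain n0 where n0: "r / real (Suc n0) < d" using r d(1) reals_Archimedean[of "d / r"]
    by (auto simp: field_simps)
  have "norm (L2_norm B (\<lambda>x. convolve \<Omega> u (\<lambda>x. of_real (\<rho> n x)) x - u x) - 0) < e" if n: "n \<ge> n0" for n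
  proof -
    have rn: "r / real (Suc n) < d" "r / real (Suc n) \<le> r"
    proof -
      have "r / real (Suc n) \<le> r / real (Suc n0)" using n r by (intro divide_left_mono) auto
      then show "r / real (Suc n) < d" using n0 by linarith
      show "r / real (Suc n) \<le> r" using r by (simp add: divide_le_eq)
    qed
    let ?k = "\<lambda>x. complex_of_real (\<rho> n x)"
    have T: "?k \<in> test_functions UNIV" using \<rho>[of n] by (simp add: is_kernel_def)
    have conv_diff: "convolve \<Omega> (\<lambda>x. u x - g x) ?k a = convolve \<Omega> u ?k a - convolve \<Omega> g ?k a" for a
      using convolve_integrable[OF L2_finite_measure_integrable[OF \<Omega>' u] T] convolve_integrable[OF L2_finite_measure_integrable[OF \<Omega>' g(3)] T]
      unfolding convolve_def by (simp add: left_diff_distrib)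
    have 1: "L2_norm B (\<lambda>a. convolve \<Omega> u ?k a - convolve \<Omega> g ?k a) < e / 4"
      using convolve_kernel_L2(2)[OF \<rho>[of n] L2_diff[OF u g(3)] \<Omega>' B'] g(4) unfolding conv_diff[abs_def] by linarith
    have 2: "L2_norm B (\<lambda>a. convolve \<Omega> g ?k a - g a) \<le> e' * mB"
      unfolding mB_def
    proof (rule L2_norm_bounded(2)[OF B'])
      show "(\<lambda>a. convolve \<Omega> g ?k a - g a) \<in> borel_measurable (lebesgue_on B)"
        by (intro borel_measurable_diff L2_measurable[OF convolve_kernel_L2(1)[OF \<rho>[of n] g(3) \<Omega>' B']] continuous_imp_measurable_lebesgue_on g)
      show "norm (convolve \<Omega> g ?k a - g a) \<le> e'" if a: "a \<in> B" for a
      proof (rule convolve_kernel_continuous[OF \<rho>[of n] g(1,2) \<Omega>'])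
        show sub: "cball a (r / real (Suc n)) \<subseteq> \<Omega>" using B(3)[OF a] rn(2) by force
        show "norm (g x - g a) \<le> e'" if x: "x \<in> cball a (r / real (Suc n))" for x
        proof -
          have "dist x a < d" using x rn(1) by (simp add: dist_commute)
          moreover have "x \<in> cball 0 R" "a \<in> cball 0 R" using x sub R a B(2) by blast+
          ultimately have "dist (g x) (g a) < e'" using d(2) by blast
          then show ?thesis by (simp add: dist_norm)
        qed
      qed
    qed (use e' in simp)
    have 3: "L2_norm B (\<lambda>a. g a - u a) \<le> e / 4"
      using L2_mono(2)[OF B(2,1) \<Omega>(1) L2_diff[OF u g(3)]] g(4) by (simp add: L2_norm_minus_commute[of B g])
    note cL = convolve_kernel_L2(1)[OF \<rho>[of n] u \<Omega>' B'] convolve_kernel_L2(1)[OF \<rho>[of n] g(3) \<Omega>' B']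
      L2_mono(1)[OF B(2,1) \<Omega>(1) u] L2_mono(1)[OF B(2,1) \<Omega>(1) g(3)]
    have "L2_norm B (\<lambda>x. convolve \<Omega> u ?k x - u x) \<le> L2_norm B (\<lambda>a. convolve \<Omega> u ?k a - convolve \<Omega> g ?k a) + L2_norm B (\<lambda>a. convolve \<Omega> g ?k a - u a)"
      by (rule L2_norm_triangle_diff[OF cL(1,2,3)])
    also have "L2_norm B (\<lambda>a. convolve \<Omega> g ?k a - u a) \<le> L2_norm B (\<lambda>a. convolve \<Omega> g ?k a - g a) + L2_norm B (\<lambda>a. g a - u a)"
      by (rule L2_norm_triangle_diff[OF cL(2,4,3)])
    finally show ?thesis using 1 2 3 e'(2) e by simp
  qed
  then show "\<exists>no. \<forall>n\<ge>no. norm (L2_norm B (\<lambda>x. convolve \<Omega> u (\<lambda>x. of_real (\<rho> n x)) x - u x) - 0) < e" by blast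
qed

section \<open>Localisation, cutoffs and the fundamental lemma\<close>

lemma L2_cong: "(\<And>x. x \<in> \<Omega> \<Longrightarrow> f x = g x) \<Longrightarrow> f \<in> L2 \<Omega> \<longleftrightarrow> g \<in> L2 \<Omega>"
  unfolding L2_def
  using measurable_cong[of "lebesgue_on \<Omega>" f g borel]
    Bochner_Integration.integrable_cong[of "lebesgue_on \<Omega>" "lebesgue_on \<Omega>" "\<lambda>x. (norm (f x))\<^sup>2" "\<lambda>x. (norm (g x))\<^sup>2"]
  by auto

lemma AE_lebesgue_on_mono:
  assumes "AE x in lebesgue_on \<Omega>. P x" "S \<subseteq> \<Omega>" "S \<in> sets lebesgue" "\<Omega> \<in> sets lebesgue"
  shows "AE x in lebesgue_on S. P x"
  using assms by (auto simp: AE_lebesgue_on_iff intro: negligible_subset)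

text \<open>Second countability: a set that is null near each of its points is null.\<close>

lemma AE_lebesgue_on_local:
  assumes "open \<Omega>" "\<And>z. z \<in> \<Omega> \<Longrightarrow> \<exists>r>0. AE x in lebesgue_on (ball z r). P x"
  shows "AE x in lebesgue_on \<Omega>. P x"
proof -
  have "negligible {x \<in> \<Omega>. \<not> P x}"
  proof (rule locally_negligible_alt[THEN iffD2], rule ballI)
    fix z assume z: "z \<in> {x \<in> \<Omega>. \<not> P x}"
    then obtain r where r: "r > 0" "AE x in lebesgue_on (ball z r). P x" using assms(2) by blast
    then have "negligible {x \<in> ball z r. \<not> P x}" by (simp add: AE_lebesgue_on_iff)
    then have "negligible ({x \<in> \<Omega>. \<not> P x} \<inter> ball z r)" by (rule negligible_subset) auto
    moreover have "openin (top_of_set {x \<in> \<Omega>. \<not> P x}) ({x \<in> \<Omega>. \<not> P x} \<inter> ball z r)"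
      by (simp add: openin_open_Int)
    ultimately show "\<exists>U. openin (top_of_set {x \<in> \<Omega>. \<not> P x}) U \<and> z \<in> U \<and> negligible U"
      using z r(1) by (intro exI[of _ "{x \<in> \<Omega>. \<not> P x} \<inter> ball z r"]) auto
  qed
  then show ?thesis using assms(1) by (simp add: AE_lebesgue_on_iff)
qed

lemma integral_lebesgue_on_eq:
  fixes f :: "'a::euclidean_space \<Rightarrow> complex"
  assumes "\<Omega> \<in> sets lebesgue" "\<And>x. x \<notin> \<Omega> \<Longrightarrow> f x = 0"
  shows "(\<integral>x. f x \<partial>lebesgue_on \<Omega>) = (\<integral>x. f x \<partial>lebesgue)"
proof -
  have "(\<integral>x. f x \<partial>lebesgue_on \<Omega>) = (\<integral>x. indicator \<Omega> x *\<^sub>R f x \<partial>lebesgue)"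
    using assms(1) by (simp add: integral_restrict_space)
  also have "(\<lambda>x. indicator \<Omega> x *\<^sub>R f x) = f" using assms(2) by (auto simp: indicator_def)
  finally show ?thesis by simp
qed

lemma integral_lebesgue_on_subset:
  fixes f :: "'a::euclidean_space \<Rightarrow> complex"
  assumes "\<Omega> \<in> sets lebesgue" "S \<in> sets lebesgue" "S \<subseteq> \<Omega>" "\<And>x. x \<in> \<Omega> \<Longrightarrow> x \<notin> S \<Longrightarrow> f x = 0"
  shows "(\<integral>x. f x \<partial>lebesgue_on \<Omega>) = (\<integral>x. f x \<partial>lebesgue_on S)"
proof -
  have "(\<integral>x. f x \<partial>lebesgue_on \<Omega>) = (\<integral>x. indicator \<Omega> x *\<^sub>R f x \<partial>lebesgue)"
    using assms by (simp add: integral_restrict_space)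
  also have "(\<lambda>x. indicator \<Omega> x *\<^sub>R f x) = (\<lambda>x. indicator S x *\<^sub>R f x)"
    using assms(3,4) by (auto simp: indicator_def fun_eq_iff)
  also have "(\<integral>x. indicator S x *\<^sub>R f x \<partial>lebesgue) = (\<integral>x. f x \<partial>lebesgue_on S)"
    using assms by (simp add: integral_restrict_space)
  finally show ?thesis .
qed

lemma cutoff_exists:
  fixes z :: "'a::euclidean_space"
  assumes "R > 0"
  obtains c where "(\<lambda>x. complex_of_real (c x)) \<in> test_functions UNIV" "\<And>x. 0 \<le> c x"
    "\<And>x. x \<in> ball z (R / 2) \<Longrightarrow> c x = 1" "\<And>x. x \<notin> cball z R \<Longrightarrow> c x = 0"
proof -
  \<comment> \<open>The cutoff is the indicator of the ball of radius \<open>3 * r\<close> smoothed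
    at scale \<open>r\<close>: it is 1 inside radius \<open>2 * r = R / 2\<close> and 0 beyond
    \<open>4 * r = R\<close>.\<close>
  define r where "r = R / 4"
  have r: "r > 0" using assms by (simp add: r_def)
  obtain \<rho> :: "'a \<Rightarrow> real" where \<rho>: "is_kernel r \<rho>" using is_kernel_exists[OF r] by blast
  have T: "(\<lambda>x. complex_of_real (\<rho> x)) \<in> test_functions UNIV" using \<rho> by (simp add: is_kernel_def)
  interpret finite_measure "lebesgue_on (ball z (3 * r))" by (rule finite_measure_lebesgue_on) simp
  define c where "c a = (\<integral>x. \<rho> (x - a) \<partial>lebesgue_on (ball z (3 * r)))" for a
  have c_eq: "(\<lambda>a. complex_of_real (c a)) = convolve (ball z (3 * r)) (\<lambda>x. 1) (\<lambda>x. of_real (\<rho> x))"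
    by (simp add: c_def convolve_def fun_eq_iff)
  have out: "c a = 0" if "a \<notin> cball z R" for a
  proof -
    have "\<rho> (x - a) = 0" if x: "x \<in> ball z (3 * r)" for x
    proof -
      have "dist z a \<le> dist z x + dist x a" by (rule dist_triangle)
      then have "x - a \<notin> cball 0 r" using x \<open>a \<notin> cball z R\<close> by (auto simp: r_def dist_norm norm_minus_commute[of x a])
      then show ?thesis using \<rho> by (simp add: is_kernel_def)
    qed
    then have "c a = (\<integral>x. 0 \<partial>lebesgue_on (ball z (3 * r)))"
      unfolding c_def by (intro Bochner_Integration.integral_cong) auto
    then show ?thesis by simp
  qed
  show ?thesis
  proof (rule that[of c])
    show "(\<lambda>x. complex_of_real (c x)) \<in> test_functions UNIV"
    proof (rule test_functionsI)
      show "smooth (\<lambda>x. complex_of_real (c x))" unfolding c_eq by (rule smooth_convolve[OF _ T]) simp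
      show "compact (cball z R)" by simp
    qed (use out in auto)
    show "0 \<le> c x" for x
      unfolding c_def by (rule Bochner_Integration.integral_nonneg) (use \<rho> in \<open>simp add: is_kernel_def\<close>)
    show "c a = 1" if "a \<in> ball z (R / 2)" for a
      unfolding c_def
    proof (rule is_kernel_shift_integral(3)[OF \<rho>])
      show "cball a r \<subseteq> ball z (3 * r)"
      proof
        fix x assume "x \<in> cball a r"
        then show "x \<in> ball z (3 * r)" using that dist_triangle[of z x a] by (auto simp: r_def)
      qed
    qed simp
  qed (rule out)
qed

lemma L2_lim_AE_subseq:
  assumes "L2_lim \<Omega> F f" "\<And>n. F n \<in> L2 \<Omega>" "f \<in> L2 \<Omega>"
  obtains r :: "nat \<Rightarrow> nat" where "strict_mono r" "AE x in lebesgue_on \<Omega>. (\<lambda>n. F (r n) x) \<longlonglongrightarrow> f x"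
proof -
  have "(\<lambda>n. (L2_norm \<Omega> (\<lambda>x. F n x - f x))\<^sup>2) \<longlonglongrightarrow> 0\<^sup>2" by (intro tendsto_intros assms(1))
  then have "(\<lambda>n. \<integral>x. norm ((norm (F n x - f x))\<^sup>2) \<partial>lebesgue_on \<Omega>) \<longlonglongrightarrow> 0"
    by (simp add: L2_norm_power2)
  moreover have "integrable (lebesgue_on \<Omega>) (\<lambda>x. (norm (F n x - f x))\<^sup>2)" for n
    by (rule L2_square_integrable[OF L2_diff[OF assms(2,3)]])
  ultimately obtain r where r: "strict_mono r" "AE x in lebesgue_on \<Omega>. (\<lambda>n. (norm (F (r n) x - f x))\<^sup>2) \<longlonglongrightarrow> 0"
    using tendsto_L1_AE_subseq[of "lebesgue_on \<Omega>" "\<lambda>n x. (norm (F n x - f x))\<^sup>2"] by blast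
  have "AE x in lebesgue_on \<Omega>. (\<lambda>n. F (r n) x) \<longlonglongrightarrow> f x"
    using r(2)
  proof eventually_elim
    case (elim x)
    have "(\<lambda>n. sqrt ((norm (F (r n) x - f x))\<^sup>2)) \<longlonglongrightarrow> sqrt 0" by (intro tendsto_intros elim)
    then show ?case by (simp add: tendsto_norm_zero_iff LIM_zero_iff)
  qed
  with r(1) show ?thesis by (rule that)
qed

lemma cball_subset_ball_add: "a \<in> ball z r \<Longrightarrow> r + s \<le> R \<Longrightarrow> cball a s \<subseteq> ball z R"
proof
  fix x assume "a \<in> ball z r" "r + s \<le> R" "x \<in> cball a s"
  then show "x \<in> ball z R" using dist_triangle[of z x a] by simp
qed

lemma kernel_sequence_exists:
  assumes "s > 0"
  obtains \<rho> :: "nat \<Rightarrow> 'a::euclidean_space \<Rightarrow> real" where "\<And>n. is_kernel (s / real (Suc n)) (\<rho> n)"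
proof -
  have "\<exists>\<rho> :: 'a \<Rightarrow> real. is_kernel (s / real (Suc n)) \<rho>" for n
    using assms by (intro is_kernel_exists) simp
  then show ?thesis using that by metis
qed

lemma is_kernel_mono: "is_kernel s \<rho> \<Longrightarrow> s \<le> s' \<Longrightarrow> is_kernel s' \<rho>"
  by (auto simp: is_kernel_def)

text \<open>The ideal test function is the conjugate sign of \<open>f\<close> on a small ball. Its
  mollifications are bounded by 1 and converge almost everywhere along a subsequence, so dominated
  convergence shows that the integral of \<open>norm (f x)\<close> over that ball is 0.\<close>

lemma du_Bois_Reymond:
  fixes f :: "'a::euclidean_space \<Rightarrow> complex"
  assumes \<Omega>: "open \<Omega>" and f: "integrable (lebesgue_on \<Omega>) f"
    and zero: "\<And>\<phi>. \<phi> \<in> test_functions \<Omega> \<Longrightarrow> (\<integral>x. f x * \<phi> x \<partial>lebesgue_on \<Omega>) = 0"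
  shows "AE x in lebesgue_on \<Omega>. f x = 0"
proof (rule AE_lebesgue_on_local[OF \<Omega>])
  fix z assume "z \<in> \<Omega>"
  then obtain e where e: "e > 0" "ball z e \<subseteq> \<Omega>" using \<Omega> open_contains_ball by metis
  \<comment> \<open>Four concentric balls: the sign is cut off at radius \<open>r\<close>, its
    mollifications are supported in radius \<open>2 * r\<close>, converge in the mean on radius
    \<open>3 * r\<close>, and are computed by integrating over radius \<open>4 * r\<close>.\<close>
  define r where "r = e / 4"
  have r: "r > 0" using e by (simp add: r_def)
  have sub: "ball z (4 * r) \<subseteq> \<Omega>" "cball z (2 * r) \<subseteq> \<Omega>" "ball z r \<subseteq> \<Omega>"
  proof -
    show 4: "ball z (4 * r) \<subseteq> \<Omega>" using e by (simp add: r_def)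
    have "cball z (2 * r) \<subseteq> ball z (4 * r)" "ball z r \<subseteq> ball z (4 * r)" using r by auto
    with 4 show "cball z (2 * r) \<subseteq> \<Omega>" "ball z r \<subseteq> \<Omega>" by blast+
  qed
  have \<Omega>s: "\<Omega> \<in> sets lebesgue" using \<Omega> by simp
  define s where "s x = (if x \<in> ball z r then cnj (sgn (f x)) else 0)" for x
  have fm: "f \<in> borel_measurable (lebesgue_on \<Omega>)" using f by simp
  have sm: "s \<in> borel_measurable (lebesgue_on \<Omega>)"
  proof -
    have "(\<lambda>x. indicator (ball z r) x *\<^sub>R cnj (sgn (f x))) \<in> borel_measurable (lebesgue_on \<Omega>)"
    proof (rule borel_measurable_scaleR)
      show "indicator (ball z r) \<in> borel_measurable (lebesgue_on \<Omega>)"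
        by (intro measurable_restrict_space1 borel_measurable_indicator) simp
      show "(\<lambda>x. cnj (sgn (f x))) \<in> borel_measurable (lebesgue_on \<Omega>)"
      proof -
        have "(\<lambda>x. norm (f x)) \<in> borel_measurable (lebesgue_on \<Omega>)" using fm by measurable
        then show ?thesis
          unfolding sgn_div_norm complex_cnj_scaleR
          by (intro borel_measurable_scaleR borel_measurable_inverse fm
              borel_measurable_continuous_on[OF continuous_on_cnj[OF continuous_on_id]])
      qed
    qed
    also have "(\<lambda>x. indicator (ball z r) x *\<^sub>R cnj (sgn (f x))) = s" by (auto simp: s_def)
    finally show ?thesis .
  qed
  have s1: "norm (s x) \<le> 1" for x by (simp add: s_def norm_sgn)
  have B4: "ball z (4 * r) \<in> lmeasurable" by simp
  have sm4: "s \<in> borel_measurable (lebesgue_on (ball z (4 * r)))"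
    using measurable_restrict_mono[OF sm sub(1)] .
  have sL: "s \<in> L2 (ball z (4 * r))" by (rule L2_norm_bounded(1)[OF B4 sm4 s1])
  obtain \<rho> :: "nat \<Rightarrow> 'a \<Rightarrow> real" where \<rho>: "\<And>n. is_kernel (r / real (Suc n)) (\<rho> n)"
    using kernel_sequence_exists[OF r] by blast
  have \<rho>r: "is_kernel r (\<rho> n)" for n by (rule is_kernel_mono[OF \<rho>]) (use r in \<open>simp add: divide_le_eq\<close>)
  have T: "(\<lambda>x. complex_of_real (\<rho> n x)) \<in> test_functions UNIV" for n using \<rho> by (simp add: is_kernel_def)
  define \<psi> where "\<psi> n = convolve (ball z (4 * r)) s (\<lambda>x. of_real (\<rho> n x))" for n
  have lim: "L2_lim (ball z (3 * r)) \<psi> s"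
    unfolding \<psi>_def
  proof (rule convolve_kernel_L2_lim[OF \<rho> r sL])
    show "ball z (3 * r) \<subseteq> ball z (4 * r)" using r by (intro subset_ball) simp
    show "a \<in> ball z (3 * r) \<Longrightarrow> cball a r \<subseteq> ball z (4 * r)" for a
      by (erule cball_subset_ball_add) simp
  qed simp_all
  have \<psi>L: "\<psi> n \<in> L2 (ball z (3 * r))" for n
    unfolding \<psi>_def by (rule convolve_kernel_L2(1)[OF \<rho> sL]) auto
  have sL3: "s \<in> L2 (ball z (3 * r))" by (rule L2_mono(1)[OF _ _ _ sL]) (use r in \<open>simp_all add: subset_ball\<close>)
  obtain h where h: "strict_mono h" "AE x in lebesgue_on (ball z (3 * r)). (\<lambda>n. \<psi> (h n) x) \<longlonglongrightarrow> s x"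
    using L2_lim_AE_subseq[OF lim \<psi>L sL3] by blast
  have out: "\<psi> n a = 0" if "a \<notin> cball z (2 * r)" for n a
  proof -
    have "s x * of_real (\<rho> n (x - a)) = 0" for x
    proof (cases "x \<in> ball z r")
      case True
      have "dist z a \<le> dist z x + dist x a" by (rule dist_triangle)
      then have "x - a \<notin> cball 0 r" using True that by (auto simp: dist_norm norm_minus_commute[of x a])
      then show ?thesis using \<rho>r[of n] by (simp add: is_kernel_def)
    qed (auto simp: s_def)
    then show ?thesis by (simp only: \<psi>_def convolve_def Bochner_Integration.integral_zero)
  qed
  have \<psi>test: "\<psi> n \<in> test_functions \<Omega>" for n
    by (rule test_functionsI[OF _ _ sub(2)])
      (use out in \<open>auto simp: \<psi>_def intro!: smooth_convolve[rule_format] L2_finite_measure_integrable[OF B4 sL] T\<close>)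
  have \<psi>1: "norm (\<psi> n a) \<le> 1" for n a
  proof -
    have nn: "\<And>x. 0 \<le> \<rho> n x" using \<rho> by (simp add: is_kernel_def)
    have "norm (\<psi> n a) \<le> (\<integral>x. norm (s x * of_real (\<rho> n (x - a))) \<partial>lebesgue_on (ball z (4 * r)))"
      unfolding \<psi>_def convolve_def by (rule integral_norm_bound)
    also have "\<dots> \<le> (\<integral>x. \<rho> n (x - a) \<partial>lebesgue_on (ball z (4 * r)))"
    proof (rule Bochner_Integration.integral_mono)
      show "integrable (lebesgue_on (ball z (4 * r))) (\<lambda>x. norm (s x * of_real (\<rho> n (x - a))))"
        by (intro integrable_norm convolve_integrable[OF L2_finite_measure_integrable[OF B4 sL] T])
      show "integrable (lebesgue_on (ball z (4 * r))) (\<lambda>x. \<rho> n (x - a))"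
        by (rule is_kernel_shift_integral(1)[OF \<rho>]) simp
      show "norm (s x * of_real (\<rho> n (x - a))) \<le> \<rho> n (x - a)" for x
        using mult_right_mono[OF s1 nn, of x "x - a"] by (simp add: norm_mult nn)
    qed
    also have "\<dots> \<le> 1" by (rule is_kernel_shift_integral(2)[OF \<rho>]) simp
    finally show ?thesis .
  qed
  have "(\<lambda>n. \<integral>x. f x * \<psi> (h n) x \<partial>lebesgue_on \<Omega>) \<longlonglongrightarrow> (\<integral>x. f x * s x \<partial>lebesgue_on \<Omega>)"
  proof (rule integral_dominated_convergence[of _ _ _ "\<lambda>x. norm (f x)"])
    show "AE x in lebesgue_on \<Omega>. (\<lambda>n. f x * \<psi> (h n) x) \<longlonglongrightarrow> f x * s x"
    proof -
      have "negligible {x \<in> ball z (3 * r). \<not> (\<lambda>n. \<psi> (h n) x) \<longlonglongrightarrow> s x}"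
        using h(2) by (simp add: AE_lebesgue_on_iff)
      moreover have "{x \<in> \<Omega>. \<not> (\<lambda>n. \<psi> (h n) x) \<longlonglongrightarrow> s x} \<subseteq> {x \<in> ball z (3 * r). \<not> (\<lambda>n. \<psi> (h n) x) \<longlonglongrightarrow> s x}"
      proof -
        have "(\<lambda>n. \<psi> (h n) x) \<longlonglongrightarrow> s x" if "x \<notin> ball z (3 * r)" for x
        proof -
          have "x \<notin> cball z (2 * r)" "x \<notin> ball z r" using that r by auto
          then show ?thesis using out by (simp add: s_def)
        qed
        then show ?thesis by blast
      qed
      ultimately have "AE x in lebesgue_on \<Omega>. (\<lambda>n. \<psi> (h n) x) \<longlonglongrightarrow> s x"
        using negligible_subset by (subst AE_lebesgue_on_iff[OF \<Omega>s]) blast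
      then show ?thesis by eventually_elim (intro tendsto_intros)
    qed
    show "AE x in lebesgue_on \<Omega>. norm (f x * \<psi> (h n) x) \<le> norm (f x)" for n
      using \<psi>1 by (intro AE_I2) (simp add: norm_mult mult_left_le)
    show "integrable (lebesgue_on \<Omega>) (\<lambda>x. norm (f x))" using f by simp
    show "(\<lambda>x. f x * s x) \<in> borel_measurable (lebesgue_on \<Omega>)"
      by (rule borel_measurable_times[OF fm sm])
    show "(\<lambda>x. f x * \<psi> (h n) x) \<in> borel_measurable (lebesgue_on \<Omega>)" for n
      by (rule borel_measurable_times[OF fm smooth_measurable[OF test_functions_smooth[OF \<psi>test]]])
  qed
  then have "(\<integral>x. f x * s x \<partial>lebesgue_on \<Omega>) = 0"
    using zero[OF \<psi>test] by (simp add: LIMSEQ_const_iff)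
  also have "(\<integral>x. f x * s x \<partial>lebesgue_on \<Omega>) = (\<integral>x. f x * s x \<partial>lebesgue_on (ball z r))"
    by (rule integral_lebesgue_on_subset[OF \<Omega>s _ sub(3)]) (auto simp: s_def)
  also have "\<dots> = (\<integral>x. complex_of_real (norm (f x)) \<partial>lebesgue_on (ball z r))"
  proof (rule Bochner_Integration.integral_cong[OF refl])
    fix x assume "x \<in> space (lebesgue_on (ball z r))"
    then have "f x * s x = f x * cnj (sgn (f x))" by (simp add: s_def)
    also have "\<dots> = complex_of_real (norm (f x))"
    proof (cases "f x = 0")
      case False
      have "f x * cnj (sgn (f x)) = of_real (inverse (norm (f x))) * (f x * cnj (f x))"
        by (simp add: sgn_div_norm scaleR_conv_of_real)
      also have "\<dots> = of_real (inverse (norm (f x)) * (norm (f x))\<^sup>2)"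
        by (simp only: complex_norm_square[symmetric] of_real_mult)
      also have "inverse (norm (f x)) * (norm (f x))\<^sup>2 = norm (f x)"
        using False by (simp add: power2_eq_square)
      finally show ?thesis .
    qed simp
    finally show "f x * s x = complex_of_real (norm (f x))" .
  qed
  finally have 0: "(\<integral>x. norm (f x) \<partial>lebesgue_on (ball z r)) = 0" by simp
  have "integrable lebesgue (\<lambda>x. indicator \<Omega> x *\<^sub>R f x)"
    using f \<Omega>s by (simp add: integrable_restrict_space)
  from integrable_mult_indicator[OF _ this, of "ball z r"]
  have "integrable lebesgue (\<lambda>x. indicator (ball z r) x *\<^sub>R indicator \<Omega> x *\<^sub>R f x)" by simp
  also have "(\<lambda>x. indicator (ball z r) x *\<^sub>R indicator \<Omega> x *\<^sub>R f x) = (\<lambda>x. indicator (ball z r) x *\<^sub>R f x)"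
    using sub(3) by (auto simp: indicator_def fun_eq_iff)
  finally have "integrable (lebesgue_on (ball z r)) f" by (simp add: integrable_restrict_space)
  then have "AE x in lebesgue_on (ball z r). norm (f x) = 0"
    using 0 integral_nonneg_eq_0_iff_AE[of "lebesgue_on (ball z r)" "\<lambda>x. norm (f x)"] by simp
  then show "\<exists>r>0. AE x in lebesgue_on (ball z r). f x = 0" using r by auto
qed

section \<open>Weak derivatives and mollification\<close>

lemma integral_lebesgue_translate:
  fixes g :: "'a::euclidean_space \<Rightarrow> complex"
  assumes "continuous_on UNIV g"
  shows "(\<integral>x. g (x - a) \<partial>lebesgue) = (\<integral>x. g x \<partial>lebesgue)"
proof -
  have m: "g \<in> borel_measurable borel" using assms by (rule borel_measurable_continuous_onI)
  have m': "(\<lambda>x. g (x - a)) \<in> borel_measurable borel" using m by measurable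
  have "(\<integral>x. g x \<partial>lebesgue) = (\<integral>x. g x \<partial>lborel)" using m by (simp add: integral_completion)
  also have "\<dots> = (\<integral>x. g x \<partial>distr lborel borel ((+) (- a)))" by (simp only: lborel_distr_plus)
  also have "\<dots> = (\<integral>x. g ((- a) + x) \<partial>lborel)" using m by (subst integral_distr) auto
  also have "\<dots> = (\<integral>x. g (x - a) \<partial>lebesgue)" using m' by (simp add: integral_completion add.commute)
  finally show ?thesis by simp
qed

text \<open>Differentiating the constant function \<open>a \<mapsto> \<integral> \<phi> (x - a) dx\<close>.\<close>

lemma integral_partial_deriv_eq_0:
  fixes \<phi> :: "'a::euclidean_space \<Rightarrow> complex"
  assumes \<phi>: "\<phi> \<in> test_functions UNIV" and b: "b \<in> Basis"
  shows "(\<integral>x. partial_deriv b \<phi> x \<partial>lebesgue) = 0"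
proof -
  obtain K where K: "compact K" "\<forall>x. x \<notin> K \<longrightarrow> \<phi> x = 0"
    using \<phi> unfolding test_functions_iff by blast
  obtain R where R: "\<forall>x\<in>K. norm x \<le> R" using compact_imp_bounded[OF K(1)] unfolding bounded_iff by blast
  \<comment> \<open>For shifts of norm below 1 the shifted support stays inside this ball, so
    integrals over \<open>S\<close> and over the whole space agree.\<close>
  define S where "S = ball (0::'a) (R + 2)"
  interpret finite_measure "lebesgue_on S" unfolding S_def by (rule finite_measure_lebesgue_on) simp
  have S: "S \<in> sets lebesgue" by (simp add: S_def)
  have one: "integrable (lebesgue_on S) (\<lambda>x. 1 :: complex)" by simp
  have "convolve S (\<lambda>x. 1) \<phi> a = (\<integral>x. \<phi> x \<partial>lebesgue)" if a: "a \<in> ball 0 1" for a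
  proof -
    have "(\<integral>x. \<phi> (x - a) \<partial>lebesgue_on S) = (\<integral>x. \<phi> (x - a) \<partial>lebesgue)"
    proof (rule integral_lebesgue_on_eq[OF S])
      fix x assume x: "x \<notin> S"
      have "norm x \<le> norm (x - a) + norm a" using norm_triangle_sub[of x a] by linarith
      then have "x - a \<notin> K" using x a R by (auto simp: S_def)
      then show "\<phi> (x - a) = 0" using K(2) by blast
    qed
    then show ?thesis
      by (simp add: convolve_def integral_lebesgue_translate smooth_continuous test_functions_smooth[OF \<phi>])
  qed
  then have "partial_deriv b (convolve S (\<lambda>x. 1) \<phi>) 0 = partial_deriv b (\<lambda>a. \<integral>x. \<phi> x \<partial>lebesgue) 0"
    by (intro partial_deriv_local[of "ball 0 1"]) auto
  then have "convolve S (\<lambda>x. 1) (partial_deriv b \<phi>) 0 = 0"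
    by (simp add: partial_deriv_convolve[OF one \<phi> b] partial_deriv_const)
  then have "(\<integral>x. partial_deriv b \<phi> x \<partial>lebesgue_on S) = 0" by (simp add: convolve_def)
  also have "(\<integral>x. partial_deriv b \<phi> x \<partial>lebesgue_on S) = (\<integral>x. partial_deriv b \<phi> x \<partial>lebesgue)"
  proof (rule integral_lebesgue_on_eq[OF S])
    fix x assume "x \<notin> S"
    then have "x \<notin> K" using R by (auto simp: S_def)
    then show "partial_deriv b \<phi> x = 0" using partial_deriv_outside[of K \<phi> x b] K compact_imp_closed by blast
  qed
  finally show ?thesis .
qed

lemma integral_partial_deriv_test:
  assumes "\<phi> \<in> test_functions \<Omega>" "b \<in> Basis" "\<Omega> \<in> sets lebesgue"
  shows "(\<integral>x. partial_deriv b \<phi> x \<partial>lebesgue_on \<Omega>) = 0"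
  using integral_partial_deriv_eq_0[OF test_functions_mono[OF subset_UNIV assms(1)] assms(2)]
    integral_lebesgue_on_eq[OF assms(3), of "partial_deriv b \<phi>"]
    test_functions_outside[OF test_functions_partial_deriv[OF assms(1,2)]] by auto

lemma smooth_test_integrable:
  assumes "\<phi> \<in> test_functions \<Omega>'" "smooth f" "\<Omega> \<in> sets lebesgue"
  shows "integrable (lebesgue_on \<Omega>) (\<lambda>x. f x * \<phi> x)"
proof -
  have "integrable lebesgue (\<lambda>x. f x * \<phi> x)"
    by (rule test_functions_integrable[OF test_functions_mult[OF assms(1,2)]])
  from integrable_mult_indicator[OF assms(3) this] show ?thesis
    using assms(3) by (simp add: integrable_restrict_space)
qed

lemma integration_by_parts:
  assumes f: "smooth f" and \<phi>: "\<phi> \<in> test_functions \<Omega>" and b: "b \<in> Basis" and \<Omega>: "\<Omega> \<in> sets lebesgue"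
  shows "(\<integral>x. f x * partial_deriv b \<phi> x \<partial>lebesgue_on \<Omega>) = - (\<integral>x. partial_deriv b f x * \<phi> x \<partial>lebesgue_on \<Omega>)"
proof -
  note s = test_functions_smooth[OF \<phi>]
  have "0 = (\<integral>x. f x * partial_deriv b \<phi> x + partial_deriv b f x * \<phi> x \<partial>lebesgue_on \<Omega>)"
    using integral_partial_deriv_test[OF test_functions_mult[OF \<phi> f] b \<Omega>] by (simp add: partial_deriv_mult f s)
  also have "\<dots> = (\<integral>x. f x * partial_deriv b \<phi> x \<partial>lebesgue_on \<Omega>) + (\<integral>x. partial_deriv b f x * \<phi> x \<partial>lebesgue_on \<Omega>)"
    by (rule Bochner_Integration.integral_add)
      (intro smooth_test_integrable[OF test_functions_partial_deriv[OF \<phi> b] f \<Omega>]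
        smooth_test_integrable[OF \<phi> smooth_partial_deriv[OF f b] \<Omega>])+
  finally show ?thesis by (simp add: eq_neg_iff_add_eq_0)
qed

lemma integration_by_parts_laplacian:
  assumes f: "smooth f" and \<phi>: "\<phi> \<in> test_functions \<Omega>" and \<Omega>: "\<Omega> \<in> sets lebesgue"
  shows "(\<integral>x. f x * laplacian \<phi> x \<partial>lebesgue_on \<Omega>) = (\<integral>x. laplacian f x * \<phi> x \<partial>lebesgue_on \<Omega>)"
proof -
  have "(\<integral>x. f x * laplacian \<phi> x \<partial>lebesgue_on \<Omega>) = (\<Sum>b\<in>Basis. \<integral>x. f x * partial_deriv b (partial_deriv b \<phi>) x \<partial>lebesgue_on \<Omega>)"
    unfolding laplacian_def sum_distrib_left
    by (intro Bochner_Integration.integral_sum smooth_test_integrable[where \<Omega>'=\<Omega>, OF _ f \<Omega>] test_functions_partial_deriv \<phi>)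
  also have "\<dots> = (\<Sum>b\<in>Basis. \<integral>x. partial_deriv b (partial_deriv b f) x * \<phi> x \<partial>lebesgue_on \<Omega>)"
  proof (intro sum.cong refl)
    fix b :: 'a assume b: "b \<in> Basis"
    show "(\<integral>x. f x * partial_deriv b (partial_deriv b \<phi>) x \<partial>lebesgue_on \<Omega>) = (\<integral>x. partial_deriv b (partial_deriv b f) x * \<phi> x \<partial>lebesgue_on \<Omega>)"
      using integration_by_parts[OF f test_functions_partial_deriv[OF \<phi> b] b \<Omega>]
        integration_by_parts[OF smooth_partial_deriv[OF f b] \<phi> b \<Omega>] by simp
  qed
  also have "\<dots> = (\<integral>x. laplacian f x * \<phi> x \<partial>lebesgue_on \<Omega>)"
    unfolding laplacian_def sum_distrib_right
    by (intro Bochner_Integration.integral_sum[symmetric] smooth_test_integrable[OF \<phi> _ \<Omega>] smooth_partial_deriv f)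
  finally show ?thesis .
qed

lemma has_weak_deriv_smooth:
  "smooth f \<Longrightarrow> b \<in> Basis \<Longrightarrow> \<Omega> \<in> sets lebesgue \<Longrightarrow> has_weak_deriv \<Omega> b f (partial_deriv b f)"
  unfolding has_weak_deriv_def using integration_by_parts by blast

lemma has_distr_laplacian_smooth:
  "smooth f \<Longrightarrow> \<Omega> \<in> sets lebesgue \<Longrightarrow> has_distr_laplacian \<Omega> f (laplacian f)"
  unfolding has_distr_laplacian_def using integration_by_parts_laplacian by blast

lemma has_weak_deriv_subset:
  assumes "has_weak_deriv \<Omega> b u g" "S \<subseteq> \<Omega>" "S \<in> sets lebesgue" "\<Omega> \<in> sets lebesgue" "b \<in> Basis"
  shows "has_weak_deriv S b u g"
  unfolding has_weak_deriv_def
proof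
  fix \<phi> assume \<phi>: "\<phi> \<in> test_functions S"
  note out = test_functions_outside[OF \<phi>] test_functions_outside[OF test_functions_partial_deriv[OF \<phi> assms(5)]]
  have "(\<integral>x. u x * partial_deriv b \<phi> x \<partial>lebesgue_on \<Omega>) = - (\<integral>x. g x * \<phi> x \<partial>lebesgue_on \<Omega>)"
    using assms(1) test_functions_mono[OF assms(2) \<phi>] by (simp add: has_weak_deriv_def)
  then show "(\<integral>x. u x * partial_deriv b \<phi> x \<partial>lebesgue_on S) = - (\<integral>x. g x * \<phi> x \<partial>lebesgue_on S)"
    using integral_lebesgue_on_subset[OF assms(4,3,2), of "\<lambda>x. u x * partial_deriv b \<phi> x"]
      integral_lebesgue_on_subset[OF assms(4,3,2), of "\<lambda>x. g x * \<phi> x"] out by simp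
qed

lemma has_distr_laplacian_subset:
  assumes "has_distr_laplacian \<Omega> u g" "S \<subseteq> \<Omega>" "S \<in> sets lebesgue" "\<Omega> \<in> sets lebesgue"
  shows "has_distr_laplacian S u g"
  unfolding has_distr_laplacian_def
proof
  fix \<phi> assume \<phi>: "\<phi> \<in> test_functions S"
  note out = test_functions_outside[OF \<phi>] test_functions_outside[OF test_functions_laplacian[OF \<phi>]]
  have "(\<integral>x. u x * laplacian \<phi> x \<partial>lebesgue_on \<Omega>) = (\<integral>x. g x * \<phi> x \<partial>lebesgue_on \<Omega>)"
    using assms(1) test_functions_mono[OF assms(2) \<phi>] by (simp add: has_distr_laplacian_def)
  then show "(\<integral>x. u x * laplacian \<phi> x \<partial>lebesgue_on S) = (\<integral>x. g x * \<phi> x \<partial>lebesgue_on S)"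
    using integral_lebesgue_on_subset[OF assms(4,3,2), of "\<lambda>x. u x * laplacian \<phi> x"]
      integral_lebesgue_on_subset[OF assms(4,3,2), of "\<lambda>x. g x * \<phi> x"] out by simp
qed

text \<open>Weak equations do not ask \<open>u\<close> to be measurable. If one product fails to be
  measurable, so does the other, and both integrals take the default value 0; hence weak equations
  are invariant under changes on null sets.\<close>

lemma integral_mult_cong_AE:
  fixes \<Omega> :: "'a::euclidean_space set"
  assumes \<Omega>: "\<Omega> \<in> sets lebesgue" and ae: "AE x in lebesgue_on \<Omega>. u x = u' x" and \<phi>: "smooth \<phi>"
  shows "(\<integral>x. u x * \<phi> x \<partial>lebesgue_on \<Omega>) = (\<integral>x. u' x * \<phi> x \<partial>lebesgue_on \<Omega>)"
proof -
  have ae': "AE x in lebesgue_on \<Omega>. u x * \<phi> x = u' x * \<phi> x" using ae by eventually_elim simp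
  show ?thesis
  proof (cases "(\<lambda>x. u x * \<phi> x) \<in> borel_measurable (lebesgue_on \<Omega>)")
    case True
    then show ?thesis using lebesgue_on_measurable_AE[OF \<Omega> True ae'] ae' by (intro integral_cong_AE)
  next
    case False
    have ae'': "AE x in lebesgue_on \<Omega>. u' x * \<phi> x = u x * \<phi> x" using ae' by eventually_elim (rule sym)
    have "(\<lambda>x. u' x * \<phi> x) \<notin> borel_measurable (lebesgue_on \<Omega>)"
      using False by (rule contrapos_nn) (rule lebesgue_on_measurable_AE[OF \<Omega> _ ae''])
    then have "\<not> integrable (lebesgue_on \<Omega>) (\<lambda>x. u' x * \<phi> x)"
      by (rule contrapos_nn) (rule borel_measurable_integrable)
    moreover have "\<not> integrable (lebesgue_on \<Omega>) (\<lambda>x. u x * \<phi> x)"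
      using False by (rule contrapos_nn) (rule borel_measurable_integrable)
    ultimately show ?thesis by (simp add: not_integrable_integral_eq)
  qed
qed

lemma has_weak_deriv_cong_AE:
  assumes "has_weak_deriv \<Omega> b u g" "\<Omega> \<in> sets lebesgue" "b \<in> Basis"
    "AE x in lebesgue_on \<Omega>. u x = u' x" "AE x in lebesgue_on \<Omega>. g x = g' x"
  shows "has_weak_deriv \<Omega> b u' g'"
  unfolding has_weak_deriv_def
proof
  fix \<phi> assume \<phi>: "\<phi> \<in> test_functions \<Omega>"
  note s = test_functions_smooth[OF \<phi>]
  show "(\<integral>x. u' x * partial_deriv b \<phi> x \<partial>lebesgue_on \<Omega>) = - (\<integral>x. g' x * \<phi> x \<partial>lebesgue_on \<Omega>)"
    using assms(1) \<phi> integral_mult_cong_AE[OF assms(2,4) smooth_partial_deriv[OF s assms(3)]]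
      integral_mult_cong_AE[OF assms(2,5) s] by (simp add: has_weak_deriv_def)
qed

lemma has_distr_laplacian_cong_AE:
  assumes "has_distr_laplacian \<Omega> u g" "\<Omega> \<in> sets lebesgue"
    "AE x in lebesgue_on \<Omega>. u x = u' x" "AE x in lebesgue_on \<Omega>. g x = g' x"
  shows "has_distr_laplacian \<Omega> u' g'"
  unfolding has_distr_laplacian_def
proof
  fix \<phi> assume \<phi>: "\<phi> \<in> test_functions \<Omega>"
  note s = test_functions_smooth[OF \<phi>]
  show "(\<integral>x. u' x * laplacian \<phi> x \<partial>lebesgue_on \<Omega>) = (\<integral>x. g' x * \<phi> x \<partial>lebesgue_on \<Omega>)"
    using assms(1) \<phi> integral_mult_cong_AE[OF assms(2,3) smooth_laplacian[OF s]]
      integral_mult_cong_AE[OF assms(2,4) s] by (simp add: has_distr_laplacian_def)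
qed

text \<open>If \<Omega> has infinite measure, an L2 function on it need not be integrable; the
  fundamental lemma is therefore applied on balls.\<close>

lemma L2_test_integral_unique:
  assumes \<Omega>: "open \<Omega>" and u: "u \<in> L2 \<Omega>" and v: "v \<in> L2 \<Omega>"
    and eq: "\<And>\<phi>. \<phi> \<in> test_functions \<Omega> \<Longrightarrow> (\<integral>x. u x * \<phi> x \<partial>lebesgue_on \<Omega>) = (\<integral>x. v x * \<phi> x \<partial>lebesgue_on \<Omega>)"
  shows "AE x in lebesgue_on \<Omega>. u x = v x"
proof (rule AE_lebesgue_on_local[OF \<Omega>])
  fix z assume "z \<in> \<Omega>"
  then obtain r where r: "r > 0" "ball z r \<subseteq> \<Omega>" using \<Omega> open_contains_ball by metis
  have sets: "ball z r \<in> sets lebesgue" "\<Omega> \<in> sets lebesgue" using \<Omega> by auto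
  note uv = L2_mono(1)[OF r(2) sets u] L2_mono(1)[OF r(2) sets v]
  have int: "integrable (lebesgue_on (ball z r)) (\<lambda>x. u x - v x)"
    by (rule L2_finite_measure_integrable[OF _ L2_diff[OF uv]]) simp
  have "AE x in lebesgue_on (ball z r). u x - v x = 0"
  proof (rule du_Bois_Reymond[OF _ int])
    fix \<phi> assume \<phi>: "\<phi> \<in> test_functions (ball z r)"
    note \<phi>L = test_functions_L2[OF \<phi> sets(1)]
    have "(\<integral>x. u x * \<phi> x \<partial>lebesgue_on (ball z r)) = (\<integral>x. v x * \<phi> x \<partial>lebesgue_on (ball z r))"
      using eq[OF test_functions_mono[OF r(2) \<phi>]] test_functions_outside[OF \<phi>]
        integral_lebesgue_on_subset[OF sets(2,1) r(2), of "\<lambda>x. u x * \<phi> x"]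
        integral_lebesgue_on_subset[OF sets(2,1) r(2), of "\<lambda>x. v x * \<phi> x"] by simp
    then show "(\<integral>x. (u x - v x) * \<phi> x \<partial>lebesgue_on (ball z r)) = 0"
      using L2_prod_integrable(1)[OF uv(1) \<phi>L] L2_prod_integrable(1)[OF uv(2) \<phi>L] by (simp add: left_diff_distrib)
  qed simp
  then show "\<exists>r>0. AE x in lebesgue_on (ball z r). u x = v x" using r(1) by auto
qed

lemma has_weak_deriv_unique:
  assumes "open \<Omega>" "g \<in> L2 \<Omega>" "g' \<in> L2 \<Omega>" "has_weak_deriv \<Omega> b u g" "has_weak_deriv \<Omega> b u g'"
  shows "AE x in lebesgue_on \<Omega>. g x = g' x"
  using assms by (intro L2_test_integral_unique) (auto simp: has_weak_deriv_def)

lemma has_distr_laplacian_unique: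
  assumes "open \<Omega>" "g \<in> L2 \<Omega>" "g' \<in> L2 \<Omega>" "has_distr_laplacian \<Omega> u g" "has_distr_laplacian \<Omega> u g'"
  shows "AE x in lebesgue_on \<Omega>. g x = g' x"
  using assms by (intro L2_test_integral_unique) (auto simp: has_distr_laplacian_def)

text \<open>Kernels of radius at most \<open>R - r\<close> centred in the small ball are supported
  in the closed region covered by the big one, so on \<open>ball z r\<close> mollification commutes
  with weak derivatives taken on \<open>ball z R\<close>. Every such argument costs some
  radius.\<close>

locale ball_mollification =
  fixes z :: "'a::euclidean_space" and r R :: real and \<rho> :: "nat \<Rightarrow> 'a \<Rightarrow> real"
  assumes r: "0 < r" "r < R" and \<rho>: "\<And>n. is_kernel ((R - r) / real (Suc n)) (\<rho> n)"
begin

definition mollify :: "nat \<Rightarrow> ('a \<Rightarrow> complex) \<Rightarrow> 'a \<Rightarrow> complex" where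
  "mollify n u = convolve (ball z R) u (\<lambda>x. of_real (\<rho> n x))"

lemma kernel_test: "(\<lambda>x. complex_of_real (\<rho> n x)) \<in> test_functions UNIV"
  using \<rho> by (simp add: is_kernel_def)

lemma kernel_smooth: "smooth (\<lambda>x. complex_of_real (\<rho> n x))"
  using kernel_test by (rule test_functions_smooth)

lemma ball_shift: "a \<in> ball z r \<Longrightarrow> cball a (R - r) \<subseteq> ball z R"
  by (rule cball_subset_ball_add) auto

lemma kernel_shift:
  assumes "a \<in> ball z r" "\<phi> \<in> test_functions UNIV" "\<And>x. x \<notin> cball 0 (R - r) \<Longrightarrow> \<phi> x = 0"
  shows "(\<lambda>x. \<phi> (x - a)) \<in> test_functions (ball z R)"
  by (rule test_functions_shift[OF assms(2,3) ball_shift[OF assms(1)]])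

lemma kernel_outside: "x \<notin> cball 0 (R - r) \<Longrightarrow> complex_of_real (\<rho> n x) = 0"
proof -
  have "(R - r) / real (Suc n) \<le> R - r" using r by (simp add: divide_le_eq)
  from is_kernel_mono[OF \<rho> this] show "x \<notin> cball 0 (R - r) \<Longrightarrow> complex_of_real (\<rho> n x) = 0"
    by (simp add: is_kernel_def)
qed

lemma integrable_ball: "u \<in> L2 (ball z R) \<Longrightarrow> integrable (lebesgue_on (ball z R)) u"
  by (rule L2_finite_measure_integrable) simp

lemma smooth_mollify: "u \<in> L2 (ball z R) \<Longrightarrow> smooth (mollify n u)"
  unfolding mollify_def by (rule smooth_convolve[OF integrable_ball kernel_test])

lemma mollify_L2: "u \<in> L2 (ball z R) \<Longrightarrow> mollify n u \<in> L2 (ball z r)"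
  unfolding mollify_def by (rule convolve_kernel_L2(1)[OF \<rho>]) auto

lemma L2_small_ball: "u \<in> L2 (ball z R) \<Longrightarrow> u \<in> L2 (ball z r)"
  by (rule L2_mono(1)[of _ "ball z R"]) (use r in auto)

lemma mollify_lim: "u \<in> L2 (ball z R) \<Longrightarrow> L2_lim (ball z r) (\<lambda>n. mollify n u) u"
  unfolding mollify_def
  by (rule convolve_kernel_L2_lim[OF \<rho>]) (use r ball_shift in auto)

lemma partial_deriv_mollify:
  assumes "u \<in> L2 (ball z R)" "has_weak_deriv (ball z R) b u g" "b \<in> Basis" "a \<in> ball z r"
  shows "partial_deriv b (mollify n u) a = mollify n g a"
  unfolding mollify_def partial_deriv_convolve[OF integrable_ball[OF assms(1)] kernel_test assms(3)]
  by (rule convolve_weak_deriv[OF assms(2) kernel_smooth kernel_shift[OF assms(4) kernel_test kernel_outside]])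

lemma laplacian_mollify:
  assumes "u \<in> L2 (ball z R)" "has_distr_laplacian (ball z R) u f" "a \<in> ball z r"
  shows "laplacian (mollify n u) a = mollify n f a"
  unfolding mollify_def laplacian_convolve[OF integrable_ball[OF assms(1)] kernel_test]
  by (rule convolve_distr_laplacian[OF assms(2) kernel_smooth kernel_shift[OF assms(3) kernel_test kernel_outside]])

text \<open>This replaces the symmetry of second derivatives.\<close>

lemma partial_deriv_mollify_commute:
  assumes "u \<in> L2 (ball z R)" "has_weak_deriv (ball z R) b u g" "g \<in> L2 (ball z R)" "b \<in> Basis" "c \<in> Basis" "a \<in> ball z r"
  shows "partial_deriv b (partial_deriv c (mollify n u)) a = partial_deriv c (partial_deriv b (mollify n u)) a"
proof -
  let ?k = "\<lambda>x. complex_of_real (\<rho> n x)"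
  note T = test_functions_partial_deriv[OF kernel_test assms(5), of n]
  have out: "x \<notin> cball 0 (R - r) \<Longrightarrow> partial_deriv c ?k x = 0" for x
    by (rule partial_deriv_outside[of "cball 0 (R - r)"]) (use kernel_outside in auto)
  have "partial_deriv b (partial_deriv c (mollify n u)) a = partial_deriv b (\<lambda>a. (-1) * convolve (ball z R) u (partial_deriv c ?k) a) a"
    unfolding mollify_def partial_deriv_convolve[OF integrable_ball[OF assms(1)] kernel_test assms(5)] by simp
  also have "\<dots> = convolve (ball z R) u (partial_deriv b (partial_deriv c ?k)) a"
    unfolding partial_deriv_cmult[OF smooth_convolve[OF integrable_ball[OF assms(1)] T]]
      partial_deriv_convolve[OF integrable_ball[OF assms(1)] T assms(4)] by simp
  also have "\<dots> = - convolve (ball z R) g (partial_deriv c ?k) a"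
    using convolve_weak_deriv[OF assms(2) smooth_partial_deriv[OF kernel_smooth assms(5)] kernel_shift[OF assms(6) T out]]
    by (metis minus_minus)
  also have "\<dots> = partial_deriv c (mollify n g) a"
    unfolding mollify_def partial_deriv_convolve[OF integrable_ball[OF assms(3)] kernel_test assms(5)] ..
  also have "\<dots> = partial_deriv c (partial_deriv b (mollify n u)) a"
    using partial_deriv_mollify[OF assms(1,2,4)] by (intro partial_deriv_local[OF _ assms(6)]) auto
  finally show ?thesis .
qed

text \<open>The derivative is put on the kernel; a partial derivative of the kernel is again an
  admissible test function for the weak equation with right-hand side 0.\<close>

lemma laplacian_partial_deriv_mollify:
  assumes "u \<in> L2 (ball z R)" "has_distr_laplacian (ball z R) u (\<lambda>x. 0)" "b \<in> Basis" "a \<in> ball z r"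
  shows "laplacian (partial_deriv b (mollify n u)) a = 0"
proof -
  let ?k = "\<lambda>x. complex_of_real (\<rho> n x)"
  note T = test_functions_partial_deriv[OF kernel_test assms(3), of n]
  note sm = smooth_convolve[OF integrable_ball[OF assms(1)] T]
  have out: "x \<notin> cball 0 (R - r) \<Longrightarrow> partial_deriv b ?k x = 0" for x
    by (rule partial_deriv_outside[of "cball 0 (R - r)"]) (use kernel_outside in auto)
  have "partial_deriv b (mollify n u) = (\<lambda>a. (-1) * convolve (ball z R) u (partial_deriv b ?k) a)"
    unfolding mollify_def partial_deriv_convolve[OF integrable_ball[OF assms(1)] kernel_test assms(3)] by simp
  then have "laplacian (partial_deriv b (mollify n u)) a = - laplacian (convolve (ball z R) u (partial_deriv b ?k)) a"
    using laplacian_mult[OF smooth_const[of "-1"] sm, of a] by (simp add: laplacian_const partial_deriv_const)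
  also have "\<dots> = - convolve (ball z R) (\<lambda>x. 0) (partial_deriv b ?k) a"
    unfolding laplacian_convolve[OF integrable_ball[OF assms(1)] T]
    using convolve_distr_laplacian[OF assms(2) smooth_partial_deriv[OF kernel_smooth assms(3)] kernel_shift[OF assms(4) T out]] by simp
  finally show ?thesis by (simp add: convolve_def)
qed

end

lemma ball_mollification_exists:
  assumes "0 < r" "r < R"
  obtains \<rho> where "ball_mollification r R (\<rho> :: nat \<Rightarrow> 'a::euclidean_space \<Rightarrow> real)"
proof -
  obtain \<rho> :: "nat \<Rightarrow> 'a \<Rightarrow> real" where "\<And>n. is_kernel ((R - r) / real (Suc n)) (\<rho> n)"
    using kernel_sequence_exists[of "R - r"] assms by auto
  then show ?thesis using that assms by (auto simp: ball_mollification_def)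
qed

text \<open>The mollifications have zero classical gradient on the smaller ball and are constants
  there. A subsequence converges almost everywhere, and convergence at a single point already
  determines the limit of these constants.\<close>

lemma weak_gradient_0_imp_constant_ball:
  fixes u :: "'a::euclidean_space \<Rightarrow> complex"
  assumes u: "u \<in> L2 (ball z R)" and D: "\<And>b. b \<in> Basis \<Longrightarrow> has_weak_deriv (ball z R) b u (\<lambda>x. 0)"
    and r: "0 < r" "r < R"
  shows "\<exists>c. AE x in lebesgue_on (ball z r). u x = c"
proof -
  obtain \<rho> :: "nat \<Rightarrow> 'a \<Rightarrow> real" where "ball_mollification r R \<rho>" using ball_mollification_exists[OF r] by blast
  then interpret ball_mollification z r R \<rho> .
  have "\<exists>c. \<forall>x\<in>ball z r. mollify n u x = c" for n
  proof (rule has_derivative_zero_constant[OF convex_ball])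
    fix x assume x: "x \<in> ball z r"
    have "partial_deriv b (mollify n u) x = 0" if "b \<in> Basis" for b
      using partial_deriv_mollify[OF u D[OF that] that x] by (simp add: mollify_def convolve_def)
    then have "(mollify n u has_derivative (\<lambda>h. 0)) (at x)"
      using smooth_has_derivative[OF smooth_mollify[OF u], of n x] by simp
    then show "(mollify n u has_derivative (\<lambda>h. 0)) (at x within ball z r)"
      using has_derivative_at_withinI by blast
  qed
  then obtain c where c: "\<And>n x. x \<in> ball z r \<Longrightarrow> mollify n u x = c n" by metis
  obtain h where h: "strict_mono h" "AE x in lebesgue_on (ball z r). (\<lambda>n. mollify (h n) u x) \<longlonglongrightarrow> u x"
    using L2_lim_AE_subseq[OF mollify_lim[OF u] mollify_L2[OF u] L2_small_ball[OF u]] by blast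
  have h2: "AE x in lebesgue_on (ball z r). (\<lambda>n. c (h n)) \<longlonglongrightarrow> u x"
    using h(2) AE_space by eventually_elim (use c in simp)
  then have "negligible {x \<in> ball z r. \<not> (\<lambda>n. c (h n)) \<longlonglongrightarrow> u x}" by (simp add: AE_lebesgue_on_iff)
  moreover have "\<not> negligible (ball z r)" using open_not_negligible[of "ball z r"] r by auto
  ultimately obtain x0 where "(\<lambda>n. c (h n)) \<longlonglongrightarrow> u x0"
    by (metis (mono_tags, lifting) mem_Collect_eq negligible_subset subsetI)
  with h2 have "AE x in lebesgue_on (ball z r). u x = u x0"
    by (auto elim!: eventually_mono intro: LIMSEQ_unique)
  then show ?thesis by blast
qed

text \<open>A unique continuation argument: assign to each point the member of \<open>Q\<close> that
  represents \<open>u\<close> near it. Overlapping balls and \<open>uniq\<close> make the assignment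
  locally constant, hence constant on a connected set. It serves for affine maps and for
  constants.\<close>

lemma AE_local_patch:
  fixes u :: "'a::euclidean_space \<Rightarrow> 'c"
  assumes \<Omega>: "open \<Omega>" "connected \<Omega>" "\<Omega> \<noteq> {}"
    and uniq: "\<And>q q' S. q \<in> Q \<Longrightarrow> q' \<in> Q \<Longrightarrow> open S \<Longrightarrow> S \<noteq> {} \<Longrightarrow> AE x in lebesgue_on S. q x = q' x \<Longrightarrow> q = q'"
    and loc: "\<And>z. z \<in> \<Omega> \<Longrightarrow> \<exists>q\<in>Q. \<exists>r>0. AE x in lebesgue_on (ball z r). u x = q x"
  shows "\<exists>q\<in>Q. AE x in lebesgue_on \<Omega>. u x = q x"
proof -
  obtain q r where q: "\<And>z. z \<in> \<Omega> \<Longrightarrow> q z \<in> Q" "\<And>z. z \<in> \<Omega> \<Longrightarrow> r z > 0"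
    "\<And>z. z \<in> \<Omega> \<Longrightarrow> AE x in lebesgue_on (ball z (r z)). u x = q z x"
    using loc by metis
  have "q constant_on \<Omega>"
  proof (rule locally_constant_imp_constant[OF \<Omega>(2)])
    fix a assume a: "a \<in> \<Omega>"
    have "q x = q a" if x: "x \<in> \<Omega> \<inter> ball a (r a)" for x
    proof (rule uniq)
      let ?S = "ball a (r a) \<inter> ball x (r x)"
      show "open ?S" by auto
      show "?S \<noteq> {}" using x q(2)[of x] by force
      have "AE y in lebesgue_on ?S. u y = q a y" "AE y in lebesgue_on ?S. u y = q x y"
        using AE_lebesgue_on_mono[OF q(3)[OF a], of ?S] AE_lebesgue_on_mono[OF q(3)[of x], of ?S] x by auto
      then show "AE y in lebesgue_on ?S. q x y = q a y" by eventually_elim simp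
    qed (use q(1) a x in auto)
    moreover have "openin (top_of_set \<Omega>) (\<Omega> \<inter> ball a (r a))" "a \<in> \<Omega> \<inter> ball a (r a)"
      using a q(2) by (auto simp: openin_open_Int)
    ultimately show "\<exists>T. openin (top_of_set \<Omega>) T \<and> a \<in> T \<and> (\<forall>x\<in>T. q x = q a)"
      by blast
  qed
  then obtain q0 where q0: "\<And>z. z \<in> \<Omega> \<Longrightarrow> q z = q0" by (auto simp: constant_on_def)
  have "AE x in lebesgue_on \<Omega>. u x = q0 x"
    by (rule AE_lebesgue_on_local[OF \<Omega>(1)]) (use q q0 in metis)
  then show ?thesis using q0 q(1) \<Omega>(3) by blast
qed

section \<open>The identities of Pohozaev and Bochner\<close>

lemma orthonormal_family:
  fixes v :: "'i \<Rightarrow> 'a::euclidean_space"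
  assumes I: "finite I" and vv: "\<And>i j. i \<in> I \<Longrightarrow> j \<in> I \<Longrightarrow> v i \<bullet> v j = (if i = j then 1 else 0)"
  shows "card I \<le> DIM('a)"
    and "card I = DIM('a) \<Longrightarrow> (\<Sum>i\<in>I. (y \<bullet> v i) *\<^sub>R v i) = y"
proof -
  have inj: "inj_on v I"
  proof (rule inj_onI)
    fix i j assume "i \<in> I" "j \<in> I" "v i = v j"
    then show "i = j" using vv[of i j] vv[of j j] by (auto split: if_splits)
  qed
  have orth: "pairwise orthogonal (v ` I)"
    unfolding pairwise_def orthogonal_def using vv by (auto split: if_splits)
  have nz: "0 \<notin> v ` I" using vv by (metis image_iff inner_zero_left zero_neq_one)
  note ind = pairwise_orthogonal_independent[OF orth nz]
  have "card (v ` I) \<le> DIM('a)" using independent_bound[OF ind] by simp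
  then show "card I \<le> DIM('a)" by (simp add: card_image[OF inj])
  assume card: "card I = DIM('a)"
  have "span (v ` I) = UNIV"
    using card_eq_dim[of "v ` I" UNIV] ind I card by (simp add: card_image[OF inj] top.extremum_unique)
  then have "(\<Sum>w\<in>v ` I. (y \<bullet> w) *\<^sub>R w) = y"
    using vv I by (intro orthonormal_basis_expand[OF orth]) (auto simp: norm_eq_sqrt_inner)
  then show "(\<Sum>i\<in>I. (y \<bullet> v i) *\<^sub>R v i) = y" by (simp add: sum.reindex[OF inj])
qed

lemma orthonormal_rows_obtain:
  fixes A :: "'i \<Rightarrow> 'a::euclidean_space \<Rightarrow> complex"
  assumes real: "\<And>i b. i \<in> I \<Longrightarrow> b \<in> Basis \<Longrightarrow> cnj (A i b) = A i b"
    and gram: "\<And>i j. i \<in> I \<Longrightarrow> j \<in> I \<Longrightarrow> (\<Sum>b\<in>Basis. A i b * A j b) = (if i = j then 1 else 0)"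
  obtains v where "\<And>i b. i \<in> I \<Longrightarrow> b \<in> Basis \<Longrightarrow> A i b = of_real (v i \<bullet> b)"
    "\<And>i j. i \<in> I \<Longrightarrow> j \<in> I \<Longrightarrow> v i \<bullet> v j = (if i = j then 1 else 0)"
proof
  define v where "v i = (\<Sum>b\<in>Basis. Re (A i b) *\<^sub>R b)" for i
  have vb: "v i \<bullet> b = Re (A i b)" if "b \<in> Basis" for i b
    using that by (simp add: v_def inner_sum_left inner_Basis if_distrib cong: if_cong)
  show A: "A i b = of_real (v i \<bullet> b)" if "i \<in> I" "b \<in> Basis" for i b
    using real[OF that] vb[OF that(2)] by (simp add: complex_eq_iff)
  show "v i \<bullet> v j = (if i = j then 1 else 0)" if "i \<in> I" "j \<in> I" for i j
  proof -
    have "complex_of_real (v i \<bullet> v j) = (\<Sum>b\<in>Basis. A i b * A j b)"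
      by (subst euclidean_inner) (simp add: A that)
    also have "\<dots> = of_real (if i = j then 1 else 0)" using gram[OF that] by simp
    finally show ?thesis by (simp only: of_real_eq_iff)
  qed
qed

text \<open>A square matrix with orthonormal rows is orthogonal, so its columns are orthonormal too.
  The entries are complex but equal to their conjugates, which is why products without conjugation
  express the inner product.\<close>

lemma orthonormal_rows:
  fixes A :: "'i \<Rightarrow> 'a::euclidean_space \<Rightarrow> complex"
  assumes I: "finite I" and real: "\<And>i b. i \<in> I \<Longrightarrow> b \<in> Basis \<Longrightarrow> cnj (A i b) = A i b"
    and gram: "\<And>i j. i \<in> I \<Longrightarrow> j \<in> I \<Longrightarrow> (\<Sum>b\<in>Basis. A i b * A j b) = (if i = j then 1 else 0)"
  shows "card I \<le> DIM('a)"
    and "card I = DIM('a) \<Longrightarrow> b \<in> Basis \<Longrightarrow> c \<in> Basis \<Longrightarrow> (\<Sum>i\<in>I. A i b * A i c) = (if b = c then 1 else 0)"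
proof -
  obtain v where A: "\<And>i b. i \<in> I \<Longrightarrow> b \<in> Basis \<Longrightarrow> A i b = of_real (v i \<bullet> b)"
    and vv: "\<And>i j. i \<in> I \<Longrightarrow> j \<in> I \<Longrightarrow> v i \<bullet> v j = (if i = j then 1 else 0)"
    using orthonormal_rows_obtain[of I A, OF real gram] by blast
  show "card I \<le> DIM('a)" by (rule orthonormal_family(1)[OF I vv])
  show "(\<Sum>i\<in>I. A i b * A i c) = (if b = c then 1 else 0)" if eq: "card I = DIM('a)" and b: "b \<in> Basis" and c: "c \<in> Basis"
  proof -
    have "(\<Sum>i\<in>I. (b \<bullet> v i) *\<^sub>R v i) \<bullet> c = b \<bullet> c" by (simp add: orthonormal_family(2)[OF I vv eq])
    then have "(\<Sum>i\<in>I. (v i \<bullet> b) * (v i \<bullet> c)) = b \<bullet> c" by (simp add: inner_sum_left inner_sum_right inner_commute mult.commute)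
    then have "complex_of_real (\<Sum>i\<in>I. (v i \<bullet> b) * (v i \<bullet> c)) = of_real (b \<bullet> c)" by simp
    then show ?thesis using A b c by (simp add: inner_Basis)
  qed
qed

lemma has_weak_deriv_cnj:
  assumes "has_weak_deriv \<Omega> b u g" "b \<in> Basis"
  shows "has_weak_deriv \<Omega> b (\<lambda>x. cnj (u x)) (\<lambda>x. cnj (g x))"
  unfolding has_weak_deriv_def
proof
  fix \<phi> assume \<phi>: "\<phi> \<in> test_functions \<Omega>"
  have "(\<integral>x. u x * partial_deriv b (\<lambda>x. cnj (\<phi> x)) x \<partial>lebesgue_on \<Omega>) = - (\<integral>x. g x * cnj (\<phi> x) \<partial>lebesgue_on \<Omega>)"
    using assms(1) test_functions_cnj[OF \<phi>] by (simp add: has_weak_deriv_def)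
  then have "cnj (\<integral>x. u x * cnj (partial_deriv b \<phi> x) \<partial>lebesgue_on \<Omega>) = cnj (- (\<integral>x. g x * cnj (\<phi> x) \<partial>lebesgue_on \<Omega>))"
    by (simp only: partial_deriv_cnj[OF test_functions_smooth[OF \<phi>]])
  then show "(\<integral>x. cnj (u x) * partial_deriv b \<phi> x \<partial>lebesgue_on \<Omega>) = - (\<integral>x. cnj (g x) * \<phi> x \<partial>lebesgue_on \<Omega>)"
    using Bochner_Integration.integral_cnj[of "lebesgue_on \<Omega>" "\<lambda>x. u x * cnj (partial_deriv b \<phi> x)"]
      Bochner_Integration.integral_cnj[of "lebesgue_on \<Omega>" "\<lambda>x. g x * cnj (\<phi> x)"] by simp
qed

section \<open>Quadratic identities by mollification\<close>

context ball_mollification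
begin

text \<open>Two factors converge in L2 and the third is bounded; all quadratic identities below pass
  to the limit in this form.\<close>

lemma mollify_prod_lim:
  assumes "u \<in> L2 (ball z R)" "v \<in> L2 (ball z R)" "\<psi> \<in> test_functions UNIV"
  shows "(\<lambda>n. \<integral>x. mollify n u x * mollify n v x * \<psi> x \<partial>lebesgue_on (ball z r)) \<longlonglongrightarrow> (\<integral>x. u x * v x * \<psi> x \<partial>lebesgue_on (ball z r))"
proof -
  obtain C where C: "\<And>x. norm (\<psi> x) \<le> C" using test_functions_bounded[OF assms(3)] by blast
  note \<psi>m = smooth_measurable[OF test_functions_smooth[OF assms(3)], of "ball z r"]
  note L = L2_mult_bounded[OF _ \<psi>m C]
  have "(\<lambda>n. \<integral>x. mollify n u x * (\<psi> x * mollify n v x) \<partial>lebesgue_on (ball z r)) \<longlonglongrightarrow> (\<integral>x. u x * (\<psi> x * v x) \<partial>lebesgue_on (ball z r))"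
    by (rule L2_lim_integral[OF mollify_lim L2_lim_mult_bounded[OF mollify_lim _ _ \<psi>m C]])
      (intro assms mollify_L2 L2_small_ball L)+
  then show ?thesis by (simp add: mult_ac)
qed

lemma prod_test_integrable:
  assumes "u \<in> L2 (ball z r)" "v \<in> L2 (ball z r)" "\<psi> \<in> test_functions UNIV"
  shows "integrable (lebesgue_on (ball z r)) (\<lambda>x. u x * v x * \<psi> x)"
  using test_functions_bounded[OF assms(3)]
    integrable_mult_bounded[OF L2_prod_integrable(1)[OF assms(1,2)] smooth_measurable[OF test_functions_smooth[OF assms(3)]]]
  by metis

text \<open>The Leibniz rule holds classically for the mollifications. In the limit its terms are
  merely integrable, so it is recorded after pairing with \<psi>.\<close>

lemma distr_laplacian_product:
  assumes u: "u \<in> L2 (ball z R)" "has_distr_laplacian (ball z R) u f" "f \<in> L2 (ball z R)"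
    "\<And>b. b \<in> Basis \<Longrightarrow> has_weak_deriv (ball z R) b u (g b)" "\<And>b. b \<in> Basis \<Longrightarrow> g b \<in> L2 (ball z R)"
    and v: "v \<in> L2 (ball z R)" "has_distr_laplacian (ball z R) v h" "h \<in> L2 (ball z R)"
    "\<And>b. b \<in> Basis \<Longrightarrow> has_weak_deriv (ball z R) b v (k b)" "\<And>b. b \<in> Basis \<Longrightarrow> k b \<in> L2 (ball z R)"
    and \<psi>: "\<psi> \<in> test_functions (ball z r)"
  shows "(\<integral>x. u x * v x * laplacian \<psi> x \<partial>lebesgue_on (ball z r)) =
    (\<integral>x. u x * h x * \<psi> x \<partial>lebesgue_on (ball z r)) + (\<integral>x. f x * v x * \<psi> x \<partial>lebesgue_on (ball z r))
    + 2 * (\<Sum>b\<in>Basis. \<integral>x. g b x * k b x * \<psi> x \<partial>lebesgue_on (ball z r))"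
proof -
  let ?B = "lebesgue_on (ball z r)"
  have \<psi>U: "\<psi> \<in> test_functions UNIV" using test_functions_mono[OF subset_UNIV \<psi>] .
  note int = prod_test_integrable[OF mollify_L2 mollify_L2 \<psi>U]
  have eq: "(\<integral>x. mollify n u x * mollify n v x * laplacian \<psi> x \<partial>?B) =
     (\<integral>x. mollify n u x * mollify n h x * \<psi> x \<partial>?B) + (\<integral>x. mollify n f x * mollify n v x * \<psi> x \<partial>?B)
    + 2 * (\<Sum>b\<in>Basis. \<integral>x. mollify n (g b) x * mollify n (k b) x * \<psi> x \<partial>?B)" for n
  proof -
    note sm = smooth_mollify[OF u(1), of n] smooth_mollify[OF v(1), of n]
    have "(\<integral>x. mollify n u x * mollify n v x * laplacian \<psi> x \<partial>?B) = (\<integral>x. laplacian (\<lambda>x. mollify n u x * mollify n v x) x * \<psi> x \<partial>?B)"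
      by (rule integration_by_parts_laplacian[OF smooth_mult[OF sm] \<psi>]) simp
    also have "\<dots> = (\<integral>x. mollify n u x * mollify n h x * \<psi> x + mollify n f x * mollify n v x * \<psi> x
         + 2 * (\<Sum>b\<in>Basis. mollify n (g b) x * mollify n (k b) x * \<psi> x) \<partial>?B)"
    proof (rule Bochner_Integration.integral_cong[OF refl])
      fix x assume "x \<in> space ?B"
      then have x: "x \<in> ball z r" by simp
      have "laplacian (\<lambda>x. mollify n u x * mollify n v x) x = mollify n u x * mollify n h x + mollify n f x * mollify n v x
         + 2 * (\<Sum>b\<in>Basis. mollify n (g b) x * mollify n (k b) x)"
        unfolding laplacian_mult[OF sm] laplacian_mollify[OF u(1,2) x] laplacian_mollify[OF v(1,2) x]
        using partial_deriv_mollify[OF u(1) u(4) _ x] partial_deriv_mollify[OF v(1) v(4) _ x] by simp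
      then show "laplacian (\<lambda>x. mollify n u x * mollify n v x) x * \<psi> x = mollify n u x * mollify n h x * \<psi> x
         + mollify n f x * mollify n v x * \<psi> x + 2 * (\<Sum>b\<in>Basis. mollify n (g b) x * mollify n (k b) x * \<psi> x)"
        by (simp add: distrib_right sum_distrib_right mult.assoc)
    qed
    also have "\<dots> = (\<integral>x. mollify n u x * mollify n h x * \<psi> x \<partial>?B) + (\<integral>x. mollify n f x * mollify n v x * \<psi> x \<partial>?B)
      + 2 * (\<Sum>b\<in>Basis. \<integral>x. mollify n (g b) x * mollify n (k b) x * \<psi> x \<partial>?B)"
      using int u v by simp
    finally show ?thesis .
  qed
  have "(\<lambda>n. \<integral>x. mollify n u x * mollify n v x * laplacian \<psi> x \<partial>?B) \<longlonglongrightarrow> (\<integral>x. u x * v x * laplacian \<psi> x \<partial>?B)"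
    by (rule mollify_prod_lim[OF u(1) v(1) test_functions_laplacian[OF \<psi>U]])
  moreover have "(\<lambda>n. \<integral>x. mollify n u x * mollify n v x * laplacian \<psi> x \<partial>?B) \<longlonglongrightarrow>
     (\<integral>x. u x * h x * \<psi> x \<partial>?B) + (\<integral>x. f x * v x * \<psi> x \<partial>?B) + 2 * (\<Sum>b\<in>Basis. \<integral>x. g b x * k b x * \<psi> x \<partial>?B)"
    unfolding eq using u v by (intro tendsto_intros mollify_prod_lim \<psi>U)
  ultimately show ?thesis by (rule LIMSEQ_unique)
qed

text \<open>The divergence identity \<open>div (\<partial>\<^sub>l u \<nabla> u) - \<partial>\<^sub>l \<bar>\<nabla> u\<bar>\<^sup>2 / 2 = \<partial>\<^sub>l u \<Delta> u\<close> in weak form.\<close>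

lemma weak_Pohozaev_identity:
  assumes u: "u \<in> L2 (ball z R)" "has_distr_laplacian (ball z R) u f" "f \<in> L2 (ball z R)"
    "\<And>b. b \<in> Basis \<Longrightarrow> has_weak_deriv (ball z R) b u (g b)" "\<And>b. b \<in> Basis \<Longrightarrow> g b \<in> L2 (ball z R)"
    and \<psi>: "\<psi> \<in> test_functions (ball z r)" and l: "l \<in> Basis"
  shows "(\<integral>x. g l x * f x * \<psi> x \<partial>lebesgue_on (ball z r)) =
    (\<Sum>k\<in>Basis. (\<integral>x. g k x * g k x * partial_deriv l \<psi> x \<partial>lebesgue_on (ball z r)) / 2
      - (\<integral>x. g k x * g l x * partial_deriv k \<psi> x \<partial>lebesgue_on (ball z r)))"
proof -
  let ?B = "lebesgue_on (ball z r)"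
  have \<psi>U: "\<psi> \<in> test_functions UNIV" using test_functions_mono[OF subset_UNIV \<psi>] .
  note s\<psi> = test_functions_smooth[OF \<psi>]
  have B: "ball z r \<in> sets lebesgue" by simp
  have eq: "(\<integral>x. mollify n (g l) x * mollify n f x * \<psi> x \<partial>?B) =
    (\<Sum>k\<in>Basis. (\<integral>x. mollify n (g k) x * mollify n (g k) x * partial_deriv l \<psi> x \<partial>?B) / 2
      - (\<integral>x. mollify n (g k) x * mollify n (g l) x * partial_deriv k \<psi> x \<partial>?B))" for n
  proof -
    define w where "w = mollify n u"
    have sw: "smooth w" unfolding w_def by (rule smooth_mollify[OF u(1)])
    have dw: "partial_deriv b w x = mollify n (g b) x" if "b \<in> Basis" "x \<in> ball z r" for b x
      unfolding w_def by (rule partial_deriv_mollify[OF u(1) u(4)[OF that(1)] that])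
    have lw: "laplacian w x = mollify n f x" if "x \<in> ball z r" for x
      unfolding w_def by (rule laplacian_mollify[OF u(1,2) that])
    have div: "(\<integral>x. partial_deriv l w x * partial_deriv k (partial_deriv k w) x * \<psi> x \<partial>?B)
       = (\<integral>x. partial_deriv k w x * partial_deriv k w x * partial_deriv l \<psi> x \<partial>?B) / 2
         - (\<integral>x. partial_deriv k w x * partial_deriv l w x * partial_deriv k \<psi> x \<partial>?B)" if k: "k \<in> Basis" for k
    proof -
      note sl = smooth_partial_deriv[OF sw l] and sk = smooth_partial_deriv[OF sw k]
      have T: "(\<lambda>x. partial_deriv l w x * \<psi> x) \<in> test_functions (ball z r)" by (rule test_functions_mult[OF \<psi> sl])
      have i1: "integrable ?B (\<lambda>x. partial_deriv k w x * partial_deriv l w x * partial_deriv k \<psi> x)"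
        by (rule smooth_test_integrable[OF test_functions_partial_deriv[OF \<psi> k] smooth_mult[OF sk sl] B])
      have i2: "integrable ?B (\<lambda>x. partial_deriv k w x * partial_deriv k (partial_deriv l w) x * \<psi> x)"
        by (rule smooth_test_integrable[OF \<psi> smooth_mult[OF sk smooth_partial_deriv[OF sl k]] B])
      have "(\<integral>x. partial_deriv l w x * partial_deriv k (partial_deriv k w) x * \<psi> x \<partial>?B)
          = (\<integral>x. partial_deriv k (partial_deriv k w) x * (partial_deriv l w x * \<psi> x) \<partial>?B)" by (simp add: mult_ac)
      also have "\<dots> = - (\<integral>x. partial_deriv k w x * partial_deriv k (\<lambda>x. partial_deriv l w x * \<psi> x) x \<partial>?B)"
        using integration_by_parts[OF sk T k B] by simp
      also have "(\<integral>x. partial_deriv k w x * partial_deriv k (\<lambda>x. partial_deriv l w x * \<psi> x) x \<partial>?B)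
          = (\<integral>x. partial_deriv k w x * partial_deriv l w x * partial_deriv k \<psi> x + partial_deriv k w x * partial_deriv k (partial_deriv l w) x * \<psi> x \<partial>?B)"
        unfolding partial_deriv_mult[OF sl s\<psi>] by (simp add: algebra_simps)
      also have "\<dots> = (\<integral>x. partial_deriv k w x * partial_deriv l w x * partial_deriv k \<psi> x \<partial>?B)
          + (\<integral>x. partial_deriv k w x * partial_deriv k (partial_deriv l w) x * \<psi> x \<partial>?B)"
        by (rule Bochner_Integration.integral_add[OF i1 i2])
      \<comment> \<open>Exchanging the two derivatives turns the integrand into half the
        \<open>l\<close>-derivative of a square times \<psi>, which can be integrated by parts once
        more.\<close>
      also have "(\<integral>x. partial_deriv k w x * partial_deriv k (partial_deriv l w) x * \<psi> x \<partial>?B)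
          = (\<integral>x. partial_deriv l (\<lambda>x. partial_deriv k w x * partial_deriv k w x) x * \<psi> x / 2 \<partial>?B)"
      proof (rule Bochner_Integration.integral_cong[OF refl])
        fix x assume "x \<in> space ?B"
        then have "partial_deriv k (partial_deriv l w) x = partial_deriv l (partial_deriv k w) x"
          unfolding w_def using partial_deriv_mollify_commute[OF u(1) u(4)[OF k] u(5)[OF k] k l] by simp
        then show "partial_deriv k w x * partial_deriv k (partial_deriv l w) x * \<psi> x = partial_deriv l (\<lambda>x. partial_deriv k w x * partial_deriv k w x) x * \<psi> x / 2"
          by (simp add: partial_deriv_mult[OF sk sk])
      qed
      also have "\<dots> = - (\<integral>x. partial_deriv k w x * partial_deriv k w x * partial_deriv l \<psi> x \<partial>?B) / 2"
        using integration_by_parts[OF smooth_mult[OF sk sk] \<psi> l B] by simp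
      finally show ?thesis by simp
    qed
    have "(\<integral>x. mollify n (g l) x * mollify n f x * \<psi> x \<partial>?B) = (\<integral>x. (\<Sum>k\<in>Basis. partial_deriv l w x * partial_deriv k (partial_deriv k w) x * \<psi> x) \<partial>?B)"
    proof (rule Bochner_Integration.integral_cong[OF refl])
      fix x assume "x \<in> space ?B"
      then have x: "x \<in> ball z r" by simp
      show "mollify n (g l) x * mollify n f x * \<psi> x = (\<Sum>k\<in>Basis. partial_deriv l w x * partial_deriv k (partial_deriv k w) x * \<psi> x)"
        using dw[OF l x] lw[OF x] unfolding laplacian_def by (simp flip: sum_distrib_left sum_distrib_right)
    qed
    also have "\<dots> = (\<Sum>k\<in>Basis. \<integral>x. partial_deriv l w x * partial_deriv k (partial_deriv k w) x * \<psi> x \<partial>?B)"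
      by (rule Bochner_Integration.integral_sum)
        (intro smooth_test_integrable[OF \<psi> _ B] smooth_mult smooth_partial_deriv sw l)
    also have "\<dots> = (\<Sum>k\<in>Basis. (\<integral>x. partial_deriv k w x * partial_deriv k w x * partial_deriv l \<psi> x \<partial>?B) / 2
         - (\<integral>x. partial_deriv k w x * partial_deriv l w x * partial_deriv k \<psi> x \<partial>?B))"
      by (intro sum.cong refl div)
    also have "\<dots> = (\<Sum>k\<in>Basis. (\<integral>x. mollify n (g k) x * mollify n (g k) x * partial_deriv l \<psi> x \<partial>?B) / 2
      - (\<integral>x. mollify n (g k) x * mollify n (g l) x * partial_deriv k \<psi> x \<partial>?B))"
      by (intro sum.cong refl arg_cong2[where f="(-)"] arg_cong2[where f="(/)"] Bochner_Integration.integral_cong)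
        (simp_all add: dw l)
    finally show ?thesis .
  qed
  have "(\<lambda>n. \<integral>x. mollify n (g l) x * mollify n f x * \<psi> x \<partial>?B) \<longlonglongrightarrow> (\<integral>x. g l x * f x * \<psi> x \<partial>?B)"
    by (rule mollify_prod_lim[OF u(5)[OF l] u(3) \<psi>U])
  moreover have "(\<lambda>n. \<integral>x. mollify n (g l) x * mollify n f x * \<psi> x \<partial>?B) \<longlonglongrightarrow>
     (\<Sum>k\<in>Basis. (\<integral>x. g k x * g k x * partial_deriv l \<psi> x \<partial>?B) / 2 - (\<integral>x. g k x * g l x * partial_deriv k \<psi> x \<partial>?B))"
    unfolding eq using u l by (intro tendsto_intros mollify_prod_lim test_functions_partial_deriv \<psi>U) auto
  ultimately show ?thesis by (rule LIMSEQ_unique)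
qed

end

lemma smooth_L2:
  assumes "smooth f" "bounded \<Omega>" "\<Omega> \<in> sets lebesgue"
  shows "f \<in> L2 \<Omega>"
proof -
  have "compact (f ` closure \<Omega>)"
    by (intro compact_continuous_image smooth_continuous assms) (use assms in auto)
  then obtain C where C: "\<forall>y\<in>f ` closure \<Omega>. norm y \<le> C"
    using compact_imp_bounded bounded_iff by metis
  show ?thesis
  proof (rule L2_norm_bounded(1)[OF _ smooth_measurable[OF assms(1)]])
    show "\<Omega> \<in> lmeasurable" using assms by (intro bounded_set_imp_lmeasurable)
    show "norm (f x) \<le> C" if "x \<in> \<Omega>" for x using C that closure_subset by blast
  qed
qed

lemma has_weak_deriv_diff:
  assumes "u \<in> L2 \<Omega>" "v \<in> L2 \<Omega>" "g \<in> L2 \<Omega>" "h \<in> L2 \<Omega>" "has_weak_deriv \<Omega> b u g" "has_weak_deriv \<Omega> b v h"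
    "b \<in> Basis" "\<Omega> \<in> sets lebesgue"
  shows "has_weak_deriv \<Omega> b (\<lambda>x. u x - v x) (\<lambda>x. g x - h x)"
  unfolding has_weak_deriv_def
proof
  fix \<phi> assume \<phi>: "\<phi> \<in> test_functions \<Omega>"
  note L = test_functions_L2[OF \<phi> assms(8)] test_functions_L2[OF test_functions_partial_deriv[OF \<phi> assms(7)] assms(8)]
  note I = L2_prod_integrable(1)[OF assms(1) L(2)] L2_prod_integrable(1)[OF assms(2) L(2)]
    L2_prod_integrable(1)[OF assms(3) L(1)] L2_prod_integrable(1)[OF assms(4) L(1)]
  show "(\<integral>x. (u x - v x) * partial_deriv b \<phi> x \<partial>lebesgue_on \<Omega>) = - (\<integral>x. (g x - h x) * \<phi> x \<partial>lebesgue_on \<Omega>)"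
    using assms(5,6) \<phi> I by (simp add: has_weak_deriv_def left_diff_distrib)
qed

lemma laplacian_cnj: "smooth f \<Longrightarrow> laplacian (\<lambda>x. cnj (f x)) x = cnj (laplacian f x)"
  unfolding laplacian_def by (simp add: partial_deriv_cnj smooth_partial_deriv)

lemma AE_ball_obtain:
  assumes "AE x in lebesgue_on (ball z r). P x" "r > 0"
  obtains x where "x \<in> ball z r" "P x"
proof -
  have "negligible {x \<in> ball z r. \<not> P x}" using assms(1) by (simp add: AE_lebesgue_on_iff)
  moreover have "\<not> negligible (ball z r)" using open_not_negligible[of "ball z r"] assms(2) by auto
  ultimately show ?thesis using that by (metis (mono_tags, lifting) mem_Collect_eq negligible_subset subsetI)
qed

context ball_mollification
begin

lemma mollify_cnj: "mollify n (\<lambda>x. cnj (u x)) a = cnj (mollify n u a)"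
  unfolding mollify_def convolve_def
  using Bochner_Integration.integral_cnj[of "lebesgue_on (ball z R)" "\<lambda>x. u x * complex_of_real (\<rho> n (x - a))"] by simp

text \<open>Integrating Bochner's identity \<open>\<Delta> \<bar>\<nabla>u\<bar>\<^sup>2 = 2 \<bar>D\<^sup>2u\<bar>\<^sup>2\<close> for the harmonic mollifications against a
  cutoff: since \<open>\<bar>\<nabla>u\<bar>\<close> is constant in the limit, the second derivatives tend to zero.\<close>

lemma harmonic_unit_gradient_imp_Hessian_0:
  assumes u: "u \<in> L2 (ball z R)" "has_distr_laplacian (ball z R) u (\<lambda>x. 0)"
    "\<And>b. b \<in> Basis \<Longrightarrow> has_weak_deriv (ball z R) b u (g b)" "\<And>b. b \<in> Basis \<Longrightarrow> g b \<in> L2 (ball z R)"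
    and unit: "AE x in lebesgue_on (ball z r). (\<Sum>b\<in>Basis. g b x * cnj (g b x)) = 1"
    and j: "j \<in> Basis" and k: "k \<in> Basis"
  shows "has_weak_deriv (ball z (r / 4)) k (g j) (\<lambda>x. 0)"
proof -
  let ?B = "lebesgue_on (ball z r)" and ?S = "ball z (r / 4)"
  have B: "ball z r \<in> sets lebesgue" by simp
  \<comment> \<open>The cutoff is 1 on radius \<open>r / 4\<close>, where the Hessian will be
    controlled, and vanishes outside radius \<open>r / 2\<close>, which makes it a test function on
    the ball of radius \<open>r\<close>.\<close>
  obtain c where c: "(\<lambda>x. complex_of_real (c x)) \<in> test_functions UNIV" "\<And>x. 0 \<le> c x"
    "\<And>x. x \<in> ball z (r / 2 / 2) \<Longrightarrow> c x = 1" "\<And>x. x \<notin> cball z (r / 2) \<Longrightarrow> c x = 0"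
    using cutoff_exists[of "r / 2" z] r by (metis half_gt_zero)
  define \<psi> where "\<psi> x = complex_of_real (c x)" for x
  have \<psi>U: "\<psi> \<in> test_functions UNIV" using c(1) by (simp add: \<psi>_def[abs_def])
  have \<psi>: "\<psi> \<in> test_functions (ball z r)"
  proof (rule test_functionsI[OF test_functions_smooth[OF \<psi>U]])
    show "compact (cball z (r / 2))" "cball z (r / 2) \<subseteq> ball z r" using r by auto
  qed (use c(4) in \<open>simp add: \<psi>_def\<close>)
  define p where "p n i = partial_deriv i (mollify n u)" for n i
  have sp: "smooth (p n i)" if "i \<in> Basis" for n i
    unfolding p_def by (rule smooth_partial_deriv[OF smooth_mollify[OF u(1)] that])
  have pB: "p n i x = mollify n (g i) x" if "i \<in> Basis" "x \<in> ball z r" for n i x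
    unfolding p_def by (rule partial_deriv_mollify[OF u(1) u(3)[OF that(1)] that])
  define E where "E n i m = (\<integral>x. (norm (partial_deriv m (p n i) x))\<^sup>2 * c x \<partial>?B)" for n i m
  have E0: "E n i m \<ge> 0" for n i m
    unfolding E_def by (rule Bochner_Integration.integral_nonneg) (use c(2) in simp)
  have intC: "integrable ?B (\<lambda>x. complex_of_real ((norm (partial_deriv m (p n i) x))\<^sup>2 * c x))" if "i \<in> Basis" "m \<in> Basis" for n i m
  proof -
    have "integrable ?B (\<lambda>x. partial_deriv m (p n i) x * cnj (partial_deriv m (p n i) x) * \<psi> x)"
      by (rule smooth_test_integrable[OF \<psi> _ B])
        (intro smooth_mult smooth_cnj smooth_partial_deriv sp that)
    then show ?thesis by (simp only: \<psi>_def of_real_mult complex_norm_square)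
  qed
  have intE: "integrable ?B (\<lambda>x. (norm (partial_deriv m (p n i) x))\<^sup>2 * c x)" if "i \<in> Basis" "m \<in> Basis" for n i m
    using integrable_Re[OF intC[OF that]] by simp
  have Bochner: "(\<integral>x. mollify n (g i) x * mollify n (\<lambda>x. cnj (g i x)) x * laplacian \<psi> x \<partial>?B) = complex_of_real (2 * (\<Sum>m\<in>Basis. E n i m))"
    if i: "i \<in> Basis" for n i
  proof -
    have "(\<integral>x. mollify n (g i) x * mollify n (\<lambda>x. cnj (g i x)) x * laplacian \<psi> x \<partial>?B)
       = (\<integral>x. p n i x * cnj (p n i x) * laplacian \<psi> x \<partial>?B)"
      by (rule Bochner_Integration.integral_cong) (simp_all add: pB i mollify_cnj)
    also have "\<dots> = (\<integral>x. laplacian (\<lambda>x. p n i x * cnj (p n i x)) x * \<psi> x \<partial>?B)"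
      by (rule integration_by_parts_laplacian[OF smooth_mult[OF sp[OF i] smooth_cnj[OF sp[OF i]]] \<psi> B])
    also have "\<dots> = (\<integral>x. (\<Sum>m\<in>Basis. complex_of_real (2 * ((norm (partial_deriv m (p n i) x))\<^sup>2 * c x))) \<partial>?B)"
    proof (rule Bochner_Integration.integral_cong[OF refl])
      fix x assume "x \<in> space ?B"
      then have x: "x \<in> ball z r" by simp
      have "laplacian (p n i) x = 0" unfolding p_def by (rule laplacian_partial_deriv_mollify[OF u(1,2) i x])
      then have "laplacian (\<lambda>x. p n i x * cnj (p n i x)) x = 2 * (\<Sum>m\<in>Basis. partial_deriv m (p n i) x * cnj (partial_deriv m (p n i) x))"
        using laplacian_mult[OF sp[OF i] smooth_cnj[OF sp[OF i]], of n n x] by (simp add: laplacian_cnj sp i partial_deriv_cnj)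
      then show "laplacian (\<lambda>x. p n i x * cnj (p n i x)) x * \<psi> x = (\<Sum>m\<in>Basis. complex_of_real (2 * ((norm (partial_deriv m (p n i) x))\<^sup>2 * c x)))"
        by (simp add: \<psi>_def sum_distrib_left sum_distrib_right mult.assoc flip: complex_norm_square)
    qed
    also have "\<dots> = (\<Sum>m\<in>Basis. \<integral>x. complex_of_real (2 * ((norm (partial_deriv m (p n i) x))\<^sup>2 * c x)) \<partial>?B)"
      by (rule Bochner_Integration.integral_sum) (use intC[OF i] in simp)
    also have "\<dots> = (\<Sum>m\<in>Basis. complex_of_real (2 * E n i m))"
      by (intro sum.cong refl) (simp only: integral_complex_of_real E_def integral_mult_right_zero)
    finally show ?thesis by (simp add: sum_distrib_left)
  qed
  have "(\<lambda>n. \<Sum>i\<in>Basis. \<integral>x. mollify n (g i) x * mollify n (\<lambda>x. cnj (g i x)) x * laplacian \<psi> x \<partial>?B)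
     \<longlonglongrightarrow> (\<Sum>i\<in>Basis. \<integral>x. g i x * cnj (g i x) * laplacian \<psi> x \<partial>?B)"
    by (intro tendsto_sum mollify_prod_lim u(4) L2_cnj test_functions_laplacian[OF \<psi>U])
  also have "(\<Sum>i\<in>Basis. \<integral>x. g i x * cnj (g i x) * laplacian \<psi> x \<partial>?B) = (\<integral>x. (\<Sum>i\<in>Basis. g i x * cnj (g i x) * laplacian \<psi> x) \<partial>?B)"
    by (rule Bochner_Integration.integral_sum[symmetric])
      (intro prod_test_integrable L2_small_ball u(4) L2_cnj test_functions_laplacian[OF \<psi>U])
  also have "\<dots> = (\<integral>x. (\<Sum>i\<in>Basis. g i x * cnj (g i x)) * laplacian \<psi> x \<partial>?B)"
    by (simp add: sum_distrib_right)
  \<comment> \<open>The unit gradient replaces the quadratic factor by 1, and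
    \<open>laplacian \<psi>\<close> has integral 0. So the total energy of the second derivatives
    tends to 0.\<close>
  also have "\<dots> = (\<integral>x. 1 * laplacian \<psi> x \<partial>?B)"
    by (rule integral_mult_cong_AE[OF B unit smooth_laplacian[OF test_functions_smooth[OF \<psi>]]])
  also have "\<dots> = 0"
    using integration_by_parts_laplacian[OF smooth_const[of 1] \<psi> B] by (simp add: laplacian_const)
  also have "(\<lambda>n. \<Sum>i\<in>Basis. \<integral>x. mollify n (g i) x * mollify n (\<lambda>x. cnj (g i x)) x * laplacian \<psi> x \<partial>?B)
     = (\<lambda>n. complex_of_real (\<Sum>i\<in>Basis. 2 * (\<Sum>m\<in>Basis. E n i m)))"
    using Bochner by (simp add: fun_eq_iff)
  finally have "(\<lambda>n. Re (complex_of_real (\<Sum>i\<in>Basis. 2 * (\<Sum>m\<in>Basis. E n i m)))) \<longlonglongrightarrow> Re 0"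
    by (rule tendsto_Re)
  then have tot: "(\<lambda>n. \<Sum>i\<in>Basis. 2 * (\<Sum>m\<in>Basis. E n i m)) \<longlonglongrightarrow> 0" by (simp only: Re_complex_of_real zero_complex.sel)
  have Elim: "(\<lambda>n. E n j k) \<longlonglongrightarrow> 0"
  proof (rule tendsto_sandwich[OF _ _ tendsto_const tot])
    have "E n j k \<le> (\<Sum>i\<in>Basis. 2 * (\<Sum>m\<in>Basis. E n i m))" for n
    proof -
      have "E n j k \<le> (\<Sum>m\<in>Basis. E n j m)" using k E0 by (intro member_le_sum) auto
      also have "\<dots> \<le> 2 * (\<Sum>m\<in>Basis. E n j m)" using E0 by (simp add: sum_nonneg)
      also have "\<dots> \<le> (\<Sum>i\<in>Basis. 2 * (\<Sum>m\<in>Basis. E n i m))"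
        using j E0 by (intro member_le_sum[of j Basis "\<lambda>i. 2 * (\<Sum>m\<in>Basis. E n i m)"]) (auto intro: sum_nonneg)
      finally show ?thesis .
    qed
    then show "\<forall>\<^sub>F n in sequentially. E n j k \<le> (\<Sum>i\<in>Basis. 2 * (\<Sum>m\<in>Basis. E n i m))" by simp
  qed (use E0 in simp)
  have S: "?S \<in> sets lebesgue" "?S \<subseteq> ball z r" using r by auto
  show ?thesis
    unfolding has_weak_deriv_def
  proof
    fix \<eta> assume \<eta>: "\<eta> \<in> test_functions ?S"
    note \<eta>L = test_functions_L2[OF \<eta> S(1)] test_functions_L2[OF test_functions_partial_deriv[OF \<eta> k] S(1)]
    have "(\<lambda>n. \<integral>x. mollify n (g j) x * partial_deriv k \<eta> x \<partial>lebesgue_on ?S) \<longlonglongrightarrow> (\<integral>x. g j x * partial_deriv k \<eta> x \<partial>lebesgue_on ?S)"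
    proof (rule L2_lim_integral_right[OF _ _ _ \<eta>L(2)])
      show "L2_lim ?S (\<lambda>n. mollify n (g j)) (g j)"
        by (rule L2_lim_mono[OF mollify_lim[OF u(4)[OF j]] mollify_L2[OF u(4)[OF j]] L2_small_ball[OF u(4)[OF j]] S(2,1) B])
      show "mollify n (g j) \<in> L2 ?S" for n
        by (rule L2_mono(1)[OF S(2,1) B mollify_L2[OF u(4)[OF j]]])
      show "g j \<in> L2 ?S" by (rule L2_mono(1)[OF S(2,1) B L2_small_ball[OF u(4)[OF j]]])
    qed
    \<comment> \<open>Integrating by parts back onto the mollification bounds the pairing by the
      square root of \<open>E n j k\<close> times the norm of \<eta>; the cutoff is 1 on
      \<open>?S\<close>, so \<open>E\<close> controls the second derivative there.\<close>
    moreover have "(\<lambda>n. \<integral>x. mollify n (g j) x * partial_deriv k \<eta> x \<partial>lebesgue_on ?S) \<longlonglongrightarrow> 0"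
    proof (rule tendsto_norm_zero_cancel, rule tendsto_sandwich[OF _ _ tendsto_const])
      show "(\<lambda>n. sqrt (E n j k) * L2_norm ?S \<eta>) \<longlonglongrightarrow> 0"
        using tendsto_mult_left_zero[OF tendsto_real_sqrt[OF Elim, unfolded real_sqrt_zero]] .
      have "norm (\<integral>x. mollify n (g j) x * partial_deriv k \<eta> x \<partial>lebesgue_on ?S) \<le> sqrt (E n j k) * L2_norm ?S \<eta>" for n
      proof -
        have sd: "smooth (partial_deriv k (p n j))" by (rule smooth_partial_deriv[OF sp[OF j] k])
        have "(\<integral>x. mollify n (g j) x * partial_deriv k \<eta> x \<partial>lebesgue_on ?S) = (\<integral>x. p n j x * partial_deriv k \<eta> x \<partial>lebesgue_on ?S)"
          by (rule Bochner_Integration.integral_cong) (use S(2) in \<open>auto simp: pB j\<close>)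
        also have "\<dots> = - (\<integral>x. partial_deriv k (p n j) x * \<eta> x \<partial>lebesgue_on ?S)"
          by (rule integration_by_parts[OF sp[OF j] \<eta> k S(1)])
        finally have "norm (\<integral>x. mollify n (g j) x * partial_deriv k \<eta> x \<partial>lebesgue_on ?S) \<le> L2_norm ?S (partial_deriv k (p n j)) * L2_norm ?S \<eta>"
          using L2_Cauchy_Schwarz[OF smooth_L2[OF sd _ S(1)] \<eta>L(1)] by simp
        also have "L2_norm ?S (partial_deriv k (p n j)) \<le> sqrt (E n j k)"
        proof -
          let ?f = "\<lambda>x. (norm (partial_deriv k (p n j) x))\<^sup>2 * c x"
          have IB: "integrable lebesgue (\<lambda>x. indicator (ball z r) x *\<^sub>R ?f x)"
            using intE[OF j k, of n] by (simp add: integrable_restrict_space)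
          have IS: "integrable lebesgue (\<lambda>x. indicator ?S x *\<^sub>R indicator (ball z r) x *\<^sub>R ?f x)"
            by (rule integrable_mult_indicator[OF S(1) IB])
          have "(\<integral>x. (norm (partial_deriv k (p n j) x))\<^sup>2 \<partial>lebesgue_on ?S) = (\<integral>x. indicator ?S x *\<^sub>R (norm (partial_deriv k (p n j) x))\<^sup>2 \<partial>lebesgue)"
            by (simp add: integral_restrict_space)
          also have "\<dots> = (\<integral>x. indicator ?S x *\<^sub>R indicator (ball z r) x *\<^sub>R ?f x \<partial>lebesgue)"
            using S(2) c(3) by (intro Bochner_Integration.integral_cong) (auto simp: indicator_def)
          also have "\<dots> \<le> (\<integral>x. indicator (ball z r) x *\<^sub>R ?f x \<partial>lebesgue)"
            by (rule Bochner_Integration.integral_mono[OF IS IB]) (use c(2) in \<open>auto simp: indicator_def\<close>)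
          also have "\<dots> = E n j k" by (simp add: E_def integral_restrict_space)
          finally show ?thesis by (simp add: L2_norm_def)
        qed
        finally show ?thesis by (simp add: mult_right_mono)
      qed
      then show "\<forall>\<^sub>F n in sequentially. norm (\<integral>x. mollify n (g j) x * partial_deriv k \<eta> x \<partial>lebesgue_on ?S) \<le> sqrt (E n j k) * L2_norm ?S \<eta>" by simp
    qed simp
    ultimately show "(\<integral>x. g j x * partial_deriv k \<eta> x \<partial>lebesgue_on ?S) = - (\<integral>x. 0 * \<eta> x \<partial>lebesgue_on ?S)"
      using LIMSEQ_unique by fastforce
  qed
qed

end

section \<open>Coordinates with orthonormal gradients\<close>

text \<open>The condition \<open>prod\<close> says that the carre du champ of \<open>t i\<close> and \<open>t j\<close> is the Kronecker delta.\<close>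

locale local_coordinates =
  fixes z :: "'a::euclidean_space" and R :: real and I :: "'i set"
    and t :: "'i \<Rightarrow> 'a \<Rightarrow> complex" and G :: "'i \<Rightarrow> 'a \<Rightarrow> 'a \<Rightarrow> complex" and F :: "'i \<Rightarrow> 'a \<Rightarrow> complex"
  assumes R: "R > 0" and I: "finite I"
    and t: "\<And>i. i \<in> I \<Longrightarrow> t i \<in> L2 (ball z R)"
    and t_real: "\<And>i. i \<in> I \<Longrightarrow> AE x in lebesgue_on (ball z R). cnj (t i x) = t i x"
    and G: "\<And>i b. i \<in> I \<Longrightarrow> b \<in> Basis \<Longrightarrow> G i b \<in> L2 (ball z R)"
    and tG: "\<And>i b. i \<in> I \<Longrightarrow> b \<in> Basis \<Longrightarrow> has_weak_deriv (ball z R) b (t i) (G i b)"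
    and F: "\<And>i. i \<in> I \<Longrightarrow> F i \<in> L2 (ball z R)"
    and tF: "\<And>i. i \<in> I \<Longrightarrow> has_distr_laplacian (ball z R) (t i) (F i)"
    and prod: "\<And>i j. i \<in> I \<Longrightarrow> j \<in> I \<Longrightarrow> has_distr_laplacian (ball z R) (\<lambda>x. t i x * t j x)
        (\<lambda>x. t i x * F j x + F i x * t j x + (if i = j then 2 else 0))"
begin

text \<open>Conjugating the weak equation of the real function \<open>t i\<close> shows that the
  conjugate of \<open>G i b\<close> is another weak derivative of it, and weak derivatives are
  unique.\<close>

lemma G_real:
  assumes "i \<in> I" "b \<in> Basis"
  shows "AE x in lebesgue_on (ball z R). cnj (G i b x) = G i b x"
proof (rule has_weak_deriv_unique[OF _ L2_cnj[OF G[OF assms]] G[OF assms] _ tG[OF assms]])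
  show "has_weak_deriv (ball z R) b (t i) (\<lambda>x. cnj (G i b x))"
    by (rule has_weak_deriv_cong_AE[OF has_weak_deriv_cnj[OF tG[OF assms] assms(2)] _ assms(2) t_real[OF assms(1)]]) auto
qed simp

text \<open>The Laplacian of \<open>t i * t j\<close> is known in two ways, from \<open>prod\<close>
  and from the Leibniz rule. The terms with \<open>F\<close> cancel and leave twice the product of
  the gradients against every test function.\<close>

lemma gram_ij:
  assumes r: "0 < r" "r < R" and ij: "i \<in> I" "j \<in> I"
  shows "AE x in lebesgue_on (ball z r). (\<Sum>b\<in>Basis. G i b x * G j b x) = (if i = j then 1 else 0)"
proof -
  obtain \<rho> :: "nat \<Rightarrow> 'a \<Rightarrow> real" where "ball_mollification r R \<rho>" using ball_mollification_exists[OF r] by blast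
  then interpret ball_mollification z r R \<rho> .
  let ?B = "lebesgue_on (ball z r)"
  interpret finite_measure ?B by (rule finite_measure_lebesgue_on) simp
  define \<delta> :: complex where "\<delta> = (if i = j then 1 else 0)"
  note tL = L2_small_ball[OF t] and GL = L2_small_ball[OF G] and FL = L2_small_ball[OF F]
  have int: "integrable ?B (\<lambda>x. (\<Sum>b\<in>Basis. G i b x * G j b x) - \<delta>)"
    by (intro Bochner_Integration.integrable_diff Bochner_Integration.integrable_sum L2_prod_integrable(1) GL ij integrable_const)
  have "AE x in ?B. (\<Sum>b\<in>Basis. G i b x * G j b x) - \<delta> = 0"
  proof (rule du_Bois_Reymond[OF open_ball int])
    fix \<psi> assume \<psi>: "\<psi> \<in> test_functions (ball z r)"
    have \<psi>U: "\<psi> \<in> test_functions UNIV" using test_functions_mono[OF subset_UNIV \<psi>] .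
    note P = prod_test_integrable[OF _ _ \<psi>U]
    have \<psi>I: "integrable ?B \<psi>" using L2_finite_measure_integrable[OF _ test_functions_L2[OF \<psi>]] by simp
    have "(\<integral>x. t i x * t j x * laplacian \<psi> x \<partial>?B) = (\<integral>x. t i x * F j x * \<psi> x \<partial>?B) + (\<integral>x. F i x * t j x * \<psi> x \<partial>?B)
       + 2 * (\<Sum>b\<in>Basis. \<integral>x. G i b x * G j b x * \<psi> x \<partial>?B)"
      by (rule distr_laplacian_product[OF t tF F tG G t tF F tG G \<psi>]) (use ij in auto)
    moreover have "has_distr_laplacian (ball z r) (\<lambda>x. t i x * t j x) (\<lambda>x. t i x * F j x + F i x * t j x + 2 * \<delta>)"
    proof -
      have "(if i = j then 2 else 0) = 2 * \<delta>" by (simp add: \<delta>_def)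
      then show ?thesis
        using has_distr_laplacian_subset[OF prod[OF ij], of "ball z r"] r by (simp add: subset_ball)
    qed
    then have "(\<integral>x. t i x * t j x * laplacian \<psi> x \<partial>?B) = (\<integral>x. t i x * F j x * \<psi> x + F i x * t j x * \<psi> x + 2 * \<delta> * \<psi> x \<partial>?B)"
      using \<psi> by (simp add: has_distr_laplacian_def distrib_right)
    moreover have "(\<integral>x. t i x * F j x * \<psi> x + F i x * t j x * \<psi> x + 2 * \<delta> * \<psi> x \<partial>?B)
        = (\<integral>x. t i x * F j x * \<psi> x \<partial>?B) + (\<integral>x. F i x * t j x * \<psi> x \<partial>?B) + 2 * (\<delta> * (\<integral>x. \<psi> x \<partial>?B))"
      using P[OF tL[OF ij(1)] FL[OF ij(2)]] P[OF FL[OF ij(1)] tL[OF ij(2)]] \<psi>I by simp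
    ultimately have eq: "(\<Sum>b\<in>Basis. \<integral>x. G i b x * G j b x * \<psi> x \<partial>?B) = \<delta> * (\<integral>x. \<psi> x \<partial>?B)" by simp
    have "(\<integral>x. ((\<Sum>b\<in>Basis. G i b x * G j b x) - \<delta>) * \<psi> x \<partial>?B) = (\<integral>x. (\<Sum>b\<in>Basis. G i b x * G j b x * \<psi> x) - \<delta> * \<psi> x \<partial>?B)"
      by (simp add: left_diff_distrib sum_distrib_right)
    also have "\<dots> = (\<Sum>b\<in>Basis. \<integral>x. G i b x * G j b x * \<psi> x \<partial>?B) - \<delta> * (\<integral>x. \<psi> x \<partial>?B)"
      using P[OF GL[OF ij(1)] GL[OF ij(2)]] \<psi>I by simp
    finally show "(\<integral>x. ((\<Sum>b\<in>Basis. G i b x * G j b x) - \<delta>) * \<psi> x \<partial>?B) = 0" using eq by simp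
  qed
  then show ?thesis by (simp add: \<delta>_def)
qed

lemma gram:
  assumes r: "0 < r" "r < R"
  shows "AE x in lebesgue_on (ball z r). \<forall>i\<in>I. \<forall>b\<in>Basis. cnj (G i b x) = G i b x"
    and "AE x in lebesgue_on (ball z r). \<forall>i\<in>I. \<forall>j\<in>I. (\<Sum>b\<in>Basis. G i b x * G j b x) = (if i = j then 1 else 0)"
proof -
  have "AE x in lebesgue_on (ball z R). \<forall>i\<in>I. \<forall>b\<in>Basis. cnj (G i b x) = G i b x"
    by (intro AE_finite_allI I finite_Basis G_real)
  then show "AE x in lebesgue_on (ball z r). \<forall>i\<in>I. \<forall>b\<in>Basis. cnj (G i b x) = G i b x"
    by (rule AE_lebesgue_on_mono) (use r in \<open>auto simp: subset_ball\<close>)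
  show "AE x in lebesgue_on (ball z r). \<forall>i\<in>I. \<forall>j\<in>I. (\<Sum>b\<in>Basis. G i b x * G j b x) = (if i = j then 1 else 0)"
    by (intro AE_finite_allI I gram_ij r)
qed

text \<open>The finitely many almost-everywhere relations hold together at some point, and there the
  gradients form an orthonormal family in \<open>'a\<close>.\<close>

lemma card_le_DIM: "card I \<le> DIM('a)"
proof -
  have r: "0 < R / 2" "R / 2 < R" using R by auto
  have AE: "AE x in lebesgue_on (ball z (R / 2)). (\<forall>i\<in>I. \<forall>b\<in>Basis. cnj (G i b x) = G i b x) \<and>
      (\<forall>i\<in>I. \<forall>j\<in>I. (\<Sum>b\<in>Basis. G i b x * G j b x) = (if i = j then 1 else 0))"
    using gram[OF r] by eventually_elim blast
  obtain x where x: "(\<forall>i\<in>I. \<forall>b\<in>Basis. cnj (G i b x) = G i b x) \<and>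
      (\<forall>i\<in>I. \<forall>j\<in>I. (\<Sum>b\<in>Basis. G i b x * G j b x) = (if i = j then 1 else 0))"
    by (rule AE_ball_obtain[OF AE r(1)]) (rule that)
  show ?thesis by (rule orthonormal_rows(1)[OF I, of "\<lambda>i b. G i b x"]) (use x in auto)
qed

context
  assumes card: "card I = DIM('a)"
begin

lemma gram_columns:
  assumes r: "0 < r" "r < R" and b: "b \<in> Basis" and c: "c \<in> Basis"
  shows "AE x in lebesgue_on (ball z r). (\<Sum>i\<in>I. G i b x * G i c x) = (if b = c then 1 else 0)"
  using gram[OF r]
proof eventually_elim
  case (elim x)
  show ?case by (rule orthonormal_rows(2)[OF I _ _ card b c, of "\<lambda>i b. G i b x"]) (use elim in auto)
qed

text \<open>The right-hand side of Pohozaev's identity contains the gradients only through products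
  \<open>G i b * G i c\<close>. Their sums over \<open>i\<close> are column products, hence
  constants, and a derivative of a test function integrates to 0. What remains is that the
  transposed Jacobian annihilates the vector of Laplacians.\<close>

lemma laplacian_zero:
  assumes r: "0 < r" "r < R" and j: "j \<in> I"
  shows "AE x in lebesgue_on (ball z r). F j x = 0"
proof -
  obtain \<rho> :: "nat \<Rightarrow> 'a \<Rightarrow> real" where "ball_mollification r R \<rho>" using ball_mollification_exists[OF r] by blast
  then interpret ball_mollification z r R \<rho> .
  let ?B = "lebesgue_on (ball z r)"
  have B: "ball z r \<in> sets lebesgue" by simp
  note GL = L2_small_ball[OF G] and FL = L2_small_ball[OF F]
  have "AE x in ?B. (\<Sum>i\<in>I. G i l x * F i x) = 0" if l: "l \<in> Basis" for l
  proof (rule du_Bois_Reymond[OF open_ball])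
    show "integrable ?B (\<lambda>x. \<Sum>i\<in>I. G i l x * F i x)"
      by (intro Bochner_Integration.integrable_sum L2_prod_integrable(1) GL FL l)
    fix \<psi> assume \<psi>: "\<psi> \<in> test_functions (ball z r)"
    have \<psi>U: "\<psi> \<in> test_functions UNIV" using test_functions_mono[OF subset_UNIV \<psi>] .
    note P = prod_test_integrable[OF _ _ \<psi>U]
    have zero: "(\<Sum>i\<in>I. \<integral>x. G i b x * G i c x * partial_deriv k \<psi> x \<partial>?B) = 0"
      if "b \<in> Basis" "c \<in> Basis" "k \<in> Basis" for b c k
    proof -
      note kT = test_functions_partial_deriv[OF \<psi>U that(3)]
      have "(\<Sum>i\<in>I. \<integral>x. G i b x * G i c x * partial_deriv k \<psi> x \<partial>?B) = (\<integral>x. (\<Sum>i\<in>I. G i b x * G i c x * partial_deriv k \<psi> x) \<partial>?B)"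
        by (rule Bochner_Integration.integral_sum[symmetric]) (intro prod_test_integrable[OF _ _ kT] GL that)
      also have "\<dots> = (\<integral>x. (\<Sum>i\<in>I. G i b x * G i c x) * partial_deriv k \<psi> x \<partial>?B)" by (simp add: sum_distrib_right)
      also have "\<dots> = (\<integral>x. (if b = c then 1 else 0) * partial_deriv k \<psi> x \<partial>?B)"
        by (rule integral_mult_cong_AE[OF B gram_columns[OF r that(1,2)] test_functions_smooth[OF kT]])
      also have "\<dots> = 0" using integral_partial_deriv_test[OF \<psi> that(3) B] by simp
      finally show ?thesis .
    qed
    have "(\<integral>x. (\<Sum>i\<in>I. G i l x * F i x) * \<psi> x \<partial>?B) = (\<integral>x. (\<Sum>i\<in>I. G i l x * F i x * \<psi> x) \<partial>?B)"
      by (simp add: sum_distrib_right)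
    also have "\<dots> = (\<Sum>i\<in>I. \<integral>x. G i l x * F i x * \<psi> x \<partial>?B)"
      by (rule Bochner_Integration.integral_sum) (intro P GL FL l)
    also have "\<dots> = (\<Sum>i\<in>I. \<Sum>k\<in>Basis. (\<integral>x. G i k x * G i k x * partial_deriv l \<psi> x \<partial>?B) / 2
        - (\<integral>x. G i k x * G i l x * partial_deriv k \<psi> x \<partial>?B))"
      by (intro sum.cong refl weak_Pohozaev_identity[OF t tF F tG G \<psi> l])
    also have "\<dots> = (\<Sum>k\<in>Basis. (\<Sum>i\<in>I. \<integral>x. G i k x * G i k x * partial_deriv l \<psi> x \<partial>?B) / 2
        - (\<Sum>i\<in>I. \<integral>x. G i k x * G i l x * partial_deriv k \<psi> x \<partial>?B))"
      by (subst sum.swap) (simp add: sum_subtractf sum_divide_distrib)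
    also have "\<dots> = 0" using zero l by simp
    finally show "(\<integral>x. (\<Sum>i\<in>I. G i l x * F i x) * \<psi> x \<partial>?B) = 0" .
  qed
  then have "AE x in ?B. \<forall>l\<in>Basis. (\<Sum>i\<in>I. G i l x * F i x) = 0" by (intro AE_finite_allI) auto
  with gram(2)[OF r] show ?thesis
  proof eventually_elim
    case (elim x)
    \<comment> \<open>Multiplying by the Jacobian and using its orthonormal rows isolates the
      component \<open>F j\<close>.\<close>
    have "0 = (\<Sum>l\<in>Basis. G j l x * (\<Sum>i\<in>I. G i l x * F i x))" using elim(2) by simp
    also have "\<dots> = (\<Sum>i\<in>I. (\<Sum>l\<in>Basis. G j l x * G i l x) * F i x)"
      unfolding sum_distrib_left sum_distrib_right by (subst sum.swap) (simp add: mult.assoc)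
    also have "\<dots> = (\<Sum>i\<in>I. (if j = i then F i x else 0))"
      by (intro sum.cong refl) (use elim(1) j in auto)
    also have "\<dots> = F j x" using I j by simp
    finally show ?case by simp
  qed
qed

lemma gradient_locally_constant:
  shows "\<exists>c. \<forall>i\<in>I. \<forall>b\<in>Basis. AE x in lebesgue_on (ball z (R / 32)). G i b x = c i b"
proof -
  \<comment> \<open>Successive losses of radius: harmonicity on \<open>R / 2\<close>, unit gradient
    on \<open>R / 4\<close>, vanishing Hessian on \<open>r2 / 4 = R / 16\<close>, and constant
    gradient on \<open>R / 32\<close>.\<close>
  define r1 where "r1 = R / 2"
  define r2 where "r2 = R / 4"
  have rs: "0 < r1" "r1 < R" "0 < r2" "r2 < r1" "0 < r2" "r2 < R" using R by (auto simp: r1_def r2_def)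
  obtain \<rho> :: "nat \<Rightarrow> 'a \<Rightarrow> real" where "ball_mollification r2 r1 \<rho>" using ball_mollification_exists[OF rs(3,4)] by blast
  then interpret ball_mollification z r2 r1 \<rho> .
  have sub: "ball z r1 \<subseteq> ball z R" "ball z r1 \<in> sets lebesgue" "ball z R \<in> sets lebesgue"
    "ball z (r2 / 4) \<subseteq> ball z R" "ball z (r2 / 4) \<in> sets lebesgue"
    using rs by (auto simp: subset_ball)
  have "\<exists>c. AE x in lebesgue_on (ball z (R / 32)). G i b x = c" if i: "i \<in> I" and b: "b \<in> Basis" for i b
  proof (rule weak_gradient_0_imp_constant_ball)
    show "G i b \<in> L2 (ball z (r2 / 4))" by (rule L2_mono(1)[OF sub(4,5,3) G[OF i b]])
    show "0 < R / 32" "R / 32 < r2 / 4" using R by (auto simp: r2_def)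
    show "has_weak_deriv (ball z (r2 / 4)) k (G i b) (\<lambda>x. 0)" if k: "k \<in> Basis" for k
    proof (rule harmonic_unit_gradient_imp_Hessian_0[OF _ _ _ _ _ b k])
      show "t i \<in> L2 (ball z r1)" by (rule L2_mono(1)[OF sub(1-3) t[OF i]])
      show "has_distr_laplacian (ball z r1) (t i) (\<lambda>x. 0)"
        by (rule has_distr_laplacian_cong_AE[OF has_distr_laplacian_subset[OF tF[OF i] sub(1-3)] sub(2) _ laplacian_zero[OF rs(1,2) i]]) simp
      show "has_weak_deriv (ball z r1) b (t i) (G i b)" if "b \<in> Basis" for b
        by (rule has_weak_deriv_subset[OF tG[OF i that] sub(1-3) that])
      show "G i b \<in> L2 (ball z r1)" if "b \<in> Basis" for b by (rule L2_mono(1)[OF sub(1-3) G[OF i that]])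
      show "AE x in lebesgue_on (ball z r2). (\<Sum>b\<in>Basis. G i b x * cnj (G i b x)) = 1"
        using gram[OF rs(5,6)] by eventually_elim (use i in simp)
    qed
  qed
  then show ?thesis by metis
qed

theorem locally_affine:
  "\<exists>s>0. \<exists>v :: 'i \<Rightarrow> 'a. \<exists>a :: 'i \<Rightarrow> real.
     (\<forall>i\<in>I. \<forall>j\<in>I. v i \<bullet> v j = (if i = j then 1 else 0)) \<and>
     (\<forall>i\<in>I. AE x in lebesgue_on (ball z s). t i x = of_real (v i \<bullet> x + a i))"
proof -
  define s1 where "s1 = R / 32"
  define s where "s = R / 64"
  have s: "0 < s1" "s1 < R" "0 < s" "s < s1" using R by (auto simp: s1_def s_def)
  have sub: "ball z s1 \<subseteq> ball z R" "ball z s1 \<in> sets lebesgue" "ball z R \<in> sets lebesgue" "ball z s \<subseteq> ball z R"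
    "ball z s \<in> sets lebesgue"
    using s by (auto simp: subset_ball)
  obtain c where c: "\<And>i b. i \<in> I \<Longrightarrow> b \<in> Basis \<Longrightarrow> AE x in lebesgue_on (ball z s1). G i b x = c i b"
    using gradient_locally_constant unfolding s1_def by blast
  then have "AE x in lebesgue_on (ball z s1). \<forall>i\<in>I. \<forall>b\<in>Basis. G i b x = c i b"
    by (intro AE_finite_allI I finite_Basis)
  then have AE: "AE x in lebesgue_on (ball z s1). (\<forall>i\<in>I. \<forall>b\<in>Basis. cnj (c i b) = c i b) \<and>
      (\<forall>i\<in>I. \<forall>j\<in>I. (\<Sum>b\<in>Basis. c i b * c j b) = (if i = j then 1 else 0))"
    using gram[OF s(1,2)] by eventually_elim simp
  \<comment> \<open>The relations no longer involve \<open>x\<close>, so holding almost everywhere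
    on a ball of positive radius means holding outright.\<close>
  have "(\<forall>i\<in>I. \<forall>b\<in>Basis. cnj (c i b) = c i b) \<and>
      (\<forall>i\<in>I. \<forall>j\<in>I. (\<Sum>b\<in>Basis. c i b * c j b) = (if i = j then 1 else 0))"
    by (rule AE_ball_obtain[OF AE s(1)])
  then have c_real: "\<And>i b. i \<in> I \<Longrightarrow> b \<in> Basis \<Longrightarrow> cnj (c i b) = c i b"
    and c_gram: "\<And>i j. i \<in> I \<Longrightarrow> j \<in> I \<Longrightarrow> (\<Sum>b\<in>Basis. c i b * c j b) = (if i = j then 1 else 0)"
    by blast+
  obtain v where c_eq: "\<And>i b. i \<in> I \<Longrightarrow> b \<in> Basis \<Longrightarrow> c i b = of_real (v i \<bullet> b)"
    and vv: "\<And>i j. i \<in> I \<Longrightarrow> j \<in> I \<Longrightarrow> v i \<bullet> v j = (if i = j then 1 else 0)"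
    using orthonormal_rows_obtain[of I c, OF c_real c_gram] by blast
  have "\<exists>a :: real. AE x in lebesgue_on (ball z s). t i x = of_real (v i \<bullet> x + a)" if i: "i \<in> I" for i
  proof -
    let ?l = "\<lambda>x. complex_of_real (x \<bullet> v i)"
    have lL: "?l \<in> L2 (ball z s1)" by (rule smooth_L2[OF smooth_inner]) auto
    have "\<exists>d. AE x in lebesgue_on (ball z s). t i x - ?l x = d"
    proof (rule weak_gradient_0_imp_constant_ball[OF _ _ s(3,4)])
      show "(\<lambda>x. t i x - ?l x) \<in> L2 (ball z s1)" by (intro L2_diff lL L2_mono(1)[OF sub(1-3) t[OF i]])
      fix b :: 'a assume b: "b \<in> Basis"
      have cb: "partial_deriv b ?l = (\<lambda>x. c i b)"
        by (simp add: partial_deriv_inner c_eq[OF i b] inner_commute)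
      have "has_weak_deriv (ball z s1) b (\<lambda>x. t i x - ?l x) (\<lambda>x. G i b x - c i b)"
      proof (rule has_weak_deriv_diff)
        show "has_weak_deriv (ball z s1) b ?l (\<lambda>x. c i b)"
          using has_weak_deriv_smooth[OF smooth_inner b sub(2), of "v i"] cb by simp
        show "(\<lambda>x. c i b) \<in> L2 (ball z s1)" by (rule smooth_L2[OF smooth_const]) auto
      qed (intro lL b sub L2_mono(1)[OF sub(1-3) t[OF i]] L2_mono(1)[OF sub(1-3) G[OF i b]] has_weak_deriv_subset[OF tG[OF i b] sub(1-3) b])+
      then show "has_weak_deriv (ball z s1) b (\<lambda>x. t i x - ?l x) (\<lambda>x. 0)"
        by (rule has_weak_deriv_cong_AE[OF _ sub(2) b]) (use c[OF i b] in auto)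
    qed
    then obtain d where d: "AE x in lebesgue_on (ball z s). t i x - ?l x = d" by blast
    have "AE x in lebesgue_on (ball z s). cnj (t i x) = t i x" by (rule AE_lebesgue_on_mono[OF t_real[OF i] sub(4,5,3)])
    with d have AE: "AE x in lebesgue_on (ball z s). cnj d = d"
      by eventually_elim (metis complex_cnj_complex_of_real complex_cnj_diff)
    have "cnj d = d" by (rule AE_ball_obtain[OF AE s(3)])
    then have "d = of_real (Re d)" by (simp add: complex_eq_iff)
    with d have "AE x in lebesgue_on (ball z s). t i x = of_real (v i \<bullet> x + Re d)"
      by (auto elim!: eventually_mono simp: inner_commute algebra_simps)
    then show ?thesis by blast
  qed
  then obtain a :: "'i \<Rightarrow> real" where "\<forall>i\<in>I. AE x in lebesgue_on (ball z s). t i x = of_real (v i \<bullet> x + a i)" by metis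
  then show ?thesis using s(3) vv by blast
qed

end

end

section \<open>Functions vanishing on the boundary\<close>

lemma L2_norm_add_power2:
  assumes "f \<in> L2 \<Omega>" "g \<in> L2 \<Omega>"
  shows "(L2_norm \<Omega> (\<lambda>x. f x + g x))\<^sup>2 = (L2_norm \<Omega> f)\<^sup>2 + (L2_norm \<Omega> g)\<^sup>2 + 2 * Re (\<integral>x. f x * cnj (g x) \<partial>lebesgue_on \<Omega>)"
proof -
  note I = L2_square_integrable[OF assms(1)] L2_square_integrable[OF assms(2)] L2_prod_integrable(1)[OF assms(1) L2_cnj[OF assms(2)]]
  have "(norm (a + b))\<^sup>2 = (norm a)\<^sup>2 + (norm b)\<^sup>2 + 2 * Re (a * cnj b)" for a b :: complex
    by (simp only: cmod_power2) (simp add: power2_eq_square algebra_simps)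
  then have "(L2_norm \<Omega> (\<lambda>x. f x + g x))\<^sup>2 = (\<integral>x. (norm (f x))\<^sup>2 + (norm (g x))\<^sup>2 + 2 * Re (f x * cnj (g x)) \<partial>lebesgue_on \<Omega>)"
    by (simp only: L2_norm_power2)
  also have "\<dots> = (\<integral>x. (norm (f x))\<^sup>2 + (norm (g x))\<^sup>2 \<partial>lebesgue_on \<Omega>) + (\<integral>x. 2 * Re (f x * cnj (g x)) \<partial>lebesgue_on \<Omega>)"
    by (intro Bochner_Integration.integral_add Bochner_Integration.integrable_add integrable_mult_right integrable_Re I)
  also have "(\<integral>x. 2 * Re (f x * cnj (g x)) \<partial>lebesgue_on \<Omega>) = 2 * Re (\<integral>x. f x * cnj (g x) \<partial>lebesgue_on \<Omega>)"
    by (simp only: integral_mult_right_zero Bochner_Integration.integral_Re[OF I(3)])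
  also have "(\<integral>x. (norm (f x))\<^sup>2 + (norm (g x))\<^sup>2 \<partial>lebesgue_on \<Omega>) = (L2_norm \<Omega> f)\<^sup>2 + (L2_norm \<Omega> g)\<^sup>2"
    by (simp only: L2_norm_power2 Bochner_Integration.integral_add[OF I(1,2)])
  finally show ?thesis .
qed

text \<open>Riesz--Fischer: a fast Cauchy subsequence converges almost everywhere; conclude by Fatou.\<close>

lemma L2_complete:
  assumes \<Omega>: "\<Omega> \<in> lmeasurable" and F: "\<And>n. F n \<in> L2 \<Omega>"
    and Cauchy: "\<And>e. e > 0 \<Longrightarrow> \<exists>N. \<forall>m\<ge>N. \<forall>n\<ge>N. L2_norm \<Omega> (\<lambda>x. F m x - F n x) < e"
  shows "\<exists>f\<in>L2 \<Omega>. L2_lim \<Omega> F f"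
proof -
  let ?M = "lebesgue_on \<Omega>"
  interpret finite_measure ?M by (rule finite_measure_lebesgue_on[OF \<Omega>])
  note [measurable] = L2_measurable[OF F]
  have "\<exists>N. \<forall>m\<ge>N. \<forall>n\<ge>N. L2_norm \<Omega> (\<lambda>x. F m x - F n x) < (1/2)^k" for k :: nat
    by (rule Cauchy) simp
  then obtain N where N: "\<And>k m n. m \<ge> N k \<Longrightarrow> n \<ge> N k \<Longrightarrow> L2_norm \<Omega> (\<lambda>x. F m x - F n x) < (1/2)^k" by metis
  \<comment> \<open>Partial sums make the indices nondecreasing and at least \<open>N j\<close> for
    every \<open>j \<le> k\<close>.\<close>
  define r where "r k = (\<Sum>i\<le>k. N i)" for k
  have rN: "r k \<ge> N k" "r (Suc k) \<ge> r k" for k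
    by (auto simp: r_def intro: member_le_sum[of k "{..k}" N, simplified])
  have r_ge: "r k \<ge> N j" if "j \<le> k" for j k
    unfolding r_def using that by (intro member_le_sum) auto
  define D where "D k x = F (r (Suc k)) x - F (r k) x" for k x
  have DL: "D k \<in> L2 \<Omega>" for k unfolding D_def[abs_def] by (intro L2_diff F)
  note [measurable] = L2_measurable[OF DL]
  have DN: "L2_norm \<Omega> (D k) \<le> (1/2)^k" for k
    unfolding D_def using N[of k "r (Suc k)" "r k"] rN[of k] by (simp add: less_imp_le)
  \<comment> \<open>On a set of finite measure the L1 norm is at most \<open>c\<close> times the L2
    norm. The increments \<open>D k\<close> are therefore summable in L1, and their sum converges
    absolutely almost everywhere.\<close>
  define c where "c = L2_norm \<Omega> (\<lambda>x. 1)"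
  have one: "(\<lambda>x. 1) \<in> L2 \<Omega>" by (simp add: L2_def)
  have D1: "(\<integral>\<^sup>+x. ennreal (norm (D k x)) \<partial>?M) \<le> ennreal ((1/2)^k * c)" for k
  proof -
    have "integrable ?M (\<lambda>x. norm (D k x))" using L2_prod_integrable(2)[OF DL one] by simp
    then have "(\<integral>\<^sup>+x. ennreal (norm (D k x)) \<partial>?M) = ennreal (\<integral>x. norm (D k x) \<partial>?M)"
      by (rule nn_integral_eq_integral) simp
    also have "(\<integral>x. norm (D k x) \<partial>?M) \<le> (1/2)^k * c"
      using L2_Cauchy_Schwarz_norm[OF DL one, of k] mult_right_mono[OF DN[of k], of c] by (simp add: c_def)
    finally show ?thesis by (simp add: ennreal_leI)
  qed
  have sum: "summable (\<lambda>k. (1/2)^k * c)" by (intro summable_mult2 summable_geometric) simp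
  have "(\<integral>\<^sup>+x. (\<Sum>k. ennreal (norm (D k x))) \<partial>?M) = (\<Sum>k. \<integral>\<^sup>+x. ennreal (norm (D k x)) \<partial>?M)"
    by (rule nn_integral_suminf) measurable
  also have "\<dots> \<le> (\<Sum>k. ennreal ((1/2)^k * c))" by (rule suminf_le[OF D1]) auto
  also have "\<dots> = ennreal (\<Sum>k. (1/2)^k * c)" by (rule suminf_ennreal2[OF _ sum]) (simp add: c_def)
  also have "\<dots> < \<infinity>" by simp
  finally have "AE x in ?M. (\<Sum>k. ennreal (norm (D k x))) \<noteq> \<infinity>"
    by (intro nn_integral_noteq_infinite) auto
  then have conv: "AE x in ?M. convergent (\<lambda>k. F (r k) x)"
  proof eventually_elim
    case (elim x)
    have "summable (\<lambda>k. norm (D k x))" by (rule summable_suminf_not_top) (use elim in auto)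
    then have "summable (\<lambda>k. D k x)" by (rule summable_norm_cancel)
    then have "convergent (\<lambda>n. (\<Sum>k<n. D k x) + F (r 0) x)"
      by (intro convergent_add convergent_const) (simp add: summable_iff_convergent)
    moreover have "(\<Sum>k<n. D k x) + F (r 0) x = F (r n) x" for n
      unfolding D_def by (subst sum_lessThan_telescope[of "\<lambda>k. F (r k) x" n]) simp
    ultimately show ?case by simp
  qed
  define f where "f x = lim (\<lambda>k. F (r k) x)" for x
  have fm[measurable]: "f \<in> borel_measurable ?M" unfolding f_def[abs_def] by (rule borel_measurable_lim_metric) measurable
  have lim: "AE x in ?M. (\<lambda>k. F (r k) x) \<longlonglongrightarrow> f x"
    using conv by eventually_elim (simp add: f_def convergent_LIMSEQ_iff)
  \<comment> \<open>Fatou along the subsequence turns the Cauchy bound for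
    \<open>F (r j) - F m\<close> into one for \<open>f - F m\<close>, for all large \<open>m\<close>
    and not only along the subsequence.\<close>
  have bound: "(\<integral>\<^sup>+x. ennreal ((norm (f x - F m x))\<^sup>2) \<partial>?M) \<le> ennreal (((1/2)^k)\<^sup>2)" if m: "m \<ge> N k" for m k
  proof -
    have "(\<integral>\<^sup>+x. ennreal ((norm (f x - F m x))\<^sup>2) \<partial>?M) = (\<integral>\<^sup>+x. liminf (\<lambda>j. ennreal ((norm (F (r j) x - F m x))\<^sup>2)) \<partial>?M)"
    proof (rule nn_integral_cong_AE)
      show "AE x in ?M. ennreal ((norm (f x - F m x))\<^sup>2) = liminf (\<lambda>j. ennreal ((norm (F (r j) x - F m x))\<^sup>2))"
        using lim
      proof eventually_elim
        case (elim x)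
        have "(\<lambda>j. ennreal ((norm (F (r j) x - F m x))\<^sup>2)) \<longlonglongrightarrow> ennreal ((norm (f x - F m x))\<^sup>2)"
          by (intro tendsto_intros elim)
        from lim_imp_Liminf[OF sequentially_bot this] show ?case by (rule sym)
      qed
    qed
    also have "\<dots> \<le> liminf (\<lambda>j. \<integral>\<^sup>+x. ennreal ((norm (F (r j) x - F m x))\<^sup>2) \<partial>?M)"
      by (rule nn_integral_liminf) measurable
    also have "\<dots> \<le> ennreal (((1/2)^k)\<^sup>2)"
    proof (rule Liminf_le)
      have "(\<integral>\<^sup>+x. ennreal ((norm (F (r j) x - F m x))\<^sup>2) \<partial>?M) \<le> ennreal (((1/2)^k)\<^sup>2)" if "j \<ge> k" for j
      proof -
        have "(\<integral>\<^sup>+x. ennreal ((norm (F (r j) x - F m x))\<^sup>2) \<partial>?M) = ennreal ((L2_norm \<Omega> (\<lambda>x. F (r j) x - F m x))\<^sup>2)"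
          unfolding L2_norm_power2 by (rule nn_integral_eq_integral[OF L2_square_integrable[OF L2_diff[OF F F]]]) simp
        also have "\<dots> \<le> ennreal (((1/2)^k)\<^sup>2)"
          using N[OF r_ge[OF that] m] by (intro ennreal_leI power_mono) auto
        finally show ?thesis .
      qed
      then show "\<forall>\<^sub>F j in sequentially. (\<integral>\<^sup>+x. ennreal ((norm (F (r j) x - F m x))\<^sup>2) \<partial>?M) \<le> ennreal (((1/2)^k)\<^sup>2)"
        by (auto simp: eventually_sequentially)
    qed simp
    finally show ?thesis .
  qed
  have dL: "(\<lambda>x. f x - F m x) \<in> L2 \<Omega>" if "m \<ge> N k" for m k
  proof -
    have "integrable ?M (\<lambda>x. (norm (f x - F m x))\<^sup>2)"
      by (rule integrableI_nonneg) (use bound[OF that] in \<open>auto simp: order_le_less_trans\<close>)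
    then show ?thesis by (simp add: L2_def)
  qed
  have fL: "f \<in> L2 \<Omega>" using L2_add[OF dL[of 0 "N 0"] F[of "N 0"]] by simp
  have nb: "L2_norm \<Omega> (\<lambda>x. F m x - f x) \<le> (1/2)^k" if "m \<ge> N k" for m k
  proof -
    have "ennreal ((L2_norm \<Omega> (\<lambda>x. f x - F m x))\<^sup>2) \<le> ennreal (((1/2)^k)\<^sup>2)"
      using bound[OF that] unfolding L2_norm_power2
      by (subst (asm) nn_integral_eq_integral[OF L2_square_integrable[OF dL[OF that]]]) auto
    then have "(L2_norm \<Omega> (\<lambda>x. f x - F m x))\<^sup>2 \<le> ((1/2)^k)\<^sup>2" by (simp add: ennreal_le_iff)
    then show ?thesis by (subst L2_norm_minus_commute) (rule power2_le_imp_le, auto)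
  qed
  have "L2_lim \<Omega> F f"
  proof (rule LIMSEQ_I)
    fix e :: real assume "e > 0"
    then obtain k where "(1/2)^k < e" using real_arch_pow_inv[of e "1/2"] by auto
    then have "\<forall>n\<ge>N k. norm (L2_norm \<Omega> (\<lambda>x. F n x - f x) - 0) < e" using nb by (force intro: le_less_trans)
    then show "\<exists>no. \<forall>n\<ge>no. norm (L2_norm \<Omega> (\<lambda>x. F n x - f x) - 0) < e" by blast
  qed
  with fL show ?thesis by blast
qed

text \<open>Membership in H10 with the gradient exhibited: one sequence of test functions converges
  together with all its partial derivatives. Later arguments thus avoid the chosen
  \<open>weak_deriv\<close> inside \<open>H1_norm\<close>; \<open>H10_iff\<close> is the
  bridge.\<close>

definition H10_gradient :: "'a::euclidean_space set \<Rightarrow> ('a \<Rightarrow> complex) \<Rightarrow> ('a \<Rightarrow> 'a \<Rightarrow> complex) \<Rightarrow> bool" where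
  "H10_gradient \<Omega> u g \<longleftrightarrow> u \<in> L2 \<Omega> \<and> (\<forall>b\<in>Basis. g b \<in> L2 \<Omega>) \<and>
     (\<exists>\<phi>. (\<forall>n. \<phi> n \<in> test_functions \<Omega>) \<and> L2_lim \<Omega> \<phi> u \<and> (\<forall>b\<in>Basis. L2_lim \<Omega> (\<lambda>n. partial_deriv b (\<phi> n)) (g b)))"

lemma H10_gradientD:
  assumes "H10_gradient \<Omega> u g"
  shows "u \<in> L2 \<Omega>" "b \<in> Basis \<Longrightarrow> g b \<in> L2 \<Omega>"
  using assms by (auto simp: H10_gradient_def)

text \<open>The approximating functions vanish near the boundary, so no boundary term appears
  although \<eta> need not vanish there. This is stronger than having a weak derivative, and it is
  what permits extension by zero.\<close>

lemma H10_gradient_by_parts: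
  assumes u: "H10_gradient \<Omega> u g" and b: "b \<in> Basis" and \<Omega>: "\<Omega> \<in> sets lebesgue" and \<eta>: "\<eta> \<in> test_functions UNIV"
  shows "(\<integral>x. u x * partial_deriv b \<eta> x \<partial>lebesgue_on \<Omega>) = - (\<integral>x. g b x * \<eta> x \<partial>lebesgue_on \<Omega>)"
proof -
  obtain \<phi> where \<phi>: "\<And>n. \<phi> n \<in> test_functions \<Omega>" "L2_lim \<Omega> \<phi> u" "L2_lim \<Omega> (\<lambda>n. partial_deriv b (\<phi> n)) (g b)"
    using u b unfolding H10_gradient_def by blast
  note \<eta>L = test_functions_L2[OF \<eta> \<Omega>] test_functions_L2[OF test_functions_partial_deriv[OF \<eta> b] \<Omega>]
  note \<phi>L = test_functions_L2[OF \<phi>(1) \<Omega>] test_functions_L2[OF test_functions_partial_deriv[OF \<phi>(1) b] \<Omega>]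
  have lim: "(\<lambda>n. \<integral>x. \<phi> n x * partial_deriv b \<eta> x \<partial>lebesgue_on \<Omega>) \<longlonglongrightarrow> (\<integral>x. u x * partial_deriv b \<eta> x \<partial>lebesgue_on \<Omega>)"
    by (rule L2_lim_integral_right[OF \<phi>(2) \<phi>L(1) H10_gradientD(1)[OF u] \<eta>L(2)])
  have eq: "(\<integral>x. \<phi> n x * partial_deriv b \<eta> x \<partial>lebesgue_on \<Omega>) = - (\<integral>x. partial_deriv b (\<phi> n) x * \<eta> x \<partial>lebesgue_on \<Omega>)" for n
    using integration_by_parts[OF test_functions_smooth[OF \<eta>] \<phi>(1) b \<Omega>, of n] by (simp add: mult.commute)
  have "(\<lambda>n. - (\<integral>x. partial_deriv b (\<phi> n) x * \<eta> x \<partial>lebesgue_on \<Omega>)) \<longlonglongrightarrow> - (\<integral>x. g b x * \<eta> x \<partial>lebesgue_on \<Omega>)"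
    by (intro tendsto_minus L2_lim_integral_right[OF \<phi>(3) \<phi>L(2) H10_gradientD(2)[OF u b] \<eta>L(1)])
  from LIMSEQ_unique[OF lim[unfolded eq] this] show ?thesis .
qed

lemma H10_gradient_weak_deriv:
  assumes "H10_gradient \<Omega> u g" "b \<in> Basis" "\<Omega> \<in> sets lebesgue"
  shows "has_weak_deriv \<Omega> b u (g b)"
  unfolding has_weak_deriv_def
  using H10_gradient_by_parts[OF assms test_functions_mono[OF subset_UNIV]] by blast

lemma L2_norm_weak_deriv:
  assumes "open \<Omega>" "k \<in> L2 \<Omega>" "has_weak_deriv \<Omega> b w k"
  shows "L2_norm \<Omega> (weak_deriv \<Omega> b w) = L2_norm \<Omega> k"
proof -
  have "weak_deriv \<Omega> b w \<in> L2 \<Omega> \<and> has_weak_deriv \<Omega> b w (weak_deriv \<Omega> b w)"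
    unfolding weak_deriv_def by (rule someI[of _ k]) (use assms in simp)
  then show ?thesis
    using has_weak_deriv_unique[OF assms(1) _ assms(2) _ assms(3)] L2_measurable assms(2)
    by (intro L2_norm_cong_AE) auto
qed

text \<open>Weak derivatives are unique up to null sets, so the ones chosen inside
  \<open>H1_norm\<close> may be replaced by any at hand.\<close>

lemma H1_norm_eq:
  assumes "open \<Omega>" "\<And>b. b \<in> Basis \<Longrightarrow> k b \<in> L2 \<Omega>" "\<And>b. b \<in> Basis \<Longrightarrow> has_weak_deriv \<Omega> b w (k b)"
  shows "H1_norm \<Omega> w = sqrt ((L2_norm \<Omega> w)\<^sup>2 + (\<Sum>b\<in>Basis. (L2_norm \<Omega> (k b))\<^sup>2))"
proof -
  have "(\<Sum>b\<in>Basis. (L2_norm \<Omega> (weak_deriv \<Omega> b w))\<^sup>2) = (\<Sum>b\<in>Basis. (L2_norm \<Omega> (k b))\<^sup>2)"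
    by (intro sum.cong refl arg_cong[where f="\<lambda>x. x\<^sup>2"] L2_norm_weak_deriv[OF assms(1)] assms(2,3))
  then show ?thesis by (simp add: H1_norm_def)
qed

lemma H10_iff:
  assumes \<Omega>: "open \<Omega>"
  shows "u \<in> H10 \<Omega> \<longleftrightarrow> (\<exists>g. H10_gradient \<Omega> u g)"
proof
  have \<Omega>s: "\<Omega> \<in> sets lebesgue" using \<Omega> by simp
  have norm_eq: "H1_norm \<Omega> (\<lambda>x. \<phi> x - u x) = sqrt ((L2_norm \<Omega> (\<lambda>x. \<phi> x - u x))\<^sup>2 + (\<Sum>b\<in>Basis. (L2_norm \<Omega> (\<lambda>x. partial_deriv b \<phi> x - g b x))\<^sup>2))"
    if u: "u \<in> L2 \<Omega>" "\<And>b. b \<in> Basis \<Longrightarrow> g b \<in> L2 \<Omega>" "\<And>b. b \<in> Basis \<Longrightarrow> has_weak_deriv \<Omega> b u (g b)"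
      and \<phi>: "\<phi> \<in> test_functions \<Omega>" for \<phi> g
  proof (rule H1_norm_eq[OF \<Omega>])
    fix b :: 'a assume b: "b \<in> Basis"
    note \<phi>L = test_functions_L2[OF \<phi> \<Omega>s] test_functions_L2[OF test_functions_partial_deriv[OF \<phi> b] \<Omega>s]
    show "(\<lambda>x. partial_deriv b \<phi> x - g b x) \<in> L2 \<Omega>" by (intro L2_diff \<phi>L u b)
    show "has_weak_deriv \<Omega> b (\<lambda>x. \<phi> x - u x) (\<lambda>x. partial_deriv b \<phi> x - g b x)"
      by (intro has_weak_deriv_diff \<phi>L u b \<Omega>s has_weak_deriv_smooth test_functions_smooth[OF \<phi>])
  qed
  assume "u \<in> H10 \<Omega>"
  then obtain \<phi> where u: "u \<in> L2 \<Omega>" "\<And>b. b \<in> Basis \<Longrightarrow> \<exists>g\<in>L2 \<Omega>. has_weak_deriv \<Omega> b u g"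
    and \<phi>: "\<And>n. \<phi> n \<in> test_functions \<Omega>" and lim: "(\<lambda>n. H1_norm \<Omega> (\<lambda>x. \<phi> n x - u x)) \<longlonglongrightarrow> 0"
    by (auto simp: H10_def H1_def)
  obtain g where g: "\<And>b. b \<in> Basis \<Longrightarrow> g b \<in> L2 \<Omega>" "\<And>b. b \<in> Basis \<Longrightarrow> has_weak_deriv \<Omega> b u (g b)"
    using u(2) by metis
  have eq: "H1_norm \<Omega> (\<lambda>x. \<phi> n x - u x) = sqrt ((L2_norm \<Omega> (\<lambda>x. \<phi> n x - u x))\<^sup>2 + (\<Sum>b\<in>Basis. (L2_norm \<Omega> (\<lambda>x. partial_deriv b (\<phi> n) x - g b x))\<^sup>2))" for n
    by (rule norm_eq[OF u(1) _ _ \<phi>]) (use g in auto)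
  have "L2_lim \<Omega> \<phi> u"
  proof (rule tendsto_sandwich[OF _ _ tendsto_const lim])
    have "L2_norm \<Omega> (\<lambda>x. \<phi> n x - u x) \<le> H1_norm \<Omega> (\<lambda>x. \<phi> n x - u x)" for n
      unfolding eq by (rule real_le_rsqrt) (simp add: sum_nonneg)
    then show "\<forall>\<^sub>F n in sequentially. L2_norm \<Omega> (\<lambda>x. \<phi> n x - u x) \<le> H1_norm \<Omega> (\<lambda>x. \<phi> n x - u x)" by simp
  qed simp
  moreover have "L2_lim \<Omega> (\<lambda>n. partial_deriv b (\<phi> n)) (g b)" if b: "b \<in> Basis" for b
  proof (rule tendsto_sandwich[OF _ _ tendsto_const lim])
    have "L2_norm \<Omega> (\<lambda>x. partial_deriv b (\<phi> n) x - g b x) \<le> H1_norm \<Omega> (\<lambda>x. \<phi> n x - u x)" for n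
      unfolding eq
    proof (rule real_le_rsqrt)
      have "(L2_norm \<Omega> (\<lambda>x. partial_deriv b (\<phi> n) x - g b x))\<^sup>2 \<le> (\<Sum>b\<in>Basis. (L2_norm \<Omega> (\<lambda>x. partial_deriv b (\<phi> n) x - g b x))\<^sup>2)"
        using b by (intro member_le_sum) auto
      then show "(L2_norm \<Omega> (\<lambda>x. partial_deriv b (\<phi> n) x - g b x))\<^sup>2 \<le> (L2_norm \<Omega> (\<lambda>x. \<phi> n x - u x))\<^sup>2 + (\<Sum>b\<in>Basis. (L2_norm \<Omega> (\<lambda>x. partial_deriv b (\<phi> n) x - g b x))\<^sup>2)"
        by (simp add: add_increasing)
    qed
    then show "\<forall>\<^sub>F n in sequentially. L2_norm \<Omega> (\<lambda>x. partial_deriv b (\<phi> n) x - g b x) \<le> H1_norm \<Omega> (\<lambda>x. \<phi> n x - u x)" by simp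
  qed simp
  ultimately show "\<exists>g. H10_gradient \<Omega> u g" using u(1) g(1) \<phi> unfolding H10_gradient_def by blast
next
  have \<Omega>s: "\<Omega> \<in> sets lebesgue" using \<Omega> by simp
  assume "\<exists>g. H10_gradient \<Omega> u g"
  then obtain g where g: "H10_gradient \<Omega> u g" by blast
  then obtain \<phi> where \<phi>: "\<And>n. \<phi> n \<in> test_functions \<Omega>" "L2_lim \<Omega> \<phi> u" "\<And>b. b \<in> Basis \<Longrightarrow> L2_lim \<Omega> (\<lambda>n. partial_deriv b (\<phi> n)) (g b)"
    unfolding H10_gradient_def by blast
  note u = H10_gradientD[OF g]
  have "H1_norm \<Omega> (\<lambda>x. \<phi> n x - u x) = sqrt ((L2_norm \<Omega> (\<lambda>x. \<phi> n x - u x))\<^sup>2 + (\<Sum>b\<in>Basis. (L2_norm \<Omega> (\<lambda>x. partial_deriv b (\<phi> n) x - g b x))\<^sup>2))" for n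
  proof (rule H1_norm_eq[OF \<Omega>])
    fix b :: 'a assume b: "b \<in> Basis"
    note \<phi>L = test_functions_L2[OF \<phi>(1) \<Omega>s] test_functions_L2[OF test_functions_partial_deriv[OF \<phi>(1) b] \<Omega>s]
    show "(\<lambda>x. partial_deriv b (\<phi> n) x - g b x) \<in> L2 \<Omega>" by (intro L2_diff \<phi>L u b)
    show "has_weak_deriv \<Omega> b (\<lambda>x. \<phi> n x - u x) (\<lambda>x. partial_deriv b (\<phi> n) x - g b x)"
      by (intro has_weak_deriv_diff \<phi>L u b \<Omega>s has_weak_deriv_smooth test_functions_smooth[OF \<phi>(1)] H10_gradient_weak_deriv[OF g])
  qed
  moreover have "(\<lambda>n. sqrt ((L2_norm \<Omega> (\<lambda>x. \<phi> n x - u x))\<^sup>2 + (\<Sum>b\<in>Basis. (L2_norm \<Omega> (\<lambda>x. partial_deriv b (\<phi> n) x - g b x))\<^sup>2))) \<longlonglongrightarrow> sqrt (0\<^sup>2 + (\<Sum>b\<in>(Basis::'a set). 0\<^sup>2))"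
    by (intro tendsto_intros \<phi>)
  ultimately have "(\<lambda>n. H1_norm \<Omega> (\<lambda>x. \<phi> n x - u x)) \<longlonglongrightarrow> 0" by simp
  then show "u \<in> H10 \<Omega>"
    unfolding H10_def H1_def using u H10_gradient_weak_deriv[OF g _ \<Omega>s] \<phi>(1) by blast
qed

lemma H10_gradient_test:
  assumes "\<phi> \<in> test_functions \<Omega>" "\<Omega> \<in> sets lebesgue"
  shows "H10_gradient \<Omega> \<phi> (\<lambda>b. partial_deriv b \<phi>)"
  unfolding H10_gradient_def
  by (intro conjI ballI exI[of _ "\<lambda>n. \<phi>"] allI L2_lim_const test_functions_L2[OF _ assms(2)] test_functions_partial_deriv assms(1))
    (use test_functions_partial_deriv[OF assms(1)] assms(1) in auto)

lemma H10_gradient_cong_AE: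
  assumes "H10_gradient \<Omega> u g" "\<Omega> \<in> sets lebesgue" "AE x in lebesgue_on \<Omega>. u x = u' x"
  shows "H10_gradient \<Omega> u' g"
proof -
  obtain \<phi> where \<phi>: "\<And>n. \<phi> n \<in> test_functions \<Omega>" "L2_lim \<Omega> \<phi> u" "\<And>b. b \<in> Basis \<Longrightarrow> L2_lim \<Omega> (\<lambda>n. partial_deriv b (\<phi> n)) (g b)"
    using assms(1) unfolding H10_gradient_def by blast
  note u = H10_gradientD[OF assms(1)]
  have u': "u' \<in> L2 \<Omega>" by (rule L2_cong_AE[OF assms(2) u(1) assms(3)])
  have "L2_norm \<Omega> (\<lambda>x. \<phi> n x - u' x) = L2_norm \<Omega> (\<lambda>x. \<phi> n x - u x)" for n
    using assms(3) by (intro L2_norm_cong_AE L2_measurable[OF L2_diff] test_functions_L2[OF \<phi>(1) assms(2)] u u') auto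
  then show ?thesis unfolding H10_gradient_def using u(2) u' \<phi> by (intro conjI exI[of _ \<phi>]) auto
qed

lemma H10_gradient_diff:
  assumes "H10_gradient \<Omega> u g" "H10_gradient \<Omega> v h" "\<Omega> \<in> sets lebesgue"
  shows "H10_gradient \<Omega> (\<lambda>x. u x - v x) (\<lambda>b x. g b x - h b x)"
proof -
  obtain \<phi> where \<phi>: "\<And>n. \<phi> n \<in> test_functions \<Omega>" "L2_lim \<Omega> \<phi> u" "\<And>b. b \<in> Basis \<Longrightarrow> L2_lim \<Omega> (\<lambda>n. partial_deriv b (\<phi> n)) (g b)"
    using assms(1) unfolding H10_gradient_def by blast
  obtain \<psi> where \<psi>: "\<And>n. \<psi> n \<in> test_functions \<Omega>" "L2_lim \<Omega> \<psi> v" "\<And>b. b \<in> Basis \<Longrightarrow> L2_lim \<Omega> (\<lambda>n. partial_deriv b (\<psi> n)) (h b)"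
    using assms(2) unfolding H10_gradient_def by blast
  note u = H10_gradientD[OF assms(1)] and v = H10_gradientD[OF assms(2)]
  have d: "L2_lim \<Omega> (\<lambda>n x. F n x - F' n x) (\<lambda>x. f x - f' x)"
    if "L2_lim \<Omega> F f" "L2_lim \<Omega> F' f'" "\<And>n. F n \<in> L2 \<Omega>" "\<And>n. F' n \<in> L2 \<Omega>" "f \<in> L2 \<Omega>" "f' \<in> L2 \<Omega>" for F F' f f'
    using L2_lim_add[OF that(1) L2_lim_cmult[OF that(2), of "-1"] that(3) L2_cmult[OF that(4)] that(5) L2_cmult[OF that(6)]] by simp
  show ?thesis
    unfolding H10_gradient_def
  proof (intro conjI ballI exI[of _ "\<lambda>n x. \<phi> n x - \<psi> n x"] allI)
    show "(\<lambda>x. u x - v x) \<in> L2 \<Omega>" by (intro L2_diff u v)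
    show "L2_lim \<Omega> (\<lambda>n x. \<phi> n x - \<psi> n x) (\<lambda>x. u x - v x)"
      by (intro d \<phi> \<psi> u v test_functions_L2[OF \<phi>(1) assms(3)] test_functions_L2[OF \<psi>(1) assms(3)])
    show "(\<lambda>x. \<phi> n x - \<psi> n x) \<in> test_functions \<Omega>" for n by (intro test_functions_diff \<phi> \<psi>)
    fix b :: 'a assume b: "b \<in> Basis"
    show "(\<lambda>x. g b x - h b x) \<in> L2 \<Omega>" by (intro L2_diff u v b)
    show "L2_lim \<Omega> (\<lambda>n. partial_deriv b (\<lambda>x. \<phi> n x - \<psi> n x)) (\<lambda>x. g b x - h b x)"
      unfolding partial_deriv_diff[OF test_functions_smooth[OF \<phi>(1)] test_functions_smooth[OF \<psi>(1)]]
      by (intro d \<phi> \<psi> u v b test_functions_L2[OF test_functions_partial_deriv[OF \<phi>(1) b] assms(3)] test_functions_L2[OF test_functions_partial_deriv[OF \<psi>(1) b] assms(3)])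
  qed
qed

lemma H10_gradient_cnj:
  assumes "H10_gradient \<Omega> u g"
  shows "H10_gradient \<Omega> (\<lambda>x. cnj (u x)) (\<lambda>b x. cnj (g b x))"
proof -
  obtain \<phi> where \<phi>: "\<And>n. \<phi> n \<in> test_functions \<Omega>" "L2_lim \<Omega> \<phi> u" "\<And>b. b \<in> Basis \<Longrightarrow> L2_lim \<Omega> (\<lambda>n. partial_deriv b (\<phi> n)) (g b)"
    using assms(1) unfolding H10_gradient_def by blast
  have c: "L2_lim \<Omega> (\<lambda>n x. cnj (F n x)) (\<lambda>x. cnj (f x))" if "L2_lim \<Omega> F f" for F f
    using that L2_norm_cnj[of \<Omega> "\<lambda>x. F _ x - f x"] by simp
  show ?thesis
    unfolding H10_gradient_def
    by (intro conjI ballI exI[of _ "\<lambda>n x. cnj (\<phi> n x)"] allI)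
      (use \<phi> c H10_gradientD[OF assms] in \<open>auto intro: L2_cnj test_functions_cnj simp: partial_deriv_cnj[OF test_functions_smooth[OF \<phi>(1)]]\<close>)
qed

section \<open>Multiplication by a coordinate\<close>

lemma bounded_inner_bound:
  assumes "bounded \<Omega>" obtains C where "\<And>x. x \<in> \<Omega> \<Longrightarrow> norm (complex_of_real (x \<bullet> v)) \<le> C"
proof -
  obtain B where B: "\<And>x. x \<in> \<Omega> \<Longrightarrow> norm x \<le> B" using assms unfolding bounded_iff by blast
  have "\<bar>x \<bullet> v\<bar> \<le> B * norm v" if "x \<in> \<Omega>" for x
    using Cauchy_Schwarz_ineq2[of x v] mult_right_mono[OF B[OF that], of "norm v"] by simp
  then show ?thesis using that[of "B * norm v"] by simp
qed

lemma L2_coordinate_mult: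
  assumes "bounded \<Omega>" "f \<in> L2 \<Omega>"
  shows "(\<lambda>x. complex_of_real (x \<bullet> v) * f x) \<in> L2 \<Omega>"
proof -
  obtain C where C: "\<And>x. x \<in> \<Omega> \<Longrightarrow> norm (complex_of_real (x \<bullet> v)) \<le> C" using bounded_inner_bound[OF assms(1)] by blast
  show ?thesis by (rule L2_mult_bounded[OF assms(2) smooth_measurable[OF smooth_inner] C])
qed

text \<open>On a bounded set the coordinate is a bounded multiplier, so multiplying the
  approximating test functions by it preserves L2 convergence, and the product rule handles their
  derivatives.\<close>

lemma H10_gradient_coordinate_mult:
  assumes u: "H10_gradient \<Omega> u g" and \<Omega>: "bounded \<Omega>" "\<Omega> \<in> sets lebesgue"
  shows "H10_gradient \<Omega> (\<lambda>x. complex_of_real (x \<bullet> v) * u x) (\<lambda>b x. complex_of_real (x \<bullet> v) * g b x + of_real (b \<bullet> v) * u x)"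
proof -
  obtain \<phi> where \<phi>: "\<And>n. \<phi> n \<in> test_functions \<Omega>" "L2_lim \<Omega> \<phi> u" "\<And>b. b \<in> Basis \<Longrightarrow> L2_lim \<Omega> (\<lambda>n. partial_deriv b (\<phi> n)) (g b)"
    using u unfolding H10_gradient_def by blast
  note uL = H10_gradientD[OF u]
  obtain C where C: "\<And>x. x \<in> \<Omega> \<Longrightarrow> norm (complex_of_real (x \<bullet> v)) \<le> C" using bounded_inner_bound[OF \<Omega>(1)] by blast
  have m: "L2_lim \<Omega> (\<lambda>n x. complex_of_real (x \<bullet> v) * F n x) (\<lambda>x. complex_of_real (x \<bullet> v) * f x)"
    if "L2_lim \<Omega> F f" "\<And>n. F n \<in> L2 \<Omega>" "f \<in> L2 \<Omega>" for F f
    by (rule L2_lim_mult_bounded[OF that smooth_measurable[OF smooth_inner] C])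
  note \<phi>L = test_functions_L2[OF \<phi>(1) \<Omega>(2)]
  show ?thesis
    unfolding H10_gradient_def
  proof (intro conjI ballI exI[of _ "\<lambda>n x. complex_of_real (x \<bullet> v) * \<phi> n x"] allI)
    show "(\<lambda>x. complex_of_real (x \<bullet> v) * u x) \<in> L2 \<Omega>" by (rule L2_coordinate_mult[OF \<Omega>(1) uL(1)])
    show "L2_lim \<Omega> (\<lambda>n x. complex_of_real (x \<bullet> v) * \<phi> n x) (\<lambda>x. complex_of_real (x \<bullet> v) * u x)"
      by (rule m[OF \<phi>(2) \<phi>L uL(1)])
    show "(\<lambda>x. complex_of_real (x \<bullet> v) * \<phi> n x) \<in> test_functions \<Omega>" for n by (rule test_functions_mult[OF \<phi>(1) smooth_inner])
    fix b :: 'a assume b: "b \<in> Basis"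
    note d\<phi>L = test_functions_L2[OF test_functions_partial_deriv[OF \<phi>(1) b] \<Omega>(2)]
    show "(\<lambda>x. complex_of_real (x \<bullet> v) * g b x + of_real (b \<bullet> v) * u x) \<in> L2 \<Omega>"
      by (intro L2_add L2_coordinate_mult[OF \<Omega>(1)] L2_cmult uL b)
    show "L2_lim \<Omega> (\<lambda>n. partial_deriv b (\<lambda>x. complex_of_real (x \<bullet> v) * \<phi> n x)) (\<lambda>x. complex_of_real (x \<bullet> v) * g b x + of_real (b \<bullet> v) * u x)"
      unfolding partial_deriv_mult[OF smooth_inner test_functions_smooth[OF \<phi>(1)]] partial_deriv_inner
      by (intro L2_lim_add m L2_lim_cmult \<phi> \<phi>L uL b d\<phi>L L2_cmult L2_coordinate_mult[OF \<Omega>(1)])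
  qed
qed

text \<open>The commutator \<open>[\<Delta>, x\<^sub>i] = 2 \<partial>\<^sub>i\<close> in weak form.
  The equation for \<open>u\<close> is tested with \<open>x\<^sub>i \<phi>\<close>, and the
  derivative of \<phi> that remains is moved to \<open>u\<close> with a change of sign.\<close>

lemma has_distr_laplacian_coordinate_mult:
  assumes u: "has_distr_laplacian \<Omega> u f" "f \<in> L2 \<Omega>" "u \<in> L2 \<Omega>" and g: "has_weak_deriv \<Omega> i u g" "g \<in> L2 \<Omega>"
    and i: "i \<in> Basis" and \<Omega>: "bounded \<Omega>" "\<Omega> \<in> sets lebesgue"
  shows "has_distr_laplacian \<Omega> (\<lambda>x. complex_of_real (x \<bullet> i) * u x) (\<lambda>x. complex_of_real (x \<bullet> i) * f x + 2 * g x)"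
  unfolding has_distr_laplacian_def
proof
  fix \<phi> assume \<phi>: "\<phi> \<in> test_functions \<Omega>"
  note s = test_functions_smooth[OF \<phi>]
  have T: "(\<lambda>x. complex_of_real (x \<bullet> i) * \<phi> x) \<in> test_functions \<Omega>" by (rule test_functions_mult[OF \<phi> smooth_inner])
  have lap: "laplacian (\<lambda>x. complex_of_real (x \<bullet> i) * \<phi> x) x = complex_of_real (x \<bullet> i) * laplacian \<phi> x + 2 * partial_deriv i \<phi> x" for x
  proof -
    have "(\<Sum>b\<in>Basis. complex_of_real (b \<bullet> i) * partial_deriv b \<phi> x) = (\<Sum>b\<in>Basis. if b = i then partial_deriv b \<phi> x else 0)"
      by (intro sum.cong refl) (use i in \<open>auto simp: inner_Basis\<close>)
    also have "\<dots> = partial_deriv i \<phi> x" using i by simp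
    finally show ?thesis
      unfolding laplacian_mult[OF smooth_inner s] laplacian_inner partial_deriv_inner by simp
  qed
  note L = test_functions_L2[OF \<phi> \<Omega>(2)] test_functions_L2[OF test_functions_partial_deriv[OF \<phi> i] \<Omega>(2)]
    test_functions_L2[OF test_functions_laplacian[OF T] \<Omega>(2)] test_functions_L2[OF T \<Omega>(2)]
  have "(\<integral>x. complex_of_real (x \<bullet> i) * u x * laplacian \<phi> x \<partial>lebesgue_on \<Omega>)
      = (\<integral>x. u x * laplacian (\<lambda>x. complex_of_real (x \<bullet> i) * \<phi> x) x - 2 * (u x * partial_deriv i \<phi> x) \<partial>lebesgue_on \<Omega>)"
    unfolding lap by (simp add: algebra_simps)
  also have "\<dots> = (\<integral>x. u x * laplacian (\<lambda>x. complex_of_real (x \<bullet> i) * \<phi> x) x \<partial>lebesgue_on \<Omega>) - 2 * (\<integral>x. u x * partial_deriv i \<phi> x \<partial>lebesgue_on \<Omega>)"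
    using L2_prod_integrable(1)[OF u(3) L(3)] L2_prod_integrable(1)[OF u(3) L(2)] by simp
  also have "\<dots> = (\<integral>x. f x * (complex_of_real (x \<bullet> i) * \<phi> x) \<partial>lebesgue_on \<Omega>) + 2 * (\<integral>x. g x * \<phi> x \<partial>lebesgue_on \<Omega>)"
    using u(1) g(1) \<phi> T by (simp add: has_distr_laplacian_def has_weak_deriv_def)
  also have "\<dots> = (\<integral>x. f x * (complex_of_real (x \<bullet> i) * \<phi> x) + 2 * (g x * \<phi> x) \<partial>lebesgue_on \<Omega>)"
    using L2_prod_integrable(1)[OF u(2) L(4)] L2_prod_integrable(1)[OF g(2) L(1)] by simp
  also have "\<dots> = (\<integral>x. (complex_of_real (x \<bullet> i) * f x + 2 * g x) * \<phi> x \<partial>lebesgue_on \<Omega>)"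
    by (simp add: algebra_simps)
  finally show "(\<integral>x. complex_of_real (x \<bullet> i) * u x * laplacian \<phi> x \<partial>lebesgue_on \<Omega>) = (\<integral>x. (complex_of_real (x \<bullet> i) * f x + 2 * g x) * \<phi> x \<partial>lebesgue_on \<Omega>)" .
qed

section \<open>The Dirichlet Laplacian and its resolvent\<close>

text \<open>The graph of the Dirichlet Laplacian as a relation: \<open>v\<close> may be any
  representative instead of the one selected by \<open>dirichlet_laplacian\<close>. For open
  \<Omega> the relation is therefore stable under changes of both functions on null sets.\<close>

definition dirichlet_graph :: "'a::euclidean_space set \<Rightarrow> ('a \<Rightarrow> complex) \<Rightarrow> ('a \<Rightarrow> complex) \<Rightarrow> bool" where
  "dirichlet_graph \<Omega> u v \<longleftrightarrow> u \<in> H10 \<Omega> \<and> v \<in> L2 \<Omega> \<and> has_distr_laplacian \<Omega> u v"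

lemma dirichlet_graph_gradient:
  assumes "dirichlet_graph \<Omega> u v" "open \<Omega>"
  obtains g where "H10_gradient \<Omega> u g"
  using assms H10_iff by (auto simp: dirichlet_graph_def)

lemma dirichlet_graph_L2:
  assumes "dirichlet_graph \<Omega> u v"
  shows "u \<in> L2 \<Omega>" "v \<in> L2 \<Omega>"
  using assms by (auto simp: dirichlet_graph_def H10_def H1_def)

lemma dirichlet_graph_cong_AE:
  assumes "dirichlet_graph \<Omega> u v" "open \<Omega>" "AE x in lebesgue_on \<Omega>. u x = u' x" "AE x in lebesgue_on \<Omega>. v x = v' x"
  shows "dirichlet_graph \<Omega> u' v'"
proof -
  have \<Omega>: "\<Omega> \<in> sets lebesgue" using assms(2) by simp
  obtain g where "H10_gradient \<Omega> u g" using dirichlet_graph_gradient[OF assms(1,2)] by blast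
  then have "u' \<in> H10 \<Omega>" using H10_gradient_cong_AE[OF _ \<Omega> assms(3)] H10_iff[OF assms(2)] by blast
  then show ?thesis
    using assms(1) L2_cong_AE[OF \<Omega> _ assms(4)] has_distr_laplacian_cong_AE[OF _ \<Omega> assms(3,4)]
    by (auto simp: dirichlet_graph_def)
qed

lemma dirichlet_graph_diff:
  assumes "dirichlet_graph \<Omega> u v" "dirichlet_graph \<Omega> u' v'" "open \<Omega>"
  shows "dirichlet_graph \<Omega> (\<lambda>x. u x - u' x) (\<lambda>x. v x - v' x)"
proof -
  have \<Omega>: "\<Omega> \<in> sets lebesgue" using assms(3) by simp
  obtain g g' where "H10_gradient \<Omega> u g" "H10_gradient \<Omega> u' g'"
    using dirichlet_graph_gradient assms by metis
  then have "(\<lambda>x. u x - u' x) \<in> H10 \<Omega>"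
    using H10_gradient_diff[OF _ _ \<Omega>] H10_iff[OF assms(3)] by blast
  moreover have "has_distr_laplacian \<Omega> (\<lambda>x. u x - u' x) (\<lambda>x. v x - v' x)"
    unfolding has_distr_laplacian_def
  proof
    fix \<phi> assume \<phi>: "\<phi> \<in> test_functions \<Omega>"
    note L = test_functions_L2[OF \<phi> \<Omega>] test_functions_L2[OF test_functions_laplacian[OF \<phi>] \<Omega>]
    note D = dirichlet_graph_L2[OF assms(1)] dirichlet_graph_L2[OF assms(2)]
    note I = L2_prod_integrable(1)[OF D(1) L(2)] L2_prod_integrable(1)[OF D(3) L(2)]
      L2_prod_integrable(1)[OF D(2) L(1)] L2_prod_integrable(1)[OF D(4) L(1)]
    show "(\<integral>x. (u x - u' x) * laplacian \<phi> x \<partial>lebesgue_on \<Omega>) = (\<integral>x. (v x - v' x) * \<phi> x \<partial>lebesgue_on \<Omega>)"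
      using assms(1,2) \<phi> I by (simp add: dirichlet_graph_def has_distr_laplacian_def left_diff_distrib)
  qed
  ultimately show ?thesis
    using L2_diff[OF dirichlet_graph_L2(2)[OF assms(1)] dirichlet_graph_L2(2)[OF assms(2)]] by (simp add: dirichlet_graph_def)
qed

lemma dirichlet_graph_test:
  assumes "\<phi> \<in> test_functions \<Omega>" "open \<Omega>"
  shows "dirichlet_graph \<Omega> \<phi> (laplacian \<phi>)"
proof -
  have \<Omega>: "\<Omega> \<in> sets lebesgue" using assms(2) by simp
  show ?thesis
    unfolding dirichlet_graph_def
    using H10_gradient_test[OF assms(1) \<Omega>] H10_iff[OF assms(2)] test_functions_L2[OF test_functions_laplacian[OF assms(1)] \<Omega>]
      has_distr_laplacian_smooth[OF test_functions_smooth[OF assms(1)] \<Omega>] by blast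
qed

lemma dirichlet_graph_coordinate_mult:
  assumes "dirichlet_graph \<Omega> u v" "H10_gradient \<Omega> u g" "i \<in> Basis" "bounded \<Omega>" "open \<Omega>"
  shows "dirichlet_graph \<Omega> (\<lambda>x. complex_of_real (x \<bullet> i) * u x) (\<lambda>x. complex_of_real (x \<bullet> i) * v x + 2 * g i x)"
proof -
  have \<Omega>: "\<Omega> \<in> sets lebesgue" using assms(5) by simp
  note D = dirichlet_graph_L2[OF assms(1)] H10_gradientD(2)[OF assms(2,3)]
  have "(\<lambda>x. complex_of_real (x \<bullet> i) * u x) \<in> H10 \<Omega>"
    using H10_gradient_coordinate_mult[OF assms(2,4) \<Omega>] H10_iff[OF assms(5)] by blast
  moreover have "(\<lambda>x. complex_of_real (x \<bullet> i) * v x + 2 * g i x) \<in> L2 \<Omega>"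
    by (intro L2_add L2_coordinate_mult[OF assms(4)] L2_cmult D)
  moreover have "has_distr_laplacian \<Omega> (\<lambda>x. complex_of_real (x \<bullet> i) * u x) (\<lambda>x. complex_of_real (x \<bullet> i) * v x + 2 * g i x)"
    by (rule has_distr_laplacian_coordinate_mult[OF _ D(2,1) H10_gradient_weak_deriv[OF assms(2,3) \<Omega>] D(3) assms(3,4) \<Omega>])
      (use assms(1) in \<open>simp add: dirichlet_graph_def\<close>)
  ultimately show ?thesis by (simp add: dirichlet_graph_def)
qed

section \<open>The energy form\<close>

lemma weak_laplacian_form:
  assumes "has_distr_laplacian \<Omega> u v" "u \<in> L2 \<Omega>" "\<And>b. b \<in> Basis \<Longrightarrow> g b \<in> L2 \<Omega>" "\<And>b. b \<in> Basis \<Longrightarrow> has_weak_deriv \<Omega> b u (g b)"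
    "\<phi> \<in> test_functions \<Omega>" "\<Omega> \<in> sets lebesgue"
  shows "(\<Sum>b\<in>Basis. \<integral>x. g b x * partial_deriv b \<phi> x \<partial>lebesgue_on \<Omega>) = - (\<integral>x. v x * \<phi> x \<partial>lebesgue_on \<Omega>)"
proof -
  have "(\<integral>x. v x * \<phi> x \<partial>lebesgue_on \<Omega>) = (\<integral>x. u x * laplacian \<phi> x \<partial>lebesgue_on \<Omega>)"
    using assms(1,5) by (simp add: has_distr_laplacian_def)
  also have "\<dots> = (\<Sum>b\<in>Basis. \<integral>x. u x * partial_deriv b (partial_deriv b \<phi>) x \<partial>lebesgue_on \<Omega>)"
    unfolding laplacian_def sum_distrib_left
    by (intro Bochner_Integration.integral_sum L2_prod_integrable(1) assms(2) test_functions_L2[OF _ assms(6)] test_functions_partial_deriv) (use assms in auto)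
  also have "\<dots> = (\<Sum>b\<in>Basis. - (\<integral>x. g b x * partial_deriv b \<phi> x \<partial>lebesgue_on \<Omega>))"
    using assms(4) test_functions_partial_deriv[OF assms(5)] by (intro sum.cong refl) (auto simp: has_weak_deriv_def)
  finally show ?thesis by (simp add: sum_negf)
qed

text \<open>Green's formula without boundary term: by density the weak equation may be tested with
  any element of H10. The pairing is bilinear, without conjugation.\<close>

lemma dirichlet_graph_energy:
  assumes "dirichlet_graph \<Omega> u v" "H10_gradient \<Omega> u g" "H10_gradient \<Omega> w k" "open \<Omega>"
  shows "(\<Sum>b\<in>Basis. \<integral>x. g b x * k b x \<partial>lebesgue_on \<Omega>) = - (\<integral>x. v x * w x \<partial>lebesgue_on \<Omega>)"
proof -
  have \<Omega>: "\<Omega> \<in> sets lebesgue" using assms(4) by simp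
  obtain \<phi> where \<phi>: "\<And>n. \<phi> n \<in> test_functions \<Omega>" "L2_lim \<Omega> \<phi> w" "\<And>b. b \<in> Basis \<Longrightarrow> L2_lim \<Omega> (\<lambda>n. partial_deriv b (\<phi> n)) (k b)"
    using assms(3) unfolding H10_gradient_def by blast
  note u = dirichlet_graph_L2[OF assms(1)] H10_gradientD(2)[OF assms(2)] and w = H10_gradientD[OF assms(3)]
  note \<phi>L = test_functions_L2[OF \<phi>(1) \<Omega>] test_functions_L2[OF test_functions_partial_deriv[OF \<phi>(1)] \<Omega>]
  have lim1: "(\<lambda>n. \<Sum>b\<in>Basis. \<integral>x. g b x * partial_deriv b (\<phi> n) x \<partial>lebesgue_on \<Omega>) \<longlonglongrightarrow> (\<Sum>b\<in>Basis. \<integral>x. g b x * k b x \<partial>lebesgue_on \<Omega>)"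
    by (intro tendsto_sum L2_lim_integral[OF L2_lim_const] \<phi> u w \<phi>L)
  have lim2: "(\<lambda>n. - (\<integral>x. v x * \<phi> n x \<partial>lebesgue_on \<Omega>)) \<longlonglongrightarrow> - (\<integral>x. v x * w x \<partial>lebesgue_on \<Omega>)"
    by (intro tendsto_minus L2_lim_integral[OF L2_lim_const] \<phi> u w \<phi>L)
  have eq: "(\<Sum>b\<in>Basis. \<integral>x. g b x * partial_deriv b (\<phi> n) x \<partial>lebesgue_on \<Omega>) = - (\<integral>x. v x * \<phi> n x \<partial>lebesgue_on \<Omega>)" for n
    by (rule weak_laplacian_form[OF _ u(1) u(3) H10_gradient_weak_deriv[OF assms(2) _ \<Omega>] \<phi>(1) \<Omega>])
      (use assms(1) in \<open>simp_all add: dirichlet_graph_def\<close>)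
  from LIMSEQ_unique[OF lim1[unfolded eq] lim2] show ?thesis .
qed

text \<open>Injectivity of \<open>1 - \<Delta>\<close>: testing with the conjugate of
  \<open>w\<close> equates the squared norm of its gradient with minus the squared norm of
  \<open>w\<close>.\<close>

lemma dirichlet_graph_self_imp_0:
  assumes "dirichlet_graph \<Omega> w w" "open \<Omega>"
  shows "AE x in lebesgue_on \<Omega>. w x = 0"
proof -
  obtain g where g: "H10_gradient \<Omega> w g" using dirichlet_graph_gradient[OF assms] by blast
  note w = H10_gradientD[OF g]
  have sq: "(\<integral>x. f x * cnj (f x) \<partial>lebesgue_on \<Omega>) = complex_of_real ((L2_norm \<Omega> f)\<^sup>2)" for f
    unfolding complex_norm_square[symmetric] L2_norm_power2 by (rule integral_complex_of_real)
  have "complex_of_real (\<Sum>b\<in>Basis. (L2_norm \<Omega> (g b))\<^sup>2) = complex_of_real (- (L2_norm \<Omega> w)\<^sup>2)"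
    using dirichlet_graph_energy[OF assms(1) g H10_gradient_cnj[OF g] assms(2)] by (simp only: sq of_real_sum of_real_minus)
  then have "(\<Sum>b\<in>Basis. (L2_norm \<Omega> (g b))\<^sup>2) = - (L2_norm \<Omega> w)\<^sup>2" by (simp only: of_real_eq_iff)
  moreover have "(\<Sum>b\<in>Basis. (L2_norm \<Omega> (g b))\<^sup>2) \<ge> 0" by (intro sum_nonneg) simp
  moreover have "(L2_norm \<Omega> w)\<^sup>2 \<ge> 0" by simp
  ultimately have "(L2_norm \<Omega> w)\<^sup>2 = 0" by linarith
  then show ?thesis using L2_norm_eq_0_imp[OF w(1)] by simp
qed

text \<open>The first variation vanishes at a minimum. The test value divides by
  \<open>a + 1\<close> so that it also covers \<open>a = 0\<close>.\<close>

lemma quadratic_nonneg_imp_0: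
  fixes a c :: real
  assumes "a \<ge> 0" "\<And>t. t\<^sup>2 * a + 2 * t * c \<ge> 0"
  shows "c = 0"
proof -
  define t where "t = - c / (a + 1)"
  have ts: "t * (a + 1) = - c" using assms(1) by (simp add: t_def)
  have "0 \<le> (t\<^sup>2 * a + 2 * t * c) * (a + 1)\<^sup>2" using assms(2)[of t] by simp
  also have "\<dots> = (t * (a + 1))\<^sup>2 * a + 2 * (t * (a + 1)) * c * (a + 1)" by (simp add: power2_eq_square algebra_simps)
  also have "\<dots> = - (c\<^sup>2 * (a + 2))" unfolding ts by (simp add: power2_eq_square algebra_simps)
  finally have "c\<^sup>2 * (a + 2) \<le> 0" by simp
  then show ?thesis using assms(1) by (simp add: mult_le_0_iff)
qed

text \<open>With the function indexed by \<open>None\<close>, the squared norm of \<open>H1\<close> is a single sum over \<open>option\<close>.\<close>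

definition H1_component :: "('a::euclidean_space \<Rightarrow> complex) \<Rightarrow> 'a option \<Rightarrow> 'a \<Rightarrow> complex" where
  "H1_component \<phi> k = (case k of None \<Rightarrow> \<phi> | Some b \<Rightarrow> partial_deriv b \<phi>)"

lemma H1_component_add:
  "smooth \<phi> \<Longrightarrow> smooth \<psi> \<Longrightarrow> H1_component (\<lambda>x. \<phi> x + \<psi> x) k = (\<lambda>x. H1_component \<phi> k x + H1_component \<psi> k x)"
  by (auto simp: H1_component_def partial_deriv_add split: option.split)

lemma H1_component_cmult:
  "smooth \<phi> \<Longrightarrow> H1_component (\<lambda>x. c * \<phi> x) k = (\<lambda>x. c * H1_component \<phi> k x)"
  by (auto simp: H1_component_def partial_deriv_cmult split: option.split)

text \<open>The resolvent equation \<open>u - \<Delta> u = f\<close> is solved by minimising the energy over test functions.\<close>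

lemma dirichlet_resolvent_exists:
  fixes \<Omega> :: "'a::euclidean_space set"
  assumes \<Omega>: "open \<Omega>" "bounded \<Omega>" and f: "f \<in> L2 \<Omega>"
  shows "\<exists>u. dirichlet_graph \<Omega> u (\<lambda>x. u x - f x)"
proof -
  have \<Omega>s: "\<Omega> \<in> sets lebesgue" using \<Omega> by simp
  have \<Omega>m: "\<Omega> \<in> lmeasurable" using \<Omega> by (intro bounded_set_imp_lmeasurable) auto
  let ?M = "lebesgue_on \<Omega>"
  define K :: "'a option set" where "K = insert None (Some ` Basis)"
  have K: "finite K" "None \<in> K" "\<And>b. b \<in> Basis \<Longrightarrow> Some b \<in> K" by (auto simp: K_def)
  have compL: "H1_component \<phi> k \<in> L2 \<Omega>" if "\<phi> \<in> test_functions \<Omega>" "k \<in> K" for \<phi> k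
    using that(2) test_functions_L2[OF that(1) \<Omega>s] test_functions_L2[OF test_functions_partial_deriv[OF that(1)] \<Omega>s]
    by (auto simp: K_def H1_component_def)
  define N where "N \<phi> = (\<Sum>k\<in>K. (L2_norm \<Omega> (H1_component \<phi> k))\<^sup>2)" for \<phi>
  define P where "P \<phi> \<psi> = (\<Sum>k\<in>K. Re (\<integral>x. H1_component \<phi> k x * cnj (H1_component \<psi> k x) \<partial>?M))" for \<phi> \<psi>
  define L where "L \<phi> = Re (\<integral>x. \<phi> x * cnj (f x) \<partial>?M)" for \<phi>
  define J where "J \<phi> = N \<phi> - 2 * L \<phi>" for \<phi>
  note T = test_functions_smooth[of _ \<Omega>]
  have N0: "N \<phi> \<ge> 0" for \<phi> by (simp add: N_def sum_nonneg)
  have N_ge: "(L2_norm \<Omega> (H1_component \<phi> k))\<^sup>2 \<le> N \<phi>" if "k \<in> K" for \<phi> k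
    unfolding N_def using that K(1) by (intro member_le_sum) auto
  have Nmul: "N (\<lambda>x. of_real t * \<phi> x) = t\<^sup>2 * N \<phi>" if "\<phi> \<in> test_functions \<Omega>" for t \<phi>
    unfolding N_def H1_component_cmult[OF T[OF that]] L2_norm_cmult by (simp add: power_mult_distrib sum_distrib_left)
  have Pmul: "P \<phi> (\<lambda>x. of_real t * \<psi> x) = t * P \<phi> \<psi>" if "\<psi> \<in> test_functions \<Omega>" for t \<phi> \<psi>
  proof -
    have "(\<integral>x. H1_component \<phi> k x * cnj (of_real t * H1_component \<psi> k x) \<partial>?M) = of_real t * (\<integral>x. H1_component \<phi> k x * cnj (H1_component \<psi> k x) \<partial>?M)" for k
      by (subst integral_mult_right_zero[symmetric]) (simp add: mult_ac)
    then show ?thesis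
      unfolding P_def H1_component_cmult[OF T[OF that]] by (simp add: sum_distrib_left)
  qed
  have Lmul: "L (\<lambda>x. of_real t * \<phi> x) = t * L \<phi>" for t \<phi>
    unfolding L_def by (simp add: mult.assoc)
  have Jadd: "J (\<lambda>x. \<phi> x + \<psi> x) = J \<phi> + N \<psi> + 2 * (P \<phi> \<psi> - L \<psi>)"
    if "\<phi> \<in> test_functions \<Omega>" "\<psi> \<in> test_functions \<Omega>" for \<phi> \<psi>
  proof -
    have "N (\<lambda>x. \<phi> x + \<psi> x) = N \<phi> + N \<psi> + 2 * P \<phi> \<psi>"
      unfolding N_def P_def H1_component_add[OF T[OF that(1)] T[OF that(2)]]
      using L2_norm_add_power2[OF compL[OF that(1)] compL[OF that(2)]]
      by (simp add: sum.distrib sum_distrib_left)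
    moreover have "L (\<lambda>x. \<phi> x + \<psi> x) = L \<phi> + L \<psi>"
      unfolding L_def using L2_prod_integrable(1)[OF test_functions_L2[OF that(1) \<Omega>s] L2_cnj[OF f]]
        L2_prod_integrable(1)[OF test_functions_L2[OF that(2) \<Omega>s] L2_cnj[OF f]] by (simp add: distrib_right)
    ultimately show ?thesis by (simp add: J_def)
  qed
  have Jadd_t: "J (\<lambda>x. \<phi> x + of_real t * \<psi> x) = J \<phi> + t\<^sup>2 * N \<psi> + 2 * t * (P \<phi> \<psi> - L \<psi>)"
    if "\<phi> \<in> test_functions \<Omega>" "\<psi> \<in> test_functions \<Omega>" for \<phi> \<psi> t
    unfolding Jadd[OF that(1) test_functions_cmult[OF that(2)]] Nmul[OF that(2)] Pmul[OF that(2)] Lmul by (simp add: algebra_simps)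
  have Jlow: "J \<phi> \<ge> - (L2_norm \<Omega> f)\<^sup>2" if "\<phi> \<in> test_functions \<Omega>" for \<phi>
  proof -
    have "L \<phi> \<le> norm (\<integral>x. \<phi> x * cnj (f x) \<partial>?M)" unfolding L_def by (rule complex_Re_le_cmod)
    also have "\<dots> \<le> L2_norm \<Omega> \<phi> * L2_norm \<Omega> f"
      using L2_Cauchy_Schwarz[OF test_functions_L2[OF that \<Omega>s] L2_cnj[OF f]] by (simp add: L2_norm_cnj)
    finally have "2 * L \<phi> \<le> (L2_norm \<Omega> \<phi>)\<^sup>2 + (L2_norm \<Omega> f)\<^sup>2"
      using sum_squares_bound[of "L2_norm \<Omega> \<phi>" "L2_norm \<Omega> f"] by linarith
    moreover have "(L2_norm \<Omega> \<phi>)\<^sup>2 \<le> N \<phi>" using N_ge[OF K(2), of \<phi>] by (simp add: H1_component_def)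
    ultimately show ?thesis by (simp add: J_def)
  qed
  define I where "I = Inf (J ` test_functions \<Omega>)"
  have bdd: "bdd_below (J ` test_functions \<Omega>)" using Jlow by (intro bdd_belowI[of _ "- (L2_norm \<Omega> f)\<^sup>2"]) auto
  have IJ: "I \<le> J \<phi>" if "\<phi> \<in> test_functions \<Omega>" for \<phi> unfolding I_def using bdd that by (simp add: cInf_lower)
  have zero: "(\<lambda>x. 0) \<in> test_functions \<Omega>" by (rule test_functionsI[of _ "{}"]) (auto simp: C_diff_const)
  have "\<exists>\<phi>\<in>test_functions \<Omega>. J \<phi> < I + 1 / real (Suc n)" for n
  proof -
    have "Inf (J ` test_functions \<Omega>) < I + 1 / real (Suc n)" by (simp add: I_def)
    then show ?thesis using cInf_less_iff[OF _ bdd] zero by blast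
  qed
  then obtain \<phi> where \<phi>: "\<And>n. \<phi> n \<in> test_functions \<Omega>" "\<And>n. J (\<phi> n) < I + 1 / real (Suc n)" by metis
  \<comment> \<open>The parallelogram law for the midpoint \<open>a\<close> and the half difference
    \<open>d\<close>: since \<open>J a\<close> is at least the infimum, two almost minimal functions
    are close, so the minimising sequence is Cauchy.\<close>
  have Ndiff: "N (\<lambda>x. \<phi> m x + of_real (-1) * \<phi> n x) \<le> 2 * (1 / real (Suc m) + 1 / real (Suc n))" for m n
  proof -
    define a where "a x = of_real (1/2) * (\<phi> m x + \<phi> n x)" for x
    define d where "d x = of_real (1/2) * (\<phi> m x + of_real (-1) * \<phi> n x)" for x
    have aT: "a \<in> test_functions \<Omega>" unfolding a_def[abs_def] by (intro test_functions_cmult test_functions_add \<phi>)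
    have dT': "(\<lambda>x. \<phi> m x + of_real (-1) * \<phi> n x) \<in> test_functions \<Omega>" by (intro test_functions_cmult test_functions_add \<phi>)
    then have dT: "d \<in> test_functions \<Omega>" unfolding d_def[abs_def] by (rule test_functions_cmult)
    have "(\<lambda>x. a x + of_real 1 * d x) = \<phi> m" "(\<lambda>x. a x + of_real (-1) * d x) = \<phi> n"
      by (auto simp: a_def d_def fun_eq_iff field_simps)
    then have "J (\<phi> m) + J (\<phi> n) = 2 * J a + 2 * N d"
      using Jadd_t[OF aT dT, of 1] Jadd_t[OF aT dT, of "-1"] by simp
    moreover have "N d = (1/2)\<^sup>2 * N (\<lambda>x. \<phi> m x + of_real (-1) * \<phi> n x)" unfolding d_def by (rule Nmul[OF dT'])
    ultimately show ?thesis using IJ[OF aT] \<phi>(2)[of m] \<phi>(2)[of n] by (simp add: power2_eq_square)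
  qed
  have "\<exists>h\<in>L2 \<Omega>. L2_lim \<Omega> (\<lambda>n. H1_component (\<phi> n) k) h" if k: "k \<in> K" for k
  proof (rule L2_complete[OF \<Omega>m compL[OF \<phi>(1) k]])
    fix e :: real assume e: "e > 0"
    obtain n0 where n0: "1 / real (Suc n0) < e\<^sup>2 / 4" using reals_Archimedean[of "e\<^sup>2 / 4"] e by (auto simp: inverse_eq_divide)
    have "L2_norm \<Omega> (\<lambda>x. H1_component (\<phi> m) k x - H1_component (\<phi> n) k x) < e" if "m \<ge> n0" "n \<ge> n0" for m n
    proof (rule power2_less_imp_less)
      have "1 / real (Suc m) \<le> 1 / real (Suc n0)" "1 / real (Suc n) \<le> 1 / real (Suc n0)"
        using that by (auto intro!: divide_left_mono)
      moreover have "2 * (a + b) < d" if "a \<le> c" "b \<le> c" "c < d / 4" for a b c d :: real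
        using that by (simp add: field_simps)
      ultimately have "2 * (1 / real (Suc m) + 1 / real (Suc n)) < e\<^sup>2" using n0 by blast
      moreover have "(L2_norm \<Omega> (H1_component (\<lambda>x. \<phi> m x + of_real (-1) * \<phi> n x) k))\<^sup>2 \<le> 2 * (1 / real (Suc m) + 1 / real (Suc n))"
        using N_ge[OF k] Ndiff order_trans by blast
      moreover have "H1_component (\<lambda>x. \<phi> m x + of_real (-1) * \<phi> n x) k = (\<lambda>x. H1_component (\<phi> m) k x - H1_component (\<phi> n) k x)"
        unfolding H1_component_add[OF T[OF \<phi>(1)] smooth_cmult[OF T[OF \<phi>(1)]]] H1_component_cmult[OF T[OF \<phi>(1)]] by simp
      ultimately show "(L2_norm \<Omega> (\<lambda>x. H1_component (\<phi> m) k x - H1_component (\<phi> n) k x))\<^sup>2 < e\<^sup>2" by simp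
    qed (use e in simp)
    then show "\<exists>N. \<forall>m\<ge>N. \<forall>n\<ge>N. L2_norm \<Omega> (\<lambda>x. H1_component (\<phi> m) k x - H1_component (\<phi> n) k x) < e" by blast
  qed
  then have "\<forall>k\<in>K. \<exists>h. h \<in> L2 \<Omega> \<and> L2_lim \<Omega> (\<lambda>n. H1_component (\<phi> n) k) h" by blast
  from bchoice[OF this] obtain h where
    h': "\<forall>k\<in>K. h k \<in> L2 \<Omega> \<and> L2_lim \<Omega> (\<lambda>n. H1_component (\<phi> n) k) (h k)" by (rule exE)
  have h: "h k \<in> L2 \<Omega>" "L2_lim \<Omega> (\<lambda>n. H1_component (\<phi> n) k) (h k)" if "k \<in> K" for k
    using bspec[OF h' that] by simp_all
  define u where "u = h None"
  define g where "g b = h (Some b)" for b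
  have u: "H10_gradient \<Omega> u g"
    unfolding H10_gradient_def u_def g_def
    using h(1) h(2)[OF K(2)] h(2)[OF K(3)] K \<phi>(1) by (auto simp: H1_component_def)
  \<comment> \<open>The Euler-Lagrange expression at the limit, conjugate-linear in \<eta>; the weak
    equation amounts to its vanishing.\<close>
  define B where "B \<eta> = (\<Sum>k\<in>K. \<integral>x. h k x * cnj (H1_component \<eta> k x) \<partial>?M) - (\<integral>x. f x * cnj (\<eta> x) \<partial>?M)" for \<eta>
  have ReB: "Re (B \<eta>) = 0" if \<eta>: "\<eta> \<in> test_functions \<Omega>" for \<eta>
  proof -
    define c where "c = (\<Sum>k\<in>K. Re (\<integral>x. h k x * cnj (H1_component \<eta> k x) \<partial>?M)) - L \<eta>"
    have Plim: "(\<lambda>n. P (\<phi> n) \<eta> - L \<eta>) \<longlonglongrightarrow> c"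
      unfolding P_def c_def
      by (intro tendsto_intros tendsto_Re L2_lim_integral_right h compL \<phi> L2_cnj \<eta>)
    have "c = 0"
    proof (rule quadratic_nonneg_imp_0[OF N0])
      fix t :: real
      have lim: "(\<lambda>n. t\<^sup>2 * N \<eta> + 2 * t * (P (\<phi> n) \<eta> - L \<eta>)) \<longlonglongrightarrow> t\<^sup>2 * N \<eta> + 2 * t * c"
        by (intro tendsto_intros Plim)
      have lim0: "(\<lambda>n. - (1 / real (Suc n))) \<longlonglongrightarrow> - 0"
        by (intro tendsto_minus) (rule LIMSEQ_Suc[OF lim_1_over_n])
      \<comment> \<open>Perturbing \<open>\<phi> n\<close> by \<open>t \<eta>\<close> cannot lower
        \<open>J\<close> by more than the gap of at most \<open>1 / real (Suc n)\<close> between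
        \<open>J (\<phi> n)\<close> and the infimum.\<close>
      have "- (1 / real (Suc n)) \<le> t\<^sup>2 * N \<eta> + 2 * t * (P (\<phi> n) \<eta> - L \<eta>)" for n
        using IJ[OF test_functions_add[OF \<phi>(1)[of n] test_functions_cmult[OF \<eta>, of "of_real t"]]] \<phi>(2)[of n]
        unfolding Jadd_t[OF \<phi>(1) \<eta>] by linarith
      then show "0 \<le> t\<^sup>2 * N \<eta> + 2 * t * c" using LIMSEQ_le[OF lim0 lim] by auto
    qed
    moreover have "L \<eta> = Re (\<integral>x. f x * cnj (\<eta> x) \<partial>?M)"
    proof -
      have "(\<integral>x. f x * cnj (\<eta> x) \<partial>?M) = cnj (\<integral>x. \<eta> x * cnj (f x) \<partial>?M)"
        using Bochner_Integration.integral_cnj[of ?M "\<lambda>x. \<eta> x * cnj (f x)"] by (simp add: mult.commute)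
      then show ?thesis by (simp add: L_def)
    qed
    ultimately show ?thesis by (simp add: B_def c_def)
  qed
  \<comment> \<open>Minimality over real multiples of \<eta> yields the real part only; replacing
    \<eta> by \<open>\<i> * \<eta>\<close> yields the imaginary part.\<close>
  have B0: "B \<eta> = 0" if \<eta>: "\<eta> \<in> test_functions \<Omega>" for \<eta>
  proof -
    have "(\<integral>x. h k x * cnj (\<i> * H1_component \<eta> k x) \<partial>?M) = - \<i> * (\<integral>x. h k x * cnj (H1_component \<eta> k x) \<partial>?M)" for k
      by (subst integral_mult_right_zero[symmetric]) (simp add: mult_ac)
    moreover have "(\<integral>x. f x * cnj (\<i> * \<eta> x) \<partial>?M) = - \<i> * (\<integral>x. f x * cnj (\<eta> x) \<partial>?M)"
      by (subst integral_mult_right_zero[symmetric]) (simp add: mult_ac)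
    ultimately have "B (\<lambda>x. \<i> * \<eta> x) = - \<i> * B \<eta>"
      unfolding B_def H1_component_cmult[OF T[OF \<eta>]] by (simp add: right_diff_distrib sum_distrib_left sum_negf)
    then have "Im (B \<eta>) = 0" using ReB[OF test_functions_cmult[OF \<eta>, of \<i>]] by simp
    then show ?thesis using ReB[OF \<eta>] by (simp add: complex_eq_iff)
  qed
  have "has_distr_laplacian \<Omega> u (\<lambda>x. u x - f x)"
    unfolding has_distr_laplacian_def
  proof
    fix \<eta> assume \<eta>: "\<eta> \<in> test_functions \<Omega>"
    note \<eta>L = test_functions_L2[OF \<eta> \<Omega>s] and uL = H10_gradientD[OF u]
    \<comment> \<open>Inserting the conjugate turns the sesquilinear identity into the bilinear
      pairing of the weak equations.\<close>
    have "B (\<lambda>x. cnj (\<eta> x)) = 0" by (rule B0[OF test_functions_cnj[OF \<eta>]])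
    then have 1: "(\<integral>x. u x * \<eta> x \<partial>?M) + (\<Sum>b\<in>Basis. \<integral>x. g b x * partial_deriv b \<eta> x \<partial>?M) = (\<integral>x. f x * \<eta> x \<partial>?M)"
      unfolding B_def K_def
      by (simp add: sum.reindex u_def g_def H1_component_def partial_deriv_cnj[OF test_functions_smooth[OF \<eta>]])
    have "(\<integral>x. u x * laplacian \<eta> x \<partial>?M) = (\<Sum>b\<in>Basis. \<integral>x. u x * partial_deriv b (partial_deriv b \<eta>) x \<partial>?M)"
      unfolding laplacian_def sum_distrib_left
      by (intro Bochner_Integration.integral_sum L2_prod_integrable(1) uL test_functions_L2[where \<Omega>'=\<Omega>, OF _ \<Omega>s] test_functions_partial_deriv \<eta>)
    also have "\<dots> = (\<Sum>b\<in>Basis. - (\<integral>x. g b x * partial_deriv b \<eta> x \<partial>?M))"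
      using H10_gradient_weak_deriv[OF u _ \<Omega>s] test_functions_partial_deriv[OF \<eta>]
      by (intro sum.cong refl) (auto simp: has_weak_deriv_def)
    also have "\<dots> = (\<integral>x. u x * \<eta> x \<partial>?M) - (\<integral>x. f x * \<eta> x \<partial>?M)"
      using 1 by (simp add: sum_negf algebra_simps)
    also have "\<dots> = (\<integral>x. (u x - f x) * \<eta> x \<partial>?M)"
      using L2_prod_integrable(1)[OF uL(1) \<eta>L] L2_prod_integrable(1)[OF f \<eta>L] by (simp add: left_diff_distrib)
    finally show "(\<integral>x. u x * laplacian \<eta> x \<partial>?M) = (\<integral>x. (u x - f x) * \<eta> x \<partial>?M)" .
  qed
  then have "dirichlet_graph \<Omega> u (\<lambda>x. u x - f x)"
    using u H10_iff[OF \<Omega>(1)] L2_diff[OF H10_gradientD(1)[OF u] f] by (auto simp: dirichlet_graph_def)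
  then show ?thesis by blast
qed

lemma dirichlet_graph_iff_domain:
  assumes "open \<Omega>"
  shows "dirichlet_graph \<Omega> u v \<longleftrightarrow> u \<in> dirichlet_domain \<Omega> \<and> v \<in> L2 \<Omega> \<and> ae_eq \<Omega> (dirichlet_laplacian \<Omega> u) v"
proof -
  have *: "dirichlet_graph \<Omega> u (dirichlet_laplacian \<Omega> u)" if "u \<in> dirichlet_domain \<Omega>"
  proof -
    have "\<exists>v. v \<in> L2 \<Omega> \<and> has_distr_laplacian \<Omega> u v" using that by (auto simp: dirichlet_domain_def)
    then have "dirichlet_laplacian \<Omega> u \<in> L2 \<Omega> \<and> has_distr_laplacian \<Omega> u (dirichlet_laplacian \<Omega> u)"
      unfolding dirichlet_laplacian_def by (rule someI_ex)
    then show ?thesis using that by (simp add: dirichlet_graph_def dirichlet_domain_def)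
  qed
  show ?thesis
  proof
    assume D: "dirichlet_graph \<Omega> u v"
    then have dom: "u \<in> dirichlet_domain \<Omega>" by (auto simp: dirichlet_graph_def dirichlet_domain_def)
    have "AE x in lebesgue_on \<Omega>. dirichlet_laplacian \<Omega> u x = v x"
      using has_distr_laplacian_unique[OF assms] *[OF dom] D by (auto simp: dirichlet_graph_def)
    then show "u \<in> dirichlet_domain \<Omega> \<and> v \<in> L2 \<Omega> \<and> ae_eq \<Omega> (dirichlet_laplacian \<Omega> u) v"
      using dom D by (auto simp: ae_eq_def dirichlet_graph_def)
  next
    assume "u \<in> dirichlet_domain \<Omega> \<and> v \<in> L2 \<Omega> \<and> ae_eq \<Omega> (dirichlet_laplacian \<Omega> u) v"
    then show "dirichlet_graph \<Omega> u v"
      using dirichlet_graph_cong_AE[OF * assms] by (auto simp: ae_eq_def)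
  qed
qed

section \<open>Multipliers behaving like coordinates\<close>

lemma laplacian_local:
  assumes "open S" "x \<in> S" "\<And>y. y \<in> S \<Longrightarrow> f y = g y"
  shows "laplacian f x = laplacian g x"
  unfolding laplacian_def
proof (intro sum.cong refl)
  fix b :: 'a
  have "partial_deriv b f y = partial_deriv b g y" if "y \<in> S" for y
    by (rule partial_deriv_local[OF assms(1) that assms(3)])
  then show "partial_deriv b (partial_deriv b f) x = partial_deriv b (partial_deriv b g) x"
    by (rule partial_deriv_local[OF assms(1,2)])
qed

text \<open>The set where two affine functions differ is open; being null in \<open>S\<close>, it is
  empty there. Moving from a point of \<open>S\<close> in the direction of the difference of the
  slopes then shows that this difference is 0.\<close>

lemma AE_affine_eq_imp_eq:
  fixes v v' :: "'a::euclidean_space"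
  assumes "open S" "S \<noteq> {}" "AE x in lebesgue_on S. v \<bullet> x + a = v' \<bullet> x + a'"
  shows "v = v' \<and> a = a'"
proof -
  let ?N = "S \<inter> {x. v \<bullet> x + a \<noteq> v' \<bullet> x + a'}"
  have "negligible ?N" using assms(1,3) by (simp add: AE_lebesgue_on_iff Int_def)
  moreover have "open ?N" using assms(1) by (intro open_Int open_Collect_neq continuous_intros)
  ultimately have "?N = {}" using open_not_negligible by blast
  then have eq: "v \<bullet> x + a = v' \<bullet> x + a'" if "x \<in> S" for x using that by blast
  obtain x where x: "x \<in> S" using assms(2) by blast
  obtain e where e: "e > 0" "ball x e \<subseteq> S" using assms(1) x open_contains_ball by metis
  have "v = v'"
  proof (rule ccontr)
    assume ne: "v \<noteq> v'"
    define d where "d = v - v'"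
    have d: "d \<noteq> 0" using ne by (simp add: d_def)
    define y where "y = x + (e / (2 * norm d)) *\<^sub>R d"
    have "y \<in> S" using e d by (intro subsetD[OF e(2)]) (simp add: y_def dist_norm)
    from eq[OF this] eq[OF x] have "d \<bullet> (y - x) = 0" by (simp add: d_def inner_diff_left inner_diff_right)
    then show False using e d by (simp add: y_def)
  qed
  with eq[OF x] show ?thesis by simp
qed

text \<open>Here \<open>p i\<close> plays the role of \<open>[\<Delta>, t i] \<phi> / 2\<close>; the second condition is the double commutator
  relation \<open>[[\<Delta>, t i], t j] = 2 \<delta>\<^sub>i\<^sub>j\<close>.\<close>

locale multiplier_coordinates =
  fixes \<Omega> :: "'a::euclidean_space set" and I :: "'i set" and t :: "'i \<Rightarrow> 'a \<Rightarrow> complex"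
  assumes open_\<Omega>: "open \<Omega>" and nonempty: "\<Omega> \<noteq> {}" and finite_I: "finite I"
    and real: "\<And>i. i \<in> I \<Longrightarrow> AE x in lebesgue_on \<Omega>. cnj (t i x) = t i x"
    and commutator: "\<And>\<phi>. \<phi> \<in> test_functions \<Omega> \<Longrightarrow> \<exists>p. \<forall>i\<in>I.
        dirichlet_graph \<Omega> (\<lambda>x. t i x * \<phi> x) (\<lambda>x. t i x * laplacian \<phi> x + 2 * p i x) \<and>
        (\<forall>j\<in>I. dirichlet_graph \<Omega> (\<lambda>x. t j x * (t i x * \<phi> x))
          (\<lambda>x. t j x * (t i x * laplacian \<phi> x + 2 * p i x) + 2 * (t i x * p j x + (if i = j then \<phi> x else 0))))"
begin

text \<open>A cutoff equal to 1 near \<open>z\<close> turns the relations for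
  \<open>t i * \<phi>\<close> into relations for \<open>t i\<close> itself on a small ball. There
  \<open>laplacian \<phi>\<close> vanishes, \<open>F i\<close> reduces to \<open>2 * p i\<close>,
  and the double commutator relation becomes the condition \<open>prod\<close>.\<close>

lemma local_coordinates_exist:
  assumes z: "z \<in> \<Omega>"
  shows "\<exists>R G F. local_coordinates z R I t G F"
proof -
  have \<Omega>s: "\<Omega> \<in> sets lebesgue" using open_\<Omega> by simp
  obtain e where e: "e > 0" "cball z e \<subseteq> \<Omega>" using open_\<Omega> z open_contains_cball by metis
  obtain c where c: "(\<lambda>x. complex_of_real (c x)) \<in> test_functions UNIV"
    "\<And>x. x \<in> ball z (e / 2) \<Longrightarrow> c x = 1" "\<And>x. x \<notin> cball z e \<Longrightarrow> c x = 0"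
    using cutoff_exists[OF e(1), of z] by metis
  define \<phi> where "\<phi> x = complex_of_real (c x)" for x
  have \<phi>: "\<phi> \<in> test_functions \<Omega>"
    unfolding \<phi>_def[abs_def]
    by (rule test_functionsI[OF test_functions_smooth[OF c(1)] _ e(2)]) (use c(3) in auto)
  define R where "R = e / 2"
  have R: "R > 0" using e by (simp add: R_def)
  let ?B = "ball z R"
  have B: "?B \<subseteq> \<Omega>" "?B \<in> sets lebesgue"
  proof -
    have "?B \<subseteq> cball z e" using e by (auto simp: R_def)
    then show "?B \<subseteq> \<Omega>" using e(2) by blast
  qed simp
  have \<phi>1: "\<phi> x = 1" if "x \<in> ?B" for x using that c(2) by (simp add: \<phi>_def R_def)
  have \<phi>0: "laplacian \<phi> x = 0" if "x \<in> ?B" for x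
    using laplacian_local[OF open_ball that, of \<phi> "\<lambda>x. 1"] \<phi>1 by (simp add: laplacian_const)
  obtain p where p: "\<And>i. i \<in> I \<Longrightarrow> dirichlet_graph \<Omega> (\<lambda>x. t i x * \<phi> x) (\<lambda>x. t i x * laplacian \<phi> x + 2 * p i x)"
    "\<And>i j. i \<in> I \<Longrightarrow> j \<in> I \<Longrightarrow> dirichlet_graph \<Omega> (\<lambda>x. t j x * (t i x * \<phi> x))
          (\<lambda>x. t j x * (t i x * laplacian \<phi> x + 2 * p i x) + 2 * (t i x * p j x + (if i = j then \<phi> x else 0)))"
    using commutator[OF \<phi>] by blast
  have "\<exists>g. H10_gradient \<Omega> (\<lambda>x. t i x * \<phi> x) g" if "i \<in> I" for i
    using dirichlet_graph_gradient[OF p(1)[OF that] open_\<Omega>] by blast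
  then obtain G where G: "\<And>i. i \<in> I \<Longrightarrow> H10_gradient \<Omega> (\<lambda>x. t i x * \<phi> x) (G i)" by metis
  define F where "F i x = t i x * laplacian \<phi> x + 2 * p i x" for i x
  have "local_coordinates z R I t G F"
  proof
    show "R > 0" by (rule R)
    show "finite I" by (rule finite_I)
    fix i assume i: "i \<in> I"
    show "AE x in lebesgue_on ?B. cnj (t i x) = t i x" by (rule AE_lebesgue_on_mono[OF real[OF i] B \<Omega>s])
    have "(\<lambda>x. t i x * \<phi> x) \<in> L2 ?B" by (rule L2_mono(1)[OF B \<Omega>s dirichlet_graph_L2(1)[OF p(1)[OF i]]])
    then show "t i \<in> L2 ?B" using L2_cong[of ?B "t i" "\<lambda>x. t i x * \<phi> x"] \<phi>1 by simp
    show "F i \<in> L2 ?B" unfolding F_def[abs_def] by (rule L2_mono(1)[OF B \<Omega>s dirichlet_graph_L2(2)[OF p(1)[OF i]]])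
    show "has_distr_laplacian ?B (t i) (F i)"
    proof (rule has_distr_laplacian_cong_AE[OF has_distr_laplacian_subset[OF _ B \<Omega>s] B(2)])
      show "has_distr_laplacian \<Omega> (\<lambda>x. t i x * \<phi> x) (F i)"
        using p(1)[OF i] by (simp add: dirichlet_graph_def F_def[abs_def])
    qed (auto simp: \<phi>1 intro!: AE_I2)
    fix b :: 'a assume b: "b \<in> Basis"
    show "G i b \<in> L2 ?B" by (rule L2_mono(1)[OF B \<Omega>s H10_gradientD(2)[OF G[OF i] b]])
    show "has_weak_deriv ?B b (t i) (G i b)"
      by (rule has_weak_deriv_cong_AE[OF has_weak_deriv_subset[OF H10_gradient_weak_deriv[OF G[OF i] b \<Omega>s] B \<Omega>s b] B(2) b])
        (auto simp: \<phi>1 intro!: AE_I2)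
  next
    fix i j assume ij: "i \<in> I" "j \<in> I"
    show "has_distr_laplacian ?B (\<lambda>x. t i x * t j x) (\<lambda>x. t i x * F j x + F i x * t j x + (if i = j then 2 else 0))"
    proof (rule has_distr_laplacian_cong_AE[OF has_distr_laplacian_subset[OF _ B \<Omega>s] B(2)])
      show "has_distr_laplacian \<Omega> (\<lambda>x. t j x * (t i x * \<phi> x))
          (\<lambda>x. t j x * (t i x * laplacian \<phi> x + 2 * p i x) + 2 * (t i x * p j x + (if i = j then \<phi> x else 0)))"
        using p(2)[OF ij] by (simp add: dirichlet_graph_def)
    qed (auto simp: \<phi>1 \<phi>0 F_def algebra_simps intro!: AE_I2)
  qed
  then show ?thesis by blast
qed

lemma card_le_DIM: "card I \<le> DIM('a)"
proof -
  obtain z where "z \<in> \<Omega>" using nonempty by blast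
  then obtain R G F where "local_coordinates z R I t G F" using local_coordinates_exist by blast
  then show ?thesis by (rule local_coordinates.card_le_DIM)
qed

theorem affine:
  assumes card: "card I = DIM('a)" and conn: "connected \<Omega>"
  shows "\<exists>v :: 'i \<Rightarrow> 'a. \<exists>a :: 'i \<Rightarrow> real. (\<forall>i\<in>I. \<forall>j\<in>I. v i \<bullet> v j = (if i = j then 1 else 0)) \<and>
     (\<forall>i\<in>I. AE x in lebesgue_on \<Omega>. t i x = of_real (v i \<bullet> x + a i))"
proof -
  \<comment> \<open>All coordinates are patched at once, as one function with values in
    \<open>'i \<Rightarrow> complex\<close>. The value 0 outside \<open>I\<close> makes equality of
    two such functions depend only on the coefficients indexed by \<open>I\<close>.\<close>
  define q where "q v a x i = (if i \<in> I then complex_of_real (v i \<bullet> x + a i) else 0)" for v :: "'i \<Rightarrow> 'a" and a x i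
  define Q where "Q = {q v a | v a. \<forall>i\<in>I. \<forall>j\<in>I. v i \<bullet> v j = (if i = j then 1 else 0)}"
  define u where "u x i = (if i \<in> I then t i x else 0)" for x i
  have "\<exists>f\<in>Q. AE x in lebesgue_on \<Omega>. u x = f x"
  proof (rule AE_local_patch[OF open_\<Omega> conn nonempty])
    fix f f' :: "'a \<Rightarrow> 'i \<Rightarrow> complex" and S :: "'a set"
    assume f: "f \<in> Q" "f' \<in> Q" and S: "open S" "S \<noteq> {}" and ae: "AE x in lebesgue_on S. f x = f' x"
    obtain v a v' a' where vf: "f = q v a" "f' = q v' a'" using f by (auto simp: Q_def)
    have "v i = v' i \<and> a i = a' i" if i: "i \<in> I" for i
    proof (rule AE_affine_eq_imp_eq[OF S])
      show "AE x in lebesgue_on S. v i \<bullet> x + a i = v' i \<bullet> x + a' i"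
        using ae
      proof eventually_elim
        case (elim x)
        then have "f x i = f' x i" by simp
        then show ?case using i by (simp add: vf q_def flip: of_real_add)
      qed
    qed
    then show "f = f'" by (auto simp: vf q_def fun_eq_iff)
  next
    fix z assume "z \<in> \<Omega>"
    then obtain R G F where "local_coordinates z R I t G F" using local_coordinates_exist by blast
    then obtain s v a where s: "s > 0" "\<forall>i\<in>I. \<forall>j\<in>I. v i \<bullet> v j = (if i = j then 1 else 0)"
      "\<forall>i\<in>I. AE x in lebesgue_on (ball z s). t i x = complex_of_real (v i \<bullet> x + a i)"
      using local_coordinates.locally_affine[OF _ card] by blast
    have "AE x in lebesgue_on (ball z s). \<forall>i\<in>I. t i x = complex_of_real (v i \<bullet> x + a i)"
      using s(3) by (intro AE_finite_allI finite_I) blast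
    then have "AE x in lebesgue_on (ball z s). u x = q v a x"
      by eventually_elim (auto simp: u_def q_def fun_eq_iff)
    moreover have "q v a \<in> Q" using s(2) by (auto simp: Q_def)
    ultimately show "\<exists>f\<in>Q. \<exists>r>0. AE x in lebesgue_on (ball z r). u x = f x" using s(1) by blast
  qed
  then obtain v a where va: "\<forall>i\<in>I. \<forall>j\<in>I. v i \<bullet> v j = (if i = j then 1 else 0)" "AE x in lebesgue_on \<Omega>. u x = q v a x"
    by (auto simp: Q_def)
  have "AE x in lebesgue_on \<Omega>. t i x = of_real (v i \<bullet> x + a i)" if i: "i \<in> I" for i
    using va(2)
  proof eventually_elim
    case (elim x)
    then have "u x i = q v a x i" by simp
    then show ?case using i by (simp add: u_def q_def)
  qed
  with va(1) show ?thesis by blast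
qed

end

section \<open>Disjointness-preserving bijections\<close>

locale disjointness_preserving_bijection =
  fixes \<Omega>1 :: "'a::euclidean_space set" and \<Omega>2 :: "'b::euclidean_space set"
    and U :: "('a \<Rightarrow> complex) \<Rightarrow> 'b \<Rightarrow> complex"
  assumes open1: "open \<Omega>1" and bounded1: "bounded \<Omega>1"
    and open2: "open \<Omega>2" and bounded2: "bounded \<Omega>2"
    and invertible: "invertible_L2_operator \<Omega>1 \<Omega>2 U"
    and disjoint: "disjointness_preserving \<Omega>1 \<Omega>2 U"
begin

abbreviation "M1 \<equiv> lebesgue_on \<Omega>1"
abbreviation "M2 \<equiv> lebesgue_on \<Omega>2"

lemma sets1: "\<Omega>1 \<in> sets lebesgue" and sets2: "\<Omega>2 \<in> sets lebesgue"
  and lmeasurable1: "\<Omega>1 \<in> lmeasurable" and lmeasurable2: "\<Omega>2 \<in> lmeasurable"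
  using open1 open2 bounded1 bounded2 by (auto intro: bounded_set_imp_lmeasurable)

lemma U_L2: "f \<in> L2 \<Omega>1 \<Longrightarrow> U f \<in> L2 \<Omega>2"
  and U_cong: "f \<in> L2 \<Omega>1 \<Longrightarrow> g \<in> L2 \<Omega>1 \<Longrightarrow> AE x in M1. f x = g x \<Longrightarrow> AE y in M2. U f y = U g y"
  and U_add: "f \<in> L2 \<Omega>1 \<Longrightarrow> g \<in> L2 \<Omega>1 \<Longrightarrow> AE y in M2. U (\<lambda>x. f x + g x) y = U f y + U g y"
  and U_cmult: "f \<in> L2 \<Omega>1 \<Longrightarrow> AE y in M2. U (\<lambda>x. c * f x) y = c * U f y"
  and U_bounded: "\<exists>C. \<forall>f\<in>L2 \<Omega>1. L2_norm \<Omega>2 (U f) \<le> C * L2_norm \<Omega>1 f"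
  using invertible by (auto simp: invertible_L2_operator_def bounded_L2_operator_def ae_eq_def)

lemma U_inj: "f \<in> L2 \<Omega>1 \<Longrightarrow> g \<in> L2 \<Omega>1 \<Longrightarrow> AE y in M2. U f y = U g y \<Longrightarrow> AE x in M1. f x = g x"
  and U_surj: "h \<in> L2 \<Omega>2 \<Longrightarrow> \<exists>f\<in>L2 \<Omega>1. AE y in M2. U f y = h y"
  using invertible by (auto simp: invertible_L2_operator_def ae_eq_def)

lemma U_disjoint:
  "f \<in> L2 \<Omega>1 \<Longrightarrow> g \<in> L2 \<Omega>1 \<Longrightarrow> AE x in M1. f x * g x = 0 \<Longrightarrow> AE y in M2. U f y * U g y = 0"
  using disjoint by (simp add: disjointness_preserving_def)

lemma U_diff:
  assumes "f \<in> L2 \<Omega>1" "g \<in> L2 \<Omega>1"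
  shows "AE y in M2. U (\<lambda>x. f x - g x) y = U f y - U g y"
  using U_add[OF assms(1) L2_cmult[OF assms(2), of "-1"]] U_cmult[OF assms(2), of "-1"]
  by eventually_elim simp

lemma U_zero: "AE y in M2. U (\<lambda>x. 0) y = 0"
  using U_cmult[OF L2_zero, of 0] by simp

lemma U_eq_0: "f \<in> L2 \<Omega>1 \<Longrightarrow> AE y in M2. U f y = 0 \<Longrightarrow> AE x in M1. f x = 0"
proof -
  assume f: "f \<in> L2 \<Omega>1" and 0: "AE y in M2. U f y = 0"
  have "AE y in M2. U f y = U (\<lambda>x. 0) y" using 0 U_zero by eventually_elim simp
  from U_inj[OF f L2_zero this] show ?thesis .
qed

lemma U_sum:
  assumes "\<And>i. i \<in> I \<Longrightarrow> f i \<in> L2 \<Omega>1"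
  shows "AE y in M2. U (\<lambda>x. \<Sum>i\<in>I. f i x) y = (\<Sum>i\<in>I. U (f i) y)"
  using assms
proof (induction I rule: infinite_finite_induct)
  case (insert i I)
  have 1: "AE y in M2. U (\<lambda>x. f i x + (\<Sum>i\<in>I. f i x)) y = U (f i) y + U (\<lambda>x. \<Sum>i\<in>I. f i x) y"
    by (rule U_add) (use insert in \<open>auto intro: L2_sum\<close>)
  have 2: "AE y in M2. U (\<lambda>x. \<Sum>i\<in>I. f i x) y = (\<Sum>i\<in>I. U (f i) y)" using insert by blast
  from 1 2 show ?case by eventually_elim (simp add: insert.hyps)
qed (use U_zero in auto)

lemma U_lim:
  assumes "L2_lim \<Omega>1 F f" "\<And>n. F n \<in> L2 \<Omega>1" "f \<in> L2 \<Omega>1"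
  shows "L2_lim \<Omega>2 (\<lambda>n. U (F n)) (U f)"
proof -
  obtain C where C: "\<And>f. f \<in> L2 \<Omega>1 \<Longrightarrow> L2_norm \<Omega>2 (U f) \<le> C * L2_norm \<Omega>1 f" using U_bounded by blast
  show ?thesis
  proof (rule L2_lim_bound[OF _ assms(1)])
    fix n
    have d: "(\<lambda>x. F n x - f x) \<in> L2 \<Omega>1" by (rule L2_diff[OF assms(2,3)])
    have "L2_norm \<Omega>2 (\<lambda>y. U (F n) y - U f y) = L2_norm \<Omega>2 (U (\<lambda>x. F n x - f x))"
      using U_diff[OF assms(2)[of n] assms(3)]
      by (intro L2_norm_cong_AE L2_measurable[OF L2_diff] L2_measurable[OF U_L2] U_L2 assms d) (auto elim: eventually_mono)
    then show "L2_norm \<Omega>2 (\<lambda>y. U (F n) y - U f y) \<le> C * L2_norm \<Omega>1 (\<lambda>x. F n x - f x)" using C[OF d] by simp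
  qed
qed

definition one_image :: "'b \<Rightarrow> complex" where "one_image = U (\<lambda>x. 1)"

lemma const_L2: "(\<lambda>x. c) \<in> L2 \<Omega>1"
  by (rule smooth_L2[OF smooth_const bounded1 sets1])

lemma one_image_L2: "one_image \<in> L2 \<Omega>2"
  unfolding one_image_def by (rule U_L2[OF const_L2])

lemma bounded_L2:
  "f \<in> borel_measurable M1 \<Longrightarrow> (\<And>x. x \<in> \<Omega>1 \<Longrightarrow> norm (f x) \<le> C) \<Longrightarrow> f \<in> L2 \<Omega>1"
  by (rule L2_norm_bounded(1)[OF lmeasurable1])

text \<open>Split 1 into \<open>e + e'\<close> and \<open>g\<close> into \<open>e g + e' g\<close>.
  Disjointness kills \<open>U e * U (e' g)\<close> and \<open>U e' * U (e g)\<close>, so both sides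
  equal \<open>U e * U (e g)\<close>.\<close>

lemma U_indicator_mult:
  assumes e: "e \<in> borel_measurable M1" "\<And>x. e x = 0 \<or> e x = 1" and g: "g \<in> L2 \<Omega>1"
  shows "AE y in M2. U (\<lambda>x. e x * g x) y * one_image y = U e y * U g y"
proof -
  define e' where "e' x = 1 - e x" for x
  have e'm: "e' \<in> borel_measurable M1" unfolding e'_def[abs_def] using e(1) by measurable
  have e': "e' x = 0 \<or> e' x = 1" for x using e(2)[of x] by (auto simp: e'_def)
  have bd: "norm (e x) \<le> 1" "norm (e' x) \<le> 1" for x using e(2)[of x] e'[of x] by auto
  have L: "e \<in> L2 \<Omega>1" "e' \<in> L2 \<Omega>1" "(\<lambda>x. e x * g x) \<in> L2 \<Omega>1" "(\<lambda>x. e' x * g x) \<in> L2 \<Omega>1"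
    by (rule bounded_L2[OF e(1) bd(1)], rule bounded_L2[OF e'm bd(2)],
        rule L2_mult_bounded[OF g e(1) bd(1)], rule L2_mult_bounded[OF g e'm bd(2)])
  have d: "e x * (e' x * g x) = 0" "e' x * (e x * g x) = 0" for x using e(2)[of x] by (auto simp: e'_def)
  have s: "(\<lambda>x. e x * g x + e' x * g x) = g" "(\<lambda>x. e x + e' x) = (\<lambda>x. 1)"
    by (auto simp: e'_def algebra_simps fun_eq_iff)
  have "AE y in M2. U e y * U (\<lambda>x. e' x * g x) y = 0" "AE y in M2. U e' y * U (\<lambda>x. e x * g x) y = 0"
    by (rule U_disjoint[OF L(1,4)], simp only: d, simp, rule U_disjoint[OF L(2,3)], simp only: d, simp)
  moreover note U_add[OF L(3,4), unfolded s] U_add[OF L(1,2), unfolded s]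
  ultimately show ?thesis unfolding one_image_def by eventually_elim (auto simp: algebra_simps)
qed

text \<open>Taking \<open>g = e\<close> in the product rule gives
  \<open>U e * one_image = (U e)\<^sup>2\<close>.\<close>

lemma U_indicator:
  assumes e: "e \<in> borel_measurable M1" "\<And>x. e x = 0 \<or> e x = 1"
  shows "AE y in M2. U e y = 0 \<or> U e y = one_image y"
proof -
  have "e \<in> L2 \<Omega>1" by (rule bounded_L2[OF e(1), of 1]) (use e(2) in \<open>metis norm_one norm_zero order_refl zero_le_one\<close>)
  from U_indicator_mult[OF e this] have "AE y in M2. U (\<lambda>x. e x * e x) y * one_image y = U e y * U e y" .
  moreover have "(\<lambda>x. e x * e x) = e" using e(2) by (auto simp: fun_eq_iff)
  ultimately show ?thesis by (auto elim!: eventually_mono)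
qed

lemma U_simple_mult:
  fixes c :: "'i \<Rightarrow> complex"
  assumes I: "finite I" and e: "\<And>i. i \<in> I \<Longrightarrow> e i \<in> borel_measurable M1" "\<And>i x. e i x = 0 \<or> e i x = 1" and g: "g \<in> L2 \<Omega>1"
  shows "AE y in M2. U (\<lambda>x. (\<Sum>i\<in>I. c i * e i x) * g x) y * one_image y = U (\<lambda>x. \<Sum>i\<in>I. c i * e i x) y * U g y"
    and "AE y in M2. U (\<lambda>x. \<Sum>i\<in>I. c i * e i x) y = (\<Sum>i\<in>I. c i * U (e i) y)"
proof -
  have bd: "norm (e i x) \<le> 1" for i x using e(2)[of i x] by auto
  have eL: "e i \<in> L2 \<Omega>1" if "i \<in> I" for i by (rule bounded_L2[OF e(1)[OF that] bd])
  have egL: "(\<lambda>x. e i x * g x) \<in> L2 \<Omega>1" if "i \<in> I" for i by (rule L2_mult_bounded[OF g e(1)[OF that] bd])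
  have p: "AE y in M2. \<forall>i\<in>I. U (\<lambda>x. e i x * g x) y * one_image y = U (e i) y * U g y"
    by (intro AE_finite_allI I U_indicator_mult[OF e(1) e(2) g])
  have c1: "AE y in M2. \<forall>i\<in>I. U (\<lambda>x. c i * e i x) y = c i * U (e i) y"
    by (intro AE_finite_allI I U_cmult eL)
  have c2: "AE y in M2. \<forall>i\<in>I. U (\<lambda>x. c i * (e i x * g x)) y = c i * U (\<lambda>x. e i x * g x) y"
    by (intro AE_finite_allI I U_cmult egL)
  have s1: "AE y in M2. U (\<lambda>x. \<Sum>i\<in>I. c i * e i x) y = (\<Sum>i\<in>I. U (\<lambda>x. c i * e i x) y)"
    by (intro U_sum L2_cmult eL)
  have s2: "AE y in M2. U (\<lambda>x. \<Sum>i\<in>I. c i * (e i x * g x)) y = (\<Sum>i\<in>I. U (\<lambda>x. c i * (e i x * g x)) y)"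
    by (intro U_sum L2_cmult egL)
  have eq: "(\<lambda>x. (\<Sum>i\<in>I. c i * e i x) * g x) = (\<lambda>x. \<Sum>i\<in>I. c i * (e i x * g x))"
    by (simp add: sum_distrib_right mult.assoc)
  show "AE y in M2. U (\<lambda>x. (\<Sum>i\<in>I. c i * e i x) * g x) y * one_image y = U (\<lambda>x. \<Sum>i\<in>I. c i * e i x) y * U g y"
    unfolding eq using p c1 c2 s1 s2
  proof eventually_elim
    case (elim y)
    have "U (\<lambda>x. \<Sum>i\<in>I. c i * (e i x * g x)) y * one_image y = (\<Sum>i\<in>I. c i * (U (\<lambda>x. e i x * g x) y * one_image y))"
      using elim(3,5) by (simp add: sum_distrib_right mult.assoc)
    also have "\<dots> = (\<Sum>i\<in>I. c i * U (e i) y * U g y)" using elim(1) by (simp add: mult.assoc)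
    also have "\<dots> = U (\<lambda>x. \<Sum>i\<in>I. c i * e i x) y * U g y" using elim(2,4) by (simp add: sum_distrib_right)
    finally show ?case .
  qed
  show "AE y in M2. U (\<lambda>x. \<Sum>i\<in>I. c i * e i x) y = (\<Sum>i\<in>I. c i * U (e i) y)"
    using c1 s1 by eventually_elim simp
qed

text \<open>The relation is linear in \<open>f\<close>, so it extends from indicators to simple
  functions and then, by continuity of \<open>U\<close>, to bounded measurable ones. It is kept in
  product form because \<open>one_image\<close> is not yet known to be nonzero.\<close>

lemma U_bounded_mult:
  assumes f: "f \<in> borel_measurable M1" "\<And>x. x \<in> \<Omega>1 \<Longrightarrow> norm (f x) \<le> C" and g: "g \<in> L2 \<Omega>1"
  shows "AE y in M2. U (\<lambda>x. f x * g x) y * one_image y = U f y * U g y"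
proof -
  obtain F where F: "\<And>n. simple_function M1 (F n)" "\<And>x. x \<in> space M1 \<Longrightarrow> (\<lambda>n. F n x) \<longlonglongrightarrow> f x"
    "\<And>n x. x \<in> space M1 \<Longrightarrow> dist (F n x) 0 \<le> 2 * dist (f x) 0"
    using borel_measurable_implies_sequence_metric[OF f(1), of 0] by blast
  have Fm: "F n \<in> borel_measurable M1" for n using F(1) by (rule borel_measurable_simple_function)
  have Fb: "norm (F n x) \<le> 2 * norm (f x)" if "x \<in> \<Omega>1" for n x using F(3)[of x n] that by simp
  have Fb': "norm (F n x) \<le> 2 * C" if "x \<in> \<Omega>1" for n x using Fb[OF that] f(2)[OF that] by (meson order_trans mult_left_mono zero_le_numeral)
  have fL: "f \<in> L2 \<Omega>1" by (rule bounded_L2[OF f])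
  have FL: "F n \<in> L2 \<Omega>1" for n by (rule bounded_L2[OF Fm Fb'])
  have fgL: "(\<lambda>x. f x * g x) \<in> L2 \<Omega>1" by (rule L2_mult_bounded[OF g f])
  have FgL: "(\<lambda>x. F n x * g x) \<in> L2 \<Omega>1" for n by (rule L2_mult_bounded[OF g Fm Fb'])
  have tri: "norm (F n x - f x) \<le> norm (3 * f x)" if "x \<in> \<Omega>1" for n x
    using norm_triangle_ineq4[of "F n x" "f x"] Fb[OF that, of n] by (simp add: norm_mult)
  have lim1: "L2_lim \<Omega>1 F f"
    by (rule L2_lim_dominated[OF Fm fL L2_cmult[OF fL, of 3]]) (use tri F(2) in \<open>auto intro!: AE_I2\<close>)
  have lim2: "L2_lim \<Omega>1 (\<lambda>n x. F n x * g x) (\<lambda>x. f x * g x)"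
  proof (rule L2_lim_dominated[OF L2_measurable[OF FgL] fgL L2_cmult[OF fgL, of 3]])
    show "AE x in M1. norm (F n x * g x - f x * g x) \<le> norm (3 * (f x * g x))" for n
    proof (rule AE_I2)
      fix x assume "x \<in> space M1"
      then have "norm (F n x - f x) * norm (g x) \<le> norm (3 * f x) * norm (g x)" by (intro mult_right_mono tri) auto
      then show "norm (F n x * g x - f x * g x) \<le> norm (3 * (f x * g x))"
        by (simp add: norm_mult flip: left_diff_distrib)
    qed
    show "AE x in M1. (\<lambda>n. F n x * g x) \<longlonglongrightarrow> f x * g x" by (rule AE_I2) (intro tendsto_intros F(2))
  qed
  have "AE y in M2. U (\<lambda>x. F n x * g x) y * one_image y = U (F n) y * U g y" for n
  proof -
    define I where "I = F n ` space M1"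
    define e where "e c x = (if F n x = c then 1 else 0 :: complex)" for c x
    have I: "finite I" using F(1) by (simp add: I_def simple_function_def)
    have em: "e c \<in> borel_measurable M1" for c
      unfolding e_def[abs_def] using Fm[of n] by measurable
    have FI: "F n x = (\<Sum>c\<in>I. c * e c x)" if "x \<in> \<Omega>1" for x
    proof -
      have "(\<Sum>c\<in>I. c * e c x) = (\<Sum>c\<in>I. if c = F n x then c else 0)" by (intro sum.cong) (auto simp: e_def)
      also have "\<dots> = F n x" using I that by (auto simp: I_def)
      finally show ?thesis by simp
    qed
    define S where "S x = (\<Sum>c\<in>I. c * e c x)" for x
    have SF: "AE x in M1. F n x = S x" "AE x in M1. F n x * g x = S x * g x" using FI by (auto simp: S_def intro!: AE_I2)
    have SL: "S \<in> L2 \<Omega>1" "(\<lambda>x. S x * g x) \<in> L2 \<Omega>1"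
      using L2_cong_AE[OF sets1 FL SF(1)] L2_cong_AE[OF sets1 FgL SF(2)] by auto
    have "AE y in M2. U (\<lambda>x. S x * g x) y * one_image y = U S y * U g y"
      unfolding S_def[abs_def] by (rule U_simple_mult(1)[OF I em _ g]) (simp add: e_def)
    with U_cong[OF FL SL(1) SF(1)] U_cong[OF FgL SL(2) SF(2)] show ?thesis by eventually_elim simp
  qed
  from L2_lim_prod_eq[OF U_lim[OF lim2 FgL fgL] U_lim[OF lim1 FL fL] U_L2[OF FgL] U_L2[OF FL] U_L2[OF fgL] U_L2[OF fL] one_image_L2 U_L2[OF g] this]
  show ?thesis .
qed

text \<open>For an indicator the image is 0 or \<open>one_image\<close>, a real multiple of
  \<open>one_image\<close>; real linear combinations and limits keep this. Multiplying crosswise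
  with conjugates expresses it without division.\<close>

lemma U_real_bounded:
  assumes f: "f \<in> borel_measurable M1" "\<And>x. x \<in> \<Omega>1 \<Longrightarrow> \<bar>f x\<bar> \<le> C"
  shows "AE y in M2. U (\<lambda>x. complex_of_real (f x)) y * cnj (one_image y) = cnj (U (\<lambda>x. complex_of_real (f x)) y) * one_image y"
proof -
  obtain F where F: "\<And>n. simple_function M1 (F n)" "\<And>x. x \<in> space M1 \<Longrightarrow> (\<lambda>n. F n x) \<longlonglongrightarrow> f x"
    "\<And>n x. x \<in> space M1 \<Longrightarrow> dist (F n x) 0 \<le> 2 * dist (f x) 0"
    using borel_measurable_implies_sequence_metric[OF f(1), of 0] by blast
  let ?F = "\<lambda>n x. complex_of_real (F n x)" and ?f = "\<lambda>x. complex_of_real (f x)"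
  have Fm: "?F n \<in> borel_measurable M1" for n using borel_measurable_simple_function[OF F(1)] by measurable
  have fm: "?f \<in> borel_measurable M1" using f(1) by measurable
  have Fb: "\<bar>F n x\<bar> \<le> 2 * \<bar>f x\<bar>" if "x \<in> \<Omega>1" for n x using F(3)[of x n] that by (simp add: dist_real_def)
  have Fb': "norm (?F n x) \<le> 2 * C" if "x \<in> \<Omega>1" for n x using Fb[OF that, of n] f(2)[OF that] by simp
  have fL: "?f \<in> L2 \<Omega>1" by (rule bounded_L2[OF fm, of C]) (use f(2) in simp)
  have FL: "?F n \<in> L2 \<Omega>1" for n by (rule bounded_L2[OF Fm Fb'])
  have lim: "L2_lim \<Omega>1 ?F ?f"
  proof (rule L2_lim_dominated[OF Fm fL L2_cmult[OF fL, of 3]])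
    show "AE x in M1. norm (?F n x - ?f x) \<le> norm (3 * ?f x)" for n
    proof (rule AE_I2)
      fix x assume "x \<in> space M1"
      then have "\<bar>F n x - f x\<bar> \<le> 3 * \<bar>f x\<bar>" using Fb[of x n] by simp
      then show "norm (?F n x - ?f x) \<le> norm (3 * ?f x)" by (simp add: norm_mult flip: of_real_diff)
    qed
    show "AE x in M1. (\<lambda>n. ?F n x) \<longlonglongrightarrow> ?f x" by (rule AE_I2) (intro tendsto_intros F(2))
  qed
  have "AE y in M2. U (?F n) y * cnj (one_image y) = cnj (U (?F n) y) * one_image y" for n
  proof -
    define I where "I = F n ` space M1"
    define e where "e c x = (if F n x = c then 1 else 0 :: complex)" for c x
    have I: "finite I" using F(1) by (simp add: I_def simple_function_def)
    have em: "e c \<in> borel_measurable M1" for c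
      unfolding e_def[abs_def] using borel_measurable_simple_function[OF F(1)[of n]] by measurable
    have FI: "?F n x = (\<Sum>c\<in>I. of_real c * e c x)" if "x \<in> \<Omega>1" for x
    proof -
      have "(\<Sum>c\<in>I. of_real c * e c x) = (\<Sum>c\<in>I. if c = F n x then of_real c else 0)" by (intro sum.cong) (auto simp: e_def)
      also have "\<dots> = ?F n x" using I that by (auto simp: I_def)
      finally show ?thesis by simp
    qed
    define S where "S x = (\<Sum>c\<in>I. of_real c * e c x)" for x
    have SF: "AE x in M1. ?F n x = S x" using FI by (auto simp: S_def intro!: AE_I2)
    have SL: "S \<in> L2 \<Omega>1" using L2_cong_AE[OF sets1 FL SF(1)] by auto
    have "AE y in M2. U S y = (\<Sum>c\<in>I. of_real c * U (e c) y)"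
      unfolding S_def[abs_def] by (rule U_simple_mult(2)[OF I em _ const_L2[of 0]]) (simp add: e_def)
    moreover have "AE y in M2. \<forall>c\<in>I. U (e c) y = 0 \<or> U (e c) y = one_image y"
      by (intro AE_finite_allI I U_indicator em) (simp add: e_def)
    ultimately show ?thesis using U_cong[OF FL SL(1) SF(1)]
    proof eventually_elim
      case (elim y)
      have "U (e c) y * cnj (one_image y) = cnj (U (e c) y) * one_image y" if "c \<in> I" for c
        using elim(2) that by (auto simp: mult.commute)
      then have "(\<Sum>c\<in>I. of_real c * (U (e c) y * cnj (one_image y))) = (\<Sum>c\<in>I. of_real c * (cnj (U (e c) y) * one_image y))"
        by (intro sum.cong) auto
      then show ?case using elim(1,3) by (simp add: sum_distrib_right mult.assoc)
    qed
  qed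
  from L2_lim_prod_eq[OF U_lim[OF lim FL fL] L2_lim_cnj[OF U_lim[OF lim FL fL]] U_L2[OF FL] L2_cnj[OF U_L2[OF FL]]
      U_L2[OF fL] L2_cnj[OF U_L2[OF fL]] L2_cnj[OF one_image_L2] one_image_L2 this]
  show ?thesis .
qed

lemma U_real:
  assumes f: "(\<lambda>x. complex_of_real (f x)) \<in> L2 \<Omega>1"
  shows "AE y in M2. U (\<lambda>x. complex_of_real (f x)) y * cnj (one_image y) = cnj (U (\<lambda>x. complex_of_real (f x)) y) * one_image y"
proof -
  let ?f = "\<lambda>x. complex_of_real (f x)"
  have TL: "truncate n ?f \<in> L2 \<Omega>1" for n by (rule truncate_L2[OF f])
  have "AE y in M2. U (truncate n ?f) y * cnj (one_image y) = cnj (U (truncate n ?f) y) * one_image y" for n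
  proof -
    have eq: "truncate n ?f = (\<lambda>x. complex_of_real (if \<bar>f x\<bar> \<le> real n then f x else 0))"
      by (auto simp: truncate_def)
    have "(\<lambda>x. Re (truncate n ?f x)) \<in> borel_measurable M1" using L2_measurable[OF TL] by measurable
    then have "(\<lambda>x. if \<bar>f x\<bar> \<le> real n then f x else 0) \<in> borel_measurable M1" unfolding eq by simp
    then show ?thesis unfolding eq by (rule U_real_bounded[of _ "real n"]) simp
  qed
  from L2_lim_prod_eq[OF U_lim[OF truncate_L2_lim[OF f] TL f] L2_lim_cnj[OF U_lim[OF truncate_L2_lim[OF f] TL f]] U_L2[OF TL] L2_cnj[OF U_L2[OF TL]]
      U_L2[OF f] L2_cnj[OF U_L2[OF f]] L2_cnj[OF one_image_L2] one_image_L2 this]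
  show ?thesis .
qed

text \<open>Choose \<open>f\<close> with \<open>U f = 1\<close>. For its truncations,
  \<open>U (truncate n f) * U f\<close> is a multiple of \<open>one_image\<close>, so
  \<open>U (truncate n f)\<close> vanishes wherever \<open>one_image\<close> does. In the limit
  \<open>U f\<close> vanishes there too, so that set is null.\<close>

lemma one_image_nonzero: "AE y in M2. one_image y \<noteq> 0"
proof -
  have one2: "(\<lambda>y. 1) \<in> L2 \<Omega>2" by (rule smooth_L2[OF smooth_const bounded2 sets2])
  obtain f where f: "f \<in> L2 \<Omega>1" "AE y in M2. U f y = 1" using U_surj[OF one2] by blast
  note TL = truncate_L2[OF f(1)]
  define s where "s y = (if one_image y = 0 then 1 else 0 :: complex)" for y
  have sL: "s \<in> L2 \<Omega>2"
  proof (rule L2_norm_bounded(1)[OF lmeasurable2])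
    show "s \<in> borel_measurable M2" unfolding s_def[abs_def] using L2_measurable[OF one_image_L2] by measurable
    show "norm (s y) \<le> 1" for y by (simp add: s_def)
  qed
  have "AE y in M2. U (truncate n f) y * s y = (\<lambda>y. 0) y * s y" for n
  proof -
    have "AE y in M2. U (\<lambda>x. truncate n f x * f x) y * one_image y = U (truncate n f) y * U f y"
      by (rule U_bounded_mult[OF L2_measurable[OF TL] truncate_bounded f(1)])
    with f(2) show ?thesis by eventually_elim (auto simp: s_def)
  qed
  from L2_lim_prod_eq[OF U_lim[OF truncate_L2_lim[OF f(1)] TL f(1)] L2_lim_const U_L2[OF TL] L2_zero U_L2[OF f(1)] L2_zero sL sL this]
  have "AE y in M2. U f y * s y = 0" by simp
  with f(2) show ?thesis by eventually_elim (auto simp: s_def)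
qed

end

section \<open>Intertwiners of Dirichlet Laplacians\<close>

locale laplacian_intertwiner = disjointness_preserving_bijection +
  assumes nonempty1: "\<Omega>1 \<noteq> {}" and nonempty2: "\<Omega>2 \<noteq> {}"
    and intertwines: "intertwines_dirichlet_laplacians \<Omega>1 \<Omega>2 U"
begin

lemma graph_forward:
  assumes "dirichlet_graph \<Omega>1 u v"
  shows "dirichlet_graph \<Omega>2 (U u) (U v)"
proof -
  have u: "u \<in> dirichlet_domain \<Omega>1" "v \<in> L2 \<Omega>1" "AE x in M1. dirichlet_laplacian \<Omega>1 u x = v x"
    using assms dirichlet_graph_iff_domain[OF open1] by (auto simp: ae_eq_def)
  have "AE x in M1. v x = dirichlet_laplacian \<Omega>1 u x" using u(3) by eventually_elim (rule sym)
  then have "dirichlet_laplacian \<Omega>1 u \<in> L2 \<Omega>1" by (rule L2_cong_AE[OF sets1 u(2)])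
  from U_cong[OF this u(2,3)] have "AE y in M2. U (dirichlet_laplacian \<Omega>1 u) y = U v y" .
  moreover have "U u \<in> dirichlet_domain \<Omega>2" "AE y in M2. dirichlet_laplacian \<Omega>2 (U u) y = U (dirichlet_laplacian \<Omega>1 u) y"
    using intertwines u(1) by (auto simp: intertwines_dirichlet_laplacians_def ae_eq_def)
  ultimately have "AE y in M2. dirichlet_laplacian \<Omega>2 (U u) y = U v y" by (auto elim: eventually_elim2)
  then show ?thesis
    using \<open>U u \<in> dirichlet_domain \<Omega>2\<close> U_L2[OF u(2)] dirichlet_graph_iff_domain[OF open2] by (auto simp: ae_eq_def)
qed

text \<open>The resolvent \<open>(1 - \<Delta>)\<^sup>-\<^sup>1\<close> exists on \<open>\<Omega>1\<close>, and \<open>1 - \<Delta>\<close> is injective on \<open>\<Omega>2\<close>.\<close>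

lemma graph_backward:
  assumes f: "f \<in> L2 \<Omega>1" and g: "g \<in> L2 \<Omega>1" and D: "dirichlet_graph \<Omega>2 (U f) (U g)"
  shows "dirichlet_graph \<Omega>1 f g"
proof -
  have fg: "(\<lambda>x. f x - g x) \<in> L2 \<Omega>1" by (rule L2_diff[OF f g])
  obtain u where u: "dirichlet_graph \<Omega>1 u (\<lambda>x. u x - (f x - g x))"
    using dirichlet_resolvent_exists[OF open1 bounded1 fg] by blast
  note uL = dirichlet_graph_L2[OF u]
  have "dirichlet_graph \<Omega>2 (\<lambda>y. U u y - U f y) (\<lambda>y. U (\<lambda>x. u x - (f x - g x)) y - U g y)"
    by (rule dirichlet_graph_diff[OF graph_forward[OF u] D open2])
  \<comment> \<open>The right-hand side \<open>f - g\<close> of the resolvent equation is chosen so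
    that the difference of the two images is reproduced by the Laplacian, which only 0 is.\<close>
  then have "dirichlet_graph \<Omega>2 (\<lambda>y. U u y - U f y) (\<lambda>y. U u y - U f y)"
  proof (rule dirichlet_graph_cong_AE[OF _ open2])
    show "AE y in M2. U (\<lambda>x. u x - (f x - g x)) y - U g y = U u y - U f y"
      using U_diff[OF uL(1) fg] U_diff[OF f g] by eventually_elim simp
  qed simp
  from dirichlet_graph_self_imp_0[OF this open2] have "AE y in M2. U u y = U f y" by simp
  from U_inj[OF uL(1) f this] have uf: "AE x in M1. u x = f x" .
  then have "AE x in M1. u x - (f x - g x) = g x" by eventually_elim simp
  from dirichlet_graph_cong_AE[OF u open1 uf this] show ?thesis .
qed

lemma graph_surj:
  assumes D: "dirichlet_graph \<Omega>2 \<phi> \<psi>"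
  obtains u v where "dirichlet_graph \<Omega>1 u v" "AE y in M2. U u y = \<phi> y" "AE y in M2. U v y = \<psi> y"
proof -
  note L = dirichlet_graph_L2[OF D]
  obtain u where u: "u \<in> L2 \<Omega>1" "AE y in M2. U u y = \<phi> y" using U_surj[OF L(1)] by blast
  obtain v where v: "v \<in> L2 \<Omega>1" "AE y in M2. U v y = \<psi> y" using U_surj[OF L(2)] by blast
  have "AE y in M2. \<phi> y = U u y" "AE y in M2. \<psi> y = U v y" using u(2) v(2) by (auto elim: eventually_mono)
  from graph_backward[OF u(1) v(1) dirichlet_graph_cong_AE[OF D open2 this]] show ?thesis by (rule that[OF _ u(2) v(2)])
qed

text \<open>The multiplier on \<Omega>2 corresponding to multiplication by
  \<open>x \<bullet> v\<close> on \<Omega>1. It is a quotient of two L2 functions, with neither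
  integrability nor smoothness at this stage.\<close>

definition t :: "'a \<Rightarrow> 'b \<Rightarrow> complex" where
  "t v y = U (\<lambda>x. complex_of_real (x \<bullet> v)) y / one_image y"

lemma inner_L2: "(\<lambda>x. complex_of_real (x \<bullet> v)) \<in> L2 \<Omega>1"
  by (rule smooth_L2[OF smooth_inner bounded1 sets1])

lemma t_mult:
  assumes "u \<in> L2 \<Omega>1"
  shows "AE y in M2. U (\<lambda>x. complex_of_real (x \<bullet> v) * u x) y = t v y * U u y"
proof -
  obtain C where C: "\<And>x. x \<in> \<Omega>1 \<Longrightarrow> norm (complex_of_real (x \<bullet> v)) \<le> C" using bounded_inner_bound[OF bounded1] by blast
  have "AE y in M2. U (\<lambda>x. complex_of_real (x \<bullet> v) * u x) y * one_image y = U (\<lambda>x. complex_of_real (x \<bullet> v)) y * U u y"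
    by (rule U_bounded_mult[OF smooth_measurable[OF smooth_inner] C assms])
  then show ?thesis
    using one_image_nonzero by eventually_elim (simp add: t_def field_simps)
qed

lemma t_real: "AE y in M2. cnj (t v y) = t v y"
  using U_real[OF inner_L2, of v] one_image_nonzero
  by eventually_elim (simp add: t_def field_simps)

text \<open>A test function on \<Omega>2 is pulled back to \<open>u\<close> in the Dirichlet domain
  of \<Omega>1. There the coordinates satisfy the commutator relations exactly, half of the first
  commutator applied to \<open>u\<close> being the partial derivative \<open>g i\<close>; pushing
  forward gives \<open>p i = U (g i)\<close>.\<close>

lemma multiplier_coordinates_t: "multiplier_coordinates \<Omega>2 (Basis :: 'a set) t"
proof
  fix \<phi> assume \<phi>: "\<phi> \<in> test_functions \<Omega>2"
  have D\<phi>: "dirichlet_graph \<Omega>2 \<phi> (laplacian \<phi>)" by (rule dirichlet_graph_test[OF \<phi> open2])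
  obtain u v where D: "dirichlet_graph \<Omega>1 u v" and u: "AE y in M2. U u y = \<phi> y" and v: "AE y in M2. U v y = laplacian \<phi> y"
    by (rule graph_surj[OF D\<phi>])
  note uL = dirichlet_graph_L2(1)[OF D] and vL = dirichlet_graph_L2(2)[OF D]
  obtain g where g: "H10_gradient \<Omega>1 u g" using dirichlet_graph_gradient[OF D open1] by blast
  note gL = H10_gradientD(2)[OF g]
  define p where "p i = U (g i)" for i
  show "\<exists>p. \<forall>i\<in>Basis. dirichlet_graph \<Omega>2 (\<lambda>y. t i y * \<phi> y) (\<lambda>y. t i y * laplacian \<phi> y + 2 * p i y) \<and>
        (\<forall>j\<in>Basis. dirichlet_graph \<Omega>2 (\<lambda>y. t j y * (t i y * \<phi> y))
          (\<lambda>y. t j y * (t i y * laplacian \<phi> y + 2 * p i y) + 2 * (t i y * p j y + (if i = j then \<phi> y else 0))))"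
  proof (intro exI[of _ p] ballI conjI)
    fix i :: 'a assume i: "i \<in> Basis"
    let ?xu = "\<lambda>x. complex_of_real (x \<bullet> i) * u x" and ?xv = "\<lambda>x. complex_of_real (x \<bullet> i) * v x + 2 * g i x"
    have Di: "dirichlet_graph \<Omega>1 ?xu ?xv" by (rule dirichlet_graph_coordinate_mult[OF D g i bounded1 open1])
    note xL = dirichlet_graph_L2[OF Di]
    have 1: "AE y in M2. U ?xu y = t i y * \<phi> y"
      using t_mult[OF uL, of i] u by eventually_elim simp
    have 2: "AE y in M2. U ?xv y = t i y * laplacian \<phi> y + 2 * p i y"
      using U_add[OF L2_coordinate_mult[OF bounded1 vL] L2_cmult[OF gL[OF i]], of i 2] t_mult[OF vL, of i] v U_cmult[OF gL[OF i], of 2]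
      by eventually_elim (simp add: p_def)
    show "dirichlet_graph \<Omega>2 (\<lambda>y. t i y * \<phi> y) (\<lambda>y. t i y * laplacian \<phi> y + 2 * p i y)"
      by (rule dirichlet_graph_cong_AE[OF graph_forward[OF Di] open2 1 2])
    fix j :: 'a assume j: "j \<in> Basis"
    have gi: "H10_gradient \<Omega>1 ?xu (\<lambda>b x. complex_of_real (x \<bullet> i) * g b x + of_real (b \<bullet> i) * u x)"
      by (rule H10_gradient_coordinate_mult[OF g bounded1 sets1])
    have Dj: "dirichlet_graph \<Omega>1 (\<lambda>x. complex_of_real (x \<bullet> j) * ?xu x)
       (\<lambda>x. complex_of_real (x \<bullet> j) * ?xv x + 2 * (complex_of_real (x \<bullet> i) * g j x + of_real (j \<bullet> i) * u x))"
      by (rule dirichlet_graph_coordinate_mult[OF Di gi j bounded1 open1])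
    have 3: "AE y in M2. U (\<lambda>x. complex_of_real (x \<bullet> j) * ?xu x) y = t j y * (t i y * \<phi> y)"
      using t_mult[OF xL(1), of j] 1 by eventually_elim simp
    let ?w = "\<lambda>x. complex_of_real (x \<bullet> i) * g j x + of_real (j \<bullet> i) * u x"
    have wL: "?w \<in> L2 \<Omega>1" by (rule H10_gradientD(2)[OF gi j])
    have ji: "complex_of_real (j \<bullet> i) = (if i = j then 1 else 0)" using i j by (auto simp: inner_Basis)
    have 4: "AE y in M2. U ?w y = t i y * p j y + (if i = j then \<phi> y else 0)"
      using U_add[OF L2_coordinate_mult[OF bounded1 gL[OF j]] L2_cmult[OF uL], of i "of_real (j \<bullet> i)"] t_mult[OF gL[OF j], of i]
        U_cmult[OF uL, of "of_real (j \<bullet> i)"] u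
      by eventually_elim (auto simp: p_def ji)
    have 5: "AE y in M2. U (\<lambda>x. complex_of_real (x \<bullet> j) * ?xv x + 2 * ?w x) y
        = t j y * (t i y * laplacian \<phi> y + 2 * p i y) + 2 * (t i y * p j y + (if i = j then \<phi> y else 0))"
      using U_add[OF L2_coordinate_mult[OF bounded1 xL(2)] L2_cmult[OF wL], of j 2] t_mult[OF xL(2), of j] 2 U_cmult[OF wL, of 2] 4
      by eventually_elim simp
    show "dirichlet_graph \<Omega>2 (\<lambda>y. t j y * (t i y * \<phi> y))
          (\<lambda>y. t j y * (t i y * laplacian \<phi> y + 2 * p i y) + 2 * (t i y * p j y + (if i = j then \<phi> y else 0)))"
      by (rule dirichlet_graph_cong_AE[OF graph_forward[OF Dj] open2 3 5])
  qed
qed (use open2 nonempty2 t_real in auto)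

section \<open>Coordinates of the second domain pulled back to the first\<close>

lemma inner_one_image_L2: "(\<lambda>y. complex_of_real (y \<bullet> w) * one_image y) \<in> L2 \<Omega>2"
  by (rule L2_coordinate_mult[OF bounded2 one_image_L2])

text \<open>The inverse of \<open>U\<close> is not treated as a disjointness-preserving operator.
  The counterpart of \<open>t\<close> is instead a preimage of \<open>y \<bullet> w\<close> times
  \<open>one_image\<close>, and its multiplier property is derived from that of
  \<open>U\<close>.\<close>

definition s :: "'b \<Rightarrow> 'a \<Rightarrow> complex" where
  "s w = (SOME f. f \<in> L2 \<Omega>1 \<and> (AE y in M2. U f y = complex_of_real (y \<bullet> w) * one_image y))"

lemma s_props: "s w \<in> L2 \<Omega>1" "AE y in M2. U (s w) y = complex_of_real (y \<bullet> w) * one_image y"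
proof -
  have "\<exists>f. f \<in> L2 \<Omega>1 \<and> (AE y in M2. U f y = complex_of_real (y \<bullet> w) * one_image y)"
    using U_surj[OF inner_one_image_L2] by blast
  from someI_ex[OF this, folded s_def]
  have "s w \<in> L2 \<Omega>1 \<and> (AE y in M2. U (s w) y = complex_of_real (y \<bullet> w) * one_image y)" .
  then show "s w \<in> L2 \<Omega>1" "AE y in M2. U (s w) y = complex_of_real (y \<bullet> w) * one_image y" by auto
qed

text \<open>A bound for \<open>s w\<close> is not at hand, so it is not clear that its product with
  an L2 function is in L2. The candidate \<open>f'\<close> is the preimage of
  \<open>(y \<bullet> w) * U f\<close>. Where \<open>norm (f x)\<close> is at most \<open>n\<close>,
  multiplicativity of \<open>U\<close> identifies it with \<open>s w * f\<close>, and these sets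
  exhaust \<Omega>1.\<close>

lemma s_mult:
  assumes f: "f \<in> L2 \<Omega>1"
  shows "(\<lambda>x. s w x * f x) \<in> L2 \<Omega>1" "AE y in M2. U (\<lambda>x. s w x * f x) y = complex_of_real (y \<bullet> w) * U f y"
proof -
  obtain f' where f': "f' \<in> L2 \<Omega>1" "AE y in M2. U f' y = complex_of_real (y \<bullet> w) * U f y"
    using U_surj[OF L2_coordinate_mult[OF bounded2 U_L2[OF f]]] by blast
  have "AE x in M1. norm (f x) \<le> real n \<longrightarrow> f' x = s w x * f x" for n
  proof -
    define e where "e x = (if norm (f x) \<le> real n then 1 else 0 :: complex)" for x
    have em: "e \<in> borel_measurable M1" unfolding e_def[abs_def] using L2_measurable[OF f] by measurable
    have e01: "e x = 0 \<or> e x = 1" for x by (simp add: e_def)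
    have ef: "(\<lambda>x. e x * f x) = truncate n f" by (auto simp: e_def truncate_def)
    have fm: "truncate n f \<in> borel_measurable M1" by (rule truncate_measurable[OF L2_measurable[OF f]])
    have fsL: "(\<lambda>x. truncate n f x * s w x) \<in> L2 \<Omega>1" by (rule L2_mult_bounded[OF s_props(1) fm truncate_bounded])
    have ef'L: "(\<lambda>x. e x * f' x) \<in> L2 \<Omega>1" by (rule L2_mult_bounded[OF f'(1) em, of 1]) (simp add: e_def)
    have "AE y in M2. U (\<lambda>x. e x * f' x) y = U (\<lambda>x. truncate n f x * s w x) y"
      using U_bounded_mult[OF fm truncate_bounded s_props(1)[of w]] U_indicator_mult[OF em e01 f'(1)] U_indicator_mult[OF em e01 f]
        s_props(2)[of w] f'(2) one_image_nonzero
    proof eventually_elim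
      case (elim y)
      have "U (\<lambda>x. e x * f' x) y * one_image y = complex_of_real (y \<bullet> w) * (U e y * U f y)" using elim(2,5) by simp
      also have "\<dots> = complex_of_real (y \<bullet> w) * (U (truncate n f) y * one_image y)" using elim(3) by (simp add: ef)
      also have "\<dots> = U (\<lambda>x. truncate n f x * s w x) y * one_image y" using elim(1,4) by (auto simp: mult_ac)
      finally show ?case using elim(6) by simp
    qed
    from U_inj[OF ef'L fsL this] show ?thesis by eventually_elim (auto simp: e_def truncate_def)
  qed
  then have "AE x in M1. \<forall>n. norm (f x) \<le> real n \<longrightarrow> f' x = s w x * f x"
    unfolding AE_all_countable by blast
  then have eq: "AE x in M1. f' x = s w x * f x"
  proof eventually_elim
    case (elim x)
    then show ?case using real_arch_simple[of "norm (f x)"] by blast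
  qed
  show L: "(\<lambda>x. s w x * f x) \<in> L2 \<Omega>1" by (rule L2_cong_AE[OF sets1 f'(1) eq])
  show "AE y in M2. U (\<lambda>x. s w x * f x) y = complex_of_real (y \<bullet> w) * U f y"
    using U_cong[OF f'(1) L eq] f'(2) by eventually_elim simp
qed

text \<open>Images of real functions are real multiples of \<open>one_image\<close>, and so is
  \<open>U (s w)\<close> by construction. Hence the image of the imaginary part of
  \<open>s w\<close> vanishes, and \<open>U\<close> is injective.\<close>

lemma s_real: "AE x in M1. cnj (s w x) = s w x"
proof -
  define a where "a x = Re (s w x)" for x
  define b where "b x = Im (s w x)" for x
  have aL: "(\<lambda>x. complex_of_real (a x)) \<in> L2 \<Omega>1" and bL: "(\<lambda>x. complex_of_real (b x)) \<in> L2 \<Omega>1"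
    by (rule L2_bound[OF s_props(1)[of w], where C=1];
      use L2_measurable[OF s_props(1)[of w]] abs_Re_le_cmod abs_Im_le_cmod in \<open>simp add: a_def[abs_def] b_def[abs_def]\<close>)+
  have sum: "(\<lambda>x. complex_of_real (a x) + \<i> * complex_of_real (b x)) = s w"
    by (auto simp: a_def b_def fun_eq_iff complex_eq_iff)
  have "AE y in M2. U (\<lambda>x. complex_of_real (b x)) y = 0"
    using U_add[OF aL L2_cmult[OF bL], of \<i>, unfolded sum] U_cmult[OF bL, of \<i>] U_real[OF aL] U_real[OF bL] s_props(2)[of w] one_image_nonzero
  proof eventually_elim
    case (elim y)
    let ?h = "one_image y" and ?A = "U (\<lambda>x. complex_of_real (a x)) y" and ?B = "U (\<lambda>x. complex_of_real (b x)) y"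
    have 1: "?A + \<i> * ?B = complex_of_real (y \<bullet> w) * ?h" using elim(1,2,5) by simp
    then have "cnj (?A + \<i> * ?B) * ?h = (?A + \<i> * ?B) * cnj ?h" by (simp add: mult_ac)
    then have "\<i> * (?B * cnj ?h) = 0" using elim(3,4) by (simp add: algebra_simps)
    then show ?case using elim(6) by simp
  qed
  from U_eq_0[OF bL this] show ?thesis
    by eventually_elim (simp add: b_def complex_eq_iff)
qed

text \<open>The mirror image of the construction for \<open>t\<close>: a test function is pushed
  forward with \<open>U\<close>, the commutators with the coordinates of \<Omega>2 are used there,
  and \<open>graph_backward\<close> brings the relations back. The \<open>p i\<close> are preimages
  of the partial derivatives of \<open>U \<phi>\<close>.\<close>

lemma multiplier_coordinates_s: "multiplier_coordinates \<Omega>1 (Basis :: 'b set) s"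
proof
  fix \<phi> assume \<phi>: "\<phi> \<in> test_functions \<Omega>1"
  have D\<phi>: "dirichlet_graph \<Omega>1 \<phi> (laplacian \<phi>)" by (rule dirichlet_graph_test[OF \<phi> open1])
  note L\<phi> = dirichlet_graph_L2[OF D\<phi>]
  note D = graph_forward[OF D\<phi>]
  obtain g where g: "H10_gradient \<Omega>2 (U \<phi>) g" using dirichlet_graph_gradient[OF D open2] by blast
  note gL = H10_gradientD(2)[OF g]
  have "\<exists>p. p \<in> L2 \<Omega>1 \<and> (AE y in M2. U p y = g i y)" if "i \<in> Basis" for i using U_surj[OF gL[OF that]] by blast
  then obtain p where p: "\<And>i. i \<in> Basis \<Longrightarrow> p i \<in> L2 \<Omega>1" "\<And>i. i \<in> Basis \<Longrightarrow> AE y in M2. U (p i) y = g i y" by metis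
  show "\<exists>p. \<forall>i\<in>Basis. dirichlet_graph \<Omega>1 (\<lambda>x. s i x * \<phi> x) (\<lambda>x. s i x * laplacian \<phi> x + 2 * p i x) \<and>
        (\<forall>j\<in>Basis. dirichlet_graph \<Omega>1 (\<lambda>x. s j x * (s i x * \<phi> x))
          (\<lambda>x. s j x * (s i x * laplacian \<phi> x + 2 * p i x) + 2 * (s i x * p j x + (if i = j then \<phi> x else 0))))"
  proof (intro exI[of _ p] ballI conjI)
    fix i :: 'b assume i: "i \<in> Basis"
    let ?u = "\<lambda>x. s i x * \<phi> x" and ?v = "\<lambda>x. s i x * laplacian \<phi> x + 2 * p i x"
    have uL: "?u \<in> L2 \<Omega>1" by (rule s_mult(1)[OF L\<phi>(1)])
    have vL: "?v \<in> L2 \<Omega>1" by (intro L2_add L2_cmult s_mult(1)[OF L\<phi>(2)] p(1)[OF i])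
    have Di: "dirichlet_graph \<Omega>2 (\<lambda>y. complex_of_real (y \<bullet> i) * U \<phi> y) (\<lambda>y. complex_of_real (y \<bullet> i) * U (laplacian \<phi>) y + 2 * g i y)"
      by (rule dirichlet_graph_coordinate_mult[OF D g i bounded2 open2])
    have 1: "AE y in M2. complex_of_real (y \<bullet> i) * U \<phi> y = U ?u y"
      using s_mult(2)[OF L\<phi>(1), of i] by eventually_elim simp
    have 2: "AE y in M2. complex_of_real (y \<bullet> i) * U (laplacian \<phi>) y + 2 * g i y = U ?v y"
      using U_add[OF s_mult(1)[OF L\<phi>(2), of i] L2_cmult[OF p(1)[OF i], of 2]] s_mult(2)[OF L\<phi>(2), of i] U_cmult[OF p(1)[OF i], of 2] p(2)[OF i]
      by eventually_elim simp
    show "dirichlet_graph \<Omega>1 ?u ?v"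
      by (rule graph_backward[OF uL vL dirichlet_graph_cong_AE[OF Di open2 1 2]])
    fix j :: 'b assume j: "j \<in> Basis"
    have gi: "H10_gradient \<Omega>2 (\<lambda>y. complex_of_real (y \<bullet> i) * U \<phi> y) (\<lambda>b y. complex_of_real (y \<bullet> i) * g b y + of_real (b \<bullet> i) * U \<phi> y)"
      by (rule H10_gradient_coordinate_mult[OF g bounded2 sets2])
    have Dj: "dirichlet_graph \<Omega>2 (\<lambda>y. complex_of_real (y \<bullet> j) * (complex_of_real (y \<bullet> i) * U \<phi> y))
       (\<lambda>y. complex_of_real (y \<bullet> j) * (complex_of_real (y \<bullet> i) * U (laplacian \<phi>) y + 2 * g i y) + 2 * (complex_of_real (y \<bullet> i) * g j y + of_real (j \<bullet> i) * U \<phi> y))"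
      by (rule dirichlet_graph_coordinate_mult[OF Di gi j bounded2 open2])
    let ?w = "\<lambda>x. s i x * p j x + (if i = j then \<phi> x else 0)"
    have cL: "(\<lambda>x. if i = j then \<phi> x else 0) \<in> L2 \<Omega>1" using L\<phi>(1) by (cases "i = j") simp_all
    have wL: "?w \<in> L2 \<Omega>1" by (intro L2_add s_mult(1)[OF p(1)[OF j]] cL)
    have c: "AE y in M2. U (\<lambda>x. if i = j then \<phi> x else 0) y = of_real (j \<bullet> i) * U \<phi> y"
      using U_zero i j by (cases "i = j") (simp_all add: inner_Basis)
    have 3: "AE y in M2. U ?w y = complex_of_real (y \<bullet> i) * g j y + of_real (j \<bullet> i) * U \<phi> y"
      using U_add[OF s_mult(1)[OF p(1)[OF j], of i] cL] s_mult(2)[OF p(1)[OF j], of i] p(2)[OF j] c by eventually_elim simp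
    have 4: "AE y in M2. complex_of_real (y \<bullet> j) * (complex_of_real (y \<bullet> i) * U \<phi> y) = U (\<lambda>x. s j x * ?u x) y"
      using s_mult(2)[OF uL, of j] 1 by eventually_elim simp
    have 5: "AE y in M2. complex_of_real (y \<bullet> j) * (complex_of_real (y \<bullet> i) * U (laplacian \<phi>) y + 2 * g i y) + 2 * (complex_of_real (y \<bullet> i) * g j y + of_real (j \<bullet> i) * U \<phi> y)
       = U (\<lambda>x. s j x * ?v x + 2 * ?w x) y"
      using U_add[OF s_mult(1)[OF vL, of j] L2_cmult[OF wL, of 2]] s_mult(2)[OF vL, of j] 2 U_cmult[OF wL, of 2] 3
      by eventually_elim simp
    show "dirichlet_graph \<Omega>1 (\<lambda>x. s j x * (s i x * \<phi> x))
          (\<lambda>x. s j x * (s i x * laplacian \<phi> x + 2 * p i x) + 2 * (s i x * p j x + (if i = j then \<phi> x else 0)))"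
      by (rule graph_backward[OF s_mult(1)[OF uL] L2_add[OF s_mult(1)[OF vL] L2_cmult[OF wL]] dirichlet_graph_cong_AE[OF Dj open2 4 5]])
  qed
qed (use open1 nonempty1 s_real in auto)

lemma DIM_eq: "DIM('a) = DIM('b)"
  using multiplier_coordinates.card_le_DIM[OF multiplier_coordinates_t]
    multiplier_coordinates.card_le_DIM[OF multiplier_coordinates_s] by simp

end

section \<open>Regularity in capacity\<close>

lemma L2_norm_UNIV_eq:
  assumes "\<Omega> \<in> sets lebesgue" "f \<in> L2 UNIV" "AE x in lebesgue. x \<notin> \<Omega> \<longrightarrow> f x = 0"
  shows "L2_norm UNIV f = L2_norm \<Omega> f"
proof -
  have fm: "f \<in> borel_measurable lebesgue" using L2_measurable[OF assms(2)] by (simp add: lebesgue_on_UNIV_eq)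
  have "(\<integral>x. (norm (f x))\<^sup>2 \<partial>lebesgue) = (\<integral>x. indicator \<Omega> x *\<^sub>R (norm (f x))\<^sup>2 \<partial>lebesgue)"
  proof (rule integral_cong_AE)
    show "(\<lambda>x. (norm (f x))\<^sup>2) \<in> borel_measurable lebesgue" using fm by measurable
    show "(\<lambda>x. indicator \<Omega> x *\<^sub>R (norm (f x))\<^sup>2) \<in> borel_measurable lebesgue" using fm assms(1) by measurable
    show "AE x in lebesgue. (norm (f x))\<^sup>2 = indicator \<Omega> x *\<^sub>R (norm (f x))\<^sup>2"
      using assms(3) by eventually_elim (auto simp: indicator_def)
  qed
  then show ?thesis using assms(1) by (simp add: L2_norm_def lebesgue_on_UNIV_eq integral_restrict_space)
qed

text \<open>If a cutoff \<open>v\<close> around a missing point \<open>w\<close> lies in \<open>H10 \<Omega>\<close>, then \<open>v - \<phi>\<close> is admissible for the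
  capacity of \<open>ball w r - \<Omega>\<close> for every test function \<open>\<phi>\<close> on \<open>\<Omega>\<close>, and these have arbitrarily small norm.\<close>

lemma regular_in_capacity_imp_subset:
  fixes \<Omega> S :: "'a::euclidean_space set"
  assumes \<Omega>: "open \<Omega>" "regular_in_capacity \<Omega>" and S: "open S" "negligible (S - \<Omega>)"
    and cutoff: "\<And>w. w \<in> S \<Longrightarrow> \<exists>v\<in>test_functions S. \<exists>r>0. (\<forall>x\<in>ball w r. v x = 1) \<and> v \<in> H10 \<Omega>"
  shows "S \<subseteq> \<Omega>"
proof
  fix w assume w: "w \<in> S"
  show "w \<in> \<Omega>"
  proof (rule ccontr)
    assume nw: "w \<notin> \<Omega>"
    have \<Omega>s: "\<Omega> \<in> sets lebesgue" using \<Omega> by simp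
    obtain v r where v: "v \<in> test_functions S" "r > 0" "\<And>x. x \<in> ball w r \<Longrightarrow> v x = 1" "v \<in> H10 \<Omega>"
      using cutoff[OF w] by blast
    \<comment> \<open>Otherwise a nonempty open part of \<open>S\<close> would lie outside \<Omega>,
      although \<open>S - \<Omega>\<close> is null. So the missing point is a boundary point, where
      the capacity condition applies.\<close>
    have "w \<in> closure \<Omega>"
    proof (rule ccontr)
      assume "w \<notin> closure \<Omega>"
      then have "w \<in> S - closure \<Omega>" using w by simp
      moreover have "open (S - closure \<Omega>)" using S(1) by (simp add: open_Diff)
      moreover have "negligible (S - closure \<Omega>)" using S(2) by (rule negligible_subset) (use closure_subset in auto)
      ultimately show False using open_not_negligible by blast
    qed
    then have "w \<in> frontier \<Omega>" using nw \<Omega>(1) by (simp add: frontier_def interior_open)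
    then have cap: "capacity (ball w r - \<Omega>) > 0" using \<Omega>(2) v(2) by (simp add: regular_in_capacity_def)
    obtain g where g: "H10_gradient \<Omega> v g" using v(4) H10_iff[OF \<Omega>(1)] by blast
    obtain \<phi> where \<phi>: "\<And>n. \<phi> n \<in> test_functions \<Omega>" "L2_lim \<Omega> \<phi> v" "\<And>b. b \<in> Basis \<Longrightarrow> L2_lim \<Omega> (\<lambda>n. partial_deriv b (\<phi> n)) (g b)"
      using g unfolding H10_gradient_def by blast
    have sv: "smooth v" by (rule test_functions_smooth[OF v(1)])
    have vU: "v \<in> test_functions UNIV" and \<phi>U: "\<phi> n \<in> test_functions UNIV" for n
      using test_functions_mono[OF subset_UNIV] v(1) \<phi>(1) by auto
    define \<psi> where "\<psi> n x = v x - \<phi> n x" for n x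
    have \<psi>U: "\<psi> n \<in> test_functions UNIV" for n unfolding \<psi>_def[abs_def] by (rule test_functions_diff[OF vU \<phi>U])
    have U: "(UNIV :: 'a set) \<in> sets lebesgue" by simp
    have ae: "AE x in lebesgue. x \<notin> \<Omega> \<longrightarrow> x \<notin> S"
    proof -
      have "{x. x \<in> S \<and> x \<notin> \<Omega>} = S - \<Omega>" by auto
      then have "AE x in lebesgue_on UNIV. x \<notin> \<Omega> \<longrightarrow> x \<notin> S"
        using S(2) by (subst AE_lebesgue_on_iff) (auto simp: conj_commute)
      then show ?thesis by (simp only: lebesgue_on_UNIV_eq)
    qed
    have dvL: "partial_deriv b v \<in> L2 \<Omega>" if "b \<in> Basis" for b
      by (rule test_functions_L2[OF test_functions_partial_deriv[OF v(1) that] \<Omega>s])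
    \<comment> \<open>The gradient delivered by H10 agrees on \<Omega> with the classical gradient
      of \<open>v\<close>. As \<open>v\<close> is supported in \<open>S\<close> and
      \<open>S - \<Omega>\<close> is null, norms over the whole space reduce to norms over
      \<Omega>.\<close>
    have gv: "AE x in lebesgue_on \<Omega>. g b x = partial_deriv b v x" if b: "b \<in> Basis" for b
      by (rule has_weak_deriv_unique[OF \<Omega>(1) H10_gradientD(2)[OF g b] dvL[OF b] H10_gradient_weak_deriv[OF g b \<Omega>s] has_weak_deriv_smooth[OF sv b \<Omega>s]])
    have n1: "L2_norm UNIV (\<psi> n) = L2_norm \<Omega> (\<lambda>x. \<phi> n x - v x)" for n
    proof -
      have "L2_norm UNIV (\<psi> n) = L2_norm \<Omega> (\<psi> n)"
        by (rule L2_norm_UNIV_eq[OF \<Omega>s test_functions_L2[OF \<psi>U U]])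
          (use ae in \<open>eventually_elim, simp add: \<psi>_def test_functions_outside[OF v(1)] test_functions_outside[OF \<phi>(1)]\<close>)
      then show ?thesis by (simp add: \<psi>_def[abs_def] L2_norm_minus_commute[of \<Omega> v])
    qed
    have n2: "L2_norm UNIV (partial_deriv b (\<psi> n)) = L2_norm \<Omega> (\<lambda>x. partial_deriv b (\<phi> n) x - g b x)" if b: "b \<in> Basis" for n b
    proof -
      note dv = test_functions_partial_deriv[OF v(1) b] and d\<phi> = test_functions_partial_deriv[OF \<phi>(1) b]
      have d: "partial_deriv b (\<psi> n) = (\<lambda>x. partial_deriv b v x - partial_deriv b (\<phi> n) x)"
        unfolding \<psi>_def[abs_def] by (rule partial_deriv_diff[OF sv test_functions_smooth[OF \<phi>(1)]])
      have "L2_norm UNIV (partial_deriv b (\<psi> n)) = L2_norm \<Omega> (partial_deriv b (\<psi> n))"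
        by (rule L2_norm_UNIV_eq[OF \<Omega>s test_functions_L2[OF test_functions_partial_deriv[OF \<psi>U b] U]])
          (use ae in \<open>eventually_elim, simp add: d test_functions_outside[OF dv] test_functions_outside[OF d\<phi>]\<close>)
      also have "\<dots> = L2_norm \<Omega> (\<lambda>x. partial_deriv b (\<phi> n) x - partial_deriv b v x)"
        unfolding d by (rule L2_norm_minus_commute)
      also have "\<dots> = L2_norm \<Omega> (\<lambda>x. partial_deriv b (\<phi> n) x - g b x)"
        by (intro L2_norm_cong_AE L2_measurable[OF L2_diff] test_functions_L2[OF d\<phi> \<Omega>s] dvL b H10_gradientD(2)[OF g b])
          (use gv[OF b] in \<open>auto elim: eventually_mono\<close>)
      finally show ?thesis .
    qed
    have H: "(H1_norm UNIV (\<psi> n))\<^sup>2 = (L2_norm \<Omega> (\<lambda>x. \<phi> n x - v x))\<^sup>2 + (\<Sum>b\<in>Basis. (L2_norm \<Omega> (\<lambda>x. partial_deriv b (\<phi> n) x - g b x))\<^sup>2)" for n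
    proof -
      have "H1_norm UNIV (\<psi> n) = sqrt ((L2_norm UNIV (\<psi> n))\<^sup>2 + (\<Sum>b\<in>Basis. (L2_norm UNIV (partial_deriv b (\<psi> n)))\<^sup>2))"
        by (rule H1_norm_eq[OF open_UNIV])
          (use test_functions_L2[OF test_functions_partial_deriv[OF \<psi>U] U] has_weak_deriv_smooth[OF test_functions_smooth[OF \<psi>U] _ U] in auto)
      then show ?thesis by (simp add: n1 n2 sum_nonneg)
    qed
    have "(\<lambda>n. (H1_norm UNIV (\<psi> n))\<^sup>2) \<longlonglongrightarrow> 0\<^sup>2 + (\<Sum>b\<in>(Basis::'a set). 0\<^sup>2)"
      unfolding H by (intro tendsto_intros \<phi>)
    then have lim: "(\<lambda>n. ennreal ((H1_norm UNIV (\<psi> n))\<^sup>2)) \<longlonglongrightarrow> ennreal 0" by (intro tendsto_ennrealI) simp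
    have "capacity (ball w r - \<Omega>) \<le> ennreal ((H1_norm UNIV (\<psi> n))\<^sup>2)" for n
      unfolding capacity_def
    proof (rule INF_lower, intro CollectI conjI)
      show "\<psi> n \<in> H1 UNIV"
        unfolding H1_def
        using test_functions_L2[OF \<psi>U U] test_functions_L2[OF test_functions_partial_deriv[OF \<psi>U] U] has_weak_deriv_smooth[OF test_functions_smooth[OF \<psi>U] _ U]
        by blast
      obtain K where K: "compact K" "K \<subseteq> \<Omega>" "\<And>x. x \<notin> K \<Longrightarrow> \<phi> n x = 0" using \<phi>(1)[of n] unfolding test_functions_iff by blast
      show "\<exists>V. open V \<and> ball w r - \<Omega> \<subseteq> V \<and> (AE x in lebesgue_on V. \<psi> n x \<in> \<real> \<and> 1 \<le> Re (\<psi> n x))"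
      \<comment> \<open>Off the compact set \<open>K\<close> the difference is just
        \<open>v\<close>, which is 1 on the ball. Since \<open>K\<close> lies inside \<Omega>, this
        open set contains the part of the ball missing from \<Omega>.\<close>
      proof (intro exI[of _ "ball w r - K"] conjI)
        show "open (ball w r - K)" using K(1) by (simp add: open_Diff compact_imp_closed)
        show "ball w r - \<Omega> \<subseteq> ball w r - K" using K(2) by blast
        show "AE x in lebesgue_on (ball w r - K). \<psi> n x \<in> \<real> \<and> 1 \<le> Re (\<psi> n x)"
          by (rule AE_I2) (use v(3) K(3) in \<open>auto simp: \<psi>_def space_restrict_space\<close>)
      qed
    qed
    then have "capacity (ball w r - \<Omega>) \<le> ennreal 0" by (intro LIMSEQ_le_const[OF lim]) blast
    with cap show False by simp
  qed
qed

lemma continuous_L2: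
  assumes "continuous_on UNIV f" "bounded \<Omega>" "\<Omega> \<in> sets lebesgue"
  shows "f \<in> L2 \<Omega>"
proof -
  have "compact (f ` closure \<Omega>)"
    by (intro compact_continuous_image continuous_on_subset[OF assms(1)]) (use assms in auto)
  then obtain C where C: "\<forall>y\<in>f ` closure \<Omega>. norm y \<le> C"
    using compact_imp_bounded bounded_iff by metis
  show ?thesis
  proof (rule L2_norm_bounded(1)[OF _ continuous_imp_measurable_lebesgue_on[OF assms(1)]])
    show "\<Omega> \<in> lmeasurable" using assms by (intro bounded_set_imp_lmeasurable)
    show "norm (f x) \<le> C" if "x \<in> \<Omega>" for x using C that closure_subset by blast
  qed
qed

lemma L2_lim_uniform:
  assumes "\<Omega> \<in> lmeasurable" "\<And>n. F n \<in> borel_measurable (lebesgue_on \<Omega>)" "f \<in> borel_measurable (lebesgue_on \<Omega>)"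
    "\<And>n x. x \<in> \<Omega> \<Longrightarrow> norm (F n x - f x) \<le> 1 / real (Suc n)"
  shows "L2_lim \<Omega> F f"
proof (rule tendsto_sandwich[OF _ _ tendsto_const])
  have "L2_norm \<Omega> (\<lambda>x. F n x - f x) \<le> 1 / real (Suc n) * sqrt (measure lebesgue \<Omega>)" for n
    by (rule L2_norm_bounded(2)[OF assms(1) borel_measurable_diff[OF assms(2,3)] assms(4)]) auto
  then show "\<forall>\<^sub>F n in sequentially. L2_norm \<Omega> (\<lambda>x. F n x - f x) \<le> 1 / real (Suc n) * sqrt (measure lebesgue \<Omega>)" by simp
  show "(\<lambda>n. 1 / real (Suc n) * sqrt (measure lebesgue \<Omega>)) \<longlonglongrightarrow> 0"
    by (rule tendsto_mult_left_zero) (rule LIMSEQ_Suc[OF lim_1_over_n])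
qed simp

section \<open>Intertwiners as weighted compositions\<close>

lemma negligible_Lipschitz_image:
  fixes f :: "'a::euclidean_space \<Rightarrow> 'b::euclidean_space"
  assumes "DIM('a) \<le> DIM('b)" "negligible N" "\<And>x y. dist (f x) (f y) \<le> dist x y"
  shows "negligible (f ` N)"
proof (rule negligible_locally_Lipschitz_image[OF assms(1,2)])
  fix x
  show "\<exists>T B. open T \<and> x \<in> T \<and> (\<forall>y\<in>N \<inter> T. norm (f y - f x) \<le> B * norm (y - x))"
    using assms(3) by (intro exI[of _ UNIV] exI[of _ 1]) (auto simp: dist_norm)
qed

lemma test_functions_isometry:
  assumes \<phi>: "\<phi> \<in> test_functions \<Omega>" and A: "\<And>x. (A has_derivative L) (at x)"
    and B: "continuous_on UNIV B" "\<And>x. A (B x) = x" "\<And>x. B (A x) = x"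
  shows "(\<lambda>x. \<phi> (A x)) \<in> test_functions (B ` \<Omega>)"
proof -
  obtain K where K: "compact K" "K \<subseteq> \<Omega>" "\<And>x. x \<notin> K \<Longrightarrow> \<phi> x = 0" using \<phi> unfolding test_functions_iff by blast
  show ?thesis
  proof (rule test_functionsI)
    show "smooth (\<lambda>x. \<phi> (A x))" using C_diff_affine[OF _ A] test_functions_smooth[OF \<phi>] by blast
    show "compact (B ` K)" by (rule compact_continuous_image[OF continuous_on_subset[OF B(1)] K(1)]) simp
    show "B ` K \<subseteq> B ` \<Omega>" using K(2) by blast
    show "\<phi> (A x) = 0" if "x \<notin> B ` K" for x using that B(3)[of x] K(3) by (metis image_eqI)
  qed
qed

lemma continuous_on_complex_polynomial:
  "real_polynomial_function p \<Longrightarrow> continuous_on S (\<lambda>x. complex_of_real (p x))"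
  by (intro continuous_on_of_real continuous_on_polymonial_function) (simp add: real_polynomial_function_eq)

lemma cutoff_in_open:
  assumes "open \<Omega>" "z \<in> \<Omega>"
  obtains \<phi> e where "\<phi> \<in> test_functions \<Omega>" "e > 0" "ball z e \<subseteq> \<Omega>" "\<And>x. x \<in> ball z e \<Longrightarrow> \<phi> x = 1"
proof -
  obtain e where e: "e > 0" "cball z e \<subseteq> \<Omega>" using assms open_contains_cball by metis
  obtain c where c: "(\<lambda>x. complex_of_real (c x)) \<in> test_functions UNIV"
    "\<And>x. x \<in> ball z (e / 2) \<Longrightarrow> c x = 1" "\<And>x. x \<notin> cball z e \<Longrightarrow> c x = 0"
    using cutoff_exists[OF e(1), of z] by metis
  have "(\<lambda>x. complex_of_real (c x)) \<in> test_functions \<Omega>"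
    by (rule test_functionsI[OF test_functions_smooth[OF c(1)] _ e(2)]) (use c(3) in auto)
  moreover have "ball z (e / 2) \<subseteq> \<Omega>"
  proof -
    have "ball z (e / 2) \<subseteq> cball z e" using e(1) by auto
    then show ?thesis using e(2) by blast
  qed
  ultimately show ?thesis using that[of "\<lambda>x. complex_of_real (c x)" "e / 2"] c(2) e(1) by simp
qed

locale affine_intertwiner = laplacian_intertwiner \<Omega>1 \<Omega>2 U
  for \<Omega>1 :: "'a::euclidean_space set" and \<Omega>2 :: "'b::euclidean_space set" and U +
  fixes v :: "'a \<Rightarrow> 'b" and a :: "'a \<Rightarrow> real"
  assumes orthonormal: "\<And>i j. i \<in> Basis \<Longrightarrow> j \<in> Basis \<Longrightarrow> v i \<bullet> v j = (if i = j then 1 else 0)"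
    and t_affine: "\<And>i. i \<in> Basis \<Longrightarrow> AE y in lebesgue_on \<Omega>2. t i y = of_real (v i \<bullet> y + a i)"
    and connected2: "connected \<Omega>2"
begin

definition \<tau> :: "'b \<Rightarrow> 'a" where "\<tau> y = (\<Sum>i\<in>Basis. (v i \<bullet> y + a i) *\<^sub>R i)"
text \<open>This will be the inverse of \<tau>: the \<open>v i\<close> form an orthonormal basis
  because the dimensions agree, so the transposed matrix inverts the linear part.\<close>

definition \<sigma> :: "'a \<Rightarrow> 'b" where "\<sigma> x = (\<Sum>i\<in>Basis. (x \<bullet> i - a i) *\<^sub>R v i)"

lemma \<tau>_inner: "i \<in> Basis \<Longrightarrow> \<tau> y \<bullet> i = v i \<bullet> y + a i"
  by (simp add: \<tau>_def inner_sum_left inner_Basis if_distrib cong: if_cong)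

lemma v_expand: "(\<Sum>i\<in>Basis. (y \<bullet> v i) *\<^sub>R v i) = y"
  by (rule orthonormal_family(2)[OF finite_Basis orthonormal]) (simp_all add: DIM_eq)

lemma \<sigma>_\<tau> [simp]: "\<sigma> (\<tau> y) = y"
proof -
  have "\<sigma> (\<tau> y) = (\<Sum>i\<in>Basis. (y \<bullet> v i) *\<^sub>R v i)"
    unfolding \<sigma>_def by (intro sum.cong refl) (simp only: \<tau>_inner, simp add: inner_commute)
  then show ?thesis by (simp add: v_expand)
qed

lemma \<tau>_\<sigma> [simp]: "\<tau> (\<sigma> x) = x"
proof (rule euclidean_eqI)
  fix i :: 'a assume i: "i \<in> Basis"
  have "v i \<bullet> \<sigma> x = (\<Sum>j\<in>Basis. if i = j then x \<bullet> j - a j else 0)"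
    unfolding \<sigma>_def inner_sum_right by (intro sum.cong refl) (use i in \<open>auto simp: orthonormal\<close>)
  also have "\<dots> = x \<bullet> i - a i" using i by simp
  finally show "\<tau> (\<sigma> x) \<bullet> i = x \<bullet> i" using i by (simp add: \<tau>_inner)
qed

lemma dist_\<tau>: "dist (\<tau> x) (\<tau> y) = dist x y"
proof -
  define d where "d = x - y"
  have "(\<tau> x - \<tau> y) \<bullet> (\<tau> x - \<tau> y) = (\<Sum>i\<in>Basis. (v i \<bullet> d) * (v i \<bullet> d))"
    by (subst euclidean_inner) (simp add: inner_diff_left \<tau>_inner d_def inner_diff_right)
  also have "\<dots> = (\<Sum>i\<in>Basis. (d \<bullet> v i) *\<^sub>R v i) \<bullet> d" by (simp only: inner_sum_left) (simp add: inner_commute)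
  also have "\<dots> = d \<bullet> d" by (simp add: v_expand)
  finally show ?thesis by (simp add: dist_norm norm_eq_sqrt_inner d_def)
qed

lemma dist_\<sigma>: "dist (\<sigma> x) (\<sigma> y) = dist x y"
  using dist_\<tau>[of "\<sigma> x" "\<sigma> y"] by simp

lemma \<tau>_has_derivative: "(\<tau> has_derivative (\<lambda>h. \<Sum>i\<in>Basis. (v i \<bullet> h) *\<^sub>R i)) (at y)"
  unfolding \<tau>_def[abs_def] by (auto intro!: derivative_eq_intros)

lemma \<sigma>_has_derivative: "(\<sigma> has_derivative (\<lambda>h. \<Sum>i\<in>Basis. (h \<bullet> i) *\<^sub>R v i)) (at x)"
  unfolding \<sigma>_def[abs_def] by (auto intro!: derivative_eq_intros)

lemma continuous_\<tau>: "continuous_on S \<tau>" and continuous_\<sigma>: "continuous_on T \<sigma>"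
  unfolding \<tau>_def[abs_def] \<sigma>_def[abs_def] by (intro continuous_intros)+

lemma negligible_\<tau>: "negligible N \<Longrightarrow> negligible (\<tau> ` N)"
  by (rule negligible_Lipschitz_image) (simp_all add: DIM_eq dist_\<tau>)

lemma negligible_\<sigma>: "negligible N \<Longrightarrow> negligible (\<sigma> ` N)"
  by (rule negligible_Lipschitz_image) (simp_all add: DIM_eq dist_\<sigma>)

lemma image_\<tau>_iff: "x \<in> \<tau> ` S \<longleftrightarrow> \<sigma> x \<in> S"
  using \<tau>_\<sigma> by (metis \<sigma>_\<tau> image_iff)

lemma open_image: "open (\<tau> ` \<Omega>2)"
proof -
  have "\<tau> ` \<Omega>2 = \<sigma> -` \<Omega>2" by (auto simp: image_\<tau>_iff)
  then show ?thesis using open_vimage[OF open2 continuous_\<sigma>] by simp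
qed

lemma AE_compose_\<sigma>:
  assumes "AE y in M2. P y" shows "AE x in lebesgue_on (\<tau> ` \<Omega>2). P (\<sigma> x)"
proof -
  have "negligible (\<tau> ` {y \<in> \<Omega>2. \<not> P y})" using assms by (intro negligible_\<tau>) (simp add: AE_lebesgue_on_iff[OF sets2])
  then have "negligible {x \<in> \<tau> ` \<Omega>2. \<not> P (\<sigma> x)}" by (rule negligible_subset) auto
  then show ?thesis using open_image by (simp add: AE_lebesgue_on_iff)
qed

text \<open>Since \<sigma> is an isometry between spaces of equal dimension, it carries null sets to
  null sets. The last premise lets \<tau> leave \<open>S\<close> on a null set, as is possible for
  \<open>S = \<Omega>1\<close> before the images are compared exactly.\<close>

lemma AE_compose_\<tau>:
  assumes "AE x in lebesgue_on S. P x" "S \<in> sets lebesgue" "AE y in M2. \<tau> y \<in> S" shows "AE y in M2. P (\<tau> y)"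
proof -
  have "negligible (\<sigma> ` {x \<in> S. \<not> P x} \<union> {y \<in> \<Omega>2. \<not> \<tau> y \<in> S})"
    using assms by (intro negligible_Un negligible_\<sigma>) (simp_all add: AE_lebesgue_on_iff[OF sets2] AE_lebesgue_on_iff[OF assms(2)])
  then have "negligible {y \<in> \<Omega>2. \<not> P (\<tau> y)}"
  proof (rule negligible_subset, intro subsetI)
    fix y assume y: "y \<in> {y \<in> \<Omega>2. \<not> P (\<tau> y)}"
    then show "y \<in> \<sigma> ` {x \<in> S. \<not> P x} \<union> {y \<in> \<Omega>2. \<not> \<tau> y \<in> S}"
      using image_eqI[of y \<sigma> "\<tau> y"] by (cases "\<tau> y \<in> S") auto
  qed
  then show ?thesis by (simp add: AE_lebesgue_on_iff[OF sets2])
qed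

text \<open>Division by \<open>one_image\<close> makes \<open>U\<close> multiplicative on bounded
  functions. On coordinates it becomes composition with \<tau> because the \<open>t i\<close> are
  affine, and polynomials are generated by coordinates and constants.\<close>

lemma U_polynomial:
  assumes "real_polynomial_function p"
  shows "AE y in M2. U (\<lambda>x. complex_of_real (p x)) y = one_image y * complex_of_real (p (\<tau> y))"
  using assms
proof (induction p rule: real_polynomial_function.induct)
  case (linear f)
  interpret f: bounded_linear f by (rule linear)
  have f: "f x = (\<Sum>i\<in>Basis. f i * (x \<bullet> i))" for x
  proof -
    have "f x = f (\<Sum>i\<in>Basis. (x \<bullet> i) *\<^sub>R i)" by (simp add: euclidean_representation)
    then show ?thesis by (simp add: f.sum f.scaleR mult.commute)
  qed
  have "AE y in M2. U (\<lambda>x. \<Sum>i\<in>Basis. complex_of_real (f i) * complex_of_real (x \<bullet> i)) y = (\<Sum>i\<in>Basis. U (\<lambda>x. complex_of_real (f i) * complex_of_real (x \<bullet> i)) y)"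
    by (intro U_sum L2_cmult inner_L2)
  moreover have "AE y in M2. \<forall>i\<in>Basis. U (\<lambda>x. complex_of_real (f i) * complex_of_real (x \<bullet> i)) y = complex_of_real (f i) * U (\<lambda>x. complex_of_real (x \<bullet> i)) y"
    by (intro AE_finite_allI finite_Basis U_cmult inner_L2)
  moreover have "AE y in M2. \<forall>i\<in>Basis. t i y = of_real (v i \<bullet> y + a i)"
    by (intro AE_finite_allI finite_Basis t_affine)
  ultimately have "AE y in M2. U (\<lambda>x. \<Sum>i\<in>Basis. complex_of_real (f i) * complex_of_real (x \<bullet> i)) y = one_image y * complex_of_real (\<Sum>i\<in>Basis. f i * (\<tau> y \<bullet> i))"
    using one_image_nonzero
  proof eventually_elim
    case (elim y)
    have "U (\<lambda>x. complex_of_real (x \<bullet> i)) y = one_image y * complex_of_real (\<tau> y \<bullet> i)" if "i \<in> Basis" for i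
      using elim(3,4) that by (simp add: t_def \<tau>_inner field_simps)
    then show ?case using elim(1,2) by (simp add: sum_distrib_left mult_ac)
  qed
  then show ?case by (subst (1 2) f) simp
next
  case (const c)
  show ?case using U_cmult[OF const_L2[of 1], of "of_real c"] by (simp add: one_image_def mult.commute)
next
  case (add p q)
  have L: "(\<lambda>x. complex_of_real (p x)) \<in> L2 \<Omega>1" "(\<lambda>x. complex_of_real (q x)) \<in> L2 \<Omega>1"
    using add(1,2) by (auto intro!: continuous_L2 bounded1 sets1 continuous_on_complex_polynomial)
  show ?case using U_add[OF L] add(3,4) by eventually_elim (simp add: algebra_simps)
next
  case (mult p q)
  have c: "continuous_on UNIV (\<lambda>x. complex_of_real (p x))" "continuous_on UNIV (\<lambda>x. complex_of_real (q x))"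
    by (intro continuous_on_complex_polynomial mult)+
  note L = c[THEN continuous_L2[OF _ bounded1 sets1]]
  have "compact ((\<lambda>x. complex_of_real (p x)) ` closure \<Omega>1)"
    by (intro compact_continuous_image continuous_on_subset[OF c(1)]) (use bounded1 in auto)
  then obtain C where "\<forall>y\<in>(\<lambda>x. complex_of_real (p x)) ` closure \<Omega>1. norm y \<le> C" using compact_imp_bounded bounded_iff by metis
  then have C: "norm (complex_of_real (p x)) \<le> C" if "x \<in> \<Omega>1" for x using that closure_subset by blast
  have "AE y in M2. U (\<lambda>x. complex_of_real (p x) * complex_of_real (q x)) y * one_image y = U (\<lambda>x. complex_of_real (p x)) y * U (\<lambda>x. complex_of_real (q x)) y"
    by (rule U_bounded_mult[OF L2_measurable[OF L(1)] C L(2)])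
  then show ?case using mult(3,4) one_image_nonzero by eventually_elim simp
qed

lemma U_continuous_real:
  assumes f: "continuous_on UNIV f"
  shows "AE y in M2. U (\<lambda>x. complex_of_real (f x)) y = one_image y * complex_of_real (f (\<tau> y))"
proof -
  have bdd: "bounded (\<Omega>1 \<union> \<tau> ` \<Omega>2)"
  proof -
    have "compact (\<tau> ` closure \<Omega>2)" by (rule compact_continuous_image[OF continuous_\<tau>]) (use bounded2 in simp)
    then have "bounded (\<tau> ` \<Omega>2)" by (rule bounded_subset[OF compact_imp_bounded]) (intro image_mono closure_subset)
    with bounded1 show ?thesis by simp
  qed
  \<comment> \<open>Uniform approximation is required on the image of \<Omega>2 as well, as it is
    not yet known that \<tau> maps into \<Omega>1.\<close>
  define K where "K = closure (\<Omega>1 \<union> \<tau> ` \<Omega>2)"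
  have K: "compact K" "\<Omega>1 \<union> \<tau> ` \<Omega>2 \<subseteq> K" using bdd by (simp only: K_def compact_closure, simp only: K_def closure_subset)
  have "\<exists>p. real_polynomial_function p \<and> (\<forall>x\<in>K. \<bar>f x - p x\<bar> < 1 / real (Suc n))" for n
    using Stone_Weierstrass_real_polynomial_function[OF K(1) continuous_on_subset[OF f], of "1 / real (Suc n)"] by (metis of_nat_0_less_iff subset_UNIV zero_less_Suc zero_less_divide_1_iff)
  then obtain p where p: "\<And>n. real_polynomial_function (p n)" "\<And>n x. x \<in> K \<Longrightarrow> \<bar>f x - p n x\<bar> < 1 / real (Suc n)" by metis
  have cp: "continuous_on UNIV (\<lambda>x. complex_of_real (p n x))" for n
    by (intro continuous_on_complex_polynomial p)
  have cf: "continuous_on UNIV (\<lambda>x. complex_of_real (f x))" by (intro continuous_intros f)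
  have cp\<tau>: "continuous_on UNIV (\<lambda>y. complex_of_real (p n (\<tau> y)))" for n
    by (rule continuous_on_compose2[OF cp continuous_\<tau>]) simp
  have cf\<tau>: "continuous_on UNIV (\<lambda>y. complex_of_real (f (\<tau> y)))"
    by (rule continuous_on_compose2[OF cf continuous_\<tau>]) simp
  have diff: "norm (complex_of_real (p n x) - complex_of_real (f x)) \<le> 1 / real (Suc n)" if "x \<in> K" for n x
  proof -
    have "norm (complex_of_real (p n x) - complex_of_real (f x)) = norm (complex_of_real (p n x - f x))" by simp
    also have "\<dots> = \<bar>p n x - f x\<bar>" by (rule norm_of_real)
    finally show ?thesis using p(2)[OF that, of n] by linarith
  qed
  have lim1: "L2_lim \<Omega>1 (\<lambda>n x. complex_of_real (p n x)) (\<lambda>x. complex_of_real (f x))"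
    by (rule L2_lim_uniform[OF lmeasurable1 continuous_imp_measurable_lebesgue_on[OF cp] continuous_imp_measurable_lebesgue_on[OF cf]])
      (intro diff, use K(2) in blast)
  have lim2: "L2_lim \<Omega>2 (\<lambda>n y. complex_of_real (p n (\<tau> y))) (\<lambda>y. complex_of_real (f (\<tau> y)))"
    by (rule L2_lim_uniform[OF lmeasurable2 continuous_imp_measurable_lebesgue_on[OF cp\<tau>] continuous_imp_measurable_lebesgue_on[OF cf\<tau>]])
      (intro diff, use K(2) in blast)
  note L1 = continuous_L2[OF cp bounded1 sets1] continuous_L2[OF cf bounded1 sets1]
  note L2' = continuous_L2[OF cp\<tau> bounded2 sets2] continuous_L2[OF cf\<tau> bounded2 sets2]
  have one2: "(\<lambda>y. 1) \<in> L2 \<Omega>2" by (rule smooth_L2[OF smooth_const bounded2 sets2])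
  have "AE y in M2. U (\<lambda>x. complex_of_real (p n x)) y * 1 = complex_of_real (p n (\<tau> y)) * one_image y" for n
    using U_polynomial[OF p(1)[of n]] by eventually_elim simp
  from L2_lim_prod_eq[OF U_lim[OF lim1 L1] lim2 U_L2[OF L1(1)] L2'(1) U_L2[OF L1(2)] L2'(2) one2 one_image_L2 this]
  show ?thesis by eventually_elim simp
qed

lemma U_continuous:
  assumes f: "continuous_on UNIV f"
  shows "AE y in M2. U f y = one_image y * f (\<tau> y)"
proof -
  have c: "continuous_on UNIV (\<lambda>x. Re (f x))" "continuous_on UNIV (\<lambda>x. Im (f x))" by (intro continuous_intros f)+
  have L: "(\<lambda>x. complex_of_real (Re (f x))) \<in> L2 \<Omega>1" "(\<lambda>x. complex_of_real (Im (f x))) \<in> L2 \<Omega>1"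
    by (intro continuous_L2 bounded1 sets1 continuous_intros f)+
  have s: "(\<lambda>x. complex_of_real (Re (f x)) + \<i> * complex_of_real (Im (f x))) = f"
    by (simp add: complex_eq[symmetric])
  show ?thesis
    using U_add[OF L(1) L2_cmult[OF L(2)], of \<i>, unfolded s] U_cmult[OF L(2), of \<i>] U_continuous_real[OF c(1)] U_continuous_real[OF c(2)]
  proof eventually_elim
    case (elim y)
    have "U f y = one_image y * (complex_of_real (Re (f (\<tau> y))) + \<i> * complex_of_real (Im (f (\<tau> y))))"
      using elim by (simp add: algebra_simps)
    then show ?case by (simp add: complex_eq[symmetric])
  qed
qed

text \<open>The composition formula is applied to continuous functions increasing to the indicator
  of \<Omega>1. In L2 of \<Omega>1 they tend to 1, which gives
  \<open>one_image = ind * one_image\<close> with \<open>ind\<close> the indicator of the preimage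
  of \<Omega>1; then \<open>one_image\<close> is cancelled.\<close>

lemma \<tau>_in_\<Omega>1: "AE y in M2. \<tau> y \<in> \<Omega>1"
proof -
  define f where "f n x = min 1 (real n * infdist x (- \<Omega>1))" for n :: nat and x
  have ne: "- \<Omega>1 \<noteq> {}" using bounded1 not_bounded_UNIV by (metis Compl_eq_Diff_UNIV Diff_cancel double_compl)
  have cf: "continuous_on UNIV (\<lambda>x. complex_of_real (f n x))" for n
    unfolding f_def by (intro continuous_intros)
  have f01: "0 \<le> f n x" "f n x \<le> 1" for n x by (auto simp: f_def infdist_nonneg)
  have f_lim: "(\<lambda>n. complex_of_real (f n x)) \<longlonglongrightarrow> (if x \<in> \<Omega>1 then 1 else 0)" for x
  proof (cases "x \<in> \<Omega>1")
    case True
    have pos: "infdist x (- \<Omega>1) > 0"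
      using True open1 ne by (intro infdist_pos_not_in_closed) auto
    then obtain N :: nat where N: "1 < real N * infdist x (- \<Omega>1)" using reals_Archimedean3 by blast
    have "\<forall>\<^sub>F n in sequentially. complex_of_real (f n x) = 1"
      using eventually_ge_at_top[of N]
    proof eventually_elim
      case (elim n)
      then have "real N * infdist x (- \<Omega>1) \<le> real n * infdist x (- \<Omega>1)" using pos by (intro mult_right_mono) auto
      then show ?case using N by (simp add: f_def)
    qed
    then show ?thesis using True by (simp add: tendsto_eventually)
  next
    case False
    then have "f n x = 0" for n by (simp add: f_def)
    then show ?thesis using False by simp
  qed
  define ind where "ind y = (if \<tau> y \<in> \<Omega>1 then 1 else 0 :: complex)" for y
  note fL = continuous_L2[OF cf bounded1 sets1]
  have cf\<tau>: "continuous_on UNIV (\<lambda>y. complex_of_real (f n (\<tau> y)))" for n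
    by (rule continuous_on_compose2[OF cf continuous_\<tau>]) simp
  have one2: "(\<lambda>y. c) \<in> L2 \<Omega>2" for c by (rule smooth_L2[OF smooth_const bounded2 sets2])
  have indm: "ind \<in> borel_measurable M2"
  proof (rule borel_measurable_LIMSEQ_metric[OF continuous_imp_measurable_lebesgue_on[OF cf\<tau>]])
    show "(\<lambda>n. complex_of_real (f n (\<tau> y))) \<longlonglongrightarrow> ind y" for y using f_lim[of "\<tau> y"] by (simp add: ind_def)
  qed
  have indL: "ind \<in> L2 \<Omega>2" by (rule L2_norm_bounded(1)[OF lmeasurable2 indm, of 1]) (simp add: ind_def)
  have lim1: "L2_lim \<Omega>1 (\<lambda>n x. complex_of_real (f n x)) (\<lambda>x. 1)"
  proof (rule L2_lim_dominated[OF L2_measurable[OF fL] const_L2 const_L2[of 1]])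
    show "AE x in M1. norm (complex_of_real (f n x) - 1) \<le> norm (1::complex)" for n
    proof (rule AE_I2)
      fix x
      have "norm (complex_of_real (f n x) - 1) = norm (complex_of_real (f n x - 1))" by simp
      also have "\<dots> = \<bar>f n x - 1\<bar>" by (rule norm_of_real)
      finally show "norm (complex_of_real (f n x) - 1) \<le> norm (1::complex)" using f01[of n x] by simp
    qed
    show "AE x in M1. (\<lambda>n. complex_of_real (f n x)) \<longlonglongrightarrow> 1"
      using f_lim by (intro AE_I2) (metis Int_UNIV_right space_lebesgue_on)
  qed
  have lim2: "L2_lim \<Omega>2 (\<lambda>n y. complex_of_real (f n (\<tau> y))) ind"
  proof (rule L2_lim_dominated[OF continuous_imp_measurable_lebesgue_on[OF cf\<tau>] indL one2[of 1]])
    show "AE y in M2. norm (complex_of_real (f n (\<tau> y)) - ind y) \<le> norm (1::complex)" for n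
    proof (rule AE_I2)
      fix y
      have "complex_of_real (f n (\<tau> y)) - ind y = complex_of_real (f n (\<tau> y) - (if \<tau> y \<in> \<Omega>1 then 1 else 0))" by (simp add: ind_def)
      then have "norm (complex_of_real (f n (\<tau> y)) - ind y) = \<bar>f n (\<tau> y) - (if \<tau> y \<in> \<Omega>1 then 1 else 0)\<bar>" by (simp only: norm_of_real)
      then show "norm (complex_of_real (f n (\<tau> y)) - ind y) \<le> norm (1::complex)" using f01[of n "\<tau> y"] by auto
    qed
    show "AE y in M2. (\<lambda>n. complex_of_real (f n (\<tau> y))) \<longlonglongrightarrow> ind y"
      using f_lim by (intro AE_I2) (simp add: ind_def)
  qed
  have "AE y in M2. U (\<lambda>x. complex_of_real (f n x)) y * 1 = complex_of_real (f n (\<tau> y)) * one_image y" for n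
    using U_continuous[OF cf[of n]] by eventually_elim simp
  from L2_lim_prod_eq[OF U_lim[OF lim1 fL const_L2] lim2 U_L2[OF fL] continuous_L2[OF cf\<tau> bounded2 sets2] U_L2[OF const_L2] indL one2 one_image_L2 this]
  show ?thesis using one_image_nonzero by eventually_elim (auto simp: ind_def one_image_def split: if_splits)
qed

text \<open>Composing a class with \<tau> makes sense because null sets of \<Omega>1 pull back to
  null sets of \<Omega>2 and \<tau> takes almost all of \<Omega>2 into \<Omega>1. Continuous
  approximations then converge almost everywhere on both sides along a common subsequence.\<close>

lemma U_composition:
  assumes f: "f \<in> L2 \<Omega>1"
  shows "AE y in M2. U f y = one_image y * f (\<tau> y)"
proof -
  have "\<exists>g. continuous_on UNIV g \<and> L2_norm \<Omega>1 (\<lambda>x. f x - g x) < 1 / real (Suc n)" for n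
    using L2_continuous_dense[OF lmeasurable1 f, of "1 / real (Suc n)"] by (metis of_nat_0_less_iff zero_less_Suc zero_less_divide_1_iff)
  then obtain g where g: "\<And>n. continuous_on UNIV (g n)" "\<And>n. L2_norm \<Omega>1 (\<lambda>x. f x - g n x) < 1 / real (Suc n)" by metis
  note gL = continuous_L2[OF g(1) bounded1 sets1]
  have lim: "L2_lim \<Omega>1 g f"
  proof (rule tendsto_sandwich[OF _ _ tendsto_const])
    show "\<forall>\<^sub>F n in sequentially. L2_norm \<Omega>1 (\<lambda>x. g n x - f x) \<le> 1 / real (Suc n)"
      using g(2) by (intro always_eventually allI) (subst L2_norm_minus_commute, simp add: less_imp_le)
    show "(\<lambda>n. 1 / real (Suc n)) \<longlonglongrightarrow> 0" by (rule LIMSEQ_Suc[OF lim_1_over_n])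
  qed simp
  obtain r where r: "strict_mono r" "AE x in M1. (\<lambda>n. g (r n) x) \<longlonglongrightarrow> f x"
    using L2_lim_AE_subseq[OF lim gL f] by blast
  have lim': "L2_lim \<Omega>1 (\<lambda>n. g (r n)) f"
    using LIMSEQ_subseq_LIMSEQ[OF lim r(1)] by (simp add: o_def)
  obtain q where q: "strict_mono q" "AE y in M2. (\<lambda>n. U (g (r (q n))) y) \<longlonglongrightarrow> U f y"
    using L2_lim_AE_subseq[OF U_lim[OF lim' gL f] U_L2[OF gL] U_L2[OF f]] by blast
  have "AE y in M2. (\<lambda>n. g (r n) (\<tau> y)) \<longlonglongrightarrow> f (\<tau> y)" by (rule AE_compose_\<tau>[OF r(2) sets1 \<tau>_in_\<Omega>1])
  moreover have "AE y in M2. \<forall>n. U (g (r (q n))) y = one_image y * g (r (q n)) (\<tau> y)"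
    unfolding AE_all_countable using U_continuous[OF g(1)] by blast
  ultimately show ?thesis using q(2)
  proof eventually_elim
    case (elim y)
    have "(\<lambda>n. one_image y * g (r (q n)) (\<tau> y)) \<longlonglongrightarrow> one_image y * f (\<tau> y)"
      using LIMSEQ_subseq_LIMSEQ[OF elim(1) q(1)] by (intro tendsto_intros) (simp add: o_def)
    then show ?case using LIMSEQ_unique[OF elim(3)] elim(2) by simp
  qed
qed

text \<open>Composed with \<tau>, the indicator of the part of \<Omega>1 missed by \<tau> becomes 0
  on \<Omega>2. So \<open>U\<close> annihilates it, and \<open>U\<close> is injective.\<close>

lemma negligible_\<Omega>1_diff: "negligible (\<Omega>1 - \<tau> ` \<Omega>2)"
proof -
  define f where "f x = (if x \<in> \<tau> ` \<Omega>2 then 0 else 1 :: complex)" for x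
  have "(\<lambda>x. if x \<in> \<tau> ` \<Omega>2 then 0 else 1 :: complex) \<in> borel_measurable borel"
    by (rule measurable_If_set) (use open_image in auto)
  then have "f \<in> borel_measurable M1"
    unfolding f_def[abs_def] by (intro measurable_restrict_space1 measurable_completion) simp
  then have fL: "f \<in> L2 \<Omega>1" by (rule bounded_L2[of _ 1]) (simp add: f_def)
  have "AE y in M2. U f y = 0"
    using U_composition[OF fL] AE_space by eventually_elim (auto simp: f_def)
  from U_eq_0[OF fL this] have "negligible {x \<in> \<Omega>1. f x \<noteq> 0}" by (simp add: AE_lebesgue_on_iff[OF sets1])
  then show ?thesis by (rule negligible_subset) (auto simp: f_def)
qed

lemma negligible_diff_\<Omega>1: "negligible (\<tau> ` \<Omega>2 - \<Omega>1)"
proof -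
  have "negligible (\<tau> ` {y \<in> \<Omega>2. \<not> \<tau> y \<in> \<Omega>1})"
    using \<tau>_in_\<Omega>1 by (intro negligible_\<tau>) (simp add: AE_lebesgue_on_iff[OF sets2])
  then show ?thesis by (rule negligible_subset) auto
qed

end

section \<open>Zero extension and constancy of the weight\<close>

lemma H10_gradient_cmult:
  assumes "H10_gradient \<Omega> u g"
  shows "H10_gradient \<Omega> (\<lambda>x. c * u x) (\<lambda>b x. c * g b x)"
proof -
  obtain \<phi> where \<phi>: "\<And>n. \<phi> n \<in> test_functions \<Omega>" "L2_lim \<Omega> \<phi> u" "\<And>b. b \<in> Basis \<Longrightarrow> L2_lim \<Omega> (\<lambda>n. partial_deriv b (\<phi> n)) (g b)"
    using assms unfolding H10_gradient_def by blast
  show ?thesis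
    unfolding H10_gradient_def
  proof (intro conjI ballI exI[of _ "\<lambda>n x. c * \<phi> n x"] allI)
    show "(\<lambda>x. c * u x) \<in> L2 \<Omega>" by (intro L2_cmult H10_gradientD[OF assms])
    show "L2_lim \<Omega> (\<lambda>n x. c * \<phi> n x) (\<lambda>x. c * u x)" by (rule L2_lim_cmult[OF \<phi>(2)])
    show "(\<lambda>x. c * \<phi> n x) \<in> test_functions \<Omega>" for n by (rule test_functions_cmult[OF \<phi>(1)])
    fix b :: 'a assume b: "b \<in> Basis"
    show "(\<lambda>x. c * g b x) \<in> L2 \<Omega>" by (intro L2_cmult H10_gradientD[OF assms] b)
    show "L2_lim \<Omega> (\<lambda>n. partial_deriv b (\<lambda>x. c * \<phi> n x)) (\<lambda>x. c * g b x)"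
      unfolding partial_deriv_cmult[OF test_functions_smooth[OF \<phi>(1)]]
      by (rule L2_lim_cmult[OF \<phi>(3)[OF b]])
  qed
qed

lemma L2_zero_extension:
  fixes \<Omega> :: "'a::euclidean_space set"
  assumes "f \<in> L2 \<Omega>" "\<Omega> \<in> sets lebesgue"
  shows "(\<lambda>x. if x \<in> \<Omega> then f x else 0) \<in> L2 UNIV"
proof -
  have "(\<lambda>x. if x \<in> \<Omega> then f x else 0) \<in> borel_measurable lebesgue"
    using L2_measurable[OF assms(1)] assms(2) by (subst measurable_restrict_space_iff[symmetric]) auto
  moreover have "integrable lebesgue (\<lambda>x. indicator \<Omega> x *\<^sub>R (norm (f x))\<^sup>2)"
    using L2_square_integrable[OF assms(1)] assms(2) by (simp add: integrable_restrict_space)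
  moreover have "(\<lambda>x. indicator \<Omega> x *\<^sub>R (norm (f x))\<^sup>2) = (\<lambda>x. (norm (if x \<in> \<Omega> then f x else 0))\<^sup>2)"
    by (auto simp: indicator_def)
  ultimately show ?thesis by (simp add: L2_def lebesgue_on_UNIV_eq)
qed

lemma laplacian_inner_add_const: "laplacian (\<lambda>x. complex_of_real (x \<bullet> v) + c) = (\<lambda>x. 0)"
proof -
  have d: "partial_deriv b (\<lambda>x. complex_of_real (x \<bullet> v) + c) = (\<lambda>x. of_real (b \<bullet> v))" for b
  proof
    fix x
    have "((\<lambda>x. complex_of_real (x \<bullet> v) + c) has_derivative (\<lambda>h. of_real (h \<bullet> v))) (at x)"
      by (auto intro!: derivative_eq_intros)
    from partial_deriv_eqI[OF this] show "partial_deriv b (\<lambda>x. complex_of_real (x \<bullet> v) + c) x = of_real (b \<bullet> v)" by simp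
  qed
  show ?thesis unfolding laplacian_def[abs_def] d partial_deriv_const by simp
qed

text \<open>A function in \<open>H10\<close> extends by zero across the boundary, so that a gradient vanishing on
  \<open>\<Omega> \<inter> S\<close> already vanishes on \<open>S\<close>.\<close>

lemma H10_gradient_zero_extension:
  fixes \<Omega> S :: "'a::euclidean_space set"
  assumes u: "H10_gradient \<Omega> u g" and b: "b \<in> Basis" and sets: "\<Omega> \<in> sets lebesgue" "S \<in> sets lebesgue"
    and g: "AE x in lebesgue_on S. x \<in> \<Omega> \<longrightarrow> g b x = 0"
  shows "has_weak_deriv S b (\<lambda>x. if x \<in> \<Omega> then u x else 0) (\<lambda>x. 0)"
  unfolding has_weak_deriv_def
proof
  fix \<eta> assume \<eta>: "\<eta> \<in> test_functions S"
  have \<eta>U: "\<eta> \<in> test_functions UNIV" using test_functions_mono[OF subset_UNIV] \<eta> by blast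
  have out: "\<eta> x = 0" "partial_deriv b \<eta> x = 0" if "x \<notin> S" for x
    using that test_functions_outside[OF \<eta>] test_functions_outside[OF test_functions_partial_deriv[OF \<eta> b]] by auto
  let ?E = "\<lambda>f x. if x \<in> \<Omega> then f x else 0 :: complex"
  have ext: "(\<integral>x. ?E f x * \<theta> x \<partial>lebesgue_on S) = (\<integral>x. f x * \<theta> x \<partial>lebesgue_on \<Omega>)" if "\<And>x. x \<notin> S \<Longrightarrow> \<theta> x = 0" for f \<theta>
  proof -
    have "(\<integral>x. ?E f x * \<theta> x \<partial>lebesgue_on S) = (\<integral>x. ?E f x * \<theta> x \<partial>lebesgue_on (\<Omega> \<union> S))"
      using sets that by (intro integral_lebesgue_on_subset[symmetric]) auto
    also have "\<dots> = (\<integral>x. ?E f x * \<theta> x \<partial>lebesgue_on \<Omega>)"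
      using sets by (intro integral_lebesgue_on_subset) auto
    also have "\<dots> = (\<integral>x. f x * \<theta> x \<partial>lebesgue_on \<Omega>)"
      by (intro Bochner_Integration.integral_cong refl) simp
    finally show ?thesis .
  qed
  have "(\<integral>x. ?E u x * partial_deriv b \<eta> x \<partial>lebesgue_on S) = - (\<integral>x. ?E (g b) x * \<eta> x \<partial>lebesgue_on S)"
    using ext[of "partial_deriv b \<eta>" u] ext[of \<eta> "g b"] out H10_gradient_by_parts[OF u b sets(1) \<eta>U] by simp
  also have "(\<integral>x. ?E (g b) x * \<eta> x \<partial>lebesgue_on S) = 0"
    by (rule integral_eq_zero_AE) (use g in eventually_elim, simp)
  finally show "(\<integral>x. ?E u x * partial_deriv b \<eta> x \<partial>lebesgue_on S) = - (\<integral>x. 0 * \<eta> x \<partial>lebesgue_on S)" by simp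
qed

context affine_intertwiner
begin

lemma sets_image: "\<tau> ` \<Omega>2 \<in> sets lebesgue"
  using open_image by simp

text \<open>Apply \<open>U\<close> and its inverse to the commutator of the Laplacian with multiplication by a
  coordinate, evaluated at a function \<open>u\<close> such that \<open>U u\<close> is constant near \<open>\<sigma> z\<close>.\<close>

lemma inverse_one_image_locally_constant:
  assumes z: "z \<in> \<tau> ` \<Omega>2"
  shows "\<exists>c. \<exists>r>0. AE x in lebesgue_on (ball z r). 1 / one_image (\<sigma> x) = c"
proof -
  have "\<sigma> z \<in> \<Omega>2" using z by (simp add: image_\<tau>_iff)
  then obtain \<phi> e where \<phi>: "\<phi> \<in> test_functions \<Omega>2" and e: "e > 0" "ball (\<sigma> z) e \<subseteq> \<Omega>2"
    and \<phi>1: "\<And>y. y \<in> ball (\<sigma> z) e \<Longrightarrow> \<phi> y = 1"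
    using cutoff_in_open[OF open2] by blast
  have D\<phi>: "dirichlet_graph \<Omega>2 \<phi> (laplacian \<phi>)" by (rule dirichlet_graph_test[OF \<phi> open2])
  obtain u w where D: "dirichlet_graph \<Omega>1 u w" and u: "AE y in M2. U u y = \<phi> y" and w: "AE y in M2. U w y = laplacian \<phi> y"
    by (rule graph_surj[OF D\<phi>])
  note uL = dirichlet_graph_L2(1)[OF D] and wL = dirichlet_graph_L2(2)[OF D]
  obtain g where g: "H10_gradient \<Omega>1 u g" using dirichlet_graph_gradient[OF D open1] by blast
  note gL = H10_gradientD(2)[OF g]
  have ball: "x \<in> ball z e \<longleftrightarrow> \<sigma> x \<in> ball (\<sigma> z) e" for x by (simp add: dist_\<sigma>)
  have ball_subset: "ball z e \<subseteq> \<tau> ` \<Omega>2" using e(2) ball by (auto simp: image_\<tau>_iff)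
  have bs: "ball z e \<in> sets lebesgue" by simp
  have g0: "AE x in lebesgue_on (ball z e). g i x = 0" if i: "i \<in> Basis" for i
  proof -
    \<comment> \<open>The affine representative of \<open>t i\<close>. It is smooth, so its product
      with \<phi> is a test function whose Laplacian can be computed classically as well as through
      \<open>U\<close>.\<close>
    define \<alpha> where "\<alpha> y = complex_of_real (y \<bullet> v i) + of_real (a i)" for y
    have s\<alpha>: "smooth \<alpha>" unfolding \<alpha>_def[abs_def] by (intro allI C_diff_add C_diff_inner C_diff_const)
    have \<alpha>\<phi>: "(\<lambda>y. \<alpha> y * \<phi> y) \<in> test_functions \<Omega>2" by (rule test_functions_mult[OF \<phi> s\<alpha>])
    have D1: "dirichlet_graph \<Omega>2 (\<lambda>y. \<alpha> y * \<phi> y) (laplacian (\<lambda>y. \<alpha> y * \<phi> y))"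
      by (rule dirichlet_graph_test[OF \<alpha>\<phi> open2])
    have ta: "AE y in M2. t i y = \<alpha> y" using t_affine[OF i] by eventually_elim (simp add: \<alpha>_def inner_commute)
    have "AE y in M2. U (\<lambda>x. complex_of_real (x \<bullet> i) * u x) y = \<alpha> y * \<phi> y"
      using t_mult[OF uL, of i] ta u by eventually_elim simp
    moreover have "AE y in M2. U (\<lambda>x. complex_of_real (x \<bullet> i) * w x + 2 * g i x) y = \<alpha> y * laplacian \<phi> y + 2 * U (g i) y"
      using U_add[OF L2_coordinate_mult[OF bounded1 wL] L2_cmult[OF gL[OF i]], of i 2] U_cmult[OF gL[OF i], of 2]
        t_mult[OF wL, of i] ta w by eventually_elim simp
    ultimately have D2: "dirichlet_graph \<Omega>2 (\<lambda>y. \<alpha> y * \<phi> y) (\<lambda>y. \<alpha> y * laplacian \<phi> y + 2 * U (g i) y)"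
      by (rule dirichlet_graph_cong_AE[OF graph_forward[OF dirichlet_graph_coordinate_mult[OF D g i bounded1 open1]] open2])
    have eq: "AE y in M2. laplacian (\<lambda>y. \<alpha> y * \<phi> y) y = \<alpha> y * laplacian \<phi> y + 2 * U (g i) y"
    proof (rule has_distr_laplacian_unique[OF open2 dirichlet_graph_L2(2)[OF D1] dirichlet_graph_L2(2)[OF D2]])
      show "has_distr_laplacian \<Omega>2 (\<lambda>y. \<alpha> y * \<phi> y) (laplacian (\<lambda>y. \<alpha> y * \<phi> y))"
        using D1 by (simp add: dirichlet_graph_def)
      show "has_distr_laplacian \<Omega>2 (\<lambda>y. \<alpha> y * \<phi> y) (\<lambda>y. \<alpha> y * laplacian \<phi> y + 2 * U (g i) y)"
        using D2 by (simp add: dirichlet_graph_def)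
    qed
    have 0: "laplacian (\<lambda>y. \<alpha> y * \<phi> y) y = 0" "laplacian \<phi> y = 0" if "y \<in> ball (\<sigma> z) e" for y
    proof -
      have "laplacian (\<lambda>y. \<alpha> y * \<phi> y) y = laplacian \<alpha> y" by (rule laplacian_local[OF open_ball that]) (simp add: \<phi>1)
      then show "laplacian (\<lambda>y. \<alpha> y * \<phi> y) y = 0" by (simp add: \<alpha>_def[abs_def] laplacian_inner_add_const)
      have "laplacian \<phi> y = laplacian (\<lambda>y. 1) y" by (rule laplacian_local[OF open_ball that]) (simp add: \<phi>1)
      then show "laplacian \<phi> y = 0" by (simp add: laplacian_const)
    qed
    \<comment> \<open>Where \<phi> is 1 both classical Laplacians vanish, and the comparison leaves
      \<open>U (g i) = 0\<close>; the composition formula turns this into a statement about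
      \<open>g i\<close>.\<close>
    have "AE y in M2. y \<in> ball (\<sigma> z) e \<longrightarrow> g i (\<tau> y) = 0"
      using eq U_composition[OF gL[OF i]] one_image_nonzero by eventually_elim (auto simp: 0 simp del: mem_ball)
    from AE_lebesgue_on_mono[OF AE_compose_\<sigma>[OF this] ball_subset bs sets_image] AE_space
    show ?thesis by eventually_elim (use ball in auto)
  qed
  \<comment> \<open>The ball lies in the image of \<Omega>2 but may contain a null set of points
    outside \<Omega>1. The function \<open>u\<close> has to be extended across it before constancy
    on a ball can be concluded.\<close>
  have "has_weak_deriv (ball z e) i (\<lambda>x. if x \<in> \<Omega>1 then u x else 0) (\<lambda>x. 0)" if "i \<in> Basis" for i
    by (rule H10_gradient_zero_extension[OF g that sets1 bs]) (use g0[OF that] in eventually_elim, simp)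
  moreover have "(\<lambda>x. if x \<in> \<Omega>1 then u x else 0) \<in> L2 (ball z e)"
    by (rule L2_mono(1)[OF subset_UNIV bs _ L2_zero_extension[OF uL sets1]]) simp
  ultimately obtain c where c: "AE x in lebesgue_on (ball z (e / 2)). (if x \<in> \<Omega>1 then u x else 0) = c"
    using weak_gradient_0_imp_constant_ball[of _ z e "e / 2"] e(1) by auto
  have half: "ball z (e / 2) \<subseteq> ball z e" using e(1) by (intro subset_ball) simp
  have hs: "ball z (e / 2) \<in> sets lebesgue" by simp
  have "AE y in M2. \<phi> y = one_image y * u (\<tau> y)" using U_composition[OF uL] u by eventually_elim simp
  with one_image_nonzero have "AE y in M2. \<phi> y / one_image y = u (\<tau> y)" by eventually_elim (simp add: field_simps)
  note 1 = AE_lebesgue_on_mono[OF AE_compose_\<sigma>[OF this] subset_trans[OF half ball_subset] hs sets_image]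
  have 2: "AE x in lebesgue_on (\<tau> ` \<Omega>2). x \<in> \<Omega>1"
    using negligible_diff_\<Omega>1 sets_image by (simp add: AE_lebesgue_on_iff set_diff_eq)
  have "AE x in lebesgue_on (ball z (e / 2)). 1 / one_image (\<sigma> x) = c"
    using 1 c AE_lebesgue_on_mono[OF 2 subset_trans[OF half ball_subset] hs sets_image] AE_space
  proof eventually_elim
    case (elim x)
    then have "\<sigma> x \<in> ball (\<sigma> z) e" using half ball by auto
    then show ?case using elim \<phi>1[of "\<sigma> x"] by simp
  qed
  then show ?thesis using e(1) by (intro exI[of _ c] exI[of _ "e / 2"]) simp
qed

text \<open>The reciprocal is treated because it is locally a function from the Dirichlet domain of
  \<Omega>1 composed with \<tau>. The local constants agree by connectedness of \<Omega>2, and their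
  common value is not 0 since \<open>one_image\<close> is nonzero almost everywhere.\<close>

lemma one_image_constant: "\<exists>C. C \<noteq> 0 \<and> (AE y in M2. one_image y = C)"
proof -
  have "\<exists>q\<in>range (\<lambda>c x. c). AE x in lebesgue_on (\<tau> ` \<Omega>2). 1 / one_image (\<sigma> x) = q x"
  proof (rule AE_local_patch[OF open_image connected_continuous_image[OF continuous_\<tau> connected2]])
    show "\<tau> ` \<Omega>2 \<noteq> {}" using nonempty2 by simp
    fix q q' :: "'a \<Rightarrow> complex" and S :: "'a set"
    assume q: "q \<in> range (\<lambda>c x. c)" "q' \<in> range (\<lambda>c x. c)" and S: "open S" "S \<noteq> {}" "AE x in lebesgue_on S. q x = q' x"
    obtain c c' where c: "q = (\<lambda>x. c)" "q' = (\<lambda>x. c')" using q by blast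
    have "negligible {x \<in> S. c \<noteq> c'}" using S by (simp add: AE_lebesgue_on_iff c)
    then have "c = c'" using open_not_negligible[OF S(1,2)] by (cases "c = c'") simp_all
    then show "q = q'" by (simp add: c)
  next
    fix z assume "z \<in> \<tau> ` \<Omega>2"
    then show "\<exists>q\<in>range (\<lambda>c x. c). \<exists>r>0. AE x in lebesgue_on (ball z r). 1 / one_image (\<sigma> x) = q x"
      using inverse_one_image_locally_constant[of z] by auto
  qed
  then obtain c where "AE x in lebesgue_on (\<tau> ` \<Omega>2). 1 / one_image (\<sigma> x) = c" by auto
  moreover have "AE y in M2. \<tau> y \<in> \<tau> ` \<Omega>2" by (rule AE_I2) simp
  ultimately have c: "AE y in M2. 1 / one_image y = c" using AE_compose_\<tau>[OF _ sets_image] by fastforce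
  have "c \<noteq> 0"
  proof
    assume "c = 0"
    have "AE y in M2. False" using c one_image_nonzero by eventually_elim (simp add: \<open>c = 0\<close>)
    then show False using open_not_negligible[OF open2 nonempty2] by (simp add: AE_lebesgue_on_iff[OF sets2])
  qed
  moreover have "AE y in M2. one_image y = 1 / c" using c one_image_nonzero by eventually_elim auto
  ultimately show ?thesis by (intro exI[of _ "1 / c"]) simp
qed

text \<open>Each inclusion uses the regularity of the larger set. A cutoff on one domain, composed
  with the isometry, is up to the constant weight a preimage or an image under \<open>U\<close> of
  an element of a Dirichlet domain, and so belongs to H10 of the other domain.\<close>

lemma image_\<tau>_eq:
  assumes regular: "regular_in_capacity \<Omega>1" "regular_in_capacity \<Omega>2"
  shows "\<tau> ` \<Omega>2 = \<Omega>1"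
proof -
  obtain C where C: "C \<noteq> 0" "AE y in M2. one_image y = C" using one_image_constant by blast
  have image_\<sigma>_iff: "y \<in> \<sigma> ` S \<longleftrightarrow> \<tau> y \<in> S" for y S using \<sigma>_\<tau> by (metis \<tau>_\<sigma> image_iff)
  have ball_\<tau>: "x \<in> ball w r \<longleftrightarrow> \<sigma> x \<in> ball (\<sigma> w) r" for x w r by (simp add: dist_\<sigma>)
  have ball_\<sigma>: "y \<in> ball w r \<longleftrightarrow> \<tau> y \<in> ball (\<tau> w) r" for y w r by (simp add: dist_\<tau>)
  have "\<tau> ` \<Omega>2 \<subseteq> \<Omega>1"
  proof (rule regular_in_capacity_imp_subset[OF open1 regular(1) open_image negligible_diff_\<Omega>1])
    fix w assume "w \<in> \<tau> ` \<Omega>2"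
    then have "\<sigma> w \<in> \<Omega>2" by (simp add: image_\<tau>_iff)
    then obtain \<phi> e where \<phi>: "\<phi> \<in> test_functions \<Omega>2" "e > 0" "ball (\<sigma> w) e \<subseteq> \<Omega>2"
      and \<phi>1: "\<And>y. y \<in> ball (\<sigma> w) e \<Longrightarrow> \<phi> y = 1"
      using cutoff_in_open[OF open2] by blast
    have D\<phi>: "dirichlet_graph \<Omega>2 \<phi> (laplacian \<phi>)" by (rule dirichlet_graph_test[OF \<phi>(1) open2])
    obtain u w' where D: "dirichlet_graph \<Omega>1 u w'" and u: "AE y in M2. U u y = \<phi> y" by (rule graph_surj[OF D\<phi>])
    note uL = dirichlet_graph_L2(1)[OF D]
    obtain g where g: "H10_gradient \<Omega>1 u g" using dirichlet_graph_gradient[OF D open1] by blast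
    have "AE y in M2. C * u (\<tau> y) = \<phi> y" using U_composition[OF uL] u C(2) by eventually_elim simp
    from AE_compose_\<sigma>[OF this] have "negligible {x \<in> \<tau> ` \<Omega>2. C * u x \<noteq> \<phi> (\<sigma> x)}"
      by (simp add: AE_lebesgue_on_iff[OF sets_image])
    \<comment> \<open>The identity holds almost everywhere on the image of \<Omega>2, which covers
      \<Omega>1 up to a null set.\<close>
    from negligible_Un[OF this negligible_\<Omega>1_diff] have "negligible {x \<in> \<Omega>1. C * u x \<noteq> \<phi> (\<sigma> x)}"
      by (rule negligible_subset) auto
    then have "AE x in M1. C * u x = \<phi> (\<sigma> x)" by (simp add: AE_lebesgue_on_iff[OF sets1])
    from H10_gradient_cong_AE[OF H10_gradient_cmult[OF g] sets1 this] have "(\<lambda>x. \<phi> (\<sigma> x)) \<in> H10 \<Omega>1"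
      using H10_iff[OF open1] by blast
    moreover have "(\<lambda>x. \<phi> (\<sigma> x)) \<in> test_functions (\<tau> ` \<Omega>2)"
      by (rule test_functions_isometry[OF \<phi>(1) \<sigma>_has_derivative continuous_\<tau> \<sigma>_\<tau> \<tau>_\<sigma>])
    ultimately show "\<exists>f\<in>test_functions (\<tau> ` \<Omega>2). \<exists>r>0. (\<forall>x\<in>ball w r. f x = 1) \<and> f \<in> H10 \<Omega>1"
      using \<phi>(2) \<phi>1 ball_\<tau> by (intro bexI[of _ "\<lambda>x. \<phi> (\<sigma> x)"] exI[of _ e]) auto
  qed
  moreover have "\<sigma> ` \<Omega>1 \<subseteq> \<Omega>2"
  proof (rule regular_in_capacity_imp_subset[OF open2 regular(2)])
    have "\<sigma> ` \<Omega>1 = \<tau> -` \<Omega>1" by (auto simp: image_\<sigma>_iff)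
    then show "open (\<sigma> ` \<Omega>1)" using open_vimage[OF open1 continuous_\<tau>] by simp
    show "negligible (\<sigma> ` \<Omega>1 - \<Omega>2)"
      by (rule negligible_subset[OF negligible_\<sigma>[OF negligible_\<Omega>1_diff]]) (auto simp: image_\<tau>_iff)
    fix w assume "w \<in> \<sigma> ` \<Omega>1"
    then have "\<tau> w \<in> \<Omega>1" by (simp add: image_\<sigma>_iff)
    then obtain \<phi> e where \<phi>: "\<phi> \<in> test_functions \<Omega>1" "e > 0" "ball (\<tau> w) e \<subseteq> \<Omega>1"
      and \<phi>1: "\<And>y. y \<in> ball (\<tau> w) e \<Longrightarrow> \<phi> y = 1"
      using cutoff_in_open[OF open1] by blast
    have D\<phi>: "dirichlet_graph \<Omega>1 \<phi> (laplacian \<phi>)" by (rule dirichlet_graph_test[OF \<phi>(1) open1])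
    obtain g where g: "H10_gradient \<Omega>2 (U \<phi>) g" using dirichlet_graph_gradient[OF graph_forward[OF D\<phi>] open2] by blast
    have "AE y in M2. (1 / C) * U \<phi> y = \<phi> (\<tau> y)"
      using U_composition[OF dirichlet_graph_L2(1)[OF D\<phi>]] C(2) by eventually_elim (simp add: C(1))
    from H10_gradient_cong_AE[OF H10_gradient_cmult[OF g] sets2 this] have "(\<lambda>y. \<phi> (\<tau> y)) \<in> H10 \<Omega>2"
      using H10_iff[OF open2] by blast
    moreover have "(\<lambda>y. \<phi> (\<tau> y)) \<in> test_functions (\<sigma> ` \<Omega>1)"
      by (rule test_functions_isometry[OF \<phi>(1) \<tau>_has_derivative continuous_\<sigma> \<tau>_\<sigma> \<sigma>_\<tau>])
    ultimately show "\<exists>f\<in>test_functions (\<sigma> ` \<Omega>1). \<exists>r>0. (\<forall>y\<in>ball w r. f y = 1) \<and> f \<in> H10 \<Omega>2"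
      using \<phi>(2) \<phi>1 ball_\<sigma> by (intro bexI[of _ "\<lambda>y. \<phi> (\<tau> y)"] exI[of _ e]) auto
  qed
  then have "\<Omega>1 \<subseteq> \<tau> ` \<Omega>2" by (auto simp: image_\<tau>_iff)
  ultimately show ?thesis by blast
qed

end

theorem corollary6p5:
  fixes \<Omega>1 :: "(real ^ 'd1) set" and \<Omega>2 :: "(real ^ 'd2) set"
    and U :: "(real ^ 'd1 \<Rightarrow> complex) \<Rightarrow> real ^ 'd2 \<Rightarrow> complex"
  assumes "\<Omega>1 \<noteq> {}" "open \<Omega>1" "bounded \<Omega>1" "connected \<Omega>1" "regular_in_capacity \<Omega>1"
    and "\<Omega>2 \<noteq> {}" "open \<Omega>2" "bounded \<Omega>2" "connected \<Omega>2" "regular_in_capacity \<Omega>2"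
    and "invertible_L2_operator \<Omega>1 \<Omega>2 U"
    and "disjointness_preserving \<Omega>1 \<Omega>2 U"
    and "intertwines_dirichlet_laplacians \<Omega>1 \<Omega>2 U"
  shows "CARD('d1) = CARD('d2) \<and>
    (\<exists>(\<tau> :: real ^ 'd2 \<Rightarrow> real ^ 'd1) (c :: complex).
       (\<forall>x y. dist (\<tau> x) (\<tau> y) = dist x y) \<and> \<tau> ` \<Omega>2 = \<Omega>1 \<and> c \<noteq> 0 \<and>
       (\<forall>f\<in>L2 \<Omega>1. ae_eq \<Omega>2 (U f) (\<lambda>y. c * f (\<tau> y))))"
proof -
  interpret laplacian_intertwiner \<Omega>1 \<Omega>2 U by unfold_locales (use assms in auto)
  obtain v :: "real ^ 'd1 \<Rightarrow> real ^ 'd2" and a :: "real ^ 'd1 \<Rightarrow> real" where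
    va: "\<forall>i\<in>Basis. \<forall>j\<in>Basis. v i \<bullet> v j = (if i = j then 1 else 0)" "\<forall>i\<in>Basis. AE y in M2. t i y = of_real (v i \<bullet> y + a i)"
    using multiplier_coordinates.affine[OF multiplier_coordinates_t DIM_eq assms(9)] by blast
  interpret affine_intertwiner \<Omega>1 \<Omega>2 U v a
    by unfold_locales (use va assms(9) in auto)
  obtain C where C: "C \<noteq> 0" "AE y in M2. one_image y = C" using one_image_constant by blast
  have "ae_eq \<Omega>2 (U f) (\<lambda>y. C * f (\<tau> y))" if "f \<in> L2 \<Omega>1" for f
    unfolding ae_eq_def using U_composition[OF that] C(2) by eventually_elim simp
  then show ?thesis using DIM_eq dist_\<tau> image_\<tau>_eq[OF assms(5,10)] C(1) by auto
qed

end
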